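(* Let $\alpha \in [0,\infty)\cup\{-\tfrac1d : d\in\mathbb{Z}, d\ge 2\}$ and $p\in[0,1]$, and let $R_n^l$ and $B_n^l$ denote the number of red and blue leaves, respectively, in the random preferential attachment tree $\mathcal{T}_n=\mathcal{T}_{\alpha,n}$ with broadcasting induced colouring $\sigma_n$ (with parameter $p$). Put $m=\left(\frac{1+\alpha}{4+2\alpha},\frac{1+\alpha}{4+2\alpha}\right)$. As $n\to\infty$: (i) The following strong law of large numbers holds: $\frac1n(R_n^l,B_n^l)\to m$ almost surely. (ii) If $p<(3-\alpha)/4$ or if $p=1/2$, then $$\frac{(R_n^l,B_n^l)-n\,m}{\sqrt n}\xrightarrow{d}\mathcal{N}(\mathbf{0},\Sigma_I^l),$$ where, when $p\neq1/2$, $$\Sigma_I^l=\frac{\alpha+1}{4(2+\alpha)^2(3+\alpha)(2p-3)(4p+\alpha-3)}\begin{pmatrix}\sigma^l_{1,1}&\sigma^l_{1,2}\\\sigma^l_{2,1}&\sigma^l_{2,2}\end{pmatrix}$$ with $$\sigma^l_{1,1}=\sigma^l_{2,2}=(8p^2-6p-1)\alpha^3+(48p^2-46p+1)\alpha^2+(112p^2-158p+49)\alpha+88p^2-158p+71,$$ $$\sigma^l_{1,2}=\sigma^l_{2,1}=(1+6p-8p^2)\alpha^3-(48p^2-50p+7)\alpha^2-(96p^2-126p+37)\alpha-72p^2+122p-53,$$ and, when $p=1/2$, $$\Sigma_I^l=\frac{\alpha+1}{4(2+\alpha)^2(3+\alpha)}\begin{pmatrix}7+6\alpha+\alpha^2&-5-4\alpha-\alpha^2\\-5-4\alpha-\alpha^2&7+6\alpha+\alpha^2\end{pmatrix}.$$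 (iii) If $p=(3-\alpha)/4$ and $p\neq\frac12$ (i.e. $\alpha\ne1$), then $$\frac{(R_n^l,B_n^l)-n\,m}{\sqrt{n\ln n}}\xrightarrow{d}\mathcal{N}(\mathbf{0},\Sigma_{II}^l),\qquad\Sigma_{II}^l=\frac{(\alpha-1)^2(\alpha+1)}{4(3+\alpha)^2}\begin{pmatrix}1&-1\\-1&1\end{pmatrix}.$$ (iv) If $p>(3-\alpha)/4$ and $p\neq\frac12$, then $$\frac{(R_n^l,B_n^l)-n\,m}{n^{(2p+\alpha-1)/(1+\alpha)}}\xrightarrow{d}\frac{BZ}{2\alpha+4p}(2p-1,\,1-2p),$$ where $Z$ is a random variable with $$\mathbb{E}[Z]=\frac{\Gamma(1/(1+\alpha))}{\Gamma((2p+\alpha)/(1+\alpha))},\qquad \mathbb{E}[Z^2]=\frac{\Gamma(1/(1+\alpha))(1+\alpha)(4p+\alpha-2)}{\Gamma((4p+2\alpha-1)/(1+\alpha))(4p+\alpha-3)},$$ and $Z$ is the same random variable for which the numbers $R_n,B_n$ of red and blue vertices of $\mathcal{T}_n$ satisfy $\frac{(R_n,B_n)-n(\frac12,\frac12)}{n^{(2p+\alpha-1)/(1+\alpha)}}\xrightarrow{d}\frac{BZ}{2(2p+\alpha-1)}(2p-1,1-2p)$.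
   Context: The random (linear) preferential attachment trees $(\mathcal{T}_n)_{n\ge1}=(\mathcal{T}_{\alpha,n})_{n\ge1}$ are rooted trees grown recursively: $\mathcal{T}_1$ is a single vertex $\rho$, the root of all the trees; $\mathcal{T}_n$ is obtained from $\mathcal{T}_{n-1}$ by choosing a vertex $v$ of $\mathcal{T}_{n-1}$ at random with probability $\frac{\alpha\deg^+(v)+1}{\sum_{u\in V(\mathcal{T}_{n-1})}(\alpha\deg^+(u)+1)}$ and adding a new child to $v$, where $\deg^+(u)$ is the number of children of $u$ in $\mathcal{T}_{n-1}$. The broadcasting induced colourings $\sigma_n:V(\mathcal{T}_n)\to\{\text{red},\text{blue}\}$ with parameter $p$ are built along with the trees: the root is red or blue with probability $1/2$ each; every newly added vertex receives the colour of its parent with probability $p$ and the other colour with probability $1-p$, independently of everything else; colours never change, so $\sigma_n$ restricted to $V(\mathcal{T}_{n-1})$ equals $\sigma_{n-1}$. A leaf is a vertex with no children. The random variable $B$ equals $1$ if the root is red and $-1$ if the root is blue. $\mathcal{N}(\mathbf{0},\Sigma)$ is the (possibly degenerate) centred multivariate normal law with covariance matrix $\Sigma$.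
   Formalization: Part (i) is proved only for p ≠ 1: at p = 1 all vertices have the root's colour, so (R_n^l, B_n^l)/n tends to ((1+α)/(2+α), 0) or (0, (1+α)/(2+α)), never to m, and the claim as printed is false there. *)

theory Defs
  imports "HOL-Probability.Probability"
begin

section \<open>Recursively grown coloured trees\<close>

text \<open>
  Vertices are numbered by their time of arrival, so that the tree with \<open>n\<close> vertices has vertex set
  \<open>{..<n}\<close> and root \<open>0\<close>. It is described by a single function \<open>par\<close>, where \<open>par i\<close> is the parent of
  vertex \<open>i\<close> for \<open>i \<ge> 1\<close>; the value \<open>par 0\<close> is meaningless and never used.
\<close>

datatype colour = Red | Blue

definition num_children :: "(nat \<Rightarrow> nat) \<Rightarrow> nat \<Rightarrow> nat \<Rightarrow> nat" where
  "num_children par n v = card {i \<in> {1..<n}. par i = v}"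

definition attach_weight :: "real \<Rightarrow> (nat \<Rightarrow> nat) \<Rightarrow> nat \<Rightarrow> nat \<Rightarrow> real" where
  "attach_weight \<alpha> par n v = \<alpha> * real (num_children par n v) + 1"

definition num_vertices :: "colour \<Rightarrow> (nat \<Rightarrow> colour) \<Rightarrow> nat \<Rightarrow> nat" where
  "num_vertices k col n = card {v \<in> {..<n}. col v = k}"

definition num_leaves :: "colour \<Rightarrow> (nat \<Rightarrow> nat) \<Rightarrow> (nat \<Rightarrow> colour) \<Rightarrow> nat \<Rightarrow> nat" where
  "num_leaves k par col n = card {v \<in> {..<n}. num_children par n v = 0 \<and> col v = k}"

definition same_history ::
  "nat \<Rightarrow> (nat \<Rightarrow> nat) \<Rightarrow> (nat \<Rightarrow> colour) \<Rightarrow> (nat \<Rightarrow> nat) \<Rightarrow> (nat \<Rightarrow> colour) \<Rightarrow> bool" where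
  "same_history n par col par' col' \<longleftrightarrow>
     (\<forall>i\<in>{1..<n}. par i = par' i) \<and> (\<forall>i<n. col i = col' i)"

text \<open>
  The first \<open>n\<close> vertices with their parents and colours record the whole evolution of the tree up to
  size \<open>n\<close>. Hence conditioning on the history \<open>(a, c)\<close> up to size \<open>n\<close> is conditioning on everything
  that has happened so far, and the conditional laws below determine the law of the process.
\<close>

locale broadcast_pa_trees = prob_space M for M :: "'w measure" +
  fixes \<alpha> p :: real
    and par :: "nat \<Rightarrow> 'w \<Rightarrow> nat"
    and col :: "nat \<Rightarrow> 'w \<Rightarrow> colour"
  assumes par_measurable: "\<And>n. par n \<in> measurable M (count_space UNIV)"
    and col_measurable: "\<And>n. col n \<in> measurable M (count_space UNIV)"
    and par_less: "\<And>n \<omega>. n \<ge> 1 \<Longrightarrow> \<omega> \<in> space M \<Longrightarrow> par n \<omega> < n"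
    and root_colour: "\<P>(\<omega> in M. col 0 \<omega> = Red) = 1 / 2"
    and attach: "\<And>n a c v. n \<ge> 1 \<Longrightarrow> v < n \<Longrightarrow>
        \<P>(\<omega> in M. same_history n (\<lambda>i. par i \<omega>) (\<lambda>i. col i \<omega>) a c) > 0 \<Longrightarrow>
        \<P>(\<omega> in M. par n \<omega> = v \<bar> same_history n (\<lambda>i. par i \<omega>) (\<lambda>i. col i \<omega>) a c)
          = attach_weight \<alpha> a n v / (\<Sum>u<n. attach_weight \<alpha> a n u)"
    and broadcast: "\<And>n a c v. n \<ge> 1 \<Longrightarrow> v < n \<Longrightarrow>
        \<P>(\<omega> in M. same_history n (\<lambda>i. par i \<omega>) (\<lambda>i. col i \<omega>) a c \<and> par n \<omega> = v) > 0 \<Longrightarrow>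
        \<P>(\<omega> in M. col n \<omega> = c v \<bar>
            same_history n (\<lambda>i. par i \<omega>) (\<lambda>i. col i \<omega>) a c \<and> par n \<omega> = v) = p"

definition colour_vec ::
  "(nat \<Rightarrow> 'w \<Rightarrow> colour) \<Rightarrow> nat \<Rightarrow> 'w \<Rightarrow> real ^ 2" where
  "colour_vec col n \<omega> =
     vector [real (num_vertices Red (\<lambda>i. col i \<omega>) n), real (num_vertices Blue (\<lambda>i. col i \<omega>) n)]"

definition leaf_vec ::
  "(nat \<Rightarrow> 'w \<Rightarrow> nat) \<Rightarrow> (nat \<Rightarrow> 'w \<Rightarrow> colour) \<Rightarrow> nat \<Rightarrow> 'w \<Rightarrow> real ^ 2" where
  "leaf_vec par col n \<omega> =
     vector [real (num_leaves Red (\<lambda>i. par i \<omega>) (\<lambda>i. col i \<omega>) n),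
             real (num_leaves Blue (\<lambda>i. par i \<omega>) (\<lambda>i. col i \<omega>) n)]"

definition root_sign :: "(nat \<Rightarrow> 'w \<Rightarrow> colour) \<Rightarrow> 'w \<Rightarrow> real" where
  "root_sign col \<omega> = (if col 0 \<omega> = Red then 1 else - 1)"


section \<open>Weak convergence and multivariate normal laws\<close>

text \<open>The library has weak convergence (\<^const>\<open>weak_conv_m\<close>) for measures on the real line only.\<close>

definition weakly_converges ::
  "(nat \<Rightarrow> 'a::metric_space measure) \<Rightarrow> 'a measure \<Rightarrow> bool" where
  "weakly_converges \<mu> \<nu> \<longleftrightarrow>
     (\<forall>f :: 'a \<Rightarrow> real. continuous_on UNIV f \<longrightarrow> bounded (range f) \<longrightarrow>
        (\<lambda>n. \<integral>x. f x \<partial>\<mu> n) \<longlonglongrightarrow> (\<integral>x. f x \<partial>\<nu>))"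

definition centred_normal_real :: "real \<Rightarrow> real measure" where
  "centred_normal_real v =
     (if v = 0 then return borel 0 else density lborel (normal_density 0 (sqrt v)))"

text \<open>
  \<open>N\<close> is the law of a random vector all of whose linear combinations are (possibly degenerate)
  normal variables, centred and with the variance prescribed by \<open>\<Sigma>\<close>. This fixes the law \<open>N\<close>
  uniquely, and there is no such \<open>N\<close> unless the quadratic form of \<open>\<Sigma>\<close> is nonnegative.
\<close>

definition centred_normal :: "real ^ 'n ^ 'n \<Rightarrow> (real ^ 'n) measure \<Rightarrow> bool" where
  "centred_normal \<Sigma> N \<longleftrightarrow>
     prob_space N \<and> sets N = sets borel \<and> transpose \<Sigma> = \<Sigma> \<and>
     (\<forall>t. t \<bullet> (\<Sigma> *v t) \<ge> 0 \<and> distr N borel (\<lambda>x. t \<bullet> x) = centred_normal_real (t \<bullet> (\<Sigma> *v t)))"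


section \<open>The constants of the limit theorems\<close>

definition leaf_mean :: "real \<Rightarrow> real ^ 2" where
  "leaf_mean \<alpha> = vector [(1 + \<alpha>) / (4 + 2 * \<alpha>), (1 + \<alpha>) / (4 + 2 * \<alpha>)]"

definition Sigma_I :: "real \<Rightarrow> real \<Rightarrow> real ^ 2 ^ 2" where
  "Sigma_I \<alpha> p =
     (if p \<noteq> 1 / 2 then
        (let s11 = (8 * p^2 - 6 * p - 1) * \<alpha>^3 + (48 * p^2 - 46 * p + 1) * \<alpha>^2
                     + (112 * p^2 - 158 * p + 49) * \<alpha> + 88 * p^2 - 158 * p + 71;
             s12 = (1 + 6 * p - 8 * p^2) * \<alpha>^3 - (48 * p^2 - 50 * p + 7) * \<alpha>^2
                     - (96 * p^2 - 126 * p + 37) * \<alpha> - 72 * p^2 + 122 * p - 53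
         in ((\<alpha> + 1) / (4 * (2 + \<alpha>)^2 * (3 + \<alpha>) * (2 * p - 3) * (4 * p + \<alpha> - 3))) *\<^sub>R
              vector [vector [s11, s12], vector [s12, s11]])
      else
        ((\<alpha> + 1) / (4 * (2 + \<alpha>)^2 * (3 + \<alpha>))) *\<^sub>R
          vector [vector [7 + 6 * \<alpha> + \<alpha>^2, - 5 - 4 * \<alpha> - \<alpha>^2],
                  vector [- 5 - 4 * \<alpha> - \<alpha>^2, 7 + 6 * \<alpha> + \<alpha>^2]])"

definition Sigma_II :: "real \<Rightarrow> real ^ 2 ^ 2" where
  "Sigma_II \<alpha> =
     ((\<alpha> - 1)^2 * (\<alpha> + 1) / (4 * (3 + \<alpha>)^2)) *\<^sub>R vector [vector [1, - 1], vector [- 1, 1]]"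

end

theory Submission
  imports Defs "HOL-Real_Asymp.Real_Asymp"
begin

text \<open>
  Give a vertex the sign \<open>1\<close> if it is red and \<open>- 1\<close> if it is blue, and put \<open>q = 2 p - 1\<close>. The total
  weight of the tree with \<open>n\<close> vertices is \<open>T n = 1 + (1 + \<alpha>) (n - 1)\<close>, whatever the tree looks
  like. Everything is read off from four statistics: the signed weight \<open>X\<close>, the signed number of
  leaves \<open>Y\<close>, the signed number of vertices \<open>S\<close>, and the number of leaves, centred, \<open>U\<close>. They have
  bounded increments, and a leaf has weight exactly \<open>1\<close>; therefore the conditional mean of an
  increment given the past is linear in the statistics: it is \<open>(\<alpha> + q) X / T\<close> for \<open>X\<close>,
  \<open>(q X - Y) / T\<close> for \<open>Y\<close>, \<open>q X / T\<close> for \<open>S\<close> and \<open>- U / T\<close> for \<open>U\<close> (\<open>inc_mean\<close>). The conditional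
  mean of a product of two increments is a constant plus a linear statistic divided by \<open>T\<close>
  (\<open>inc_cov\<close>), so that second moments satisfy closed linear recursions (\<open>second_moment_Suc\<close>). The
  growth exponent of \<open>X\<close> is \<open>(\<alpha> + q) / (1 + \<alpha>)\<close>; the three regimes correspond to its being smaller
  than, equal to or larger than \<open>1 / 2\<close>. For \<open>p = 1 / 2\<close> the colour of a child is independent of
  that of its parent, \<open>X\<close> has no influence on \<open>Y\<close>, and the leaves behave as in the subcritical
  regime.

  Strong law. For \<open>p < 1\<close> the second moments of \<open>U\<close> and \<open>Y\<close> are bounded by a power of \<open>n\<close> with
  exponent less than \<open>2\<close>. Hence \<open>U / n\<close> and \<open>Y / n\<close> tend to \<open>0\<close> almost surely along the sequence of
  \<open>k\<close>-th powers for a suitable \<open>k\<close>, and the bounded increments fill the gaps (\<open>AE_over_n\<close>).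

  Normal limits. The characteristic function of a linear statistic \<open>J\<close> of the tree of size \<open>n\<close> is
  compared with that of a centred normal variable with the same second moment. When a vertex is
  added, the difference of the two becomes the difference for a slightly changed statistic, the
  drift being moved into the coefficients, up to errors of higher order (\<open>char_step\<close>). In the
  subcritical and critical regimes the change of the coefficients is a contraction on the scale on
  which \<open>J\<close> fluctuates, and so the difference tends to \<open>0\<close> (\<open>contraction_family\<close>,
  \<open>Hgap_tendsto\<close>, \<open>gap_X_tendsto\<close>). It remains to find the limits of the second moments from their
  recursions. At criticality, and above it, the scale exceeds the square root of \<open>n\<close>, and \<open>Y\<close> is
  \<open>q / (\<alpha> + 2 p)\<close> times \<open>X\<close> up to a negligible remainder (\<open>negligible_remainder\<close>).

  Supercritical regime. Up to deterministic factors that tend to a constant, \<open>X\<close> divided by its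
  power of \<open>n\<close> is a martingale bounded in mean square, and therefore converges in mean square
  (\<open>f_cauchy\<close>). Its limit is \<open>B Z\<close>; the moments of \<open>Z\<close> are limits of the exactly known moments of
  \<open>X\<close>, and the Gamma function enters through the products \<open>growth\<close>.

  Convergence of characteristic functions implies weak convergence on the plane for tight sequences
  (\<open>weakly_converges_char\<close>); tightness comes from the second moments.
\<close>

section \<open>Real sequences and recursions\<close>

text \<open>The contraction rates \<open>b n\<close> may tend to \<open>0\<close>, as long as their sum diverges; the sequence \<open>g\<close>
  witnesses the divergence. The positive part of \<open>w - d\<close>, multiplied by \<open>g\<close>, cannot grow once the
  perturbation \<open>e\<close> is below \<open>d\<close>; since \<open>g\<close> tends to infinity, \<open>w\<close> is finally at most \<open>2 d\<close>.\<close>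

lemma contraction_tendsto_0:
  fixes w b e g :: "nat \<Rightarrow> real"
  assumes step: "\<And>n. n \<ge> n0 \<Longrightarrow> w (Suc n) \<le> (1 - b n) * w n + b n * e n"
    and b: "\<And>n. n \<ge> n0 \<Longrightarrow> 0 \<le> b n" "\<And>n. n \<ge> n0 \<Longrightarrow> b n \<le> 1"
    and g: "\<And>n. n \<ge> n0 \<Longrightarrow> 0 < g n" "\<And>n. n \<ge> n0 \<Longrightarrow> (1 - b n) * g (Suc n) \<le> g n"
    and g_top: "filterlim g at_top sequentially"
    and e: "e \<longlonglongrightarrow> 0"
    and w: "\<And>n. 0 \<le> w n"
  shows "w \<longlonglongrightarrow> 0"
proof (rule LIMSEQ_I)
  fix r :: real assume r: "r > 0"
  define d where "d = r / 2"
  have d: "d > 0" using r by (simp add: d_def)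
  from e d have "eventually (\<lambda>n. e n < d) sequentially"
    by (rule order_tendstoD)
  then obtain n1 where n1: "\<And>n. n \<ge> n1 \<Longrightarrow> e n < d"
    by (auto simp: eventually_sequentially)
  define m where "m = max n0 n1"
  define v where "v n = max 0 (w n - d)" for n
  have v0: "v n \<ge> 0" for n by (simp add: v_def)
  have vstep: "v (Suc n) \<le> (1 - b n) * v n" if n: "n \<ge> m" for n
  proof -
    have bn: "0 \<le> b n" "b n \<le> 1" and en: "e n \<le> d"
      using b n n1[of n] by (auto simp: m_def)
    have "w (Suc n) - d \<le> (1 - b n) * w n + b n * e n - d"
      using step[of n] n by (simp add: m_def)
    also have "b n * e n \<le> b n * d" using bn en by (simp add: mult_left_mono)
    finally have "w (Suc n) - d \<le> (1 - b n) * (w n - d)" by (simp add: algebra_simps)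
    also have "\<dots> \<le> (1 - b n) * v n" using bn by (intro mult_left_mono) (auto simp: v_def)
    finally show ?thesis using bn v0[of n] by (simp add: v_def)
  qed
  have mono: "v n * g n \<le> v m * g m" if "n \<ge> m" for n
    using that
  proof (induction n rule: dec_induct)
    case (step n)
    have "v (Suc n) * g (Suc n) \<le> (1 - b n) * v n * g (Suc n)"
      using vstep[of n] g(1)[of "Suc n"] step by (intro mult_right_mono) (auto simp: m_def)
    also have "\<dots> = v n * ((1 - b n) * g (Suc n))" by simp
    also have "\<dots> \<le> v n * g n"
      using g(2)[of n] v0 step by (intro mult_left_mono) (auto simp: m_def)
    finally show ?case using step by simp
  qed simp
  have "eventually (\<lambda>n. g n > v m * g m / d) sequentially"
    using g_top by (simp add: filterlim_at_top_dense)
  then obtain n2 where n2: "\<And>n. n \<ge> n2 \<Longrightarrow> g n > v m * g m / d"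
    by (auto simp: eventually_sequentially)
  show "\<exists>no. \<forall>n\<ge>no. norm (w n - 0) < r"
  proof (intro exI allI impI)
    fix n assume n: "n \<ge> max m n2"
    have gn: "g n > 0" using g(1)[of n] n by (simp add: m_def)
    have "v n * g n \<le> v m * g m" using mono n by simp
    also have "\<dots> < d * g n" using n2[of n] n d by (simp add: field_simps)
    finally have "v n < d" using gn by simp
    then have "w n < 2 * d" using d by (simp add: v_def)
    then show "norm (w n - 0) < r" using w[of n] by (simp add: d_def)
  qed
qed

lemma contraction_tendsto:
  fixes w b s g :: "nat \<Rightarrow> real"
  assumes step: "\<And>n. n \<ge> n0 \<Longrightarrow> w (Suc n) = (1 - b n) * w n + b n * s n"
    and b: "\<And>n. n \<ge> n0 \<Longrightarrow> 0 \<le> b n" "\<And>n. n \<ge> n0 \<Longrightarrow> b n \<le> 1"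
    and g: "\<And>n. n \<ge> n0 \<Longrightarrow> 0 < g n" "\<And>n. n \<ge> n0 \<Longrightarrow> (1 - b n) * g (Suc n) \<le> g n"
    and g_top: "filterlim g at_top sequentially"
    and s: "s \<longlonglongrightarrow> l"
  shows "w \<longlonglongrightarrow> l"
proof -
  have "(\<lambda>n. \<bar>w n - l\<bar>) \<longlonglongrightarrow> 0"
  proof (rule contraction_tendsto_0[where b = b and g = g and e = "\<lambda>n. \<bar>s n - l\<bar>"])
    fix n assume n: "n \<ge> n0"
    have "w (Suc n) - l = (1 - b n) * (w n - l) + b n * (s n - l)"
      using step[OF n] by (simp add: algebra_simps)
    also have "\<bar>\<dots>\<bar> \<le> \<bar>(1 - b n) * (w n - l)\<bar> + \<bar>b n * (s n - l)\<bar>" by simp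
    also have "\<dots> = (1 - b n) * \<bar>w n - l\<bar> + b n * \<bar>s n - l\<bar>"
      using b[OF n] by (simp add: abs_mult)
    finally show "\<bar>w (Suc n) - l\<bar> \<le> (1 - b n) * \<bar>w n - l\<bar> + b n * \<bar>s n - l\<bar>" .
  next
    show "(\<lambda>n. \<bar>s n - l\<bar>) \<longlonglongrightarrow> 0"
      using s by (simp add: LIM_zero_iff tendsto_rabs_zero_iff)
  qed (use b g g_top in auto)
  then show ?thesis by (simp add: LIM_zero_iff tendsto_rabs_zero_iff)
qed

text \<open>For \<open>b = 1 + \<alpha>\<close> this is the total attachment weight of a tree with \<open>n\<close> vertices: an arrival
  contributes \<open>1\<close> itself and \<open>\<alpha>\<close> through its parent.\<close>

definition tot :: "real \<Rightarrow> nat \<Rightarrow> real" where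
  "tot b n = 1 + b * (real n - 1)"

lemma tot_Suc: "tot b (Suc n) = tot b n + b"
  by (simp add: tot_def algebra_simps)

lemma tot_ge_1: "b > 0 \<Longrightarrow> n \<ge> 1 \<Longrightarrow> tot b n \<ge> 1"
  by (simp add: tot_def)

lemma tot_ge_min: "b > 0 \<Longrightarrow> n \<ge> 1 \<Longrightarrow> min 1 b * real n \<le> tot b n"
  using mult_nonneg_nonneg[of "b - 1" "real n - 1"]
  unfolding tot_def by (cases "b \<le> 1") (auto simp: min_def algebra_simps)

lemma tot_le_max: "b > 0 \<Longrightarrow> n \<ge> 1 \<Longrightarrow> tot b n \<le> max 1 b * real n"
  using mult_nonneg_nonneg[of "1 - b" "real n - 1"]
  unfolding tot_def by (cases "b \<le> 1") (auto simp: max_def algebra_simps)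

lemma tot_at_top: "b > 0 \<Longrightarrow> filterlim (tot b) at_top sequentially"
  unfolding tot_def by real_asymp

lemma ln_tot_at_top: "b > 0 \<Longrightarrow> filterlim (\<lambda>n. ln (tot b n)) at_top sequentially"
  by (rule filterlim_compose[OF ln_at_top tot_at_top])

lemma tot_over_n: "(\<lambda>n. tot b n / real n) \<longlonglongrightarrow> b"
  unfolding tot_def by real_asymp

lemma tot_eventually_ge:
  assumes "b > 0" obtains n0 where "n0 \<ge> 1" "\<And>n. n \<ge> n0 \<Longrightarrow> tot b n \<ge> c"
proof -
  have "eventually (\<lambda>n. tot b n \<ge> c) sequentially"
    using tot_at_top[OF assms] by (auto simp: filterlim_at_top)
  then obtain N where "\<And>n. n \<ge> N \<Longrightarrow> tot b n \<ge> c" by (auto simp: eventually_sequentially)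
  then show thesis by (intro that[of "max 1 N"]) auto
qed

text \<open>The contraction rate \<open>k / tot b n\<close> is slow, but not summable: the logarithm of the total weight
  serves as the divergent comparison sequence.\<close>

lemma ln_tot_rate:
  assumes b: "b > 0" and k: "k > 0"
  obtains n0 where "n0 \<ge> 1" "\<And>n. n \<ge> n0 \<Longrightarrow> 0 < ln (tot b n)"
    "\<And>n. n \<ge> n0 \<Longrightarrow> k / tot b n \<le> 1"
    "\<And>n. n \<ge> n0 \<Longrightarrow> (1 - k / tot b n) * ln (tot b (Suc n)) \<le> ln (tot b n)"
proof -
  obtain n0 where n0: "n0 \<ge> 1" "\<And>n. n \<ge> n0 \<Longrightarrow> tot b n \<ge> max (max 2 k) (exp (b / k))"
    using tot_eventually_ge[OF b] by blast
  show thesis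
  proof
    show "n0 \<ge> 1" by fact
    fix n assume n: "n \<ge> n0"
    have T: "tot b n \<ge> 2" "tot b n \<ge> k" "tot b n \<ge> exp (b/k)" using n0(2)[OF n] by auto
    show "0 < ln (tot b n)" using T by simp
    show "k / tot b n \<le> 1" using T by simp
    have "ln (tot b (Suc n)) \<ge> ln (tot b n)" using T b by (simp add: tot_Suc)
    moreover have "ln (tot b n) \<ge> b / k" using T ln_ge_iff[of "tot b n" "b / k"] by simp
    ultimately have l: "ln (tot b (Suc n)) \<ge> b / k" by simp
    have "ln (tot b (Suc n)) - ln (tot b n) = ln (tot b (Suc n) / tot b n)"
      using T b by (simp add: ln_div tot_Suc)
    also have "tot b (Suc n) / tot b n = 1 + b / tot b n"
      using T by (simp add: tot_Suc field_simps)
    also have "ln (1 + b / tot b n) \<le> b / tot b n" using T b by (intro ln_add_one_self_le_self) auto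
    also have "\<dots> = k / tot b n * (b / k)" using k by simp
    also have "\<dots> \<le> k / tot b n * ln (tot b (Suc n))"
      using l T k by (intro mult_left_mono) auto
    finally show "(1 - k / tot b n) * ln (tot b (Suc n)) \<le> ln (tot b n)"
      by (simp add: algebra_simps)
  qed
qed

text \<open>If \<open>s\<close> were constantly \<open>l\<close>, then \<open>l / (b - c) * tot b n\<close> would be an exact solution. The quotient
  of \<open>w\<close> and \<open>tot b\<close> is drawn towards the corresponding momentary value \<open>s n / (b - c)\<close> at the
  contraction rate \<open>(b - c) / tot b (Suc n)\<close>.\<close>

lemma linear_recursion_limit:
  fixes w s :: "nat \<Rightarrow> real"
  assumes b: "b > 0" and c: "c < b"
    and step: "\<And>n. n \<ge> 1 \<Longrightarrow> w (Suc n) = (1 + c / tot b n) * w n + s n"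
    and s: "s \<longlonglongrightarrow> l"
  shows "(\<lambda>n. w n / tot b n) \<longlonglongrightarrow> l / (b - c)"
proof -
  define k where "k = b - c"
  have k: "k > 0" using c by (simp add: k_def)
  obtain n0 where n0: "n0 \<ge> 1" "\<And>n. n \<ge> n0 \<Longrightarrow> 0 < ln (tot b n)"
    "\<And>n. n \<ge> n0 \<Longrightarrow> k / tot b n \<le> 1"
    "\<And>n. n \<ge> n0 \<Longrightarrow> (1 - k / tot b n) * ln (tot b (Suc n)) \<le> ln (tot b n)"
    using ln_tot_rate[OF b k] by blast
  have "(\<lambda>n. w n / tot b n) \<longlonglongrightarrow> l / k"
  proof (rule contraction_tendsto[where b = "\<lambda>n. k / tot b (Suc n)" and s = "\<lambda>n. s n / k"
        and g = "\<lambda>n. ln (tot b (Suc n))" and ?n0.0 = n0])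
    fix n assume n: "n \<ge> n0"
    have T: "tot b n \<ge> 1" "tot b (Suc n) \<ge> 1" using n n0(1) b by (auto intro!: tot_ge_1)
    show "0 \<le> k / tot b (Suc n)" using T k by simp
    show "k / tot b (Suc n) \<le> 1" "0 < ln (tot b (Suc n))" using n0 n by simp_all
    show "(1 - k / tot b (Suc n)) * ln (tot b (Suc (Suc n))) \<le> ln (tot b (Suc n))"
      using n0(4)[of "Suc n"] n by simp
    have eq: "tot b (Suc n) - k = tot b n + c" by (simp add: tot_Suc k_def)
    have "w (Suc n) / tot b (Suc n) = ((tot b n + c) / tot b (Suc n)) * (w n / tot b n) + s n / tot b (Suc n)"
      using T n n0(1) by (simp add: step field_simps)
    also have "(tot b n + c) / tot b (Suc n) = 1 - k / tot b (Suc n)"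
      using T by (simp add: eq[symmetric] diff_divide_distrib)
    finally show "w (Suc n) / tot b (Suc n) =
       (1 - k / tot b (Suc n)) * (w n / tot b n) + k / tot b (Suc n) * (s n / k)"
      using k by simp
  next
    show "filterlim (\<lambda>n. ln (tot b (Suc n))) at_top sequentially"
      using filterlim_compose[OF ln_tot_at_top[OF b] filterlim_Suc] .
  next
    show "(\<lambda>n. s n / k) \<longlonglongrightarrow> l / k"
      using s k by (intro tendsto_intros) auto
  qed
  then show ?thesis by (simp add: k_def)
qed

text \<open>At the critical coefficient \<open>c = b\<close> the solution picks up a logarithm.\<close>

lemma critical_recursion_limit:
  fixes w :: "nat \<Rightarrow> real"
  assumes b: "b > 0"
    and step: "\<And>n. n \<ge> 1 \<Longrightarrow> w (Suc n) = (1 + b / tot b n) * w n + s"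
  shows "(\<lambda>n. w n / (tot b n * ln (tot b n))) \<longlonglongrightarrow> s / b"
proof -
  obtain n0 where n0: "n0 \<ge> 1" "\<And>n. n \<ge> n0 \<Longrightarrow> tot b n \<ge> 2"
    using tot_eventually_ge[OF b] by blast
  let ?l = "\<lambda>n. ln (tot b n)"
  let ?r = "\<lambda>n. 1 - ?l n / ?l (Suc n)"
  show ?thesis
  proof (rule contraction_tendsto[where b = ?r and s = "\<lambda>n. s / (tot b (Suc n) * (?l (Suc n) - ?l n))"
        and g = ?l and ?n0.0 = n0])
    fix n assume n: "n \<ge> n0"
    have T: "tot b n \<ge> 2" "tot b (Suc n) > tot b n" using n n0(2) b by (auto simp: tot_Suc)
    have l: "0 < ?l n" "?l n < ?l (Suc n)" using T by auto
    show "0 \<le> ?r n" "?r n \<le> 1" "0 < ?l n" "(1 - ?r n) * ?l (Suc n) \<le> ?l n" using l by auto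
    have "w (Suc n) = tot b (Suc n) * (w n / tot b n) + s"
      using step[of n] n n0(1) T by (simp add: tot_Suc field_simps)
    then have "w (Suc n) / (tot b (Suc n) * ?l (Suc n)) = w n / tot b n / ?l (Suc n) + s / (tot b (Suc n) * ?l (Suc n))"
      using T by (simp add: field_simps)
    also have "\<dots> = (1 - ?r n) * (w n / (tot b n * ?l n)) + s / (tot b (Suc n) * ?l (Suc n))"
      using l by simp
    also have "s / (tot b (Suc n) * ?l (Suc n)) = ?r n * (s / (tot b (Suc n) * (?l (Suc n) - ?l n)))"
      using l T by (simp add: divide_simps)
    finally show "w (Suc n) / (tot b (Suc n) * ?l (Suc n)) = (1 - ?r n) * (w n / (tot b n * ?l n))
       + ?r n * (s / (tot b (Suc n) * (?l (Suc n) - ?l n)))" .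
  next
    show "filterlim ?l at_top sequentially" using ln_tot_at_top[OF b] .
    have "(\<lambda>n. tot b (Suc n) * (?l (Suc n) - ?l n)) \<longlonglongrightarrow> b * (inverse b - inverse b * (1 - b))"
      using b unfolding tot_def by real_asymp
    also have "b * (inverse b - inverse b * (1 - b)) = b"
      using b by (simp add: field_simps)
    finally have "(\<lambda>n. tot b (Suc n) * (?l (Suc n) - ?l n)) \<longlonglongrightarrow> b" .
    then show "(\<lambda>n. s / (tot b (Suc n) * (?l (Suc n) - ?l n))) \<longlonglongrightarrow> s / b"
      using b by (intro tendsto_intros) auto
  qed
qed

text \<open>The multiple \<open>K * tot b n\<close> is a supersolution as soon as \<open>K * (b - c) \<ge> s\<close>. Comparison needs a
  nonnegative factor \<open>1 + c / tot b n\<close>, which fails at most for finitely many \<open>n\<close>; there \<open>K\<close> is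
  made large.\<close>

lemma linear_recursion_bound:
  fixes w :: "nat \<Rightarrow> real"
  assumes b: "b > 0" and c: "c < b"
    and step: "\<And>n. n \<ge> 1 \<Longrightarrow> w (Suc n) \<le> (1 + c / tot b n) * w n + s"
  obtains K where "K \<ge> 0" "\<And>n. n \<ge> 1 \<Longrightarrow> w n \<le> K * tot b n"
proof -
  obtain n0 where n0: "n0 \<ge> 1" "\<And>n. n \<ge> n0 \<Longrightarrow> tot b n \<ge> max 1 (- c)"
    using tot_eventually_ge[OF b] by blast
  define K where "K = max (\<bar>s\<bar> / (b - c)) (\<Sum>n\<le>n0. \<bar>w n\<bar>)"
  have K: "K \<ge> 0" "K * (b - c) \<ge> s"
  proof -
    show "K \<ge> 0" unfolding K_def by (auto intro: order_trans[OF sum_nonneg max.cobounded2])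
    have "\<bar>s\<bar> / (b - c) \<le> K" by (simp add: K_def)
    then have "\<bar>s\<bar> \<le> K * (b - c)" using c by (simp add: field_simps)
    then show "K * (b - c) \<ge> s" by simp
  qed
  have init: "w n \<le> K * tot b n" if "n \<ge> 1" "n \<le> n0" for n
  proof -
    have "w n \<le> \<bar>w n\<bar>" by simp
    also have "\<dots> \<le> (\<Sum>n\<le>n0. \<bar>w n\<bar>)" using that by (intro member_le_sum) auto
    also have "\<dots> \<le> K * 1" by (simp add: K_def)
    also have "\<dots> \<le> K * tot b n" using that b K by (intro mult_left_mono tot_ge_1) auto
    finally show ?thesis .
  qed
  have late: "w n \<le> K * tot b n" if "n \<ge> n0" for n
    using that
  proof (induction n rule: dec_induct)
    case base show ?case using init n0(1) by simp
  next
    case (step n)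
    have T: "tot b n \<ge> 1" "tot b n \<ge> - c" using n0(2)[of n] step by auto
    have "w (Suc n) \<le> (1 + c / tot b n) * w n + s"
      using assms(3)[of n] step n0(1) by simp
    also have "(1 + c / tot b n) * w n \<le> (1 + c / tot b n) * (K * tot b n)"
      using T step.IH by (intro mult_left_mono) (auto simp: field_simps)
    also have "(1 + c / tot b n) * (K * tot b n) = K * tot b n + K * c"
      using T by (simp add: field_simps)
    finally show ?case using K(2) by (simp add: tot_Suc algebra_simps)
  qed
  show thesis
  proof (rule that[OF K(1)])
    fix n :: nat assume "n \<ge> 1" then show "w n \<le> K * tot b n"
      using init[of n] late[of n] by (cases "n \<le> n0") auto
  qed
qed

lemma powr_supporting_line:
  fixes x r :: real
  assumes "x > 0" "r \<ge> 1"
  shows "1 + r * x \<le> (1 + x) powr r"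
proof -
  have "\<exists>z. 1 < z \<and> z < 1 + x \<and> (1 + x) powr r - 1 powr r = (1 + x - 1) * (r * z powr (r - 1))"
    by (rule MVT2) (use assms in \<open>auto intro!: derivative_eq_intros\<close>)
  then obtain z where z: "1 < z" "(1 + x) powr r - 1 = x * (r * z powr (r - 1))" by auto
  have "1 \<le> z powr (r - 1)" using z assms by (intro ge_one_powr_ge_zero) auto
  then have "x * (r * 1) \<le> x * (r * z powr (r - 1))" using assms by (intro mult_left_mono) auto
  with z show ?thesis by (simp add: mult.commute)
qed

text \<open>Without a restriction on the coefficient the solution is still bounded by any power of \<open>n\<close>
  whose exponent exceeds both \<open>1\<close> and the growth exponent \<open>c / b\<close> of the homogeneous equation:
  by Bernoulli such a power is a supersolution.\<close>

lemma power_recursion_bound: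
  fixes w :: "nat \<Rightarrow> real"
  assumes b: "b > 0" and c: "c / b < r" and r: "1 < r" and w: "\<And>n. 0 \<le> w n"
    and step: "\<And>n. n \<ge> 1 \<Longrightarrow> w (Suc n) \<le> (1 + c / tot b n) * w n + s n"
    and s: "\<And>n. n \<ge> 1 \<Longrightarrow> s n \<le> K * real n powr (r - 1)"
  obtains C where "C \<ge> 0" "\<And>n. n \<ge> 1 \<Longrightarrow> w n \<le> C * real n powr r"
proof -
  define c' where "c' = max 0 c"
  have c': "c' / b < r" "c' \<ge> 0" using c r by (auto simp: c'_def max_def)
  obtain d where d: "d < r" "c' / b < d" using dense[OF c'(1)] by blast
  have d0: "d \<ge> 0" using d(2) c'(2) b by (meson divide_nonneg_pos less_imp_le order_trans)
  have "(\<lambda>n. c' * (real n / tot b n)) \<longlonglongrightarrow> c' * (1 / b)"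
  proof (rule tendsto_mult_left)
    have "(\<lambda>n. real n / tot b n) \<longlonglongrightarrow> inverse b" unfolding tot_def using b by real_asymp
    then show "(\<lambda>n. real n / tot b n) \<longlonglongrightarrow> 1 / b" by (simp add: inverse_eq_divide)
  qed
  then have "eventually (\<lambda>n. c' * (real n / tot b n) < d) sequentially"
    using d by (intro order_tendstoD(2)[where y = "c' * (1/b)"]) simp_all
  then obtain m where m: "\<And>n. n \<ge> m \<Longrightarrow> c' * (real n / tot b n) < d"
    by (auto simp: eventually_sequentially)
  define n0 where "n0 = max 1 m"
  define C where "C = max (\<bar>K\<bar> / (r - d)) (\<Sum>n\<le>n0. \<bar>w n\<bar>)"
  have C: "C \<ge> 0" "C * (r - d) \<ge> K"
  proof -
    show "C \<ge> 0" unfolding C_def by (auto intro: order_trans[OF sum_nonneg max.cobounded2])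
    have "\<bar>K\<bar> / (r - d) \<le> C" by (simp add: C_def)
    then have "\<bar>K\<bar> \<le> C * (r - d)" using d by (simp add: field_simps)
    then show "C * (r - d) \<ge> K" by simp
  qed
  have init: "w n \<le> C * real n powr r" if "n \<ge> 1" "n \<le> n0" for n
  proof -
    have "w n \<le> \<bar>w n\<bar>" by simp
    also have "\<dots> \<le> (\<Sum>n\<le>n0. \<bar>w n\<bar>)" using that by (intro member_le_sum) auto
    also have "\<dots> \<le> C * 1" by (simp add: C_def)
    also have "\<dots> \<le> C * real n powr r" using that r C by (intro mult_left_mono ge_one_powr_ge_zero) auto
    finally show ?thesis .
  qed
  have late: "w n \<le> C * real n powr r" if "n \<ge> n0" for n
    using that
  proof (induction n rule: dec_induct)
    case base show ?case using init by (simp add: n0_def)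
  next
    case (step n)
    have n: "n \<ge> 1" "n \<ge> m" using step by (auto simp: n0_def)
    have T: "tot b n \<ge> 1" using tot_ge_1[OF b n(1)] .
    have cn: "c / tot b n \<le> d / real n"
    proof -
      have "c / tot b n \<le> c' / tot b n" using T by (intro divide_right_mono) (auto simp: c'_def)
      also have "\<dots> \<le> d / real n" using m[OF n(2)] n T by (simp add: field_simps)
      finally show ?thesis .
    qed
    have pos: "real n powr r = real n * real n powr (r - 1)"
      using n by (simp add: powr_diff)
    have "w (Suc n) \<le> (1 + c / tot b n) * w n + s n" using assms(5) n by simp
    also have "(1 + c / tot b n) * w n \<le> (1 + d / real n) * w n"
      using cn w by (intro mult_right_mono) auto
    also have "\<dots> \<le> (1 + d / real n) * (C * real n powr r)"
      using d c' b step.IH by (intro mult_left_mono) (use d0 in auto)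
    also have "(1 + d / real n) * (C * real n powr r) = C * real n powr r + C * d * real n powr (r - 1)"
      using n by (simp add: pos field_simps)
    also have "s n \<le> C * (r - d) * real n powr (r - 1)"
      using s[OF n(1)] C(2) by (meson mult_right_mono order_trans powr_ge_zero)
    finally have "w (Suc n) \<le> C * (real n powr r + r * real n powr (r - 1))"
      by (simp add: algebra_simps)
    also have "real n powr r + r * real n powr (r - 1) = real n powr r * (1 + r * (1 / real n))"
      using n by (simp add: pos field_simps)
    also have "\<dots> \<le> real n powr r * (1 + 1 / real n) powr r"
      using r n by (intro mult_left_mono powr_supporting_line) auto
    also have "\<dots> = real (Suc n) powr r"
    proof -
      have "real n * (1 + 1 / real n) = real (Suc n)" using n by (simp add: field_simps)
      then show ?thesis using n by (simp add: powr_mult[symmetric])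
    qed
    finally show ?case using C(1) by (simp add: mult_left_mono)
  qed
  show thesis
  proof (rule that[OF C(1)])
    fix n :: nat assume "n \<ge> 1" then show "w n \<le> C * real n powr r"
      using init[of n] late[of n] by (cases "n \<le> n0") auto
  qed
qed

text \<open>The contraction principle for a family \<open>D n\<close> of functions whose arguments are moved by
  the maps \<open>L n\<close>. It is the size \<open>r n\<close> of the arguments that contracts: a bound of \<open>D n\<close> by
  \<open>d n\<close> times the size reproduces itself with smaller \<open>d\<close>, provided that it holds in this form,
  linear in the size, at the start, and that the new errors are linear in the size, too.\<close>

lemma contraction_family:
  fixes D r :: "nat \<Rightarrow> 'z \<Rightarrow> real" and L :: "nat \<Rightarrow> 'z \<Rightarrow> 'z" and b e g :: "nat \<Rightarrow> real"
  assumes step: "\<And>n z. n \<ge> n0 \<Longrightarrow> r (Suc n) z \<le> R \<Longrightarrow>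
        D (Suc n) z \<le> D n (L n z) + b n * e n * r (Suc n) z"
    and L: "\<And>n z. n \<ge> n0 \<Longrightarrow> r n (L n z) \<le> (1 - b n) * r (Suc n) z"
    and b: "\<And>n. n \<ge> n0 \<Longrightarrow> 0 \<le> b n" "\<And>n. n \<ge> n0 \<Longrightarrow> b n \<le> 1"
    and g: "\<And>n. n \<ge> n0 \<Longrightarrow> 0 < g n" "\<And>n. n \<ge> n0 \<Longrightarrow> (1 - b n) * g (Suc n) \<le> g n"
    and g_top: "filterlim g at_top sequentially"
    and e: "e \<longlonglongrightarrow> 0"
    and r: "\<And>n z. n \<ge> n0 \<Longrightarrow> 0 \<le> r n z"
    and init: "\<And>z. r n0 z \<le> R \<Longrightarrow> D n0 z \<le> C * r n0 z"
  obtains d where "d \<longlonglongrightarrow> 0" "\<And>n z. n \<ge> n0 \<Longrightarrow> r n z \<le> R \<Longrightarrow> D n z \<le> d n * r n z"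
proof -
  define d where "d n = rec_nat \<bar>C\<bar> (\<lambda>k c. (1 - b (n0 + k)) * c + b (n0 + k) * \<bar>e (n0 + k)\<bar>) (n - n0)" for n
  have d0: "d n = \<bar>C\<bar>" if "n \<le> n0" for n using that by (simp add: d_def)
  have dS: "d (Suc n) = (1 - b n) * d n + b n * \<bar>e n\<bar>" if "n \<ge> n0" for n
    using that by (simp add: d_def Suc_diff_le)
  have dpos: "0 \<le> d n" for n
  proof (cases "n \<le> n0")
    case False
    then have "n0 \<le> n" by simp
    then show ?thesis
    proof (induction n rule: dec_induct)
      case (step n) then show ?case using b[of n] by (simp add: dS)
    qed (simp add: d0)
  qed (simp add: d0)
  show thesis
  proof
    show "d \<longlonglongrightarrow> 0"
    proof (rule contraction_tendsto_0[where b = b and e = "\<lambda>n. \<bar>e n\<bar>" and g = g and ?n0.0 = n0])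
      show "(\<lambda>n. \<bar>e n\<bar>) \<longlonglongrightarrow> 0" using e by (rule tendsto_rabs_zero)
    qed (use b g g_top dS dpos in auto)
    fix n z assume "n \<ge> n0" "r n z \<le> R"
    then show "D n z \<le> d n * r n z"
    proof (induction n arbitrary: z rule: dec_induct)
      case base
      have "C * r n0 z \<le> \<bar>C\<bar> * r n0 z" using r by (intro mult_right_mono) auto
      then show ?case using init[of z] base by (simp add: d0)
    next
      case (step n)
      have "r n (L n z) \<le> (1 - b n) * r (Suc n) z" using L step by simp
      also have "\<dots> \<le> 1 * r (Suc n) z" using b[of n] r step by (intro mult_right_mono) auto
      finally have le: "r n (L n z) \<le> R" using step.prems by simp
      have "D (Suc n) z \<le> D n (L n z) + b n * e n * r (Suc n) z"
        using assms(1)[of n z] step by simp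
      also have "D n (L n z) \<le> d n * r n (L n z)" using step.IH[OF le] .
      also have "\<dots> \<le> d n * ((1 - b n) * r (Suc n) z)"
        using L[of n z] step dpos by (intro mult_left_mono) auto
      also have "b n * e n * r (Suc n) z \<le> b n * \<bar>e n\<bar> * r (Suc n) z"
        using b[of n] r step by (intro mult_right_mono mult_left_mono) auto
      finally show ?case using step by (simp add: dS algebra_simps)
    qed
  qed
qed

text \<open>Between \<open>j ^ k\<close> and \<open>(j + 1) ^ k\<close> the sequence \<open>z\<close> moves by at most \<open>c * ((j + 1) ^ k - j ^ k)\<close>,
  which is small compared with \<open>j ^ k\<close>.\<close>

lemma tendsto_along_powers:
  fixes z :: "nat \<Rightarrow> real"
  assumes k: "k \<ge> 1" and inc: "\<And>n. n \<ge> 1 \<Longrightarrow> \<bar>z (Suc n) - z n\<bar> \<le> c"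
    and sub: "(\<lambda>j. z (j ^ k) / real (j ^ k)) \<longlonglongrightarrow> 0"
  shows "(\<lambda>n. z n / real n) \<longlonglongrightarrow> 0"
proof (rule LIMSEQ_I)
  fix r :: real assume r: "r > 0"
  have c: "c \<ge> 0" using inc[of 1] by simp
  have inc': "\<bar>z n - z m\<bar> \<le> c * real (n - m)" if "1 \<le> m" "m \<le> n" for m n
    using that(2)
  proof (induction n rule: dec_induct)
    case (step n)
    then show ?case using inc[of n] that(1) by (auto simp: Suc_diff_le algebra_simps)
  qed simp
  have "(\<lambda>j. (1 + 1 / real j) ^ k) \<longlonglongrightarrow> (1 + 0) ^ k"
    by (intro tendsto_intros lim_1_over_n)
  then have "(\<lambda>j. (1 + 1 / real j) ^ k) \<longlonglongrightarrow> 1" by simp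
  then have "(\<lambda>j. c * ((1 + 1 / real j) ^ k - 1)) \<longlonglongrightarrow> c * (1 - 1)"
    by (intro tendsto_mult_left tendsto_diff tendsto_const)
  then have "eventually (\<lambda>j. c * ((1 + 1 / real j) ^ k - 1) < r / 2) sequentially"
    using r by (intro order_tendstoD(2)) auto
  moreover have "eventually (\<lambda>j. \<bar>z (j ^ k) / real (j ^ k)\<bar> < r / 2) sequentially"
    using tendstoD[OF sub, of "r / 2"] r by (simp add: dist_real_def)
  moreover have "eventually (\<lambda>j. j \<ge> 1) sequentially" by (rule eventually_ge_at_top)
  ultimately have "eventually (\<lambda>j. c * ((1 + 1 / real j) ^ k - 1) < r / 2 \<and> \<bar>z (j ^ k) / real (j ^ k)\<bar> < r / 2 \<and> j \<ge> 1) sequentially"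
    by eventually_elim simp
  then obtain m where m: "\<And>j. j \<ge> m \<Longrightarrow> c * ((1 + 1 / real j) ^ k - 1) < r / 2 \<and> \<bar>z (j ^ k) / real (j ^ k)\<bar> < r / 2 \<and> j \<ge> 1"
    by (auto simp: eventually_sequentially)
  show "\<exists>no. \<forall>n\<ge>no. norm (z n / real n - 0) < r"
  proof (intro exI allI impI)
    fix n assume n: "n \<ge> m ^ k"
    define i where "i = (LEAST i. n < i ^ k)"
    have "n < Suc n ^ k" using self_le_power[of "Suc n" k] k by simp
    then have i: "n < i ^ k" unfolding i_def by (rule LeastI)
    have "i > m"
    proof (rule ccontr)
      assume "\<not> i > m"
      then have "i ^ k \<le> m ^ k" by (intro power_mono) auto
      with i n show False by simp
    qed
    define j where "j = i - 1"
    have j: "i = Suc j" "j \<ge> m" using \<open>i > m\<close> by (auto simp: j_def)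
    have jn: "j ^ k \<le> n" using not_less_Least[of j "\<lambda>i. n < i ^ k"] j unfolding i_def by force
    note mj = m[OF j(2)]
    have j1: "j ^ k \<ge> 1" using mj by simp
    then have pos: "real (j ^ k) > 0" by linarith
    have "\<bar>z n\<bar> \<le> \<bar>z (j ^ k)\<bar> + c * real (n - j ^ k)"
      using inc'[OF j1 jn] by linarith
    also have "\<dots> \<le> \<bar>z (j ^ k)\<bar> + c * (real (i ^ k) - real (j ^ k))"
      using i jn c by (intro add_left_mono mult_left_mono) (auto simp: of_nat_diff)
    finally have "\<bar>z n\<bar> / real n \<le> (\<bar>z (j ^ k)\<bar> + c * (real (i ^ k) - real (j ^ k))) / real n"
      by (intro divide_right_mono) auto
    also have "\<dots> \<le> (\<bar>z (j ^ k)\<bar> + c * (real (i ^ k) - real (j ^ k))) / real (j ^ k)"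
    proof (rule divide_left_mono)
      show "real (j ^ k) \<le> real n" using jn by (simp only: of_nat_le_iff)
      show "0 \<le> \<bar>z (j ^ k)\<bar> + c * (real (i ^ k) - real (j ^ k))"
        using c j by (intro add_nonneg_nonneg mult_nonneg_nonneg) (auto simp: power_mono)
      show "0 < real n * real (j ^ k)" using pos j1 jn by (intro mult_pos_pos) linarith+
    qed
    also have "\<dots> = \<bar>z (j ^ k) / real (j ^ k)\<bar> + c * ((1 + 1 / real j) ^ k - 1)"
    proof -
      have "real (i ^ k) = real (j ^ k) * (1 + 1 / real j) ^ k"
        using mj by (simp add: j power_mult_distrib[symmetric] field_simps)
      then show ?thesis using pos by (simp add: field_simps)
    qed
    also have "\<dots> < r" using mj by linarith
    finally show "norm (z n / real n - 0) < r" by simp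
  qed
qed

section \<open>Weak convergence from characteristic functions\<close>

inductive trig_poly :: "('a::real_inner \<Rightarrow> complex) \<Rightarrow> bool" where
  wave: "trig_poly (\<lambda>x. c * cis (t \<bullet> x))"
| add: "trig_poly f \<Longrightarrow> trig_poly g \<Longrightarrow> trig_poly (\<lambda>x. f x + g x)"

lemma trig_poly_const: "trig_poly (\<lambda>x. c)"
  using trig_poly.wave[of c 0] by simp

lemma trig_poly_mult_wave:
  assumes "trig_poly f" shows "trig_poly (\<lambda>x. c * cis (t \<bullet> x) * f x)"
  using assms
proof induction
  case (wave c' t')
  have "(\<lambda>x. c * cis (t \<bullet> x) * (c' * cis (t' \<bullet> x))) = (\<lambda>x. (c * c') * cis ((t + t') \<bullet> x))"
    by (rule ext) (simp add: inner_add_left cis_mult[symmetric] mult_ac)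
  then show ?case by (simp only: trig_poly.wave)
next
  case (add f g) then show ?case using trig_poly.add by (simp add: distrib_left)
qed

lemma trig_poly_mult: "trig_poly f \<Longrightarrow> trig_poly g \<Longrightarrow> trig_poly (\<lambda>x. f x * g x)"
proof (induction rule: trig_poly.induct)
  case (wave c t) then show ?case by (rule trig_poly_mult_wave)
next
  case (add f h) then show ?case using trig_poly.add by (simp add: distrib_right)
qed

lemma trig_poly_sum:
  "finite I \<Longrightarrow> (\<And>i. i \<in> I \<Longrightarrow> trig_poly (f i)) \<Longrightarrow> trig_poly (\<lambda>x. \<Sum>i\<in>I. f i x)"
  by (induction I rule: finite_induct) (auto intro: trig_poly_const trig_poly.add)

lemma trig_poly_sin: "trig_poly (\<lambda>x. complex_of_real (sin (t \<bullet> x)))"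
proof -
  have "trig_poly (\<lambda>x. (- \<i> / 2) * cis (t \<bullet> x) + (\<i> / 2) * cis ((- t) \<bullet> x))"
    by (intro trig_poly.intros)
  also have "(\<lambda>x. (- \<i> / 2) * cis (t \<bullet> x) + (\<i> / 2) * cis ((- t) \<bullet> x)) = (\<lambda>x. complex_of_real (sin (t \<bullet> x)))"
    by (rule ext) (auto simp: complex_eq_iff)
  finally show ?thesis .
qed

lemma trig_poly_polynomial_sin:
  assumes "real_polynomial_function (P :: real ^ 'n \<Rightarrow> real)"
  shows "trig_poly (\<lambda>x :: real ^ 'n. complex_of_real (P (\<chi> i. sin (s * x $ i))))"
  using assms
proof induction
  case (linear f)
  interpret bounded_linear f by fact
  have eq: "f (\<chi> i. sin (s * x $ i)) = (\<Sum>i\<in>UNIV. f (axis i 1) * sin ((s *\<^sub>R axis i 1) \<bullet> x))" for x :: "real ^ 'n"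
  proof -
    have "(\<chi> i. sin (s * x $ i)) = (\<Sum>i\<in>UNIV. sin (s * x $ i) *\<^sub>R axis i 1)"
      by (simp add: vec_eq_iff axis_def sum.delta if_distrib cong: if_cong)
    then show ?thesis by (simp add: sum scaleR inner_axis' mult.commute)
  qed
  show ?case unfolding eq of_real_sum of_real_mult
    by (intro trig_poly_sum trig_poly_mult trig_poly_sin trig_poly_const) auto
next
  case (const c) then show ?case by (rule trig_poly_const)
next
  case (add f g) then show ?case using trig_poly.add by simp
next
  case (mult f g) then show ?case using trig_poly_mult by simp
qed

lemma integrable_cis:
  fixes f :: "'a \<Rightarrow> real"
  assumes "finite_measure M" "f \<in> borel_measurable M"
  shows "integrable M (\<lambda>x. cis (f x))"
proof -
  interpret finite_measure M by fact
  have [measurable]: "f \<in> borel_measurable M" by fact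
  have "(\<lambda>x. cis (f x)) \<in> borel_measurable M" unfolding cis_conv_exp by measurable
  then show ?thesis by (intro integrable_const_bound[of _ 1]) auto
qed

lemma trig_poly_integral_tendsto:
  fixes f :: "real ^ 'n \<Rightarrow> complex"
  assumes mu: "\<And>n. prob_space (\<mu> n)" "\<And>n. sets (\<mu> n) = sets borel"
    and N: "prob_space N" "sets N = sets borel"
    and char: "\<And>t. (\<lambda>n. \<integral>x. cis (t \<bullet> x) \<partial>\<mu> n) \<longlonglongrightarrow> (\<integral>x. cis (t \<bullet> x) \<partial>N)"
    and f: "trig_poly f"
  shows "(\<forall>n. integrable (\<mu> n) f) \<and> integrable N f \<and> (\<lambda>n. \<integral>x. f x \<partial>\<mu> n) \<longlonglongrightarrow> (\<integral>x. f x \<partial>N)"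
  using f
proof induction
  case (wave c t)
  have "integrable (\<mu> n) (\<lambda>x. cis (t \<bullet> x))" for n
    by (rule integrable_cis) (use mu in \<open>simp_all add: prob_space.finite_measure cong: measurable_cong_sets\<close>)
  moreover have "integrable N (\<lambda>x. cis (t \<bullet> x))"
    by (rule integrable_cis) (use N in \<open>simp_all add: prob_space.finite_measure cong: measurable_cong_sets\<close>)
  ultimately show ?case using tendsto_mult_left[OF char, of c] by simp
next
  case (add f g)
  then show ?case by (auto intro: tendsto_add)
qed

text \<open>On a large ball, a bounded continuous \<open>f\<close> agrees with the function obtained by folding
  each coordinate \<open>y\<close> to \<open>a arcsin (sin (y / a))\<close>. The latter is everywhere bounded by the bound of
  \<open>f\<close> and, by the Stone--Weierstrass theorem on the cube, uniformly close to a polynomial in the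
  \<open>sin (y / a)\<close>, which is a trigonometric polynomial; what happens outside the ball is
  controlled by tightness.\<close>

lemma weakly_converges_char:
  fixes \<mu> :: "nat \<Rightarrow> (real ^ 'n) measure"
  assumes mu: "\<And>n. prob_space (\<mu> n)" "\<And>n. sets (\<mu> n) = sets borel"
    and N: "prob_space N" "sets N = sets borel"
    and char: "\<And>t. (\<lambda>n. \<integral>x. cis (t \<bullet> x) \<partial>\<mu> n) \<longlonglongrightarrow> (\<integral>x. cis (t \<bullet> x) \<partial>N)"
    and tight: "\<And>e. e > 0 \<Longrightarrow> \<exists>A. \<forall>\<^sub>F n in sequentially. measure (\<mu> n) {x. norm x > A} \<le> e"
  shows "weakly_converges \<mu> N"
  unfolding weakly_converges_def
proof (intro allI impI)
  fix f :: "real ^ 'n \<Rightarrow> real"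
  assume cont: "continuous_on UNIV f" and bdd: "bounded (range f)"
  obtain F where F: "F > 0" "\<And>x. \<bar>f x\<bar> \<le> F"
    using bdd by (auto simp: bounded_pos)
  have fm: "f \<in> borel_measurable borel" by (rule borel_measurable_continuous_onI[OF cont])
  show "(\<lambda>n. \<integral>x. f x \<partial>\<mu> n) \<longlonglongrightarrow> (\<integral>x. f x \<partial>N)"
  proof (rule LIMSEQ_I)
    fix r :: real assume r: "r > 0"
    \<comment> \<open>Replacing \<open>f\<close> by the trigonometric polynomial \<open>h\<close> costs \<open>e + 2 F e\<close> for \<open>\<mu> n\<close> and for
        \<open>N\<close>, and comparing the integrals of \<open>h\<close> another \<open>e\<close>: in total \<open>(4 F + 3) e\<close>.\<close>
    define e where "e = r / (4 * F + 4)"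
    have e: "e > 0" "(4 * F + 3) * e < r" using r F by (auto simp: e_def field_simps)
    obtain A1 where A1: "\<forall>\<^sub>F n in sequentially. measure (\<mu> n) {x. norm x > A1} \<le> e"
      using tight[OF e(1)] by blast
    interpret N: prob_space N by fact
    have "(\<lambda>k. N.prob {x. norm x > real k}) \<longlonglongrightarrow> N.prob (\<Inter>k. {x. norm x > real k})"
    proof (rule N.finite_Lim_measure_decseq)
      show "range (\<lambda>k. {x. norm x > real k}) \<subseteq> N.events" by (auto simp: N(2))
      show "decseq (\<lambda>k. {x :: real ^ 'n. norm x > real k})"
        unfolding decseq_def by (auto intro: le_less_trans[OF of_nat_mono])
    qed
    also have "(\<Inter>k. {x::real^'n. norm x > real k}) = {}"
    proof -
      have "x \<notin> (\<Inter>k. {x. norm x > real k})" for x :: "real ^ 'n"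
      proof -
        obtain n where "norm x < real n" using reals_Archimedean2 by blast
        then show ?thesis by (auto simp: not_less intro!: exI[of _ n])
      qed
      then show ?thesis by blast
    qed
    finally have "eventually (\<lambda>k. N.prob {x. norm x > real k} < e) sequentially"
      using e(1) by (intro order_tendstoD) auto
    then obtain A2 where A2: "N.prob {x. norm x > real A2} < e"
      by (auto simp: eventually_sequentially)
    define B where "B = max A1 (real A2)"
    define a where "a = \<bar>B\<bar> + 1"
    have a: "a > 0" "\<bar>B\<bar> \<le> a" by (auto simp: a_def)
    define G where "G y = f (\<chi> i. a * arcsin (y $ i))" for y :: "real ^ 'n"
    define fold where "fold x = (\<chi> i. sin (1 / a * x $ i))" for x :: "real ^ 'n"
    have fold: "fold x \<in> cbox (\<chi> i. -1) (\<chi> i. 1)" for x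
      by (auto simp: mem_box_cart fold_def)
    have "continuous_on (cbox (\<chi> i. -1) (\<chi> i. 1)) (\<lambda>y :: real ^ 'n. \<chi> i. a * arcsin (y $ i))"
      by (intro continuous_on_vec_lambda continuous_intros) (auto simp: mem_box_cart)
    then have "continuous_on (cbox (\<chi> i. -1) (\<chi> i. 1)) G"
      unfolding G_def by (rule continuous_on_compose2[OF cont]) auto
    then obtain P where P: "real_polynomial_function P"
      "\<And>y. y \<in> cbox (\<chi> i. -1) (\<chi> i. 1) \<Longrightarrow> \<bar>G y - P y\<bar> < e"
      using Stone_Weierstrass_real_polynomial_function[OF compact_cbox _ e(1)] by metis
    define h where "h x = P (fold x)" for x
    have near: "\<bar>G (fold x) - h x\<bar> \<le> e" for x using P(2)[OF fold, of x] by (simp add: h_def)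
    have inside: "G (fold x) = f x" if "norm x \<le> B" for x
    proof -
      have "a * arcsin (sin (1 / a * x $ i)) = x $ i" for i
      proof -
        have "\<bar>x $ i\<bar> \<le> a" using component_le_norm_cart[of x i] that a by linarith
        then have "\<bar>1 / a * x $ i\<bar> \<le> 1" using a by (simp add: abs_mult)
        then have "- (pi / 2) \<le> 1 / a * x $ i \<and> 1 / a * x $ i \<le> pi / 2"
          using pi_gt3 by linarith
        then show ?thesis using a by (subst arcsin_sin) auto
      qed
      then show ?thesis by (simp add: G_def fold_def vec_nth_inverse)
    qed
    have hm: "h \<in> borel_measurable borel"
    proof -
      have "continuous_on UNIV h" unfolding h_def fold_def
        by (rule continuous_on_compose2[OF continuous_on_polymonial_function[of P UNIV]])
           (use P a in \<open>auto simp: real_polynomial_function_eq intro!: continuous_intros continuous_on_vec_lambda\<close>)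
      then show ?thesis by (rule borel_measurable_continuous_onI)
    qed
    have hb: "\<bar>h x\<bar> \<le> F + e" for x
      using near[of x] F(2)[of "\<chi> i. a * arcsin (fold x $ i)"] by (auto simp: G_def)
    have pw: "\<bar>f x - h x\<bar> \<le> e + 2 * F * indicator {x. norm x > B} x" for x
    proof (cases "norm x \<le> B")
      case True then show ?thesis using near[of x] inside[of x] by simp
    next
      case False then show ?thesis
        using near[of x] F(2)[of "\<chi> i. a * arcsin (fold x $ i)"] F(2)[of x] by (auto simp: G_def)
    qed
    have close: "\<bar>(\<integral>x. f x \<partial>m) - (\<integral>x. h x \<partial>m)\<bar> \<le> e + 2 * F * measure m {x. norm x > B}"
      if m: "prob_space m" "sets m = sets borel" for m
    proof -
      interpret prob_space m by fact
      have [simp]: "space m = UNIV" using sets_eq_imp_space_eq[OF m(2)] by simp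
      have fi: "integrable m f"
        by (rule integrable_const_bound[of _ F]) (use F fm m in \<open>auto cong: measurable_cong_sets\<close>)
      have hi: "integrable m h"
        by (rule integrable_const_bound[of _ "F + e"]) (use hb hm m in \<open>auto cong: measurable_cong_sets\<close>)
      have Bs: "{x. norm x > B} \<in> sets m" using m by simp
      have "\<bar>(\<integral>x. f x \<partial>m) - (\<integral>x. h x \<partial>m)\<bar> = \<bar>\<integral>x. f x - h x \<partial>m\<bar>" using fi hi by simp
      also have "\<dots> \<le> (\<integral>x. \<bar>f x - h x\<bar> \<partial>m)" by (rule integral_abs_bound)
      also have "\<dots> \<le> (\<integral>x. e + 2 * F * indicator {x. norm x > B} x \<partial>m)"
        using fi hi Bs pw by (intro integral_mono) (auto simp: emeasure_eq_measure)
      also have "\<dots> = e + 2 * F * measure m {x. norm x > B}"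
        using Bs prob_space by (simp add: emeasure_eq_measure)
      finally show ?thesis .
    qed
    have hc: "trig_poly (\<lambda>x. complex_of_real (h x))"
      unfolding h_def fold_def by (rule trig_poly_polynomial_sin[OF P(1)])
    have "(\<lambda>n. \<integral>x. complex_of_real (h x) \<partial>\<mu> n) \<longlonglongrightarrow> (\<integral>x. complex_of_real (h x) \<partial>N)"
      using trig_poly_integral_tendsto[OF mu N char hc] by blast
    then have "(\<lambda>n. \<integral>x. h x \<partial>\<mu> n) \<longlonglongrightarrow> (\<integral>x. h x \<partial>N)"
      by (simp only: integral_complex_of_real tendsto_of_real_iff)
    then have "eventually (\<lambda>n. \<bar>(\<integral>x. h x \<partial>\<mu> n) - (\<integral>x. h x \<partial>N)\<bar> < e) sequentially"
      using e(1) by (auto dest: tendstoD simp: dist_real_def)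
    with A1 have "eventually (\<lambda>n. norm ((\<integral>x. f x \<partial>\<mu> n) - (\<integral>x. f x \<partial>N)) < r) sequentially"
    proof eventually_elim
      case (elim n)
      interpret m: prob_space "\<mu> n" by fact
      have [simp]: "space (\<mu> n) = UNIV" using sets_eq_imp_space_eq[OF mu(2)] by simp
      have "measure (\<mu> n) {x. norm x > B} \<le> measure (\<mu> n) {x. norm x > A1}"
        by (rule m.finite_measure_mono) (auto simp: B_def mu(2))
      then have 1: "2 * F * measure (\<mu> n) {x. norm x > B} \<le> 2 * F * e"
        using elim F by (intro mult_left_mono) auto
      have "measure N {x. norm x > B} \<le> measure N {x. norm x > real A2}"
        by (rule N.finite_measure_mono) (auto simp: B_def N(2))
      then have 2: "2 * F * measure N {x. norm x > B} \<le> 2 * F * e"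
        using A2 F by (intro mult_left_mono) auto
      have "\<bar>(\<integral>x. f x \<partial>\<mu> n) - (\<integral>x. f x \<partial>N)\<bar> \<le> (4 * F + 3) * e"
        using close[OF mu, of n] close[OF N] elim(2) 1 2 by (simp add: algebra_simps)
      then show ?case using e(2) by simp
    qed
    then show "\<exists>no. \<forall>n\<ge>no. norm ((\<integral>x. f x \<partial>\<mu> n) - (\<integral>x. f x \<partial>N)) < r"
      by (simp add: eventually_sequentially)
  qed
qed

section \<open>Normal laws on the plane\<close>

lemma real_distribution_centred_normal:
  "v \<ge> 0 \<Longrightarrow> real_distribution (centred_normal_real v)"
  unfolding centred_normal_real_def real_distribution_def real_distribution_axioms_def
  by (auto intro: prob_space_return prob_space_normal_density)

lemma char_centred_normal_real:
  assumes "v \<ge> 0"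
  shows "char (centred_normal_real v) t = of_real (exp (- (v * t\<^sup>2) / 2))"
proof (cases "v = 0")
  case True
  then show ?thesis by (simp add: centred_normal_real_def char_def integral_return)
next
  case False
  then have s: "sqrt v > 0" using assms by simp
  interpret S: prob_space std_normal_distribution
    by (rule prob_space_normal_density) simp
  have "distributed std_normal_distribution lborel (\<lambda>x. x) std_normal_density"
    by (auto simp: distributed_def distr_id2)
  from S.normal_density_affine[OF this, of "sqrt v" 0] s
  have "distributed std_normal_distribution lborel (\<lambda>x. sqrt v * x) (normal_density 0 (sqrt v))"
    by simp
  then have "distr std_normal_distribution lborel (\<lambda>x. sqrt v * x) = centred_normal_real v"
    using False by (simp add: distributed_def centred_normal_real_def)
  then have "char (centred_normal_real v) t = char (distr std_normal_distribution lborel (\<lambda>x. sqrt v * x)) t"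
    by simp
  also have "\<dots> = char std_normal_distribution (t * sqrt v)"
    unfolding char_def by (subst integral_distr) (auto simp: mult_ac)
  also have "\<dots> = of_real (exp (- (v * t\<^sup>2) / 2))"
    using assms by (simp add: char_std_normal_distribution power_mult_distrib mult.commute)
  finally show ?thesis .
qed

lemma centred_normal_char:
  assumes "centred_normal \<Sigma> N"
  shows "(\<integral>x. cis (t \<bullet> x) \<partial>N) = of_real (exp (- (t \<bullet> (\<Sigma> *v t)) / 2))"
proof -
  have N: "sets N = sets borel" and q: "t \<bullet> (\<Sigma> *v t) \<ge> 0"
    and d: "distr N borel (\<lambda>x. t \<bullet> x) = centred_normal_real (t \<bullet> (\<Sigma> *v t))"
    using assms by (auto simp: centred_normal_def)
  have [measurable]: "(\<lambda>x. t \<bullet> x) \<in> borel_measurable N"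
    using N by (simp cong: measurable_cong_sets)
  have "(\<integral>x. cis (t \<bullet> x) \<partial>N) = char (distr N borel (\<lambda>x. t \<bullet> x)) 1"
    unfolding char_def by (subst integral_distr) (auto simp: cis_conv_exp)
  also have "\<dots> = of_real (exp (- (t \<bullet> (\<Sigma> *v t)) / 2))"
    unfolding d using char_centred_normal_real[OF q, of 1] by simp
  finally show ?thesis .
qed

lemma std_normal_pair_combination:
  "distr (std_normal_distribution \<Otimes>\<^sub>M std_normal_distribution) borel (\<lambda>(g, h). c * g + d * h)
     = centred_normal_real (c\<^sup>2 + d\<^sup>2)"
proof (rule Levy_uniqueness)
  let ?S = "std_normal_distribution" and ?f = "\<lambda>(g, h). c * g + d * h"
  interpret S: prob_space ?S by (rule prob_space_normal_density) simp
  interpret P: pair_prob_space ?S ?S ..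
  show "real_distribution (distr (?S \<Otimes>\<^sub>M ?S) borel ?f)"
    by (rule P.real_distribution_distr) simp
  show "real_distribution (centred_normal_real (c\<^sup>2 + d\<^sup>2))"
    by (rule real_distribution_centred_normal) simp
  show "char (distr (?S \<Otimes>\<^sub>M ?S) borel ?f) = char (centred_normal_real (c\<^sup>2 + d\<^sup>2))"
  proof
    fix t
    have int: "integrable (?S \<Otimes>\<^sub>M ?S) (\<lambda>(g, h). iexp (t * c * g) * iexp (t * d * h))"
      by (rule P.integrable_const_bound[of _ 1]) (auto simp: norm_mult)
    have "char (distr (?S \<Otimes>\<^sub>M ?S) borel ?f) t = (\<integral>z. iexp (t * ?f z) \<partial>(?S \<Otimes>\<^sub>M ?S))"
      unfolding char_def by (subst integral_distr) auto
    also have "\<dots> = (\<integral>z. (case z of (g, h) \<Rightarrow> iexp (t * c * g) * iexp (t * d * h)) \<partial>(?S \<Otimes>\<^sub>M ?S))"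
      by (intro Bochner_Integration.integral_cong) (auto simp: algebra_simps exp_add split: prod.splits)
    also have "\<dots> = (\<integral>g. (\<integral>h. iexp (t * c * g) * iexp (t * d * h) \<partial>?S) \<partial>?S)"
      using P.integral_fst'[OF int] by simp
    also have "\<dots> = char ?S (t * c) * char ?S (t * d)"
      by (simp add: char_def)
    also have "\<dots> = char (centred_normal_real (c\<^sup>2 + d\<^sup>2)) t"
      by (simp add: char_std_normal_distribution char_centred_normal_real exp_of_real of_real_mult[symmetric]
          exp_add[symmetric] power_mult_distrib algebra_simps add_divide_distrib[symmetric] del: of_real_mult)
    finally show "char (distr (?S \<Otimes>\<^sub>M ?S) borel ?f) t = char (centred_normal_real (c\<^sup>2 + d\<^sup>2)) t" .
  qed
qed

lemma quadratic_form_symmetric: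
  fixes t :: "real ^ 2"
  assumes "\<Sigma> = vector [vector [a + b, a - b], vector [a - b, a + b :: real]]"
  shows "t \<bullet> (\<Sigma> *v t) = a * (t $ 1 + t $ 2)\<^sup>2 + b * (t $ 1 - t $ 2)\<^sup>2"
  unfolding assms
  by (simp add: inner_vec_def matrix_vector_mult_def sum_2 power2_eq_square algebra_simps)

text \<open>For independent standard normal \<open>g\<close> and \<open>h\<close>, the vector
  \<open>(sqrt a g + sqrt b h, sqrt a g - sqrt b h)\<close> has this covariance matrix. The limiting covariance
  matrices have this form because exchanging the colours does not change the law of the process.\<close>

lemma centred_normal_exists:
  assumes S: "\<Sigma> = vector [vector [a + b, a - b], vector [a - b, a + b :: real]]"
    and ab: "a \<ge> 0" "b \<ge> 0"
  shows "\<exists>N. centred_normal (\<Sigma> :: real ^ 2 ^ 2) N"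
proof
  let ?S = "std_normal_distribution"
  let ?v = "\<lambda>(g, h). vector [sqrt a * g + sqrt b * h, sqrt a * g - sqrt b * h] :: real ^ 2"
  let ?N = "distr (?S \<Otimes>\<^sub>M ?S) borel ?v"
  interpret S: prob_space ?S by (rule prob_space_normal_density) simp
  interpret P: pair_prob_space ?S ?S ..
  have vec: "?v z = (sqrt a * fst z + sqrt b * snd z) *\<^sub>R axis 1 1 + (sqrt a * fst z - sqrt b * snd z) *\<^sub>R axis 2 1" for z
    by (cases z) (simp add: vec_eq_iff forall_2 axis_def)
  have [measurable]: "?v \<in> borel_measurable (?S \<Otimes>\<^sub>M ?S)"
    unfolding vec by measurable
  show "centred_normal \<Sigma> ?N"
    unfolding centred_normal_def
  proof (intro conjI allI)
    show "prob_space ?N" by (rule P.prob_space_distr) measurable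
    show "sets ?N = sets borel" by simp
    show "transpose \<Sigma> = \<Sigma>" by (simp add: S vec_eq_iff forall_2 transpose_def)
    fix t :: "real ^ 2"
    have q: "t \<bullet> (\<Sigma> *v t) = (sqrt a * (t $ 1 + t $ 2))\<^sup>2 + (sqrt b * (t $ 1 - t $ 2))\<^sup>2"
      using quadratic_form_symmetric[OF S] ab by (simp add: power_mult_distrib)
    then show "t \<bullet> (\<Sigma> *v t) \<ge> 0" by simp
    have "distr ?N borel (\<lambda>x. t \<bullet> x) = distr (?S \<Otimes>\<^sub>M ?S) borel (\<lambda>z. t \<bullet> ?v z)"
      by (subst distr_distr) (auto simp: comp_def)
    also have "(\<lambda>z. t \<bullet> ?v z) = (\<lambda>(g, h). (sqrt a * (t $ 1 + t $ 2)) * g + (sqrt b * (t $ 1 - t $ 2)) * h)"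
      by (auto simp: inner_vec_def sum_2 algebra_simps)
    also have "distr (?S \<Otimes>\<^sub>M ?S) borel \<dots> = centred_normal_real (t \<bullet> (\<Sigma> *v t))"
      unfolding q by (rule std_normal_pair_combination)
    finally show "distr ?N borel (\<lambda>x. t \<bullet> x) = centred_normal_real (t \<bullet> (\<Sigma> *v t))" .
  qed
qed

section \<open>Events and expectations determined by the past\<close>

definition csign :: "colour \<Rightarrow> real" where
  "csign k = (if k = Red then 1 else - 1)"

lemma csign_simps [simp]: "csign Red = 1" "csign Blue = - 1" "csign k * csign k = 1" "\<bar>csign k\<bar> = 1"
  by (simp_all add: csign_def)

lemma csign_of_bool:
  "csign k = 2 * of_bool (k = Red) - 1" "csign k = 1 - 2 * of_bool (k = Blue)"
  by (cases k; simp)+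

lemma colour_UNIV: "(UNIV :: colour set) = {Red, Blue}"
  by (auto intro: colour.exhaust)

instance colour :: finite
  by standard (simp add: colour_UNIV)

lemma sum_colour: "(\<Sum>k\<in>UNIV. f k) = f Red + f Blue"
  unfolding colour_UNIV by simp

locale pa_process = broadcast_pa_trees +
  assumes alpha_gt: "- 1 < \<alpha>" and p_range: "0 \<le> p" "p \<le> 1"
begin

definition same :: "nat \<Rightarrow> 'a \<Rightarrow> 'a \<Rightarrow> bool" where
  "same n \<omega> \<omega>' \<longleftrightarrow> same_history n (\<lambda>i. par i \<omega>) (\<lambda>i. col i \<omega>) (\<lambda>i. par i \<omega>') (\<lambda>i. col i \<omega>')"

lemma same_sym: "same n \<omega> \<omega>' \<Longrightarrow> same n \<omega>' \<omega>"
  by (auto simp: same_def same_history_def)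

lemma same_trans: "same n \<omega> \<omega>' \<Longrightarrow> same n \<omega>' \<omega>'' \<Longrightarrow> same n \<omega> \<omega>''"
  by (auto simp: same_def same_history_def)

lemma same_mono: "same n \<omega> \<omega>' \<Longrightarrow> m \<le> n \<Longrightarrow> same m \<omega> \<omega>'"
  by (auto simp: same_def same_history_def)

lemma same_par: "same n \<omega> \<omega>' \<Longrightarrow> 1 \<le> i \<Longrightarrow> i < n \<Longrightarrow> par i \<omega> = par i \<omega>'"
  and same_col: "same n \<omega> \<omega>' \<Longrightarrow> i < n \<Longrightarrow> col i \<omega> = col i \<omega>'"
  by (auto simp: same_def same_history_def)

text \<open>Being a function of the first \<open>n\<close> arrivals. Since these have finitely many possible
  outcomes, every such function is automatically measurable and integrable.\<close>

definition past :: "nat \<Rightarrow> ('a \<Rightarrow> 'b) \<Rightarrow> bool" where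
  "past n g \<longleftrightarrow> (\<forall>\<omega>\<in>space M. \<forall>\<omega>'\<in>space M. same n \<omega> \<omega>' \<longrightarrow> g \<omega> = g \<omega>')"

named_theorems past_intros

lemma past_mono: "past m g \<Longrightarrow> m \<le> n \<Longrightarrow> past n g"
  unfolding past_def using same_mono by blast

lemma past_Suc: "past n g \<Longrightarrow> past (Suc n) g"
  by (rule past_mono) auto

lemma past_const [past_intros]: "past n (\<lambda>\<omega>. c)"
  by (simp add: past_def)

lemma past_comp: "past n f \<Longrightarrow> past n (\<lambda>\<omega>. F (f \<omega>))"
  unfolding past_def by metis

lemma past_comp2: "past n f \<Longrightarrow> past n g \<Longrightarrow> past n (\<lambda>\<omega>. F (f \<omega>) (g \<omega>))"
  unfolding past_def by metis

lemma past_ops [past_intros]: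
  "past n f \<Longrightarrow> past n g \<Longrightarrow> past n (\<lambda>\<omega>. f \<omega> + g \<omega>)"
  "past n f \<Longrightarrow> past n g \<Longrightarrow> past n (\<lambda>\<omega>. f \<omega> - g \<omega>)"
  "past n f \<Longrightarrow> past n g \<Longrightarrow> past n (\<lambda>\<omega>. f \<omega> * g \<omega>)"
  "past n f \<Longrightarrow> past n g \<Longrightarrow> past n (\<lambda>\<omega>. f \<omega> / g \<omega>)"
  "past n k \<Longrightarrow> past n h \<Longrightarrow> past n (\<lambda>\<omega>. k \<omega> *\<^sub>R h \<omega>)"
  "past n f \<Longrightarrow> past n (\<lambda>\<omega>. - f \<omega>)"
  "past n f \<Longrightarrow> past n (\<lambda>\<omega>. f \<omega> ^ m)"
  "past n f \<Longrightarrow> past n (\<lambda>\<omega>. \<bar>f \<omega>\<bar>)"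
  "past n k \<Longrightarrow> past n (\<lambda>\<omega>. cis (k \<omega>))"
  "past n h \<Longrightarrow> past n (\<lambda>\<omega>. norm (h \<omega>))"
  "past n k \<Longrightarrow> past n (\<lambda>\<omega>. complex_of_real (k \<omega>))"
  for f g :: "'a \<Rightarrow> 'f :: {field, abs}" and h :: "'a \<Rightarrow> 'v::real_normed_vector" and k :: "'a \<Rightarrow> real"
  by (rule past_comp2 past_comp; assumption)+

lemma past_sum [past_intros]: "(\<And>i. i \<in> I \<Longrightarrow> past n (f i)) \<Longrightarrow> past n (\<lambda>\<omega>. \<Sum>i\<in>I. f i \<omega>)"
  unfolding past_def by (auto intro: sum.cong)

lemma past_col [past_intros]: "i < n \<Longrightarrow> past n (col i)"
  unfolding past_def using same_col by blast

definition atom :: "nat \<Rightarrow> 'a \<Rightarrow> 'a set" where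
  "atom n r = {\<omega> \<in> space M. same n \<omega> r}"

lemma par_event [measurable]: "{\<omega> \<in> space M. par i \<omega> = v} \<in> events"
  and col_event [measurable]: "{\<omega> \<in> space M. col i \<omega> = k} \<in> events"
  using measurable_sets[OF par_measurable[of i], of "{v}"] measurable_sets[OF col_measurable[of i], of "{k}"]
  by (auto simp: vimage_def Int_def conj_commute)

lemma atom_event [measurable]: "atom n r \<in> events"
proof -
  have "atom n r = {\<omega> \<in> space M. (\<forall>i\<in>{1..<n}. par i \<omega> = par i r) \<and> (\<forall>i\<in>{..<n}. col i \<omega> = col i r)}"
    by (auto simp: atom_def same_def same_history_def)
  also have "\<dots> \<in> events"
    by (intro sets.sets_Collect_conj sets.sets_Collect_finite_All par_event col_event) auto
  finally show ?thesis .
qed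

text \<open>One outcome from each atom of the partition by the first \<open>n\<close> arrivals, so that integrals of
  functions of the past become finite sums over these outcomes.\<close>

definition reps :: "nat \<Rightarrow> 'a set \<Rightarrow> bool" where
  "reps n R \<longleftrightarrow> finite R \<and> R \<subseteq> space M \<and> (\<forall>\<omega>\<in>space M. \<exists>r\<in>R. same n \<omega> r) \<and>
     (\<forall>r\<in>R. \<forall>r'\<in>R. same n r r' \<longrightarrow> r = r')"

lemma representatives: "\<exists>R. reps n R"
proof -
  define h where "h \<omega> = (map (\<lambda>i. par i \<omega>) [1..<n], map (\<lambda>i. col i \<omega>) [0..<n])" for \<omega>
  have h: "h \<omega> = h \<omega>' \<longleftrightarrow> same n \<omega> \<omega>'" for \<omega> \<omega>'
    by (auto simp: h_def same_def same_history_def)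
  have "h ` space M \<subseteq> {xs. set xs \<subseteq> {..<n} \<and> length xs = n - 1} \<times> {xs. set xs \<subseteq> UNIV \<and> length xs = n}"
    using par_less by (auto simp: h_def) (meson less_trans)
  then have fin: "finite (h ` space M)"
    by (rule finite_subset) (intro finite_cartesian_product finite_lists_length_eq; simp)
  define s where "s = inv_into (space M) h"
  have s: "s y \<in> space M" "h (s y) = y" if "y \<in> h ` space M" for y
    using that by (simp_all add: s_def inv_into_into f_inv_into_f)
  have "\<exists>r\<in>s ` h ` space M. same n \<omega> r" if "\<omega> \<in> space M" for \<omega>
  proof
    have "h (s (h \<omega>)) = h \<omega>" using s(2) that by blast
    then show "same n \<omega> (s (h \<omega>))" using h same_sym by blast
    show "s (h \<omega>) \<in> s ` h ` space M" using that by blast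
  qed
  moreover have "r = r'" if "r \<in> s ` h ` space M" "r' \<in> s ` h ` space M" "same n r r'" for r r'
    using that s(2) h by (metis imageE)
  moreover have "s ` h ` space M \<subseteq> space M" using s(1) by auto
  ultimately have "reps n (s ` h ` space M)" unfolding reps_def using fin by blast
  then show ?thesis ..
qed

lemma past_decomposition:
  fixes g :: "'a \<Rightarrow> 'b::real_vector"
  assumes R: "reps n R"
    and g: "past n g" and \<omega>: "\<omega> \<in> space M"
  shows "g \<omega> = (\<Sum>r\<in>R. indicator (atom n r) \<omega> *\<^sub>R g r)"
proof -
  obtain r where r: "r \<in> R" "same n \<omega> r" using R \<omega> unfolding reps_def by blast
  have uniq: "r' = r" if "r' \<in> R" "same n \<omega> r'" for r'
    using R that(1) r(1) same_trans[OF same_sym[OF that(2)] r(2)] unfolding reps_def by blast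
  have "indicator (atom n r') \<omega> *\<^sub>R g r' = (if r' = r then g r else 0)" if "r' \<in> R" for r'
  proof (cases "r' = r")
    case True
    then have "\<omega> \<in> atom n r'" using \<omega> r(2) by (simp add: atom_def)
    then show ?thesis using True by simp
  next
    case False
    then have "\<omega> \<notin> atom n r'" using uniq[OF that] by (auto simp: atom_def)
    then show ?thesis using False by simp
  qed
  then have "(\<Sum>r'\<in>R. indicator (atom n r') \<omega> *\<^sub>R g r') = (\<Sum>r'\<in>R. if r' = r then g r else 0)"
    by (rule sum.cong[OF refl])
  also have "\<dots> = g r" using r R by (simp add: reps_def)
  also have "\<dots> = g \<omega>" using g \<omega> r R unfolding past_def reps_def by auto
  finally show ?thesis by simp
qed

lemma past_integrable_event:
  fixes g :: "'a \<Rightarrow> 'b::{banach, second_countable_topology}"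
  assumes R: "reps n R"
    and g: "past n g" and E [measurable]: "E \<in> events"
  shows "integrable M (\<lambda>\<omega>. indicator E \<omega> *\<^sub>R g \<omega>)"
    and "(\<integral>\<omega>. indicator E \<omega> *\<^sub>R g \<omega> \<partial>M) = (\<Sum>r\<in>R. prob (atom n r \<inter> E) *\<^sub>R g r)"
proof -
  have eq: "indicator E \<omega> *\<^sub>R g \<omega> = (\<Sum>r\<in>R. indicator (atom n r \<inter> E) \<omega> *\<^sub>R g r)" if "\<omega> \<in> space M" for \<omega>
    by (subst past_decomposition[OF R g that])
       (auto simp: scaleR_sum_right indicator_inter_arith mult.commute intro!: sum.cong)
  have int: "integrable M (\<lambda>\<omega>. indicator (atom n r \<inter> E) \<omega> *\<^sub>R g r)" for r
    by (intro integrable_scaleR_left) (auto simp: emeasure_eq_measure)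
  show "integrable M (\<lambda>\<omega>. indicator E \<omega> *\<^sub>R g \<omega>)"
    by (subst Bochner_Integration.integrable_cong[OF refl eq]) (auto intro: int)
  have "(\<integral>\<omega>. indicator E \<omega> *\<^sub>R g \<omega> \<partial>M) = (\<Sum>r\<in>R. \<integral>\<omega>. indicator (atom n r \<inter> E) \<omega> *\<^sub>R g r \<partial>M)"
    by (subst Bochner_Integration.integral_cong[OF refl eq]) (auto intro: int Bochner_Integration.integral_sum)
  also have "\<dots> = (\<Sum>r\<in>R. prob (atom n r \<inter> E) *\<^sub>R g r)"
    by (intro sum.cong) (auto simp: emeasure_eq_measure)
  finally show "(\<integral>\<omega>. indicator E \<omega> *\<^sub>R g \<omega> \<partial>M) = (\<Sum>r\<in>R. prob (atom n r \<inter> E) *\<^sub>R g r)" .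
qed

lemma past_integrable:
  fixes g :: "'a \<Rightarrow> 'b::{banach, second_countable_topology}"
  assumes "past n g" shows "integrable M g"
proof -
  obtain R where R: "reps n R"
    using representatives by blast
  have "integrable M (\<lambda>\<omega>. indicator (space M) \<omega> *\<^sub>R g \<omega>)"
    by (rule past_integrable_event[OF R assms]) simp
  then show ?thesis by (subst (asm) Bochner_Integration.integrable_cong[OF refl]) auto
qed

lemma past_measurable:
  fixes g :: "'a \<Rightarrow> 'b::{banach, second_countable_topology}"
  shows "past n g \<Longrightarrow> g \<in> borel_measurable M"
  by (rule borel_measurable_integrable[OF past_integrable])

section \<open>The growth step\<close>

definition wt :: "nat \<Rightarrow> nat \<Rightarrow> 'a \<Rightarrow> real" where
  "wt n v \<omega> = attach_weight \<alpha> (\<lambda>i. par i \<omega>) n v"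

definition leaf :: "nat \<Rightarrow> nat \<Rightarrow> 'a \<Rightarrow> real" where
  "leaf n v \<omega> = of_bool (num_children (\<lambda>i. par i \<omega>) n v = 0)"

abbreviation T :: "nat \<Rightarrow> real" where "T \<equiv> tot (1 + \<alpha>)"
abbreviation q :: real where "q \<equiv> 2 * p - 1"

definition kernel :: "nat \<Rightarrow> nat \<Rightarrow> colour \<Rightarrow> 'a \<Rightarrow> real" where
  "kernel n v k \<omega> = wt n v \<omega> / T n * (if k = col v \<omega> then p else 1 - p)"

lemma alpha_pos: "1 + \<alpha> > 0" using alpha_gt by simp

lemma T_ge_1: "n \<ge> 1 \<Longrightarrow> T n \<ge> 1"
  using tot_ge_1[OF alpha_pos] .

lemma past_children [past_intros]: "past n (\<lambda>\<omega>. num_children (\<lambda>i. par i \<omega>) n v)"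
  unfolding past_def num_children_def
proof (intro ballI impI)
  fix \<omega> \<omega>' assume "same n \<omega> \<omega>'"
  then have "{i \<in> {1..<n}. par i \<omega> = v} = {i \<in> {1..<n}. par i \<omega>' = v}"
    using same_par by auto
  then show "card {i \<in> {1..<n}. par i \<omega> = v} = card {i \<in> {1..<n}. par i \<omega>' = v}" by simp
qed

lemma past_wt [past_intros]: "past n (wt n v)"
  unfolding wt_def attach_weight_def
  by (rule past_comp[OF past_children, where F = "\<lambda>x. \<alpha> * real x + 1"])

lemma past_leaf [past_intros]: "past n (leaf n v)"
  unfolding leaf_def by (rule past_comp[OF past_children])

lemma past_csign [past_intros]: "i < n \<Longrightarrow> past n (\<lambda>\<omega>. csign (col i \<omega>))"
  by (rule past_comp[OF past_col])

lemma past_kernel [past_intros]: "v < n \<Longrightarrow> past n (kernel n v k)"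
  unfolding kernel_def
  by (intro past_intros past_comp[OF past_col, where F = "\<lambda>c. if k = c then p else 1 - p"])

lemma sum_children:
  assumes "n \<ge> 1" "\<omega> \<in> space M"
  shows "(\<Sum>v<n. num_children (\<lambda>i. par i \<omega>) n v) = n - 1"
proof -
  have "(\<Sum>v<n. num_children (\<lambda>i. par i \<omega>) n v) = card (\<Union>v<n. {i \<in> {1..<n}. par i \<omega> = v})"
    unfolding num_children_def by (subst card_UN_disjoint) auto
  also have "(\<Union>v<n. {i \<in> {1..<n}. par i \<omega> = v}) = {1..<n}"
  proof -
    have "par i \<omega> < n" if "1 \<le> i" "i < n" for i using par_less[OF that(1) assms(2)] that by simp
    then show ?thesis by auto
  qed
  finally show ?thesis by simp
qed

lemma sum_wt: "n \<ge> 1 \<Longrightarrow> \<omega> \<in> space M \<Longrightarrow> (\<Sum>v<n. wt n v \<omega>) = T n"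
  using sum_children[of n \<omega>]
  by (simp add: wt_def attach_weight_def sum.distrib sum_distrib_left[symmetric] of_nat_sum[symmetric]
      tot_def algebra_simps of_nat_diff del: of_nat_sum)

text \<open>The conditional probabilities of the process are given only for histories of positive probability;
  multiplied out, the transition rule holds for all of them.\<close>

lemma prob_step:
  assumes n: "n \<ge> 1" and v: "v < n" and r: "r \<in> space M"
  shows "prob (atom n r \<inter> {\<omega> \<in> space M. par n \<omega> = v \<and> col n \<omega> = k}) = prob (atom n r) * kernel n v k r"
proof -
  let ?same = "\<lambda>\<omega>. same_history n (\<lambda>i. par i \<omega>) (\<lambda>i. col i \<omega>) (\<lambda>i. par i r) (\<lambda>i. col i r)"
  have at: "{\<omega> \<in> space M. ?same \<omega>} = atom n r" by (auto simp: atom_def same_def)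
  let ?V = "atom n r \<inter> {\<omega> \<in> space M. par n \<omega> = v}"
  let ?C = "\<lambda>k. atom n r \<inter> {\<omega> \<in> space M. par n \<omega> = v \<and> col n \<omega> = k}"
  have V: "{\<omega> \<in> space M. ?same \<omega> \<and> par n \<omega> = v} = ?V"
    "{\<omega> \<in> space M. par n \<omega> = v \<and> ?same \<omega>} = ?V" by (auto simp: atom_def same_def)
  have C: "{\<omega> \<in> space M. col n \<omega> = k \<and> ?same \<omega> \<and> par n \<omega> = v} = ?C k" for k
    by (auto simp: atom_def same_def)
  have Cint: "?C k = ?V \<inter> {\<omega> \<in> space M. col n \<omega> = k}" for k by auto
  have ev [measurable]: "?V \<in> events" "?C k \<in> events" for k
    unfolding Cint by (intro sets.Int atom_event par_event col_event)+
  have pV: "prob ?V = prob (atom n r) * (wt n v r / T n)"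
  proof (cases "prob (atom n r) > 0")
    case True
    from attach[OF n v, of "\<lambda>i. par i r" "\<lambda>i. col i r"] True sum_wt[OF n r]
    have "prob ?V / prob (atom n r) = wt n v r / T n"
      by (simp add: at cond_prob_def V wt_def)
    then show ?thesis using True by (simp add: field_simps)
  next
    case False
    then have "prob (atom n r) = 0" using measure_nonneg[of M "atom n r"] by simp
    moreover have "prob ?V \<le> prob (atom n r)" by (rule finite_measure_mono) auto
    ultimately show ?thesis using measure_nonneg[of M ?V] by simp
  qed
  have pC: "prob (?C (col v r)) = prob ?V * p"
  proof (cases "prob ?V > 0")
    case True
    from broadcast[OF n v, of "\<lambda>i. par i r" "\<lambda>i. col i r"] True
    have "prob (?C (col v r)) / prob ?V = p"
      by (simp add: cond_prob_def V C)
    then show ?thesis using True by (simp add: field_simps)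
  next
    case False
    then have "prob ?V = 0" using measure_nonneg[of M ?V] by simp
    moreover have "prob (?C (col v r)) \<le> prob ?V" by (rule finite_measure_mono) (auto simp: ev)
    ultimately show ?thesis using measure_nonneg[of M "?C (col v r)"] by simp
  qed
  show ?thesis
  proof (cases "k = col v r")
    case True then show ?thesis using pC pV by (simp add: kernel_def)
  next
    case False
    then have "?C k = ?V - ?C (col v r)" by (auto, (metis colour.exhaust)+)
    then have "prob (?C k) = prob ?V - prob (?C (col v r))"
      by (simp only:) (rule finite_measure_Diff, auto simp: ev)
    then show ?thesis unfolding pC pV kernel_def using False by (simp add: algebra_simps diff_divide_distrib)
  qed
qed

text \<open>The transition rule of the process in the form in which it is used below: a function of the
  new arrival may be replaced by its average under the transition kernel when integrated against a
  function of the past.\<close>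

lemma integral_step:
  fixes g :: "'a \<Rightarrow> 'b::{banach, second_countable_topology}" and u :: "nat \<Rightarrow> colour \<Rightarrow> 'a \<Rightarrow> real"
  assumes n: "n \<ge> 1" and u: "\<And>v k. v < n \<Longrightarrow> past n (u v k)" and g: "past n g"
  shows "(\<integral>\<omega>. u (par n \<omega>) (col n \<omega>) \<omega> *\<^sub>R g \<omega> \<partial>M) =
     (\<integral>\<omega>. (\<Sum>v<n. \<Sum>k\<in>UNIV. kernel n v k \<omega> * u v k \<omega>) *\<^sub>R g \<omega> \<partial>M)"
proof -
  obtain R where R: "reps n R"
    using representatives by blast
  let ?E = "\<lambda>v k. {\<omega> \<in> space M. par n \<omega> = v \<and> col n \<omega> = k}"
  have E [measurable]: "?E v k \<in> events" for v k
    by (intro sets.sets_Collect_conj par_event col_event)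
  have ug: "past n (\<lambda>\<omega>. u v k \<omega> *\<^sub>R g \<omega>)" if "v < n" for v k
    using u[OF that] g by (intro past_intros)
  have one: "(\<integral>\<omega>. indicator (?E v k) \<omega> *\<^sub>R (u v k \<omega> *\<^sub>R g \<omega>) \<partial>M)
      = (\<integral>\<omega>. kernel n v k \<omega> *\<^sub>R (u v k \<omega> *\<^sub>R g \<omega>) \<partial>M)" if v: "v < n" for v k
  proof -
    have "(\<integral>\<omega>. indicator (?E v k) \<omega> *\<^sub>R (u v k \<omega> *\<^sub>R g \<omega>) \<partial>M)
       = (\<Sum>r\<in>R. prob (atom n r \<inter> ?E v k) *\<^sub>R (u v k r *\<^sub>R g r))"
      by (rule past_integrable_event[OF R ug[OF v] E])
    also have "\<dots> = (\<Sum>r\<in>R. prob (atom n r \<inter> space M) *\<^sub>R (kernel n v k r *\<^sub>R (u v k r *\<^sub>R g r)))"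
    proof (intro sum.cong refl)
      fix r assume "r \<in> R"
      then have "r \<in> space M" using R by (auto simp: reps_def)
      moreover have "atom n r \<inter> space M = atom n r" by (auto simp: atom_def)
      ultimately show "prob (atom n r \<inter> ?E v k) *\<^sub>R (u v k r *\<^sub>R g r) =
          prob (atom n r \<inter> space M) *\<^sub>R (kernel n v k r *\<^sub>R (u v k r *\<^sub>R g r))"
        by (simp add: prob_step[OF n v])
    qed
    also have "\<dots> = (\<integral>\<omega>. indicator (space M) \<omega> *\<^sub>R (kernel n v k \<omega> *\<^sub>R (u v k \<omega> *\<^sub>R g \<omega>)) \<partial>M)"
      by (rule past_integrable_event(2)[OF R _ sets.top, symmetric]) (intro past_intros v ug)
    also have "\<dots> = (\<integral>\<omega>. kernel n v k \<omega> *\<^sub>R (u v k \<omega> *\<^sub>R g \<omega>) \<partial>M)"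
      by (intro Bochner_Integration.integral_cong) auto
    finally show ?thesis .
  qed
  have int: "integrable M (\<lambda>\<omega>. indicator (?E v k) \<omega> *\<^sub>R (u v k \<omega> *\<^sub>R g \<omega>))" if "v < n" for v k
    by (rule past_integrable_event(1)[OF R ug[OF that] E])
  have int': "integrable M (\<lambda>\<omega>. kernel n v k \<omega> *\<^sub>R (u v k \<omega> *\<^sub>R g \<omega>))" if "v < n" for v k
    by (rule past_integrable[of n]) (intro past_intros that ug)
  have "(\<integral>\<omega>. u (par n \<omega>) (col n \<omega>) \<omega> *\<^sub>R g \<omega> \<partial>M) =
     (\<integral>\<omega>. (\<Sum>v<n. \<Sum>k\<in>UNIV. indicator (?E v k) \<omega> *\<^sub>R (u v k \<omega> *\<^sub>R g \<omega>)) \<partial>M)"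
  proof (intro Bochner_Integration.integral_cong refl)
    fix \<omega> assume \<omega>: "\<omega> \<in> space M"
    have "(\<Sum>v<n. \<Sum>k\<in>UNIV. indicator (?E v k) \<omega> *\<^sub>R (u v k \<omega> *\<^sub>R g \<omega>))
      = (\<Sum>v<n. if v = par n \<omega> then u (par n \<omega>) (col n \<omega>) \<omega> *\<^sub>R g \<omega> else 0)"
      using \<omega> by (intro sum.cong refl) (cases "col n \<omega>"; auto simp: sum_colour indicator_def)
    also have "\<dots> = u (par n \<omega>) (col n \<omega>) \<omega> *\<^sub>R g \<omega>"
      using par_less[OF n \<omega>] by simp
    finally show "u (par n \<omega>) (col n \<omega>) \<omega> *\<^sub>R g \<omega> =
      (\<Sum>v<n. \<Sum>k\<in>UNIV. indicator (?E v k) \<omega> *\<^sub>R (u v k \<omega> *\<^sub>R g \<omega>))" by simp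
  qed
  also have "\<dots> = (\<Sum>v<n. \<Sum>k\<in>UNIV. \<integral>\<omega>. indicator (?E v k) \<omega> *\<^sub>R (u v k \<omega> *\<^sub>R g \<omega>) \<partial>M)"
    using int by (simp add: Bochner_Integration.integral_sum Bochner_Integration.integrable_sum)
  also have "\<dots> = (\<Sum>v<n. \<Sum>k\<in>UNIV. \<integral>\<omega>. kernel n v k \<omega> *\<^sub>R (u v k \<omega> *\<^sub>R g \<omega>) \<partial>M)"
    by (intro sum.cong refl one) auto
  also have "\<dots> = (\<integral>\<omega>. (\<Sum>v<n. \<Sum>k\<in>UNIV. kernel n v k \<omega> *\<^sub>R (u v k \<omega> *\<^sub>R g \<omega>)) \<partial>M)"
    using int' by (simp add: Bochner_Integration.integral_sum Bochner_Integration.integrable_sum)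
  also have "\<dots> = (\<integral>\<omega>. (\<Sum>v<n. \<Sum>k\<in>UNIV. kernel n v k \<omega> * u v k \<omega>) *\<^sub>R g \<omega> \<partial>M)"
    by (simp add: scaleR_sum_left)
  finally show ?thesis .
qed

section \<open>The signed statistics\<close>

definition X :: "nat \<Rightarrow> 'a \<Rightarrow> real" where "X n \<omega> = (\<Sum>v<n. csign (col v \<omega>) * wt n v \<omega>)"
definition Y :: "nat \<Rightarrow> 'a \<Rightarrow> real" where "Y n \<omega> = (\<Sum>v<n. csign (col v \<omega>) * leaf n v \<omega>)"
definition L :: "nat \<Rightarrow> 'a \<Rightarrow> real" where "L n \<omega> = (\<Sum>v<n. leaf n v \<omega>)"
definition S :: "nat \<Rightarrow> 'a \<Rightarrow> real" where "S n \<omega> = (\<Sum>v<n. csign (col v \<omega>))"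

definition parent_sign :: "nat \<Rightarrow> 'a \<Rightarrow> real" where "parent_sign n \<omega> = csign (col (par n \<omega>) \<omega>)"
definition child_sign :: "nat \<Rightarrow> 'a \<Rightarrow> real" where "child_sign n \<omega> = csign (col n \<omega>)"
definition parent_leaf :: "nat \<Rightarrow> 'a \<Rightarrow> real" where "parent_leaf n \<omega> = leaf n (par n \<omega>) \<omega>"

lemma past_stats [past_intros]: "past n (X n)" "past n (Y n)" "past n (L n)" "past n (S n)"
  unfolding X_def Y_def L_def S_def by (intro past_intros; simp)+

lemma past_stats_Suc [past_intros]:
  "past (Suc n) (X n)" "past (Suc n) (Y n)" "past (Suc n) (L n)" "past (Suc n) (S n)"
  by (rule past_Suc, rule past_stats)+

text \<open>The parent of the new vertex is itself random, but it is one of the old vertices and becomes known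
  with the new arrival.\<close>

lemma past_at_par:
  assumes "n \<ge> 1" and "\<And>v. v < n \<Longrightarrow> past n (f v)"
  shows "past (Suc n) (\<lambda>\<omega>. f (par n \<omega>) \<omega>)"
  unfolding past_def
proof (intro ballI impI)
  fix \<omega> \<omega>' assume *: "\<omega> \<in> space M" "\<omega>' \<in> space M" "same (Suc n) \<omega> \<omega>'"
  have "par n \<omega> = par n \<omega>'" using same_par[OF *(3)] assms(1) by simp
  moreover have "f (par n \<omega>) \<omega> = f (par n \<omega>) \<omega>'"
    using assms(2)[OF par_less[OF assms(1) *(1)]] * same_mono[OF *(3), of n] unfolding past_def by auto
  ultimately show "f (par n \<omega>) \<omega> = f (par n \<omega>') \<omega>'" by simp
qed

lemma past_arrival [past_intros]:
  "n \<ge> 1 \<Longrightarrow> past (Suc n) (parent_sign n)" "past (Suc n) (child_sign n)"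
  "n \<ge> 1 \<Longrightarrow> past (Suc n) (parent_leaf n)"
  unfolding parent_sign_def child_sign_def parent_leaf_def
  by (auto intro: past_intros past_at_par[where f = "\<lambda>v \<omega>. csign (col v \<omega>)"] past_at_par[where f = "leaf n"])

lemma arrival_squares [simp]:
  "parent_sign n \<omega> * parent_sign n \<omega> = 1" "child_sign n \<omega> * child_sign n \<omega> = 1"
  "parent_leaf n \<omega> * parent_leaf n \<omega> = parent_leaf n \<omega>"
  unfolding parent_sign_def child_sign_def parent_leaf_def leaf_def by (simp_all add: of_bool_def)

lemma arrival_bounds:
  "\<bar>parent_sign n \<omega>\<bar> = 1" "\<bar>child_sign n \<omega>\<bar> = 1" "0 \<le> parent_leaf n \<omega>" "parent_leaf n \<omega> \<le> 1"
  by (simp_all add: parent_sign_def child_sign_def parent_leaf_def leaf_def)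

lemma num_children_Suc:
  "n \<ge> 1 \<Longrightarrow> num_children f (Suc n) v = num_children f n v + (if f n = v then 1 else 0)"
proof -
  assume n: "n \<ge> 1"
  have "{i \<in> {1..<Suc n}. f i = v} = {i \<in> {1..<n}. f i = v} \<union> (if f n = v then {n} else {})"
    using n by (auto simp: less_Suc_eq)
  then show ?thesis unfolding num_children_def by (auto simp: card_insert_if)
qed

lemma new_vertex_childless:
  assumes "\<omega> \<in> space M" "n \<ge> 1" shows "num_children (\<lambda>i. par i \<omega>) (Suc n) n = 0"
proof -
  have "par i \<omega> \<noteq> n" if "1 \<le> i" "i < Suc n" for i using par_less[OF that(1) assms(1)] that by simp
  then have "{i \<in> {1..<Suc n}. par i \<omega> = n} = {}" by auto
  then show ?thesis unfolding num_children_def by (simp only: card.empty)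
qed

lemma stats_Suc:
  assumes n: "n \<ge> 1" and \<omega>: "\<omega> \<in> space M"
  shows "X (Suc n) \<omega> = X n \<omega> + (\<alpha> * parent_sign n \<omega> + child_sign n \<omega>)"
    and "Y (Suc n) \<omega> = Y n \<omega> + (child_sign n \<omega> - parent_sign n \<omega> * parent_leaf n \<omega>)"
    and "L (Suc n) \<omega> = L n \<omega> + (1 - parent_leaf n \<omega>)"
    and "S (Suc n) \<omega> = S n \<omega> + child_sign n \<omega>"
proof -
  have v: "par n \<omega> < n" using par_less[OF n \<omega>] .
  have w: "wt (Suc n) v \<omega> = wt n v \<omega> + (if v = par n \<omega> then \<alpha> else 0)" for v
    using n by (auto simp: wt_def attach_weight_def num_children_Suc algebra_simps)
  have l: "leaf (Suc n) v \<omega> = leaf n v \<omega> - (if v = par n \<omega> then leaf n (par n \<omega>) \<omega> else 0)" for v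
  proof (cases "v = par n \<omega>")
    case True
    then have "num_children (\<lambda>i. par i \<omega>) (Suc n) v \<noteq> 0" using n by (simp add: num_children_Suc)
    then have "leaf (Suc n) v \<omega> = 0" by (simp add: leaf_def)
    then show ?thesis using True by simp
  next
    case False
    then have "num_children (\<lambda>i. par i \<omega>) (Suc n) v = num_children (\<lambda>i. par i \<omega>) n v"
      using n by (simp add: num_children_Suc)
    then show ?thesis using False by (simp add: leaf_def)
  qed
  have new: "wt (Suc n) n \<omega> = 1" "leaf (Suc n) n \<omega> = 1"
    using new_vertex_childless[OF \<omega> n] by (simp_all add: wt_def attach_weight_def leaf_def)
  have d: "(\<Sum>v<n. h v * (if v = par n \<omega> then c else 0)) = h (par n \<omega>) * c" for h :: "nat \<Rightarrow> real" and c
    using v by (simp add: if_distrib cong: if_cong)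
  show "X (Suc n) \<omega> = X n \<omega> + (\<alpha> * parent_sign n \<omega> + child_sign n \<omega>)"
    unfolding X_def sum.lessThan_Suc new unfolding w
    by (simp add: distrib_left sum.distrib d parent_sign_def child_sign_def)
  show "Y (Suc n) \<omega> = Y n \<omega> + (child_sign n \<omega> - parent_sign n \<omega> * parent_leaf n \<omega>)"
    unfolding Y_def sum.lessThan_Suc new unfolding l
    by (simp add: right_diff_distrib sum_subtractf d parent_sign_def child_sign_def parent_leaf_def)
  show "L (Suc n) \<omega> = L n \<omega> + (1 - parent_leaf n \<omega>)"
    unfolding L_def sum.lessThan_Suc new unfolding l
    using d[of "\<lambda>_. 1"] by (simp add: sum_subtractf parent_leaf_def)
  show "S (Suc n) \<omega> = S n \<omega> + child_sign n \<omega>"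
    by (simp add: S_def child_sign_def)
qed

text \<open>The parent is a leaf with total probability \<open>L / T\<close> because leaves have weight \<open>1\<close>, and the
  sign of the child has conditional mean \<open>q\<close> times that of the parent. As signs square to \<open>1\<close> and
  indicators to themselves, every polynomial in the data of an arrival has the form treated here.\<close>

lemma arrival_integral:
  fixes g :: "'a \<Rightarrow> 'b::{banach, second_countable_topology}"
  assumes n: "n \<ge> 1" and g: "past n g"
  shows "(\<integral>\<omega>. (c0 + c1 * parent_sign n \<omega> + c2 * child_sign n \<omega> + c3 * (parent_sign n \<omega> * child_sign n \<omega>)
      + c4 * parent_leaf n \<omega> + c5 * (parent_sign n \<omega> * parent_leaf n \<omega>) + c6 * (child_sign n \<omega> * parent_leaf n \<omega>)
      + c7 * (parent_sign n \<omega> * child_sign n \<omega> * parent_leaf n \<omega>)) *\<^sub>R g \<omega> \<partial>M)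
    = (\<integral>\<omega>. (c0 + c3 * q + ((c1 + c2 * q) * X n \<omega> + (c4 + c7 * q) * L n \<omega> + (c5 + c6 * q) * Y n \<omega>) / T n) *\<^sub>R g \<omega> \<partial>M)"
proof -
  define u where "u v k \<omega> = c0 + c1 * csign (col v \<omega>) + c2 * csign k + c3 * (csign (col v \<omega>) * csign k)
      + c4 * leaf n v \<omega> + c5 * (csign (col v \<omega>) * leaf n v \<omega>) + c6 * (csign k * leaf n v \<omega>)
      + c7 * (csign (col v \<omega>) * csign k * leaf n v \<omega>)" for v k \<omega>
  have past: "past n (u v k)" if "v < n" for v k
    unfolding u_def using that by (intro past_intros)
  have ker: "(\<Sum>v<n. \<Sum>k\<in>UNIV. kernel n v k \<omega> * u v k \<omega>) =
     c0 + c3 * q + ((c1 + c2 * q) * X n \<omega> + (c4 + c7 * q) * L n \<omega> + (c5 + c6 * q) * Y n \<omega>) / T n"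
    if \<omega>: "\<omega> \<in> space M" for \<omega>
  proof -
    have wl: "wt n v \<omega> * leaf n v \<omega> = leaf n v \<omega>" for v
      by (cases "num_children (\<lambda>i. par i \<omega>) n v = 0") (auto simp: wt_def leaf_def attach_weight_def)
    have "(\<Sum>k\<in>UNIV. kernel n v k \<omega> * u v k \<omega>) =
       ((c0 + c3 * q) * wt n v \<omega> + (c1 + c2 * q) * (csign (col v \<omega>) * wt n v \<omega>)
         + (c4 + c7 * q) * (wt n v \<omega> * leaf n v \<omega>) + (c5 + c6 * q) * (csign (col v \<omega>) * (wt n v \<omega> * leaf n v \<omega>))) / T n" for v
      by (cases "col v \<omega>") (simp_all add: sum_colour kernel_def u_def add_divide_distrib diff_divide_distrib algebra_simps)
    then have "(\<Sum>v<n. \<Sum>k\<in>UNIV. kernel n v k \<omega> * u v k \<omega>) =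
       ((c0 + c3 * q) * (\<Sum>v<n. wt n v \<omega>) + (c1 + c2 * q) * X n \<omega> + (c4 + c7 * q) * L n \<omega> + (c5 + c6 * q) * Y n \<omega>) / T n"
      by (simp only: wl X_def L_def Y_def sum_divide_distrib[symmetric] sum.distrib sum_distrib_left[symmetric])
    also have "\<dots> = c0 + c3 * q + ((c1 + c2 * q) * X n \<omega> + (c4 + c7 * q) * L n \<omega> + (c5 + c6 * q) * Y n \<omega>) / T n"
      using T_ge_1[OF n] sum_wt[OF n \<omega>] by (simp add: add_divide_distrib)
    finally show ?thesis .
  qed
  have "(\<integral>\<omega>. u (par n \<omega>) (col n \<omega>) \<omega> *\<^sub>R g \<omega> \<partial>M) =
    (\<integral>\<omega>. (c0 + c3 * q + ((c1 + c2 * q) * X n \<omega> + (c4 + c7 * q) * L n \<omega> + (c5 + c6 * q) * Y n \<omega>) / T n) *\<^sub>R g \<omega> \<partial>M)"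
    by (rule trans[OF integral_step[where u = u, OF n past g] Bochner_Integration.integral_cong[OF refl]])
       (simp_all only: ker)
  then show ?thesis by (simp add: u_def parent_sign_def child_sign_def parent_leaf_def)
qed

lemma leaf_vec_eq: "leaf_vec par col n \<omega> = vector [(L n \<omega> + Y n \<omega>) / 2, (L n \<omega> - Y n \<omega>) / 2]"
proof -
  have "real (num_leaves k (\<lambda>i. par i \<omega>) (\<lambda>i. col i \<omega>) n) = (\<Sum>v<n. leaf n v \<omega> * of_bool (col v \<omega> = k))" for k
    unfolding num_leaves_def leaf_def of_bool_conj[symmetric]
    by (subst sum_of_bool_eq) (simp_all add: Int_def)
  moreover have "Y n \<omega> = 2 * (\<Sum>v<n. leaf n v \<omega> * of_bool (col v \<omega> = Red)) - L n \<omega>"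
    unfolding L_def Y_def csign_of_bool(1) sum_distrib_left sum_subtractf[symmetric]
    by (rule sum.cong) (auto simp: algebra_simps)
  moreover have "Y n \<omega> = L n \<omega> - 2 * (\<Sum>v<n. leaf n v \<omega> * of_bool (col v \<omega> = Blue))"
    unfolding L_def Y_def csign_of_bool(2) sum_distrib_left sum_subtractf[symmetric]
    by (rule sum.cong) (auto simp: algebra_simps)
  ultimately show ?thesis by (simp add: leaf_vec_def)
qed

lemma colour_vec_eq: "colour_vec col n \<omega> = vector [(real n + S n \<omega>) / 2, (real n - S n \<omega>) / 2]"
proof -
  have "real (num_vertices k (\<lambda>i. col i \<omega>) n) = (\<Sum>v<n. of_bool (col v \<omega> = k))" for k
    unfolding num_vertices_def by (subst sum_of_bool_eq) (simp_all add: Int_def)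
  moreover have "S n \<omega> = 2 * (\<Sum>v<n. of_bool (col v \<omega> = Red)) - real n"
    unfolding S_def csign_of_bool(1) by (simp add: sum_subtractf sum_distrib_left)
  moreover have "S n \<omega> = real n - 2 * (\<Sum>v<n. of_bool (col v \<omega> = Blue))"
    unfolding S_def csign_of_bool(2) by (simp add: sum_subtractf sum_distrib_left)
  ultimately show ?thesis by (simp add: colour_vec_def)
qed

end

section \<open>Elementary estimates\<close>

lemma cis_expand2: "cmod (cis x - (1 + \<i> * of_real x - of_real (x\<^sup>2) / 2)) \<le> \<bar>x\<bar> ^ 3 / 6"
  using iexp_approx1[of x 2]
  by (simp add: cis_conv_exp numeral_2_eq_2 numeral_3_eq_3 fact_numeral power2_eq_square field_simps)

lemma cis_expand1: "cmod (cis x - (1 + \<i> * of_real x)) \<le> x\<^sup>2 / 2"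
  using iexp_approx1[of x 1]
  by (simp add: cis_conv_exp numeral_2_eq_2 power2_eq_square field_simps)

lemma cis_expand0: "cmod (cis x - 1) \<le> \<bar>x\<bar>"
  using iexp_approx1[of x 0] by (simp add: cis_conv_exp)

lemma exp_minus_diff_le:
  fixes a b :: real assumes "0 \<le> a" "0 \<le> b"
  shows "\<bar>exp (- a) - exp (- b)\<bar> \<le> \<bar>a - b\<bar>"
proof -
  have *: "exp (- a) - exp (- b) \<le> b - a" if "0 \<le> a" "a \<le> b" for a b :: real
  proof -
    have "exp (- a) - exp (- b) = exp (- a) * (1 - exp (- (b - a)))"
      by (simp add: right_diff_distrib exp_add[symmetric])
    also have "\<dots> \<le> 1 * (b - a)"
    proof (rule mult_mono)
      show "1 - exp (- (b - a)) \<le> b - a" using exp_ge_add_one_self[of "- (b - a)"] by linarith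
      show "0 \<le> 1 - exp (- (b - a))" using that by simp
    qed (use that in auto)
    finally show ?thesis by simp
  qed
  show ?thesis using *[of a b] *[of b a] assms by (cases "a \<le> b") auto
qed

lemma exp_minus_expand:
  fixes y :: real assumes "0 \<le> y"
  shows "\<bar>1 - y - exp (- y)\<bar> \<le> y\<^sup>2 / 2"
proof -
  have "exp (- y) \<ge> 1 - y" using exp_ge_add_one_self[of "- y"] by simp
  moreover have "exp (- y) \<le> 1 - y + y\<^sup>2 / 2"
  proof -
    have "(\<lambda>t. 1 - t + t\<^sup>2 / 2 - exp (- t)) 0 \<le> (\<lambda>t. 1 - t + t\<^sup>2 / 2 - exp (- t)) y"
    proof (rule DERIV_nonneg_imp_nondecreasing[OF assms])
      fix t :: real assume "0 \<le> t" "t \<le> y"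
      have "((\<lambda>t. 1 - t + t\<^sup>2 / 2 - exp (- t)) has_real_derivative (t - 1 + exp (- t))) (at t)"
        by (auto intro!: derivative_eq_intros)
      moreover have "0 \<le> t - 1 + exp (- t)" using exp_ge_add_one_self[of "- t"] by simp
      ultimately show "\<exists>z. ((\<lambda>t. 1 - t + t\<^sup>2 / 2 - exp (- t)) has_real_derivative z) (at t) \<and> 0 \<le> z" by blast
    qed
    then show ?thesis by simp
  qed
  ultimately show ?thesis by simp
qed

lemma power2_sum_le: "(r + s)\<^sup>2 \<le> 2 * r\<^sup>2 + 2 * s\<^sup>2" for r s :: real
  using zero_le_power2[of "r - s"] unfolding power2_sum power2_diff by linarith

abbreviation (in prob_space) mean_sq :: "('a \<Rightarrow> real) \<Rightarrow> real" where
  "mean_sq f \<equiv> expectation (\<lambda>\<omega>. (f \<omega>)\<^sup>2)"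

lemma (in prob_space) expectation_abs_le:
  fixes f :: "'a \<Rightarrow> real"
  assumes "f \<in> borel_measurable M" "integrable M (\<lambda>\<omega>. (f \<omega>)\<^sup>2)"
  shows "expectation (\<lambda>\<omega>. \<bar>f \<omega>\<bar>) \<le> sqrt (mean_sq f)"
proof -
  have 1: "integrable M (\<lambda>\<omega>. \<bar>f \<omega>\<bar>)" "integrable M (\<lambda>\<omega>. \<bar>f \<omega>\<bar>\<^sup>2)"
    using square_integrable_imp_integrable[OF assms] assms(2) by auto
  have "0 \<le> variance (\<lambda>\<omega>. \<bar>f \<omega>\<bar>)" by (rule variance_positive)
  then have "(expectation (\<lambda>\<omega>. \<bar>f \<omega>\<bar>))\<^sup>2 \<le> mean_sq f"
    using variance_eq[OF 1] by simp
  then show ?thesis by (rule real_le_rsqrt)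
qed

context pa_process
begin

lemma past_expectation_abs_le:
  assumes "past n f" shows "expectation (\<lambda>\<omega>. \<bar>f \<omega>\<bar>) \<le> sqrt (mean_sq f)"
  by (rule expectation_abs_le) (intro past_measurable[of n] past_integrable[of n] past_intros assms)+

section \<open>One step of the characteristic function\<close>

text \<open>Here \<open>\<mu>\<close> and \<open>Q\<close> are the conditional mean and second moment of an increment \<open>D\<close> of \<open>J\<close>.
  Second-order expansion shows that the characteristic function is multiplied by
  \<open>exp (- E Q / 2)\<close>, up to a shift of \<open>J\<close> by \<open>\<mu>\<close>; so is the Gaussian one with the same second
  moments, and the distance of the two can only grow by the error terms listed: the third-order
  remainder of the expansion in \<open>D\<close>, the square of the shift, the fluctuation of \<open>Q\<close> about its
  mean, the product of the shift and the variance, and the second-order remainder of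
  \<open>exp (- E Q / 2)\<close>.\<close>

lemma char_step:
  fixes J D \<mu> Q :: "'a \<Rightarrow> real"
  assumes J: "past n J" and D: "past (Suc n) D" and mu: "past n \<mu>" and Q: "past n Q"
    and D1: "\<And>g :: 'a \<Rightarrow> complex. past n g \<Longrightarrow> (\<integral>\<omega>. D \<omega> *\<^sub>R g \<omega> \<partial>M) = (\<integral>\<omega>. \<mu> \<omega> *\<^sub>R g \<omega> \<partial>M)"
    and D2: "\<And>g :: 'a \<Rightarrow> complex. past n g \<Longrightarrow> (\<integral>\<omega>. (D \<omega>)\<^sup>2 *\<^sub>R g \<omega> \<partial>M) = (\<integral>\<omega>. Q \<omega> *\<^sub>R g \<omega> \<partial>M)"
    and DJ: "expectation (\<lambda>\<omega>. D \<omega> * J \<omega>) = expectation (\<lambda>\<omega>. \<mu> \<omega> * J \<omega>)"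
    and DD: "mean_sq D = expectation Q"
  shows "cmod ((\<integral>\<omega>. cis (J \<omega> + D \<omega>) \<partial>M) - exp (- expectation (\<lambda>\<omega>. (J \<omega> + D \<omega>)\<^sup>2) / 2))
    \<le> cmod ((\<integral>\<omega>. cis (J \<omega> + \<mu> \<omega>) \<partial>M) - exp (- expectation (\<lambda>\<omega>. (J \<omega> + \<mu> \<omega>)\<^sup>2) / 2))
      + (expectation (\<lambda>\<omega>. \<bar>D \<omega>\<bar> ^ 3) / 6 + mean_sq \<mu>
      + expectation (\<lambda>\<omega>. \<bar>Q \<omega> - expectation Q\<bar>) / 2
      + expectation Q / 2 * expectation (\<lambda>\<omega>. \<bar>\<mu> \<omega>\<bar>) + (expectation Q)\<^sup>2 / 8)"
proof -
  define s where "s = expectation Q"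
  have s: "s \<ge> 0" unfolding s_def DD[symmetric] by simp
  note p1 = past_Suc[OF J] D past_Suc[OF mu] past_Suc[OF Q]
  have int: "integrable M f" if "past (Suc n) f" for f :: "'a \<Rightarrow> complex" by (rule past_integrable[OF that])
  have intr: "integrable M f" if "past (Suc n) f" for f :: "'a \<Rightarrow> real" by (rule past_integrable[OF that])
  \<comment> \<open>The chain of comparisons is: expand \<open>cis D\<close>, take conditional means (\<open>A = B\<close>), collect
      \<open>1 + \<i> \<mu>\<close> into a shift of \<open>J\<close>, replace \<open>1 - s / 2\<close> by \<open>exp (- s / 2)\<close>, and do the same on the
      Gaussian side, where only \<open>m\<close> has to be removed from the exponent.\<close>
  define A where "A = (\<integral>\<omega>. cis (J \<omega>) * (1 + \<i> * D \<omega> - of_real ((D \<omega>)\<^sup>2) / 2) \<partial>M)"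
  have e1: "cmod ((\<integral>\<omega>. cis (J \<omega> + D \<omega>) \<partial>M) - A) \<le> expectation (\<lambda>\<omega>. \<bar>D \<omega>\<bar> ^ 3) / 6"
  proof -
    have "(\<integral>\<omega>. cis (J \<omega> + D \<omega>) \<partial>M) - A = (\<integral>\<omega>. cis (J \<omega> + D \<omega>) - cis (J \<omega>) * (1 + \<i> * D \<omega> - of_real ((D \<omega>)\<^sup>2) / 2) \<partial>M)"
      unfolding A_def by (rule Bochner_Integration.integral_diff[symmetric]) (intro int past_intros p1)+
    also have "cmod \<dots> \<le> expectation (\<lambda>\<omega>. cmod (cis (J \<omega> + D \<omega>) - cis (J \<omega>) * (1 + \<i> * D \<omega> - of_real ((D \<omega>)\<^sup>2) / 2)))"
      by (rule integral_norm_bound)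
    also have "\<dots> \<le> expectation (\<lambda>\<omega>. \<bar>D \<omega>\<bar> ^ 3 / 6)"
    proof (rule integral_mono)
      fix \<omega>
      have "cis (J \<omega> + D \<omega>) - cis (J \<omega>) * (1 + \<i> * D \<omega> - of_real ((D \<omega>)\<^sup>2) / 2)
        = cis (J \<omega>) * (cis (D \<omega>) - (1 + \<i> * D \<omega> - of_real ((D \<omega>)\<^sup>2) / 2))"
        by (simp add: cis_mult[symmetric] algebra_simps)
      then show "cmod (cis (J \<omega> + D \<omega>) - cis (J \<omega>) * (1 + \<i> * D \<omega> - of_real ((D \<omega>)\<^sup>2) / 2)) \<le> \<bar>D \<omega>\<bar> ^ 3 / 6"
        using cis_expand2[of "D \<omega>"] by (simp add: norm_mult)
    qed (intro intr past_intros p1)+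
    finally show ?thesis by simp
  qed
  define B where "B = (\<integral>\<omega>. cis (J \<omega>) * (1 + \<i> * \<mu> \<omega> - of_real (Q \<omega>) / 2) \<partial>M)"
  have AB: "A = B"
  proof -
    have split: "(\<integral>\<omega>. cis (J \<omega>) * (1 + \<i> * x \<omega> - of_real (y \<omega>) / 2) \<partial>M)
       = (\<integral>\<omega>. cis (J \<omega>) \<partial>M) + \<i> * (\<integral>\<omega>. x \<omega> *\<^sub>R cis (J \<omega>) \<partial>M) - (\<integral>\<omega>. y \<omega> *\<^sub>R cis (J \<omega>) \<partial>M) / 2"
      if "past (Suc n) x" "past (Suc n) y" for x y :: "'a \<Rightarrow> real"
    proof -
      have i: "integrable M (\<lambda>\<omega>. x \<omega> *\<^sub>R cis (J \<omega>))" "integrable M (\<lambda>\<omega>. y \<omega> *\<^sub>R cis (J \<omega>))" "integrable M (\<lambda>\<omega>. cis (J \<omega>))"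
        by (intro int past_intros p1 that)+
      have "(\<integral>\<omega>. cis (J \<omega>) * (1 + \<i> * x \<omega> - of_real (y \<omega>) / 2) \<partial>M) =
        (\<integral>\<omega>. cis (J \<omega>) + \<i> * (x \<omega> *\<^sub>R cis (J \<omega>)) - (y \<omega> *\<^sub>R cis (J \<omega>)) / 2 \<partial>M)"
        by (intro Bochner_Integration.integral_cong refl) (simp add: scaleR_conv_of_real algebra_simps)
      also have "\<dots> = (\<integral>\<omega>. cis (J \<omega>) \<partial>M) + \<i> * (\<integral>\<omega>. x \<omega> *\<^sub>R cis (J \<omega>) \<partial>M) - (\<integral>\<omega>. y \<omega> *\<^sub>R cis (J \<omega>) \<partial>M) / 2"
        by (subst Bochner_Integration.integral_diff,
            (intro Bochner_Integration.integrable_add integrable_mult_right integrable_divide i)+,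
            subst Bochner_Integration.integral_add, (intro integrable_mult_right i)+,
            simp only: integral_mult_right_zero integral_divide_zero)
      finally show ?thesis .
    qed
    have "past n (\<lambda>\<omega>. cis (J \<omega>))" by (intro past_intros J)
    note D1[OF this] D2[OF this]
    then show ?thesis unfolding A_def B_def
      by (subst (1 2) split) (auto intro!: past_intros p1)
  qed
  define C where "C = (\<integral>\<omega>. cis (J \<omega> + \<mu> \<omega>) \<partial>M)"
  have C1: "cmod C \<le> 1"
  proof -
    have "cmod C \<le> expectation (\<lambda>\<omega>. cmod (cis (J \<omega> + \<mu> \<omega>)))" unfolding C_def by (rule integral_norm_bound)
    then show ?thesis by (simp add: prob_space)
  qed
  have e2: "cmod (B - (1 - s / 2) * C) \<le> mean_sq \<mu> / 2 + expectation (\<lambda>\<omega>. \<bar>Q \<omega> - s\<bar>) / 2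
      + s / 2 * expectation (\<lambda>\<omega>. \<bar>\<mu> \<omega>\<bar>)"
  proof -
    have eq: "B - (1 - s / 2) * C =
      (\<integral>\<omega>. cis (J \<omega>) * (1 + \<i> * \<mu> \<omega> - of_real (Q \<omega>) / 2) - (1 - s / 2) * cis (J \<omega> + \<mu> \<omega>) \<partial>M)"
      unfolding B_def C_def
      by (subst Bochner_Integration.integral_diff) (auto intro!: int past_intros p1 integrable_mult_right)
    have "cmod (B - (1 - s / 2) * C) \<le> expectation (\<lambda>\<omega>. cmod (cis (J \<omega>) * (1 + \<i> * \<mu> \<omega> - of_real (Q \<omega>) / 2) - (1 - s / 2) * cis (J \<omega> + \<mu> \<omega>)))"
      unfolding eq by (rule integral_norm_bound)
    also have "\<dots> \<le> expectation (\<lambda>\<omega>. (\<mu> \<omega>)\<^sup>2 / 2 + \<bar>Q \<omega> - s\<bar> / 2 + s / 2 * \<bar>\<mu> \<omega>\<bar>)"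
    proof (rule integral_mono)
      fix \<omega>
      have "cis (J \<omega>) * (1 + \<i> * \<mu> \<omega> - of_real (Q \<omega>) / 2) - (1 - s / 2) * cis (J \<omega> + \<mu> \<omega>) =
        cis (J \<omega>) * (- (cis (\<mu> \<omega>) - (1 + \<i> * \<mu> \<omega>)) + of_real (- (Q \<omega> - s) / 2) + of_real (s / 2) * (cis (\<mu> \<omega>) - 1))"
        by (simp add: cis_mult[symmetric] field_simps)
      also have "cmod \<dots> \<le> cmod (- (cis (\<mu> \<omega>) - (1 + \<i> * \<mu> \<omega>))) + cmod (of_real (- (Q \<omega> - s) / 2)) + cmod (of_real (s / 2) * (cis (\<mu> \<omega>) - 1))"
        unfolding norm_mult[of "cis (J \<omega>)"] norm_cis mult_1 by (intro norm_triangle_mono order_refl)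
      also have "\<dots> \<le> (\<mu> \<omega>)\<^sup>2 / 2 + \<bar>Q \<omega> - s\<bar> / 2 + s / 2 * \<bar>\<mu> \<omega>\<bar>"
      proof (intro add_mono)
        show "cmod (- (cis (\<mu> \<omega>) - (1 + \<i> * \<mu> \<omega>))) \<le> (\<mu> \<omega>)\<^sup>2 / 2"
          unfolding norm_minus_cancel by (rule cis_expand1)
        show "cmod (of_real (- (Q \<omega> - s) / 2)) \<le> \<bar>Q \<omega> - s\<bar> / 2"
          unfolding norm_of_real by simp
        show "cmod (of_real (s / 2) * (cis (\<mu> \<omega>) - 1)) \<le> s / 2 * \<bar>\<mu> \<omega>\<bar>"
          unfolding norm_mult norm_of_real using s cis_expand0[of "\<mu> \<omega>"] by (intro mult_mono) auto
      qed
      finally show "cmod (cis (J \<omega>) * (1 + \<i> * \<mu> \<omega> - of_real (Q \<omega>) / 2) - (1 - s / 2) * cis (J \<omega> + \<mu> \<omega>))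
        \<le> (\<mu> \<omega>)\<^sup>2 / 2 + \<bar>Q \<omega> - s\<bar> / 2 + s / 2 * \<bar>\<mu> \<omega>\<bar>" .
    qed (intro int intr past_intros p1)+
    also have "\<dots> = mean_sq \<mu> / 2 + expectation (\<lambda>\<omega>. \<bar>Q \<omega> - s\<bar>) / 2 + s / 2 * expectation (\<lambda>\<omega>. \<bar>\<mu> \<omega>\<bar>)"
    proof -
      have "integrable M (\<lambda>\<omega>. (\<mu> \<omega>)\<^sup>2)" "integrable M (\<lambda>\<omega>. \<bar>Q \<omega> - s\<bar>)" "integrable M (\<lambda>\<omega>. \<bar>\<mu> \<omega>\<bar>)"
        by (intro intr past_intros p1)+
      then show ?thesis by simp
    qed
    finally show ?thesis .
  qed
  have e3: "cmod ((1 - s / 2) * C - exp (- (s / 2)) * C) \<le> s\<^sup>2 / 8"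
  proof -
    have "cmod ((1 - s / 2) * C - exp (- (s / 2)) * C) = \<bar>1 - s / 2 - exp (- (s / 2))\<bar> * cmod C"
    proof -
      have "(1 - s / 2) * C - exp (- (s / 2)) * C = of_real (1 - s / 2 - exp (- (s / 2))) * C"
        by (simp add: algebra_simps exp_of_real)
      then show ?thesis by (simp only: norm_mult norm_of_real)
    qed
    also have "\<dots> \<le> \<bar>1 - s / 2 - exp (- (s / 2))\<bar> * 1" using C1 by (intro mult_left_mono) auto
    also have "\<dots> \<le> (s / 2)\<^sup>2 / 2" using exp_minus_expand[of "s / 2"] s by simp
    finally show ?thesis by (simp add: power2_eq_square)
  qed
  define v where "v = expectation (\<lambda>\<omega>. (J \<omega> + \<mu> \<omega>)\<^sup>2)"
  define w where "w = expectation (\<lambda>\<omega>. (J \<omega> + D \<omega>)\<^sup>2)"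
  define m where "m = mean_sq \<mu>"
  have vw: "w = v + s - m"
  proof -
    have sq: "expectation (\<lambda>\<omega>. (J \<omega> + x \<omega>)\<^sup>2) = mean_sq J + 2 * expectation (\<lambda>\<omega>. x \<omega> * J \<omega>) + mean_sq x"
      if "past (Suc n) x" for x
    proof -
      have i: "integrable M (\<lambda>\<omega>. (J \<omega>)\<^sup>2)" "integrable M (\<lambda>\<omega>. x \<omega> * J \<omega>)" "integrable M (\<lambda>\<omega>. (x \<omega>)\<^sup>2)"
        by (intro intr past_intros p1 that)+
      have "expectation (\<lambda>\<omega>. (J \<omega> + x \<omega>)\<^sup>2) = expectation (\<lambda>\<omega>. (J \<omega>)\<^sup>2 + 2 * (x \<omega> * J \<omega>) + (x \<omega>)\<^sup>2)"
        by (simp add: power2_sum algebra_simps)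
      then show ?thesis using i by simp
    qed
    show ?thesis unfolding v_def w_def m_def s_def using sq[OF D] sq[OF past_Suc[OF mu]] DJ DD by simp
  qed
  have pos: "v \<ge> 0" "w \<ge> 0" "m \<ge> 0" by (simp_all add: v_def w_def m_def)
  have e4: "cmod (exp (- (s / 2)) * exp (- v / 2) - exp (- w / 2)) \<le> m / 2"
  proof -
    have "cmod (exp (- (s / 2)) * exp (- v / 2) - exp (- w / 2)) = \<bar>exp (- ((s + v) / 2)) - exp (- (w / 2))\<bar>"
    proof -
      have "exp (- (s / 2)) * exp (- v / 2) = exp (- ((s + v) / 2))"
        unfolding exp_add[symmetric] by (simp add: add_divide_distrib)
      then show ?thesis unfolding of_real_mult[symmetric] of_real_diff[symmetric] norm_of_real by simp
    qed
    also have "\<dots> \<le> \<bar>(s + v) / 2 - w / 2\<bar>" using s pos by (intro exp_minus_diff_le) auto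
    also have "(s + v) / 2 - w / 2 = m / 2" using vw by (simp add: field_simps)
    finally show ?thesis using pos by (simp only: abs_of_nonneg[of "m / 2"] divide_nonneg_pos[of m 2])
  qed
  have e5: "cmod (exp (- (s / 2)) * C - exp (- (s / 2)) * exp (- v / 2)) \<le> cmod (C - exp (- v / 2))"
  proof -
    have "cmod (exp (- (s / 2)) * C - exp (- (s / 2)) * exp (- v / 2)) = exp (- (s / 2)) * cmod (C - exp (- v / 2))"
      by (simp add: right_diff_distrib[symmetric] norm_mult exp_of_real)
    also have "\<dots> \<le> 1 * cmod (C - exp (- v / 2))" using s by (intro mult_right_mono) auto
    finally show ?thesis by simp
  qed
  let ?I = "(\<integral>\<omega>. cis (J \<omega> + D \<omega>) \<partial>M)"
  have eq: "?I - exp (- w / 2) = (?I - A) + (B - (1 - s / 2) * C) + ((1 - s / 2) * C - exp (- (s / 2)) * C)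
    + (exp (- (s / 2)) * C - exp (- (s / 2)) * exp (- v / 2)) + (exp (- (s / 2)) * exp (- v / 2) - exp (- w / 2))"
    by (simp add: AB)
  have "cmod (?I - exp (- w / 2)) \<le> cmod (?I - A) + cmod (B - (1 - s / 2) * C) + cmod ((1 - s / 2) * C - exp (- (s / 2)) * C)
    + cmod (exp (- (s / 2)) * C - exp (- (s / 2)) * exp (- v / 2)) + cmod (exp (- (s / 2)) * exp (- v / 2) - exp (- w / 2))"
    unfolding eq by (intro norm_triangle_mono order_refl)
  also have "\<dots> \<le> cmod (C - exp (- v / 2)) + (expectation (\<lambda>\<omega>. \<bar>D \<omega>\<bar> ^ 3) / 6 + m
      + expectation (\<lambda>\<omega>. \<bar>Q \<omega> - s\<bar>) / 2 + s / 2 * expectation (\<lambda>\<omega>. \<bar>\<mu> \<omega>\<bar>) + s\<^sup>2 / 8)"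
    using e1 e2 e3 e4 e5 by (simp add: m_def)
  finally show ?thesis unfolding C_def v_def w_def m_def s_def by simp
qed

section \<open>Linear statistics and their first two moments\<close>

text \<open>The limit of \<open>L / T\<close>. A leaf disappears when it receives a child, so the drift of \<open>L\<close> is
  \<open>1 - L / T\<close>; for \<open>L = \<rho> T\<close> this must equal the increment \<open>\<rho> (1 + \<alpha>)\<close>.\<close>

definition \<rho> :: real where "\<rho> = 1 / (2 + \<alpha>)"

lemma rho: "\<rho> * (2 + \<alpha>) = 1" "0 < \<rho>" "\<rho> < 1"
  using alpha_gt by (simp_all add: \<rho>_def)

text \<open>\<open>L\<close> is centred by \<open>\<rho> T\<close>, an exact solution of the recursion for its mean, rather than by the
  multiple of \<open>n\<close> in the limit theorems; the two differ by a constant.\<close>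

definition U :: "nat \<Rightarrow> 'a \<Rightarrow> real" where "U n \<omega> = L n \<omega> - \<rho> * T n"

definition lin :: "nat \<Rightarrow> real \<Rightarrow> real \<Rightarrow> real \<Rightarrow> real \<Rightarrow> 'a \<Rightarrow> real" where
  "lin n u x y s \<omega> = u * U n \<omega> + x * X n \<omega> + y * Y n \<omega> + s * S n \<omega>"

definition inc :: "nat \<Rightarrow> real \<Rightarrow> real \<Rightarrow> real \<Rightarrow> real \<Rightarrow> 'a \<Rightarrow> real" where
  "inc n u x y s \<omega> = u * \<rho> + x * \<alpha> * parent_sign n \<omega> + (x + y + s) * child_sign n \<omega> - u * parent_leaf n \<omega>
     - y * (parent_sign n \<omega> * parent_leaf n \<omega>)"

lemma past_U [past_intros]: "past n (U n)" "past (Suc n) (U n)"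
  unfolding U_def by (intro past_intros)+

lemma past_lin [past_intros]: "past n (lin n u x y s)" "past (Suc n) (lin n u x y s)"
  unfolding lin_def by (intro past_intros)+

lemma past_inc [past_intros]: "n \<ge> 1 \<Longrightarrow> past (Suc n) (inc n u x y s)"
  unfolding inc_def by (intro past_intros)

lemma lin_Suc:
  assumes "n \<ge> 1" "\<omega> \<in> space M"
  shows "lin (Suc n) u x y s \<omega> = lin n u x y s \<omega> + inc n u x y s \<omega>"
proof -
  have "1 - \<rho> * (1 + \<alpha>) = \<rho>" using rho(1) by (simp add: algebra_simps)
  then have eq: "U (Suc n) \<omega> = U n \<omega> + (\<rho> - parent_leaf n \<omega>)"
    using stats_Suc(3)[OF assms] by (simp add: U_def tot_Suc algebra_simps)
  show ?thesis
    unfolding lin_def inc_def stats_Suc[OF assms] eq by (simp add: algebra_simps)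
qed

lemma inc_bound: "\<bar>inc n u x y s \<omega>\<bar> \<le> (\<bar>\<alpha>\<bar> + 3) * (\<bar>u\<bar> + \<bar>x\<bar> + \<bar>y\<bar> + \<bar>s\<bar>)"
proof -
  note b = arrival_bounds[of n \<omega>]
  have 1: "\<bar>u * (\<rho> - parent_leaf n \<omega>)\<bar> \<le> \<bar>u\<bar> * 1"
    unfolding abs_mult using rho b by (intro mult_left_mono) auto
  have 2: "\<bar>x * \<alpha> * parent_sign n \<omega>\<bar> = \<bar>x\<bar> * \<bar>\<alpha>\<bar>" "\<bar>(x + y + s) * child_sign n \<omega>\<bar> = \<bar>x + y + s\<bar>"
    using b by (simp_all add: abs_mult)
  have 3: "\<bar>y * (parent_sign n \<omega> * parent_leaf n \<omega>)\<bar> \<le> \<bar>y\<bar> * 1"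
    unfolding abs_mult using b by (intro mult_left_mono) auto
  have "inc n u x y s \<omega> = u * (\<rho> - parent_leaf n \<omega>) + x * \<alpha> * parent_sign n \<omega> + (x + y + s) * child_sign n \<omega>
     - y * (parent_sign n \<omega> * parent_leaf n \<omega>)"
    by (simp add: inc_def algebra_simps)
  moreover have "\<bar>A + B + C - D\<bar> \<le> \<bar>A\<bar> + \<bar>B\<bar> + \<bar>C\<bar> + \<bar>D\<bar>" for A B C D :: real by linarith
  ultimately have "\<bar>inc n u x y s \<omega>\<bar> \<le> \<bar>u * (\<rho> - parent_leaf n \<omega>)\<bar> + \<bar>x * \<alpha> * parent_sign n \<omega>\<bar>
     + \<bar>(x + y + s) * child_sign n \<omega>\<bar> + \<bar>y * (parent_sign n \<omega> * parent_leaf n \<omega>)\<bar>" by simp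
  also have "\<dots> \<le> \<bar>u\<bar> * 1 + \<bar>x\<bar> * \<bar>\<alpha>\<bar> + \<bar>x + y + s\<bar> + \<bar>y\<bar> * 1"
    unfolding 2 using 1 3 by (intro add_mono order_refl)
  also have "\<dots> = \<bar>u\<bar> + \<bar>x\<bar> * \<bar>\<alpha>\<bar> + \<bar>x + y + s\<bar> + \<bar>y\<bar>" by simp
  also have "\<dots> \<le> \<bar>u\<bar> + \<bar>x\<bar> * \<bar>\<alpha>\<bar> + (\<bar>x\<bar> + \<bar>y\<bar> + \<bar>s\<bar>) + \<bar>y\<bar>" by simp
  also have "\<dots> \<le> (\<bar>\<alpha>\<bar> + 3) * (\<bar>u\<bar> + \<bar>x\<bar> + \<bar>y\<bar> + \<bar>s\<bar>)"
    by (simp add: algebra_simps)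
  finally show ?thesis .
qed

text \<open>On the coefficients \<open>(u, x, y, s)\<close> the drift acts as a constant triangular matrix, divided by \<open>T\<close>,
  with the eigenvalues \<open>- 1\<close>, \<open>\<alpha> + q\<close>, \<open>- 1\<close> and \<open>0\<close>.\<close>

lemma inc_mean:
  fixes g :: "'a \<Rightarrow> 'b::{banach, second_countable_topology}"
  assumes n: "n \<ge> 1" and g: "past n g"
  shows "(\<integral>\<omega>. inc n u x y s \<omega> *\<^sub>R g \<omega> \<partial>M) =
    (\<integral>\<omega>. (lin n (- u) (x * (\<alpha> + q) + (y + s) * q) (- y) 0 \<omega> / T n) *\<^sub>R g \<omega> \<partial>M)"
proof -
  have "lin n (- u) (x * (\<alpha> + q) + (y + s) * q) (- y) 0 \<omega> / T n =
    u * \<rho> + 0 * q + ((x * \<alpha> + (x + y + s) * q) * X n \<omega> + (- u + 0 * q) * L n \<omega> + (- y + 0 * q) * Y n \<omega>) / T n" for \<omega>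
    using T_ge_1[OF n] by (simp add: lin_def U_def add_divide_distrib diff_divide_distrib algebra_simps)
  then show ?thesis
    using arrival_integral[OF n g, of "u * \<rho>" "x * \<alpha>" "x + y + s" 0 "- u" "- y" 0 0]
    by (simp add: inc_def)
qed

text \<open>The conditional mean of a product of two increments consists of a deterministic term and of a
  linear statistic divided by \<open>T\<close>. The functions below are the deterministic term and the
  coefficients of \<open>U\<close>, \<open>X\<close> and \<open>Y\<close>.\<close>

definition cov0 :: "real \<Rightarrow> real \<Rightarrow> real \<Rightarrow> real \<Rightarrow> real \<Rightarrow> real \<Rightarrow> real \<Rightarrow> real \<Rightarrow> real" where
  "cov0 u x y s u' x' y' s' = u * u' * (\<rho> - \<rho>\<^sup>2) + x * x' * \<alpha>\<^sup>2 + (x + y + s) * (x' + y' + s')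
     + \<alpha> * q * (x * (x' + y' + s') + x' * (x + y + s))
     + \<rho> * (y * y' - \<alpha> * (x * y' + x' * y) - q * (y * (x' + y' + s') + y' * (x + y + s)))"

definition covU :: "real \<Rightarrow> real \<Rightarrow> real \<Rightarrow> real \<Rightarrow> real \<Rightarrow> real \<Rightarrow> real \<Rightarrow> real \<Rightarrow> real" where
  "covU u x y s u' x' y' s' = u * u' * (1 - 2 * \<rho>) + y * y' - \<alpha> * (x * y' + x' * y)
     - q * (y * (x' + y' + s') + y' * (x + y + s))"

definition covX :: "real \<Rightarrow> real \<Rightarrow> real \<Rightarrow> real \<Rightarrow> real \<Rightarrow> real \<Rightarrow> real \<Rightarrow> real \<Rightarrow> real" where
  "covX u x y s u' x' y' s' = \<rho> * (\<alpha> * (u * x' + u' * x) + q * (u * (x' + y' + s') + u' * (x + y + s)))"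

definition covY :: "real \<Rightarrow> real \<Rightarrow> real \<Rightarrow> real \<Rightarrow> real \<Rightarrow> real \<Rightarrow> real \<Rightarrow> real \<Rightarrow> real" where
  "covY u x y s u' x' y' s' = (1 - \<rho>) * (u * y' + u' * y) - \<alpha> * (u * x' + u' * x)
     - q * (u * (x' + y' + s') + u' * (x + y + s))"

lemma inc_cov:
  fixes g :: "'a \<Rightarrow> 'b::{banach, second_countable_topology}"
  assumes n: "n \<ge> 1" and g: "past n g"
  shows "(\<integral>\<omega>. (inc n u x y s \<omega> * inc n u' x' y' s' \<omega>) *\<^sub>R g \<omega> \<partial>M) =
      (\<integral>\<omega>. (cov0 u x y s u' x' y' s' + lin n (covU u x y s u' x' y' s') (covX u x y s u' x' y' s')
        (covY u x y s u' x' y' s') 0 \<omega> / T n) *\<^sub>R g \<omega> \<partial>M)"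
proof -
  define d where "d = x + y + s"
  define d' where "d' = x' + y' + s'"
  let ?c0 = "u * u' * \<rho>\<^sup>2 + x * x' * \<alpha>\<^sup>2 + d * d'" and ?c1 = "\<rho> * \<alpha> * (u * x' + u' * x)"
    and ?c2 = "\<rho> * (u * d' + u' * d)" and ?c3 = "\<alpha> * (x * d' + x' * d)"
    and ?c4 = "u * u' * (1 - 2 * \<rho>) - \<alpha> * (x * y' + x' * y) + y * y'"
    and ?c5 = "(1 - \<rho>) * (u * y' + u' * y) - \<alpha> * (u * x' + u' * x)"
    and ?c6 = "- (u * d' + u' * d)" and ?c7 = "- (y * d' + y' * d)"
  have prod: "inc n u x y s \<omega> * inc n u' x' y' s' \<omega> = ?c0 + ?c1 * parent_sign n \<omega> + ?c2 * child_sign n \<omega>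
     + ?c3 * (parent_sign n \<omega> * child_sign n \<omega>) + ?c4 * parent_leaf n \<omega> + ?c5 * (parent_sign n \<omega> * parent_leaf n \<omega>)
     + ?c6 * (child_sign n \<omega> * parent_leaf n \<omega>) + ?c7 * (parent_sign n \<omega> * child_sign n \<omega> * parent_leaf n \<omega>)" for \<omega>
  proof -
    define e k l where "e = parent_sign n \<omega>" and "k = child_sign n \<omega>" and "l = parent_leaf n \<omega>"
    have sq: "e * e = 1" "k * k = 1" "l * l = l" by (simp_all add: e_def k_def l_def)
    show ?thesis
      unfolding inc_def d_def[symmetric] d'_def[symmetric] e_def[symmetric] k_def[symmetric] l_def[symmetric]
      using sq by algebra
  qed
  have val: "?c0 + ?c3 * q + ((?c1 + ?c2 * q) * X n \<omega> + (?c4 + ?c7 * q) * L n \<omega> + (?c5 + ?c6 * q) * Y n \<omega>) / T n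
    = cov0 u x y s u' x' y' s' + lin n (covU u x y s u' x' y' s') (covX u x y s u' x' y' s')
        (covY u x y s u' x' y' s') 0 \<omega> / T n" for \<omega>
  proof -
    have a: "?c1 + ?c2 * q = covX u x y s u' x' y' s'" "?c4 + ?c7 * q = covU u x y s u' x' y' s'"
      "?c5 + ?c6 * q = covY u x y s u' x' y' s'"
      unfolding covX_def covU_def covY_def d_def[symmetric] d'_def[symmetric] by algebra+
    have c: "cov0 u x y s u' x' y' s' = ?c0 + ?c3 * q + \<rho> * covU u x y s u' x' y' s'"
      unfolding cov0_def covU_def d_def[symmetric] d'_def[symmetric] by algebra
    show ?thesis unfolding a c lin_def U_def using T_ge_1[OF n]
      by (simp add: field_simps)
  qed
  show ?thesis
    unfolding prod arrival_integral[OF n g] val ..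
qed

section \<open>Means and second moments\<close>

lemma initial_stats:
  "X 1 \<omega> = csign (col 0 \<omega>)" "Y 1 \<omega> = csign (col 0 \<omega>)" "L 1 \<omega> = 1" "S 1 \<omega> = csign (col 0 \<omega>)" "U 1 \<omega> = 1 - \<rho>"
  by (simp_all add: X_def Y_def L_def S_def U_def wt_def leaf_def attach_weight_def num_children_def tot_def)

lemma root_sign_mean: "expectation (\<lambda>\<omega>. csign (col 0 \<omega>)) = 0"
proof -
  have E: "{\<omega> \<in> space M. col 0 \<omega> = Red} \<in> events" by (rule col_event)
  have "expectation (\<lambda>\<omega>. csign (col 0 \<omega>)) = expectation (\<lambda>\<omega>. 2 * indicator {\<omega> \<in> space M. col 0 \<omega> = Red} \<omega> - 1)"
    by (intro Bochner_Integration.integral_cong) (auto simp: csign_def)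
  also have "\<dots> = 0" using E root_colour by (simp add: prob_space emeasure_eq_measure)
  finally show ?thesis .
qed

lemma integrable_stats [intro]:
  "integrable M (X n)" "integrable M (Y n)" "integrable M (S n)" "integrable M (U n)" "integrable M (lin n u x y s)"
  by (rule past_integrable[of n]; intro past_intros)+

lemma mean_lin_Suc:
  assumes n: "n \<ge> 1"
  shows "expectation (lin (Suc n) u x y s) = expectation (lin n u x y s)
    + expectation (lin n (- u) (x * (\<alpha> + q) + (y + s) * q) (- y) 0) / T n"
proof -
  have i: "integrable M (inc n u x y s)" by (rule past_integrable[of "Suc n"]) (intro past_intros n)
  have "expectation (lin (Suc n) u x y s) = expectation (\<lambda>\<omega>. lin n u x y s \<omega> + inc n u x y s \<omega>)"
    by (intro Bochner_Integration.integral_cong refl) (rule lin_Suc[OF n])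
  also have "\<dots> = expectation (lin n u x y s) + expectation (inc n u x y s)"
    using i integrable_stats(5)[of n u x y s] by simp
  also have "expectation (inc n u x y s) = expectation (\<lambda>\<omega>. lin n (- u) (x * (\<alpha> + q) + (y + s) * q) (- y) 0 \<omega> / T n)"
    using inc_mean[OF n past_const[of n "1 :: real"]] by simp
  finally show ?thesis by simp
qed

lemma expectation_lin: "expectation (lin n u x y s) = u * expectation (U n) + x * expectation (X n) + y * expectation (Y n) + s * expectation (S n)"
  unfolding lin_def by (simp add: integrable_stats)

text \<open>By the symmetry of the colours the signed statistics are centred; \<open>U\<close> is centred from
  \<open>n = 2\<close> on, since \<open>T 1 = 1\<close> makes the first factor \<open>1 - 1 / T\<close> of its mean vanish.\<close>

lemma mean_zero:
  assumes "n \<ge> 2" shows "expectation (lin n u x y s) = 0"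
proof -
  have lin1: "lin n 1 0 0 0 = U n" "lin n 0 1 0 0 = X n" "lin n 0 0 1 0 = Y n" "lin n 0 0 0 1 = S n" for n
    by (auto simp: lin_def)
  have signed: "expectation (X n) = 0 \<and> expectation (Y n) = 0 \<and> expectation (S n) = 0" if "n \<ge> 1" for n
    using that
  proof (induction n rule: dec_induct)
    case base
    have "X 1 = (\<lambda>\<omega>. csign (col 0 \<omega>))" "Y 1 = (\<lambda>\<omega>. csign (col 0 \<omega>))" "S 1 = (\<lambda>\<omega>. csign (col 0 \<omega>))"
      using initial_stats by auto
    then show ?case using root_sign_mean by simp
  next
    case (step n)
    then show ?case
      using mean_lin_Suc[of n 0 1 0 0] mean_lin_Suc[of n 0 0 1 0] mean_lin_Suc[of n 0 0 0 1]
      by (simp add: lin1[of "Suc n"] expectation_lin[of n])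
  qed
  have "expectation (U n) = 0" using assms
  proof (induction n rule: dec_induct)
    case base
    have "expectation (lin (Suc 1) 1 0 0 0) = 0"
      using mean_lin_Suc[of 1 1 0 0 0] signed[of 1] by (simp add: expectation_lin[of 1] expectation_lin[of "Suc 0"] tot_def)
    then show ?case by (simp add: lin1 numeral_2_eq_2)
  next
    case (step n)
    then show ?case using mean_lin_Suc[of n 1 0 0 0] signed[of n]
      by (simp add: lin1[of "Suc n"] expectation_lin[of n])
  qed
  then show ?thesis using signed[of n] assms by (simp add: expectation_lin)
qed

lemma inc_cov_mean:
  assumes "n \<ge> 2"
  shows "expectation (\<lambda>\<omega>. inc n u x y s \<omega> * inc n u' x' y' s' \<omega>) = cov0 u x y s u' x' y' s'"
proof -
  have n: "n \<ge> 1" using assms by simp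
  have "expectation (\<lambda>\<omega>. inc n u x y s \<omega> * inc n u' x' y' s' \<omega>) =
    expectation (\<lambda>\<omega>. cov0 u x y s u' x' y' s' + lin n (covU u x y s u' x' y' s') (covX u x y s u' x' y' s')
        (covY u x y s u' x' y' s') 0 \<omega> / T n)"
    using inc_cov[OF n past_const[of n "1 :: real"], of u x y s u' x' y' s'] by simp
  also have "\<dots> = cov0 u x y s u' x' y' s'"
    using mean_zero[OF assms] by (simp add: integrable_stats prob_space)
  finally show ?thesis .
qed

lemma inc_var_X:
  fixes g :: "'a \<Rightarrow> 'b::{banach, second_countable_topology}"
  assumes n: "n \<ge> 1" and g: "past n g"
  shows "(\<integral>\<omega>. (inc n 0 1 0 0 \<omega>)\<^sup>2 *\<^sub>R g \<omega> \<partial>M) = (\<integral>\<omega>. (\<alpha>\<^sup>2 + 1 + 2 * \<alpha> * q) *\<^sub>R (g \<omega>) \<partial>M)"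
  using inc_cov[OF n g, of 0 1 0 0 0 1 0 0]
  by (simp add: power2_eq_square cov0_def covX_def covU_def covY_def lin_def algebra_simps)

text \<open>The increment is replaced by its drift in the two mixed terms, which are correlations with the past.
  On the right-hand side only second moments of linear statistics remain.\<close>

lemma second_moment_Suc:
  assumes n: "n \<ge> 1"
  shows "expectation (\<lambda>\<omega>. lin (Suc n) u x y s \<omega> * lin (Suc n) u' x' y' s' \<omega>) =
    expectation (\<lambda>\<omega>. lin n u x y s \<omega> * lin n u' x' y' s' \<omega>)
    + (expectation (\<lambda>\<omega>. lin n (- u) (x * (\<alpha> + q) + (y + s) * q) (- y) 0 \<omega> * lin n u' x' y' s' \<omega>)
     + expectation (\<lambda>\<omega>. lin n u x y s \<omega> * lin n (- u') (x' * (\<alpha> + q) + (y' + s') * q) (- y') 0 \<omega>)) / T n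
    + expectation (\<lambda>\<omega>. inc n u x y s \<omega> * inc n u' x' y' s' \<omega>)"
proof -
  let ?J = "lin n u x y s" and ?J' = "lin n u' x' y' s'" and ?D = "inc n u x y s" and ?D' = "inc n u' x' y' s'"
  have i: "integrable M (\<lambda>\<omega>. ?J \<omega> * ?J' \<omega>)" "integrable M (\<lambda>\<omega>. ?D \<omega> * ?J' \<omega>)"
    "integrable M (\<lambda>\<omega>. ?D' \<omega> * ?J \<omega>)" "integrable M (\<lambda>\<omega>. ?D \<omega> * ?D' \<omega>)"
    by (rule past_integrable[of "Suc n"]; intro past_intros n)+
  have "expectation (\<lambda>\<omega>. lin (Suc n) u x y s \<omega> * lin (Suc n) u' x' y' s' \<omega>) =
    expectation (\<lambda>\<omega>. ?J \<omega> * ?J' \<omega> + ?D \<omega> * ?J' \<omega> + ?D' \<omega> * ?J \<omega> + ?D \<omega> * ?D' \<omega>)"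
    by (intro Bochner_Integration.integral_cong refl) (simp add: lin_Suc[OF n] algebra_simps)
  also have "\<dots> = expectation (\<lambda>\<omega>. ?J \<omega> * ?J' \<omega>) + expectation (\<lambda>\<omega>. ?D \<omega> * ?J' \<omega>)
     + expectation (\<lambda>\<omega>. ?D' \<omega> * ?J \<omega>) + expectation (\<lambda>\<omega>. ?D \<omega> * ?D' \<omega>)"
    using i by simp
  also have "expectation (\<lambda>\<omega>. ?D \<omega> * ?J' \<omega>) = expectation (\<lambda>\<omega>. lin n (- u) (x * (\<alpha> + q) + (y + s) * q) (- y) 0 \<omega> * ?J' \<omega>) / T n"
    using inc_mean[OF n, of ?J' u x y s] by (simp add: past_intros)
  also have "expectation (\<lambda>\<omega>. ?D' \<omega> * ?J \<omega>) = expectation (\<lambda>\<omega>. ?J \<omega> * lin n (- u') (x' * (\<alpha> + q) + (y' + s') * q) (- y') 0 \<omega>) / T n"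
    using inc_mean[OF n, of ?J u' x' y' s'] by (simp add: past_intros mult.commute)
  finally show ?thesis by (simp add: add_divide_distrib)
qed

lemma inc_sq_bound:
  obtains C where "\<And>n. n \<ge> 1 \<Longrightarrow> mean_sq (inc n u x y s) \<le> C"
proof
  fix n :: nat assume n: "n \<ge> 1"
  have "mean_sq (inc n u x y s) \<le> expectation (\<lambda>\<omega>. ((\<bar>\<alpha>\<bar> + 3) * (\<bar>u\<bar> + \<bar>x\<bar> + \<bar>y\<bar> + \<bar>s\<bar>))\<^sup>2)"
    by (intro integral_mono past_integrable[of "Suc n"] past_intros n)
       (use inc_bound in \<open>auto intro!: power2_mono abs_le_square_iff[THEN iffD1] simp: abs_le_square_iff[symmetric] abs_mult\<close>)
  then show "mean_sq (inc n u x y s) \<le> ((\<bar>\<alpha>\<bar> + 3) * (\<bar>u\<bar> + \<bar>x\<bar> + \<bar>y\<bar> + \<bar>s\<bar>))\<^sup>2"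
    by (simp add: prob_space)
qed

text \<open>The drift conditions say that the vector of coefficients is an eigenvector for the eigenvalue \<open>c\<close>,
  so that the drift of the statistic is \<open>c / T\<close> times the statistic itself.\<close>

lemma eigen_moment_Suc:
  assumes n: "n \<ge> 1"
    and drift: "- u = c * u" "x * (\<alpha> + q) + (y + s) * q = c * x" "- y = c * y" "0 = c * s"
  shows "mean_sq (lin (Suc n) u x y s) =
    (1 + 2 * c / T n) * mean_sq (lin n u x y s) + mean_sq (inc n u x y s)"
proof -
  have d: "lin n (- u) (x * (\<alpha> + q) + (y + s) * q) (- y) 0 \<omega> = c * lin n u x y s \<omega>" for \<omega>
    unfolding drift(1-3) by (subst drift(4)) (simp add: lin_def algebra_simps)
  have "expectation (\<lambda>\<omega>. (c * lin n u x y s \<omega>) * lin n u x y s \<omega>) = c * mean_sq (lin n u x y s)"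
    "expectation (\<lambda>\<omega>. lin n u x y s \<omega> * (c * lin n u x y s \<omega>)) = c * mean_sq (lin n u x y s)"
    by (simp_all add: power2_eq_square mult.left_commute mult.assoc)
  then show ?thesis
    using second_moment_Suc[OF n, of u x y s u x y s]
    unfolding d by (simp add: power2_eq_square distrib_right)
qed

text \<open>Fluctuations are of the order of the square root of \<open>n\<close> when \<open>2 c\<close> is below the growth rate of \<open>T\<close>.\<close>

lemma eigen_moment_bound:
  assumes c: "2 * c < 1 + \<alpha>"
    and drift: "- u = c * u" "x * (\<alpha> + q) + (y + s) * q = c * x" "- y = c * y" "0 = c * s"
  obtains K where "K \<ge> 0" "\<And>n. n \<ge> 1 \<Longrightarrow> mean_sq (lin n u x y s) \<le> K * T n"
proof -
  obtain C where C: "\<And>n. n \<ge> 1 \<Longrightarrow> mean_sq (inc n u x y s) \<le> C"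
    by (rule inc_sq_bound) blast
  have "mean_sq (lin (Suc n) u x y s) \<le> (1 + 2 * c / T n) * mean_sq (lin n u x y s) + C"
    if n: "n \<ge> 1" for n
    using eigen_moment_Suc[OF n drift] C[OF n] by simp
  from linear_recursion_bound[OF alpha_pos c this] that show thesis by blast
qed

section \<open>The law of large numbers\<close>

text \<open>The exponent \<open>k\<close> is so large that the second moments of \<open>Z / n\<close> are summable along the \<open>k\<close>-th
  powers; then almost surely the squares are summable along them, too.\<close>

lemma AE_over_n:
  fixes Z :: "nat \<Rightarrow> 'a \<Rightarrow> real"
  assumes Z: "\<And>n. past n (Z n)" and inc: "\<And>n \<omega>. n \<ge> 1 \<Longrightarrow> \<omega> \<in> space M \<Longrightarrow> \<bar>Z (Suc n) \<omega> - Z n \<omega>\<bar> \<le> c"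
    and C: "\<And>n. n \<ge> 1 \<Longrightarrow> mean_sq (Z n) \<le> C * real n powr r" and r: "r < 2"
  shows "AE \<omega> in M. (\<lambda>n. Z n \<omega> / real n) \<longlonglongrightarrow> 0"
proof -
  obtain k :: nat where k: "real k * (2 - r) > 1"
    using reals_Archimedean3[of "2 - r"] r by auto
  then have k1: "k \<ge> 1" by (cases k) auto
  define f where "f j \<omega> = (Z (j ^ k) \<omega> / real (j ^ k))\<^sup>2" for j \<omega>
  have past: "past (j ^ k) (f j)" for j unfolding f_def by (intro past_intros Z)
  have int: "integrable M (f j)" for j by (rule past_integrable[OF past])
  have [measurable]: "f j \<in> borel_measurable M" for j using int by simp
  have f0: "f j \<omega> \<ge> 0" for j \<omega> by (simp add: f_def)
  have bound: "expectation (f j) \<le> C * real j powr (real k * (r - 2))" for j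
  proof (cases "j = 0")
    case True
    have "f 0 = (\<lambda>_. 0)" using k1 by (auto simp: f_def fun_eq_iff power_0_left)
    then show ?thesis using True by simp
  next
    case False
    have jk: "real (j ^ k) = real j powr real k" using False by (simp add: powr_realpow)
    have "expectation (f j) = mean_sq (Z (j ^ k)) / (real (j ^ k))\<^sup>2"
      unfolding f_def power_divide by simp
    also have "\<dots> \<le> C * real (j ^ k) powr r / (real (j ^ k))\<^sup>2"
      using False by (intro divide_right_mono C) auto
    also have "\<dots> = C * real j powr (real k * (r - 2))"
      unfolding jk using False
      by (simp add: powr_powr powr_numeral[symmetric] powr_diff right_diff_distrib mult_ac del: powr_numeral)
    finally show ?thesis .
  qed
  have "summable (\<lambda>j. C * real j powr (real k * (r - 2)))"
    using k by (intro summable_mult) (simp add: summable_real_powr_iff algebra_simps)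
  then have sum: "summable (\<lambda>j. expectation (f j))"
    by (rule summable_comparison_test'[where N = 0]) (use bound f0 in \<open>simp add: integral_nonneg_AE\<close>)
  have "(\<integral>\<^sup>+\<omega>. (\<Sum>j. ennreal (f j \<omega>)) \<partial>M) = (\<Sum>j. \<integral>\<^sup>+\<omega>. ennreal (f j \<omega>) \<partial>M)"
    by (rule nn_integral_suminf) simp
  also have "\<dots> = (\<Sum>j. ennreal (expectation (f j)))"
    using int f0 by (simp add: nn_integral_eq_integral)
  also have "\<dots> = ennreal (\<Sum>j. expectation (f j))"
    using sum f0 by (intro suminf_ennreal2) (auto simp: integral_nonneg_AE)
  finally have "(\<integral>\<^sup>+\<omega>. (\<Sum>j. ennreal (f j \<omega>)) \<partial>M) \<noteq> \<infinity>" by simp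
  then have "AE \<omega> in M. (\<Sum>j. ennreal (f j \<omega>)) \<noteq> \<infinity>"
    by (intro nn_integral_PInf_AE) auto
  then show ?thesis
  proof (rule AE_mp, intro AE_I2 impI)
    fix \<omega> assume \<omega>: "\<omega> \<in> space M" and "(\<Sum>j. ennreal (f j \<omega>)) \<noteq> \<infinity>"
    then have "summable (\<lambda>j. f j \<omega>)"
      using f0 by (intro summable_suminf_not_top) auto
    then have "(\<lambda>j. f j \<omega>) \<longlonglongrightarrow> 0" by (rule summable_LIMSEQ_zero)
    then have "(\<lambda>j. Z (j ^ k) \<omega> / real (j ^ k)) \<longlonglongrightarrow> 0"
      unfolding f_def using tendsto_real_sqrt[of "\<lambda>j. (Z (j ^ k) \<omega> / real (j ^ k))\<^sup>2" 0 sequentially]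
      by (simp only: real_sqrt_abs real_sqrt_zero tendsto_rabs_zero_iff)
    then show "(\<lambda>n. Z n \<omega> / real n) \<longlonglongrightarrow> 0"
      by (rule tendsto_along_powers[where z = "\<lambda>n. Z n \<omega>", OF k1 inc[OF _ \<omega>], rotated])
  qed
qed

lemma moment_X_Suc:
  assumes n: "n \<ge> 1"
  shows "mean_sq (X (Suc n)) = (1 + 2 * (\<alpha> + q) / T n) * mean_sq (X n) + (\<alpha>\<^sup>2 + 1 + 2 * \<alpha> * q)"
proof -
  have "mean_sq (inc n 0 1 0 0) = \<alpha>\<^sup>2 + 1 + 2 * \<alpha> * q"
    using inc_var_X[OF n past_const[of n "1 :: real"]] by (simp add: prob_space)
  then show ?thesis
    using eigen_moment_Suc[OF n, of 0 "\<alpha> + q" 1 0 0] by (simp add: lin_def)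
qed

text \<open>The second moment of \<open>X\<close> grows with the exponent \<open>2 (\<alpha> + q) / (1 + \<alpha>)\<close> or with exponent \<open>1\<close>, and
  \<open>\<alpha> + q < 1 + \<alpha>\<close> for \<open>p < 1\<close>. The statistic \<open>Y\<close> is fed by \<open>X\<close>: the mixed moment is estimated by
  the squares of both, and what is added to the drift of the square of \<open>Y\<close> in this way is
  compensated by its own coefficient \<open>- 2\<close>.\<close>

lemma moment_Y_bound:
  assumes p: "p \<noteq> 1"
  obtains C r where "r < 2" "1 < r" "\<And>n. n \<ge> 1 \<Longrightarrow> mean_sq (Y n) \<le> C * real n powr r"
proof -
  have "2 * (\<alpha> + q) / (1 + \<alpha>) < 2" using p p_range alpha_gt by (simp add: field_simps)
  then obtain r where r: "max 1 (2 * (\<alpha> + q) / (1 + \<alpha>)) < r" "r < 2"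
    using dense[of "max 1 (2 * (\<alpha> + q) / (1 + \<alpha>))" 2] by auto
  let ?v = "\<alpha>\<^sup>2 + 1 + 2 * \<alpha> * q"
  have one: "1 \<le> real n powr (r - 1)" if "n \<ge> 1" for n
    using that r by (intro ge_one_powr_ge_zero) auto
  obtain C where C: "C \<ge> 0" "\<And>n. n \<ge> 1 \<Longrightarrow> mean_sq (X n) \<le> C * real n powr r"
  proof (rule power_recursion_bound[OF alpha_pos, of "2 * (\<alpha> + q)" r "\<lambda>n. mean_sq (X n)" "\<lambda>_. ?v" "\<bar>?v\<bar>"])
    show "?v \<le> \<bar>?v\<bar> * real n powr (r - 1)" if "n \<ge> 1" for n
      using mult_left_mono[OF one[OF that], of "\<bar>?v\<bar>"] by simp
  qed (use r in \<open>auto simp: moment_X_Suc\<close>)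
  obtain D where D: "\<And>n. n \<ge> 1 \<Longrightarrow> mean_sq (inc n 0 0 1 0) \<le> D"
    by (rule inc_sq_bound) blast
  define s where "s n = \<bar>q\<bar> * mean_sq (X n) / T n + \<bar>D\<bar>" for n
  obtain C' where C': "\<And>n. n \<ge> 1 \<Longrightarrow> mean_sq (Y n) \<le> C' * real n powr r"
  proof (rule power_recursion_bound[OF alpha_pos, of "\<bar>q\<bar> - 2" r "\<lambda>n. mean_sq (Y n)" s
        "\<bar>q\<bar> * C / min 1 (1 + \<alpha>) + \<bar>D\<bar>"])
    have "(\<bar>q\<bar> - 2) / (1 + \<alpha>) < 0" using p_range alpha_pos by (intro divide_neg_pos) auto
    then show "(\<bar>q\<bar> - 2) / (1 + \<alpha>) < r" using r by simp
    fix n :: nat assume n: "n \<ge> 1"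
    have T: "T n \<ge> 1" "T n \<ge> min 1 (1 + \<alpha>) * real n" using T_ge_1 tot_ge_min alpha_pos n by auto
    have m: "0 < min 1 (1 + \<alpha>)" using alpha_pos by simp
    have i: "integrable M (\<lambda>\<omega>. (X n \<omega>)\<^sup>2)" "integrable M (\<lambda>\<omega>. (Y n \<omega>)\<^sup>2)" "integrable M (\<lambda>\<omega>. X n \<omega> * Y n \<omega>)"
      by (rule past_integrable[of n]; intro past_intros)+
    have "2 * q * expectation (\<lambda>\<omega>. X n \<omega> * Y n \<omega>) = expectation (\<lambda>\<omega>. q * (2 * (X n \<omega> * Y n \<omega>)))"
      using i by simp
    also have "\<dots> \<le> expectation (\<lambda>\<omega>. \<bar>q\<bar> * ((X n \<omega>)\<^sup>2 + (Y n \<omega>)\<^sup>2))"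
    proof (rule integral_mono)
      fix \<omega>
      have "q * (2 * (X n \<omega> * Y n \<omega>)) \<le> \<bar>q\<bar> * \<bar>2 * (X n \<omega> * Y n \<omega>)\<bar>"
        unfolding abs_mult[symmetric] by (rule abs_ge_self)
      also have "\<dots> \<le> \<bar>q\<bar> * ((X n \<omega>)\<^sup>2 + (Y n \<omega>)\<^sup>2)"
        using sum_squares_bound[of "\<bar>X n \<omega>\<bar>" "\<bar>Y n \<omega>\<bar>"] by (intro mult_left_mono) (auto simp: abs_mult)
      finally show "q * (2 * (X n \<omega> * Y n \<omega>)) \<le> \<bar>q\<bar> * ((X n \<omega>)\<^sup>2 + (Y n \<omega>)\<^sup>2)" .
    qed (use i in auto)
    also have "\<dots> = \<bar>q\<bar> * mean_sq (X n) + \<bar>q\<bar> * mean_sq (Y n)"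
      using i by (simp add: distrib_left)
    finally have cross: "2 * q * expectation (\<lambda>\<omega>. X n \<omega> * Y n \<omega>) / T n \<le>
       (\<bar>q\<bar> * mean_sq (X n) + \<bar>q\<bar> * mean_sq (Y n)) / T n"
      using T by (intro divide_right_mono) auto
    have "mean_sq (Y (Suc n)) = mean_sq (Y n)
       + (expectation (\<lambda>\<omega>. (q * X n \<omega> - Y n \<omega>) * Y n \<omega>) + expectation (\<lambda>\<omega>. Y n \<omega> * (q * X n \<omega> - Y n \<omega>))) / T n
       + mean_sq (inc n 0 0 1 0)"
      using second_moment_Suc[OF n, of 0 0 1 0 0 0 1 0] by (simp add: lin_def power2_eq_square)
    also have "expectation (\<lambda>\<omega>. (q * X n \<omega> - Y n \<omega>) * Y n \<omega>) = expectation (\<lambda>\<omega>. q * (X n \<omega> * Y n \<omega>) - (Y n \<omega>)\<^sup>2)"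
      by (simp add: algebra_simps power2_eq_square)
    also have "expectation (\<lambda>\<omega>. Y n \<omega> * (q * X n \<omega> - Y n \<omega>)) = expectation (\<lambda>\<omega>. q * (X n \<omega> * Y n \<omega>) - (Y n \<omega>)\<^sup>2)"
      by (simp add: algebra_simps power2_eq_square)
    also have "expectation (\<lambda>\<omega>. q * (X n \<omega> * Y n \<omega>) - (Y n \<omega>)\<^sup>2) = q * expectation (\<lambda>\<omega>. X n \<omega> * Y n \<omega>) - mean_sq (Y n)"
      using i by simp
    finally show "mean_sq (Y (Suc n)) \<le> (1 + (\<bar>q\<bar> - 2) / T n) * mean_sq (Y n) + s n"
      using cross D[OF n] unfolding s_def
      by (simp add: add_divide_distrib diff_divide_distrib distrib_right left_diff_distrib)
    have "mean_sq (X n) / T n \<le> (C * real n powr r) / (min 1 (1 + \<alpha>) * real n)"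
      using C T m n by (intro frac_le) auto
    also have "\<dots> = C / min 1 (1 + \<alpha>) * real n powr (r - 1)"
      using n by (simp add: powr_diff)
    finally have "\<bar>q\<bar> * (mean_sq (X n) / T n) \<le> \<bar>q\<bar> * (C / min 1 (1 + \<alpha>) * real n powr (r - 1))"
      by (rule mult_left_mono) simp
    moreover have "\<bar>D\<bar> \<le> \<bar>D\<bar> * real n powr (r - 1)"
      using mult_left_mono[OF one[OF n], of "\<bar>D\<bar>"] by simp
    ultimately show "s n \<le> (\<bar>q\<bar> * C / min 1 (1 + \<alpha>) + \<bar>D\<bar>) * real n powr (r - 1)"
      unfolding s_def by (simp add: distrib_right)
  qed (use r in auto)
  then show thesis using that r by auto
qed

lemma moment_U_bound:
  obtains K where "K \<ge> 0" "\<And>n. n \<ge> 1 \<Longrightarrow> mean_sq (U n) \<le> K * T n"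
  using eigen_moment_bound[of "- 1" 1 0 0 0] alpha_pos by (auto simp: lin_def)

lemma leaf_mean_eq: "leaf_mean \<alpha> = vector [\<rho> * (1 + \<alpha>) / 2, \<rho> * (1 + \<alpha>) / 2]"
  unfolding leaf_mean_def \<rho>_def by (simp add: field_simps)

theorem strong_law:
  assumes "p \<noteq> 1"
  shows "AE \<omega> in M. (\<lambda>n. (1 / real n) *\<^sub>R leaf_vec par col n \<omega>) \<longlonglongrightarrow> leaf_mean \<alpha>"
proof -
  obtain C r where Y: "r < 2" "1 < r" "\<And>n. n \<ge> 1 \<Longrightarrow> mean_sq (Y n) \<le> C * real n powr r"
    using moment_Y_bound[OF assms] by metis
  obtain K where K: "K \<ge> 0" "\<And>n. n \<ge> 1 \<Longrightarrow> mean_sq (U n) \<le> K * T n"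
    using moment_U_bound by metis
  have lin1: "lin n 1 0 0 0 \<omega> = U n \<omega>" "lin n 0 0 1 0 \<omega> = Y n \<omega>" for n \<omega>
    by (auto simp: lin_def)
  have U': "mean_sq (U n) \<le> (K * max 1 (1 + \<alpha>)) * real n powr 1" if "n \<ge> 1" for n
    using K(2)[OF that] mult_left_mono[OF tot_le_max[OF alpha_pos that] K(1)] that by (simp add: mult.assoc)
  have "AE \<omega> in M. (\<lambda>n. U n \<omega> / real n) \<longlonglongrightarrow> 0"
  proof (rule AE_over_n[OF past_U(1) _ U'])
    show "\<bar>U (Suc n) \<omega> - U n \<omega>\<bar> \<le> (\<bar>\<alpha>\<bar> + 3) * (\<bar>1\<bar> + \<bar>0\<bar> + \<bar>0\<bar> + \<bar>0\<bar>)" if "n \<ge> 1" "\<omega> \<in> space M" for n \<omega>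
      using inc_bound[of n 1 0 0 0 \<omega>] lin_Suc[OF that, of 1 0 0 0] unfolding lin1 by simp
  qed auto
  moreover have "AE \<omega> in M. (\<lambda>n. Y n \<omega> / real n) \<longlonglongrightarrow> 0"
  proof (rule AE_over_n[OF past_stats(2) _ Y(3) Y(1)])
    show "\<bar>Y (Suc n) \<omega> - Y n \<omega>\<bar> \<le> (\<bar>\<alpha>\<bar> + 3) * (\<bar>0\<bar> + \<bar>0\<bar> + \<bar>1\<bar> + \<bar>0\<bar>)" if "n \<ge> 1" "\<omega> \<in> space M" for n \<omega>
      using inc_bound[of n 0 0 1 0 \<omega>] lin_Suc[OF that, of 0 0 1 0] unfolding lin1 by simp
  qed auto
  ultimately show ?thesis
  proof eventually_elim
    case (elim \<omega>)
    have T: "(\<lambda>n. T n / real n) \<longlonglongrightarrow> 1 + \<alpha>" by (rule tot_over_n)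
    have "(\<lambda>n. ((U n \<omega> / real n + \<rho> * (T n / real n)) + c * (Y n \<omega> / real n)) / 2) \<longlonglongrightarrow> ((0 + \<rho> * (1 + \<alpha>)) + c * 0) / 2" for c
      by (intro tendsto_intros elim T) simp
    then have "(\<lambda>n. (L n \<omega> / real n + c * (Y n \<omega> / real n)) / 2) \<longlonglongrightarrow> \<rho> * (1 + \<alpha>) / 2" for c
      by (simp add: U_def diff_divide_distrib)
    from this[of 1] this[of "- 1"] show ?case
      unfolding leaf_mean_eq leaf_vec_eq
    proof (intro vec_tendstoI)
      fix i :: 2
      assume 1: "(\<lambda>n. (L n \<omega> / real n + 1 * (Y n \<omega> / real n)) / 2) \<longlonglongrightarrow> \<rho> * (1 + \<alpha>) / 2"
        "(\<lambda>n. (L n \<omega> / real n + - 1 * (Y n \<omega> / real n)) / 2) \<longlonglongrightarrow> \<rho> * (1 + \<alpha>) / 2"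
      have eq: "(L n \<omega> / real n + c * (Y n \<omega> / real n)) / 2 = (L n \<omega> + c * Y n \<omega>) / 2 / real n" for n c
        by (simp add: add_divide_distrib)
      from 1 show "(\<lambda>n. ((1 / real n) *\<^sub>R vector [(L n \<omega> + Y n \<omega>) / 2, (L n \<omega> - Y n \<omega>) / 2] :: real ^ 2) $ i)
        \<longlonglongrightarrow> (vector [\<rho> * (1 + \<alpha>) / 2, \<rho> * (1 + \<alpha>) / 2] :: real ^ 2) $ i"
        unfolding eq using exhaust_2[of i] by auto
    qed
  qed
qed

section \<open>Reduction of weak convergence to the signed coordinates\<close>

text \<open>Pairing the vector with \<open>t\<close> gives \<open>(t $ 1 + t $ 2) / 2 * A + (t $ 1 - t $ 2) / 2 * B\<close>, whose
  characteristic function is known; tightness follows from the second moments by Chebyshev's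
  inequality.\<close>

lemma weak_limit_signed:
  fixes A B :: "nat \<Rightarrow> 'a \<Rightarrow> real" and N :: "(real ^ 2) measure"
  assumes A: "\<And>n. past n (A n)" and B: "\<And>n. past n (B n)"
    and N: "prob_space N" "sets N = sets borel"
    and char: "\<And>u y. (\<lambda>n. \<integral>\<omega>. cis (u * A n \<omega> + y * B n \<omega>) \<partial>M) \<longlonglongrightarrow>
        (\<integral>x. cis (vector [u + y, u - y] \<bullet> x) \<partial>N)"
    and C: "\<forall>\<^sub>F n in sequentially. expectation (\<lambda>\<omega>. (A n \<omega>)\<^sup>2 + (B n \<omega>)\<^sup>2) \<le> C"
  shows "weakly_converges (\<lambda>n. distr M borel (\<lambda>\<omega>. vector [(A n \<omega> + B n \<omega>) / 2, (A n \<omega> - B n \<omega>) / 2])) N"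
proof (rule weakly_converges_char)
  let ?V = "\<lambda>n \<omega>. vector [(A n \<omega> + B n \<omega>) / 2, (A n \<omega> - B n \<omega>) / 2] :: real ^ 2"
  have "past n (?V n)" for n
    by (rule past_comp2[OF A B, where F = "\<lambda>a b. vector [(a + b) / 2, (a - b) / 2]"])
  then have [measurable]: "?V n \<in> borel_measurable M" for n by (rule past_measurable)
  show "prob_space (distr M borel (?V n))" for n by (rule prob_space_distr) simp
  show "sets (distr M borel (?V n)) = sets borel" for n by simp
  show "prob_space N" "sets N = sets borel" by fact+
  show "(\<lambda>n. \<integral>x. cis (t \<bullet> x) \<partial>distr M borel (?V n)) \<longlonglongrightarrow> (\<integral>x. cis (t \<bullet> x) \<partial>N)" for t
  proof -
    have cm: "(\<lambda>x :: real ^ 2. cis (t \<bullet> x)) \<in> borel_measurable borel"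
      unfolding cis_conv_exp by measurable
    have t: "vector [(t $ 1 + t $ 2) / 2 + (t $ 1 - t $ 2) / 2, (t $ 1 + t $ 2) / 2 - (t $ 1 - t $ 2) / 2] = t"
      by (simp add: vec_eq_iff forall_2 field_simps)
    have "t \<bullet> ?V n \<omega> = (t $ 1 + t $ 2) / 2 * A n \<omega> + (t $ 1 - t $ 2) / 2 * B n \<omega>" for n \<omega>
      by (simp add: inner_vec_def sum_2 field_simps)
    then show ?thesis
      using char[of "(t $ 1 + t $ 2) / 2" "(t $ 1 - t $ 2) / 2"] cm unfolding t
      by (simp add: integral_distr)
  qed
  fix e :: real assume e: "e > 0"
  define R where "R = sqrt (\<bar>C\<bar> / e) + 1"
  have R: "R > 0" "\<bar>C\<bar> / R\<^sup>2 \<le> e"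
  proof -
    have "0 \<le> sqrt (\<bar>C\<bar> / e)" using e by simp
    then show "R > 0" unfolding R_def by linarith
    have "\<bar>C\<bar> / e = (sqrt (\<bar>C\<bar> / e))\<^sup>2" using e by simp
    also have "\<dots> \<le> R\<^sup>2" using e by (intro power_mono) (auto simp: R_def)
    finally show "\<bar>C\<bar> / R\<^sup>2 \<le> e" using e \<open>R > 0\<close> by (simp add: field_simps)
  qed
  show "\<exists>R. \<forall>\<^sub>F n in sequentially. measure (distr M borel (?V n)) {x. norm x > R} \<le> e"
  proof (intro exI eventually_mono[OF C])
    fix n assume elim: "expectation (\<lambda>\<omega>. (A n \<omega>)\<^sup>2 + (B n \<omega>)\<^sup>2) \<le> C"
    have nV: "(norm (?V n \<omega>))\<^sup>2 \<le> (A n \<omega>)\<^sup>2 + (B n \<omega>)\<^sup>2" for \<omega>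
    proof -
      have "(norm (?V n \<omega>))\<^sup>2 = ((A n \<omega>)\<^sup>2 + (B n \<omega>)\<^sup>2) / 2"
        unfolding power2_norm_eq_inner inner_vec_def sum_2 by (simp add: power2_eq_square field_simps)
      moreover have "0 \<le> (A n \<omega>)\<^sup>2 + (B n \<omega>)\<^sup>2" by simp
      moreover have "v \<le> w" if "v = w / 2" "0 \<le> w" for v w :: real using that by linarith
      ultimately show ?thesis by blast
    qed
    have i: "integrable M (\<lambda>\<omega>. ((A n \<omega>)\<^sup>2 + (B n \<omega>)\<^sup>2) / R\<^sup>2)"
      by (rule past_integrable[of n]) (intro past_intros A B)
    have S: "{\<omega> \<in> space M. norm (?V n \<omega>) > R} \<in> events" by measurable
    have "measure (distr M borel (?V n)) {x. norm x > R} = expectation (indicator {\<omega> \<in> space M. norm (?V n \<omega>) > R})"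
      by (subst measure_distr) (auto simp: vimage_def Int_def conj_commute)
    also have "\<dots> \<le> expectation (\<lambda>\<omega>. ((A n \<omega>)\<^sup>2 + (B n \<omega>)\<^sup>2) / R\<^sup>2)"
    proof (rule integral_mono[OF _ i])
      show "integrable M (indicator {\<omega> \<in> space M. norm (?V n \<omega>) > R} :: 'a \<Rightarrow> real)"
        using S by (simp add: emeasure_eq_measure)
      fix \<omega>
      show "indicator {\<omega> \<in> space M. norm (?V n \<omega>) > R} \<omega> \<le> ((A n \<omega>)\<^sup>2 + (B n \<omega>)\<^sup>2) / R\<^sup>2"
      proof (cases "norm (?V n \<omega>) > R")
        case True
        then have "R\<^sup>2 \<le> (norm (?V n \<omega>))\<^sup>2" using R by (intro power_mono) auto
        then have "R\<^sup>2 \<le> (A n \<omega>)\<^sup>2 + (B n \<omega>)\<^sup>2" using nV[of \<omega>] by simp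
        then show ?thesis using R by (auto simp: indicator_def)
      qed (auto simp: indicator_def)
    qed
    also have "\<dots> \<le> \<bar>C\<bar> / R\<^sup>2" using elim R by (auto intro!: divide_right_mono)
    finally show "measure (distr M borel (?V n)) {x. norm x > R} \<le> e" using R by simp
  qed
qed

text \<open>The leaf vector in signed coordinates; the centring at \<open>n m\<close> differs from that at the
  mean by a constant.\<close>

lemma leaf_vec_scaled:
  "c *\<^sub>R (leaf_vec par col n \<omega> - real n *\<^sub>R leaf_mean \<alpha>) =
    vector [(c * (U n \<omega> - \<rho> * \<alpha>) + c * Y n \<omega>) / 2, (c * (U n \<omega> - \<rho> * \<alpha>) - c * Y n \<omega>) / 2]"
  unfolding leaf_vec_eq leaf_mean_eq U_def tot_def
  by (simp add: vec_eq_iff forall_2 algebra_simps add_divide_distrib diff_divide_distrib)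

lemma colour_vec_scaled:
  "c *\<^sub>R (colour_vec col n \<omega> - real n *\<^sub>R vector [1 / 2, 1 / 2]) =
    vector [(0 + c * S n \<omega>) / 2, (0 - c * S n \<omega>) / 2]"
  unfolding colour_vec_eq
  by (simp add: vec_eq_iff forall_2 algebra_simps add_divide_distrib diff_divide_distrib)

section \<open>The Gaussian gap\<close>

text \<open>Distance of the characteristic function of a linear statistic from the Gaussian one with the
  same second moment. Comparing with the second moment at the same time \<open>n\<close>, and not with its limit,
  keeps the rate of convergence of the second moments out of the recursion. The coefficients also
  play the role of the frequencies.\<close>

definition gap :: "nat \<Rightarrow> real \<Rightarrow> real \<Rightarrow> real \<Rightarrow> real" where
  "gap n u x y = cmod ((\<integral>\<omega>. cis (lin n u x y 0 \<omega>) \<partial>M) - exp (- mean_sq (lin n u x y 0) / 2))"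

text \<open>\<open>char_step\<close> for linear statistics. The shift by the conditional mean is a change of the
  coefficients; \<open>m\<close> bounds the root mean square of the drift, and \<open>k\<close> that of the random part of the
  conditional second moment of the increment, both before division by \<open>T\<close>.\<close>

lemma gap_Suc:
  assumes n: "n \<ge> 2"
    and D: "\<And>\<omega>. \<bar>inc n u x y 0 \<omega>\<bar> \<le> d"
    and m: "mean_sq (lin n (- u) (x * (\<alpha> + q) + y * q) (- y) 0) \<le> m\<^sup>2" "0 \<le> m"
    and k: "mean_sq (lin n (covU u x y 0 u x y 0) (covX u x y 0 u x y 0) (covY u x y 0 u x y 0) 0) \<le> k\<^sup>2" "0 \<le> k"
  shows "gap (Suc n) u x y \<le> gap n (u - u / T n) (x + (x * (\<alpha> + q) + y * q) / T n) (y - y / T n)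
     + (d ^ 3 / 6 + m\<^sup>2 / (T n)\<^sup>2 + k / T n / 2 + d\<^sup>2 / 2 * (m / T n) + d ^ 4 / 8)"
proof -
  have n1: "n \<ge> 1" using n by simp
  have T: "T n > 0" using T_ge_1[OF n1] by simp
  have d0: "0 \<le> d" using D abs_ge_zero order_trans by blast
  define J where "J = lin n u x y 0"
  define I where "I = inc n u x y 0"
  define A where "A = lin n (- u) (x * (\<alpha> + q) + y * q) (- y) 0"
  define K where "K = lin n (covU u x y 0 u x y 0) (covX u x y 0 u x y 0) (covY u x y 0 u x y 0) 0"
  define s where "s = cov0 u x y 0 u x y 0"
  have past: "past n J" "past (Suc n) I" "past n (\<lambda>\<omega>. A \<omega> / T n)" "past n (\<lambda>\<omega>. s + K \<omega> / T n)" "past n A" "past n K"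
    unfolding J_def I_def A_def K_def by (intro past_intros n1)+
  have D1: "(\<integral>\<omega>. I \<omega> *\<^sub>R g \<omega> \<partial>M) = (\<integral>\<omega>. (A \<omega> / T n) *\<^sub>R g \<omega> \<partial>M)" if "past n g"
    for g :: "'a \<Rightarrow> 'b::{banach, second_countable_topology}"
    unfolding I_def A_def using inc_mean[OF n1 that, of u x y 0] by simp
  have D2: "(\<integral>\<omega>. (I \<omega>)\<^sup>2 *\<^sub>R g \<omega> \<partial>M) = (\<integral>\<omega>. (s + K \<omega> / T n) *\<^sub>R g \<omega> \<partial>M)" if "past n g"
    for g :: "'a \<Rightarrow> 'b::{banach, second_countable_topology}"
    unfolding I_def K_def s_def power2_eq_square by (rule inc_cov[OF n1 that])
  have DJ: "expectation (\<lambda>\<omega>. I \<omega> * J \<omega>) = expectation (\<lambda>\<omega>. A \<omega> / T n * J \<omega>)"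
    using D1[OF past(1)] by simp
  have DD: "mean_sq I = expectation (\<lambda>\<omega>. s + K \<omega> / T n)"
    using D2[OF past_const[of n "1 :: real"]] by simp
  have Es: "expectation (\<lambda>\<omega>. s + K \<omega> / T n) = s"
    using mean_zero[OF n] past_integrable[OF past(6)] unfolding K_def by (simp add: prob_space)
  have iI: "integrable M (\<lambda>\<omega>. \<bar>I \<omega>\<bar> ^ 3)" "integrable M (\<lambda>\<omega>. (I \<omega>)\<^sup>2)"
    by (rule past_integrable[of "Suc n"]; intro past_intros past)+
  have s: "0 \<le> s" "s \<le> d\<^sup>2"
  proof -
    have "0 \<le> mean_sq I" by simp
    then show "0 \<le> s" unfolding DD Es .
    have "mean_sq I \<le> expectation (\<lambda>\<omega>. d\<^sup>2)"
      using D d0 by (intro integral_mono iI) (auto simp: I_def abs_le_square_iff[symmetric])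
    then show "s \<le> d\<^sup>2" unfolding DD Es by (simp add: prob_space)
  qed
  have e1: "expectation (\<lambda>\<omega>. \<bar>I \<omega>\<bar> ^ 3) \<le> d ^ 3"
  proof -
    have "expectation (\<lambda>\<omega>. \<bar>I \<omega>\<bar> ^ 3) \<le> expectation (\<lambda>\<omega>. d ^ 3)"
      using D by (intro integral_mono iI power_mono) (auto simp: I_def)
    then show ?thesis by (simp add: prob_space)
  qed
  have e2: "expectation (\<lambda>\<omega>. (A \<omega> / T n)\<^sup>2) \<le> m\<^sup>2 / (T n)\<^sup>2"
    using m(1) T by (simp add: power_divide A_def divide_right_mono)
  have e3: "expectation (\<lambda>\<omega>. \<bar>s + K \<omega> / T n - expectation (\<lambda>\<omega>. s + K \<omega> / T n)\<bar>) \<le> k / T n"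
  proof -
    have "expectation (\<lambda>\<omega>. \<bar>s + K \<omega> / T n - expectation (\<lambda>\<omega>. s + K \<omega> / T n)\<bar>) = expectation (\<lambda>\<omega>. \<bar>K \<omega>\<bar>) / T n"
      unfolding Es using T by (simp add: abs_divide)
    also have "expectation (\<lambda>\<omega>. \<bar>K \<omega>\<bar>) \<le> k"
      using past_expectation_abs_le[OF past(6)] real_sqrt_le_mono[OF k(1)] k(2) unfolding K_def by simp
    finally show ?thesis using T by (simp add: divide_right_mono)
  qed
  have e4: "expectation (\<lambda>\<omega>. \<bar>A \<omega> / T n\<bar>) \<le> m / T n"
  proof -
    have "expectation (\<lambda>\<omega>. \<bar>A \<omega>\<bar>) \<le> m"
      using past_expectation_abs_le[OF past(5)] real_sqrt_le_mono[OF m(1)] m(2) unfolding A_def by simp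
    then show ?thesis using T by (simp add: abs_divide divide_right_mono)
  qed
  have eq1: "(\<integral>\<omega>. cis (lin (Suc n) u x y 0 \<omega>) \<partial>M) = (\<integral>\<omega>. cis (J \<omega> + I \<omega>) \<partial>M)"
    "mean_sq (lin (Suc n) u x y 0) = expectation (\<lambda>\<omega>. (J \<omega> + I \<omega>)\<^sup>2)"
    unfolding J_def I_def by (intro Bochner_Integration.integral_cong refl; simp add: lin_Suc[OF n1])+
  have eq2: "lin n (u - u / T n) (x + (x * (\<alpha> + q) + y * q) / T n) (y - y / T n) 0 = (\<lambda>\<omega>. J \<omega> + A \<omega> / T n)"
    unfolding J_def A_def lin_def using T by (auto simp: field_simps)
  have "gap (Suc n) u x y \<le> gap n (u - u / T n) (x + (x * (\<alpha> + q) + y * q) / T n) (y - y / T n)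
     + (expectation (\<lambda>\<omega>. \<bar>I \<omega>\<bar> ^ 3) / 6 + expectation (\<lambda>\<omega>. (A \<omega> / T n)\<^sup>2)
      + expectation (\<lambda>\<omega>. \<bar>s + K \<omega> / T n - expectation (\<lambda>\<omega>. s + K \<omega> / T n)\<bar>) / 2
      + expectation (\<lambda>\<omega>. s + K \<omega> / T n) / 2 * expectation (\<lambda>\<omega>. \<bar>A \<omega> / T n\<bar>) + (expectation (\<lambda>\<omega>. s + K \<omega> / T n))\<^sup>2 / 8)"
    unfolding gap_def eq1 eq2 by (rule char_step[OF past(1-4) D1 D2 DJ DD])
  also have "\<dots> \<le> gap n (u - u / T n) (x + (x * (\<alpha> + q) + y * q) / T n) (y - y / T n)
     + (d ^ 3 / 6 + m\<^sup>2 / (T n)\<^sup>2 + k / T n / 2 + d\<^sup>2 / 2 * (m / T n) + d ^ 4 / 8)"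
  proof (intro add_left_mono add_mono)
    have "s\<^sup>2 \<le> (d\<^sup>2)\<^sup>2" using s by (intro power_mono) auto
    then show "(expectation (\<lambda>\<omega>. s + K \<omega> / T n))\<^sup>2 / 8 \<le> d ^ 4 / 8"
      unfolding Es by (simp flip: power_mult)
    show "expectation (\<lambda>\<omega>. s + K \<omega> / T n) / 2 * expectation (\<lambda>\<omega>. \<bar>A \<omega> / T n\<bar>) \<le> d\<^sup>2 / 2 * (m / T n)"
      unfolding Es using s by (intro mult_mono divide_right_mono e4) (auto simp del: abs_divide)
    show "expectation (\<lambda>\<omega>. \<bar>s + K \<omega> / T n - expectation (\<lambda>\<omega>. s + K \<omega> / T n)\<bar>) / 2 \<le> k / T n / 2"
      by (rule divide_right_mono[OF e3]) simp
    show "expectation (\<lambda>\<omega>. \<bar>I \<omega>\<bar> ^ 3) / 6 \<le> d ^ 3 / 6" using e1 by simp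
  qed (use e2 in simp_all)
  finally show ?thesis .
qed

text \<open>Both characteristic functions are close to \<open>1\<close> for small arguments. The bound is linear in the
  argument up to higher order, as is needed to start the contraction.\<close>

lemma gap_initial:
  assumes v: "mean_sq (lin n u x y 0) \<le> v\<^sup>2" "0 \<le> v"
  shows "gap n u x y \<le> v + v\<^sup>2 / 2"
proof -
  let ?J = "lin n u x y 0"
  have i: "integrable M (\<lambda>\<omega>. cis (?J \<omega>))" "integrable M (\<lambda>\<omega>. cis (?J \<omega>) - 1)"
    by (rule past_integrable[of n]; intro past_intros)+
  have iJ: "integrable M (\<lambda>\<omega>. \<bar>?J \<omega>\<bar>)" "integrable M (\<lambda>\<omega>. cmod (cis (?J \<omega>) - 1))"
    by (rule past_integrable[of n]; intro past_intros)+
  have "cmod ((\<integral>\<omega>. cis (?J \<omega>) \<partial>M) - 1) = cmod (\<integral>\<omega>. cis (?J \<omega>) - 1 \<partial>M)"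
    using i by (simp add: prob_space)
  also have "\<dots> \<le> expectation (\<lambda>\<omega>. cmod (cis (?J \<omega>) - 1))" by (rule integral_norm_bound)
  also have "\<dots> \<le> expectation (\<lambda>\<omega>. \<bar>?J \<omega>\<bar>)" by (intro integral_mono iJ cis_expand0)
  also have "\<dots> \<le> v"
  proof -
    have "expectation (\<lambda>\<omega>. \<bar>?J \<omega>\<bar>) \<le> sqrt (mean_sq ?J)"
      by (rule past_expectation_abs_le[OF past_lin(1)])
    also have "\<dots> \<le> v" using real_sqrt_le_mono[OF v(1)] v(2) by simp
    finally show ?thesis .
  qed
  finally have 1: "cmod ((\<integral>\<omega>. cis (?J \<omega>) \<partial>M) - 1) \<le> v" .
  let ?w = "mean_sq ?J"
  have w: "0 \<le> ?w" by simp
  have "cmod (1 - complex_of_real (exp (- ?w / 2))) = \<bar>exp (- 0) - exp (- (?w / 2))\<bar>"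
    using norm_of_real[of "1 - exp (- ?w / 2)", where 'a = complex] by simp
  also have "\<dots> \<le> \<bar>0 - ?w / 2\<bar>" using w by (intro exp_minus_diff_le) auto
  also have "\<dots> \<le> v\<^sup>2 / 2" using v w by simp
  finally have 2: "cmod (1 - complex_of_real (exp (- ?w / 2))) \<le> v\<^sup>2 / 2" .
  have "a - b = (a - 1) + (1 - b)" for a b :: complex by simp
  then have "gap n u x y = cmod (((\<integral>\<omega>. cis (?J \<omega>) \<partial>M) - 1) + (1 - complex_of_real (exp (- ?w / 2))))"
    unfolding gap_def by metis
  also have "\<dots> \<le> v + v\<^sup>2 / 2" by (intro norm_triangle_mono 1 2)
  finally show ?thesis .
qed

end

section \<open>The Gaussian gap in the subcritical regime\<close>

text \<open>Here \<open>y\<close> is the size of the argument on the scale \<open>t\<close>, the square root of the total weight. As long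
  as \<open>y\<close> stays bounded, every error term of \<open>gap_Suc\<close> is \<open>y / t\<^sup>2\<close> times a quantity of order \<open>1 / t\<close>.
  Since the contraction rate is of order \<open>1 / t\<^sup>2\<close>, this is small enough.\<close>

lemma step_error_bound:
  fixes y t R :: real
  assumes t: "t \<ge> 1" and y: "0 \<le> y" "y \<le> R" and "0 \<le> A" "0 \<le> B" "0 \<le> C" "0 \<le> D" "0 \<le> E"
  shows "A * (y / t) ^ 3 + B * (y / t)\<^sup>2 / t\<^sup>2 + C * (y / t)\<^sup>2 / t + D * (y / t) ^ 3 / t + E * (y / t) ^ 4
    \<le> (A * R\<^sup>2 + B * R + C * R + D * R\<^sup>2 + E * R ^ 3) * ((y / t) / t\<^sup>2)"
proof -
  define w where "w = (y / t) / t\<^sup>2"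
  have w: "w \<ge> 0" using t y by (simp add: w_def)
  have "y / t \<le> y / 1" using t y by (intro divide_left_mono) auto
  then have yt: "0 \<le> y / t" "y / t \<le> R" using t y by auto
  have y2: "y\<^sup>2 \<le> R\<^sup>2" using y by (intro power_mono) auto
  have 1: "(y / t) ^ 3 = y\<^sup>2 * w" "(y / t)\<^sup>2 / t\<^sup>2 = (y / t) * w" "(y / t)\<^sup>2 / t = y * w"
    "(y / t) ^ 3 / t = (y\<^sup>2 / t) * w" "(y / t) ^ 4 = (y\<^sup>2 * (y / t)) * w"
    using t by (simp_all add: w_def power2_eq_square power3_eq_cube power4_eq_xxxx)
  have y2t: "y\<^sup>2 / t \<le> R\<^sup>2"
    using y2 t by (smt (verit) divide_le_eq_1 divide_left_mono div_by_1 mult_pos_pos zero_le_power2)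
  have y3: "y\<^sup>2 * (y / t) \<le> R ^ 3"
    using mult_mono[OF y2 yt(2)] yt by (simp add: power2_eq_square power3_eq_cube)
  have "A * (y / t) ^ 3 \<le> A * (R\<^sup>2 * w)" unfolding 1(1) by (intro mult_left_mono mult_right_mono y2 w assms)
  moreover have "B * ((y / t)\<^sup>2 / t\<^sup>2) \<le> B * (R * w)" unfolding 1(2) by (intro mult_left_mono mult_right_mono yt w assms)
  moreover have "C * ((y / t)\<^sup>2 / t) \<le> C * (R * w)" unfolding 1(3) by (intro mult_left_mono mult_right_mono y w assms)
  moreover have "D * ((y / t) ^ 3 / t) \<le> D * (R\<^sup>2 * w)" unfolding 1(4) by (intro mult_left_mono mult_right_mono y2t w assms)
  moreover have "E * (y / t) ^ 4 \<le> E * (R ^ 3 * w)" unfolding 1(5) by (intro mult_left_mono mult_right_mono y3 w assms)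
  ultimately show ?thesis unfolding w_def[symmetric] by (simp add: algebra_simps)
qed

text \<open>The drift multiplies an argument by \<open>1 + a / tot b n\<close>, while the scale of the square root grows by
  about \<open>1 + (b / 2) / tot b n\<close>: relative to the scale, the argument shrinks.\<close>

lemma tot_sqrt_contraction:
  assumes b: "b > 0" and a: "2 * a < b"
  obtains k n0 where "k > 0" "n0 \<ge> 1"
    "\<And>n. n \<ge> n0 \<Longrightarrow> (1 + a / tot b n) * sqrt (tot b n) \<le> (1 - k / tot b n) * sqrt (tot b (Suc n))"
    "\<And>n. n \<ge> n0 \<Longrightarrow> 0 \<le> 1 + a / tot b n"
proof -
  obtain k where k: "k > 0" "a + k < b / 2"
    using dense[of 0 "b / 2 - a"] a by (auto simp: algebra_simps)
  have "(\<lambda>n. b / 2 * ((tot b n + a) / tot b (Suc n))) \<longlonglongrightarrow> b / 2 * 1"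
  proof (rule tendsto_mult_left)
    show "(\<lambda>n. (tot b n + a) / tot b (Suc n)) \<longlonglongrightarrow> 1" unfolding tot_def using b by real_asymp
  qed
  then have "eventually (\<lambda>n. a + k < b / 2 * ((tot b n + a) / tot b (Suc n))) sequentially"
    using k by (intro order_tendstoD(1)) auto
  then obtain n1 where n1: "\<And>n. n \<ge> n1 \<Longrightarrow> a + k < b / 2 * ((tot b n + a) / tot b (Suc n))"
    by (auto simp: eventually_sequentially)
  obtain n2 where n2: "n2 \<ge> 1" "\<And>n. n \<ge> n2 \<Longrightarrow> tot b n \<ge> max 1 (- a)"
    using tot_eventually_ge[OF b] by blast
  show thesis
  proof (rule that[OF k(1)])
    show "max n1 n2 \<ge> 1" using n2 by simp
    fix n assume n: "n \<ge> max n1 n2"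
    define t where "t = tot b n"
    have t: "t \<ge> 1" "t \<ge> - a" using n2(2)[of n] n by (auto simp: t_def)
    have t': "tot b (Suc n) = t + b" by (simp add: tot_Suc t_def)
    show nn: "0 \<le> 1 + a / tot b n" using t unfolding t_def[symmetric] by (simp add: field_simps)
    \<comment> \<open>With this \<open>h\<close> the quotient of consecutive total weights is \<open>1 - 2 h \<le> (1 - h)\<^sup>2\<close>.\<close>
    define h where "h = b / 2 / (t + b)"
    have h: "0 \<le> h" "h \<le> 1" using b t by (auto simp: h_def field_simps)
    have "t = (t + b) * (1 - 2 * h)" using b t by (simp add: h_def field_simps)
    also have "\<dots> \<le> (t + b) * (1 - h)\<^sup>2"
      using b t by (intro mult_left_mono) (auto simp: power2_eq_square algebra_simps)
    finally have "sqrt t \<le> sqrt ((t + b) * (1 - h)\<^sup>2)" by (rule real_sqrt_le_mono)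
    also have "\<dots> = (1 - h) * sqrt (t + b)" using h by (simp add: real_sqrt_mult)
    finally have "(1 + a / t) * sqrt t \<le> (1 + a / t) * ((1 - h) * sqrt (t + b))"
      using nn unfolding t_def[symmetric] by (rule mult_left_mono)
    also have "\<dots> = ((1 + a / t) * (1 - h)) * sqrt (t + b)" by simp
    also have "\<dots> \<le> (1 - k / t) * sqrt (t + b)"
    proof (rule mult_right_mono)
      have "a + k < b / 2 * ((t + a) / (t + b))" using n1[of n] n unfolding t' t_def[symmetric] by simp
      then have "a + k \<le> h * (t + a)" by (simp add: h_def)
      then have "(a + k) / t \<le> h * (t + a) / t" using t by (intro divide_right_mono) auto
      moreover have "h * (t + a) / t = h * (1 + a / t)" using t by (simp add: field_simps)
      ultimately show "(1 + a / t) * (1 - h) \<le> 1 - k / t" by (simp add: algebra_simps add_divide_distrib diff_divide_distrib)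
    qed (use t b in auto)
    finally show "(1 + a / tot b n) * sqrt (tot b n) \<le> (1 - k / tot b n) * sqrt (tot b (Suc n))"
      by (simp add: t' t_def)
  qed
qed

text \<open>Either the colour of a child is independent of that of its parent, or the growth exponent of \<open>X\<close> is
  less than \<open>1 / 2\<close>, which means \<open>p < (3 - \<alpha>) / 4\<close>.\<close>

locale subcritical = pa_process +
  assumes sub: "q = 0 \<or> 2 * (\<alpha> + q) < 1 + \<alpha>"
begin

text \<open>When \<open>q = 0\<close> the statistic \<open>X\<close> does not influence \<open>Y\<close> and may grow faster than the square
  root of \<open>n\<close>. Working with \<open>q X\<close>, which then vanishes, treats this case together with the
  regime of slow growth: the drift coefficient of \<open>q X\<close> is \<open>a\<close>.\<close>

definition a :: real where "a = (if q = 0 then 0 else \<alpha> + q)"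

lemma a: "q * (\<alpha> + q) = a * q" "2 * a < 1 + \<alpha>"
  using sub alpha_pos by (auto simp: a_def)

definition H :: "nat \<Rightarrow> real \<Rightarrow> real \<Rightarrow> real \<Rightarrow> 'a \<Rightarrow> real" where
  "H n u x y = lin n u (q * x) y 0"

lemma past_H [past_intros]: "past n (H n u x y)"
  unfolding H_def by (intro past_intros)

definition m2 :: "nat \<Rightarrow> real \<Rightarrow> real \<Rightarrow> real \<Rightarrow> real \<Rightarrow> real \<Rightarrow> real \<Rightarrow> real" where
  "m2 n u x y u' x' y' = expectation (\<lambda>\<omega>. H n u x y \<omega> * H n u' x' y' \<omega>)"

lemma m2_bilinear:
  "m2 n (c * u1 + d * u2) (c * x1 + d * x2) (c * y1 + d * y2) u x y = c * m2 n u1 x1 y1 u x y + d * m2 n u2 x2 y2 u x y"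
proof -
  have i: "integrable M (\<lambda>\<omega>. H n u1 x1 y1 \<omega> * H n u x y \<omega>)" "integrable M (\<lambda>\<omega>. H n u2 x2 y2 \<omega> * H n u x y \<omega>)"
    by (rule past_integrable[of n]; intro past_intros)+
  have "m2 n (c * u1 + d * u2) (c * x1 + d * x2) (c * y1 + d * y2) u x y
    = expectation (\<lambda>\<omega>. c * (H n u1 x1 y1 \<omega> * H n u x y \<omega>) + d * (H n u2 x2 y2 \<omega> * H n u x y \<omega>))"
    unfolding m2_def by (intro Bochner_Integration.integral_cong refl) (simp add: H_def lin_def algebra_simps)
  then show ?thesis using i by (simp add: m2_def)
qed

lemma m2_commute: "m2 n u x y u' x' y' = m2 n u' x' y' u x y"
  by (simp add: m2_def mult.commute)

lemma m2_Suc: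
  assumes n: "n \<ge> 1"
  shows "m2 (Suc n) u x y u' x' y' = m2 n u x y u' x' y'
    + (m2 n (- u) (a * x + y) (- y) u' x' y' + m2 n u x y (- u') (a * x' + y') (- y')) / T n
    + expectation (\<lambda>\<omega>. inc n u (q * x) y 0 \<omega> * inc n u' (q * x') y' 0 \<omega>)"
proof -
  have d: "q * x * (\<alpha> + q) + (y + 0) * q = q * (a * x + y)" for x y
    using a(1) by (simp add: distrib_left mult.commute mult.left_commute)
  show ?thesis
    unfolding m2_def H_def using second_moment_Suc[OF n, of u "q * x" y 0 u' "q * x'" y' 0]
    unfolding d by simp
qed

lemma inc_cov_limit: "(\<lambda>n. expectation (\<lambda>\<omega>. inc n u x y s \<omega> * inc n u' x' y' s' \<omega>)) \<longlonglongrightarrow> cov0 u x y s u' x' y' s'"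
  by (rule tendsto_eventually, rule eventually_sequentiallyI[of 2]) (rule inc_cov_mean)

text \<open>The second moments of \<open>q X\<close>, \<open>Y\<close> and \<open>U\<close> divided by \<open>T\<close> have these limits; \<open>vXY\<close> belongs to the
  product of \<open>q X\<close> and \<open>Y\<close>. The denominators are the growth rate \<open>1 + \<alpha>\<close> of \<open>T\<close> minus the sum of the
  drift eigenvalues of the two factors.\<close>

definition vX :: real where "vX = cov0 0 q 0 0 0 q 0 0 / (1 + \<alpha> - 2 * a)"
definition vXY :: real where "vXY = (vX + cov0 0 q 0 0 0 0 1 0) / (1 + \<alpha> - (a - 1))"
definition vY :: real where "vY = (2 * vXY + cov0 0 0 1 0 0 0 1 0) / (1 + \<alpha> + 2)"
definition vU :: real where "vU = cov0 1 0 0 0 1 0 0 0 / (1 + \<alpha> + 2)"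

text \<open>The drift matrix is triangular, so the recursions can be solved one after the other, the limit found
  for \<open>q X\<close> entering the inhomogeneous term for the product, and that one the term for \<open>Y\<close>. \<open>U\<close> is
  asymptotically uncorrelated with the signed statistics, since exchanging the colours changes
  their signs and leaves \<open>U\<close> as it is.\<close>

lemma moment_limits:
  shows "(\<lambda>n. m2 n 0 1 0 0 1 0 / T n) \<longlonglongrightarrow> vX"
    and "(\<lambda>n. m2 n 0 1 0 0 0 1 / T n) \<longlonglongrightarrow> vXY"
    and "(\<lambda>n. m2 n 0 0 1 0 0 1 / T n) \<longlonglongrightarrow> vY"
    and "(\<lambda>n. m2 n 1 0 0 1 0 0 / T n) \<longlonglongrightarrow> vU"
    and "(\<lambda>n. m2 n 1 0 0 0 1 0 / T n) \<longlonglongrightarrow> 0"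
    and "(\<lambda>n. m2 n 1 0 0 0 0 1 / T n) \<longlonglongrightarrow> 0"
proof -
  note lim = linear_recursion_limit[OF alpha_pos]
  have ca: "a - 1 < 1 + \<alpha>" using a(2) alpha_pos by simp
  have drift: "m2 n 0 a 0 u x y = a * m2 n 0 1 0 u x y"
    "m2 n 0 1 (- 1) u x y = m2 n 0 1 0 u x y - m2 n 0 0 1 u x y"
    "m2 n (- 1) 0 0 u x y = - m2 n 1 0 0 u x y" for n u x y
    using m2_bilinear[of n a 0 0 0 1 0 0 0 u x y] m2_bilinear[of n 1 0 "- 1" 0 1 0 0 1 u x y]
      m2_bilinear[of n "- 1" 1 0 0 0 0 0 0 u x y] by simp_all
  have drift': "m2 n u x y 0 a 0 = a * m2 n u x y 0 1 0"
    "m2 n u x y 0 1 (- 1) = m2 n u x y 0 1 0 - m2 n u x y 0 0 1"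
    "m2 n u x y (- 1) 0 0 = - m2 n u x y 1 0 0" for n u x y
    unfolding m2_commute[of n u x y] by (rule drift)+
  note step = m2_Suc minus_zero mult_1_right mult_zero_right add_0 add_0_right drift drift'
  note il = inc_cov_limit
  show XX: "(\<lambda>n. m2 n 0 1 0 0 1 0 / T n) \<longlonglongrightarrow> vX"
    unfolding vX_def
    by (rule lim[OF a(2) _ il]) (simp only: step, simp add: algebra_simps add_divide_distrib)
  show XY: "(\<lambda>n. m2 n 0 1 0 0 0 1 / T n) \<longlonglongrightarrow> vXY"
    unfolding vXY_def
    by (rule lim[OF ca _ tendsto_add[OF XX il]])
       (simp only: step, simp add: algebra_simps add_divide_distrib diff_divide_distrib)
  have c2: "- 2 < 1 + \<alpha>" using alpha_pos by simp
  have "(\<lambda>n. m2 n 0 0 1 0 0 1 / T n) \<longlonglongrightarrow> (2 * vXY + cov0 0 0 1 0 0 0 1 0) / (1 + \<alpha> - - 2)"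
    by (rule lim[OF c2 _ tendsto_add[OF tendsto_mult_left[OF XY] il]])
       (simp only: step m2_commute[of _ 0 0 1 0 1 0], simp add: algebra_simps add_divide_distrib diff_divide_distrib)
  then show "(\<lambda>n. m2 n 0 0 1 0 0 1 / T n) \<longlonglongrightarrow> vY" by (simp add: vY_def)
  have "(\<lambda>n. m2 n 1 0 0 1 0 0 / T n) \<longlonglongrightarrow> cov0 1 0 0 0 1 0 0 0 / (1 + \<alpha> - - 2)"
    by (rule lim[OF c2 _ il[of 1 "q * 0" 0 0 1 "q * 0" 0 0, simplified]])
       (simp only: step, simp add: algebra_simps add_divide_distrib diff_divide_distrib)
  then show "(\<lambda>n. m2 n 1 0 0 1 0 0 / T n) \<longlonglongrightarrow> vU" by (simp add: vU_def)
  have z: "cov0 1 0 0 0 0 q 0 0 = 0" "cov0 1 0 0 0 0 0 1 0 = 0" by (simp_all add: cov0_def)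
  have "(\<lambda>n. m2 n 1 0 0 0 1 0 / T n) \<longlonglongrightarrow> cov0 1 0 0 0 0 q 0 0 / (1 + \<alpha> - (a - 1))"
    by (rule lim[OF ca _ il[of 1 "q * 0" 0 0 0 "q * 1" 0 0, simplified]])
       (simp only: step, simp add: algebra_simps add_divide_distrib diff_divide_distrib)
  then show UX: "(\<lambda>n. m2 n 1 0 0 0 1 0 / T n) \<longlonglongrightarrow> 0" by (simp add: z)
  have "(\<lambda>n. m2 n 1 0 0 0 0 1 / T n) \<longlonglongrightarrow> (0 + cov0 1 0 0 0 0 0 1 0) / (1 + \<alpha> - - 2)"
    by (rule lim[OF c2 _ tendsto_add[OF UX il[of 1 "q * 0" 0 0 0 "q * 0" 1 0, simplified]]])
       (simp only: step, simp add: algebra_simps add_divide_distrib diff_divide_distrib)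
  then show "(\<lambda>n. m2 n 1 0 0 0 0 1 / T n) \<longlonglongrightarrow> 0" by (simp add: z)
qed

lemma tendsto_imp_linear_bound:
  assumes "(\<lambda>n. f n / T n) \<longlonglongrightarrow> v"
  shows "\<exists>K\<ge>0. \<forall>n\<ge>1. f n \<le> K * T n"
proof -
  obtain K where K: "K > 0" "\<And>n. norm (f n / T n) \<le> K"
    using convergent_imp_Bseq[OF convergentI[OF assms]] by (auto simp: Bseq_def)
  have "f n \<le> K * T n" if "n \<ge> 1" for n
  proof -
    have T: "T n > 0" using T_ge_1[OF that] by simp
    have "f n / T n \<le> K" using K(2)[of n] unfolding real_norm_def by (rule order_trans[OF abs_ge_self])
    then show ?thesis using T by (simp add: field_simps)
  qed
  then show ?thesis using K by (intro exI[of _ K]) auto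
qed

lemma H_square: "mean_sq (H n u x y) = u\<^sup>2 * m2 n 1 0 0 1 0 0 + x\<^sup>2 * m2 n 0 1 0 0 1 0 + y\<^sup>2 * m2 n 0 0 1 0 0 1
    + 2 * (u * x * m2 n 1 0 0 0 1 0 + u * y * m2 n 1 0 0 0 0 1 + x * y * m2 n 0 1 0 0 0 1)"
proof -
  have i: "integrable M (\<lambda>\<omega>. H n a b c \<omega> * H n d e f \<omega>)" for a b c d e f
    by (rule past_integrable[of n]; intro past_intros)+
  have "(H n u x y \<omega>)\<^sup>2 = u\<^sup>2 * (H n 1 0 0 \<omega> * H n 1 0 0 \<omega>) + x\<^sup>2 * (H n 0 1 0 \<omega> * H n 0 1 0 \<omega>) + y\<^sup>2 * (H n 0 0 1 \<omega> * H n 0 0 1 \<omega>)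
    + 2 * (u * x * (H n 1 0 0 \<omega> * H n 0 1 0 \<omega>) + u * y * (H n 1 0 0 \<omega> * H n 0 0 1 \<omega>) + x * y * (H n 0 1 0 \<omega> * H n 0 0 1 \<omega>))" for \<omega>
    by (simp add: H_def lin_def power2_eq_square algebra_simps)
  then show ?thesis using i by (simp add: m2_def)
qed

lemma H_moment_bound:
  "\<exists>K\<ge>0. \<forall>n\<ge>1. \<forall>u x y. mean_sq (H n u x y) \<le> K * (\<bar>u\<bar> + \<bar>x\<bar> + \<bar>y\<bar>)\<^sup>2 * T n"
proof -
  obtain K1 K2 K3 where K: "K1 \<ge> 0" "K2 \<ge> 0" "K3 \<ge> 0" "\<And>n. n \<ge> 1 \<Longrightarrow> m2 n 1 0 0 1 0 0 \<le> K1 * T n"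
    "\<And>n. n \<ge> 1 \<Longrightarrow> m2 n 0 1 0 0 1 0 \<le> K2 * T n" "\<And>n. n \<ge> 1 \<Longrightarrow> m2 n 0 0 1 0 0 1 \<le> K3 * T n"
    using tendsto_imp_linear_bound[OF moment_limits(4)] tendsto_imp_linear_bound[OF moment_limits(1)]
      tendsto_imp_linear_bound[OF moment_limits(3)] by metis
  let ?K = "3 * (K1 + K2 + K3)"
  have "mean_sq (H n u x y) \<le> ?K * (\<bar>u\<bar> + \<bar>x\<bar> + \<bar>y\<bar>)\<^sup>2 * T n" if n: "n \<ge> 1" for n u x y
  proof -
    have T: "T n \<ge> 0" using T_ge_1[OF n] by simp
    have i: "integrable M (\<lambda>\<omega>. H n a b c \<omega> * H n a b c \<omega>)" "integrable M (\<lambda>\<omega>. (H n a b c \<omega>)\<^sup>2)" for a b c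
      by (rule past_integrable[of n]; intro past_intros)+
    have "mean_sq (H n u x y) \<le> expectation (\<lambda>\<omega>. 3 * (u\<^sup>2 * (H n 1 0 0 \<omega> * H n 1 0 0 \<omega>)
       + x\<^sup>2 * (H n 0 1 0 \<omega> * H n 0 1 0 \<omega>) + y\<^sup>2 * (H n 0 0 1 \<omega> * H n 0 0 1 \<omega>)))"
    proof (rule integral_mono)
      fix \<omega>
      have sq: "(r + s + t)\<^sup>2 \<le> 3 * (r\<^sup>2 + s\<^sup>2 + t\<^sup>2)" for r s t :: real
      proof -
        have "3 * (r\<^sup>2 + s\<^sup>2 + t\<^sup>2) - (r + s + t)\<^sup>2 = (r - s)\<^sup>2 + (s - t)\<^sup>2 + (r - t)\<^sup>2"
          by (simp add: power2_eq_square algebra_simps)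
        moreover have "0 \<le> (r - s)\<^sup>2 + (s - t)\<^sup>2 + (r - t)\<^sup>2" by simp
        ultimately show ?thesis by linarith
      qed
      show "(H n u x y \<omega>)\<^sup>2 \<le> 3 * (u\<^sup>2 * (H n 1 0 0 \<omega> * H n 1 0 0 \<omega>)
       + x\<^sup>2 * (H n 0 1 0 \<omega> * H n 0 1 0 \<omega>) + y\<^sup>2 * (H n 0 0 1 \<omega> * H n 0 0 1 \<omega>))"
        using sq[of "u * H n 1 0 0 \<omega>" "x * H n 0 1 0 \<omega>" "y * H n 0 0 1 \<omega>"]
        by (simp add: H_def lin_def power2_eq_square algebra_simps)
    qed (use i in auto)
    also have "\<dots> = 3 * (u\<^sup>2 * m2 n 1 0 0 1 0 0 + x\<^sup>2 * m2 n 0 1 0 0 1 0 + y\<^sup>2 * m2 n 0 0 1 0 0 1)"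
      using i by (simp add: m2_def)
    also have "\<dots> \<le> 3 * ((\<bar>u\<bar> + \<bar>x\<bar> + \<bar>y\<bar>)\<^sup>2 * (K1 * T n) + (\<bar>u\<bar> + \<bar>x\<bar> + \<bar>y\<bar>)\<^sup>2 * (K2 * T n) + (\<bar>u\<bar> + \<bar>x\<bar> + \<bar>y\<bar>)\<^sup>2 * (K3 * T n))"
    proof (intro mult_left_mono[of _ _ "3 :: real"] add_mono mult_mono K(4-6) n)
      show "u\<^sup>2 \<le> (\<bar>u\<bar> + \<bar>x\<bar> + \<bar>y\<bar>)\<^sup>2" "x\<^sup>2 \<le> (\<bar>u\<bar> + \<bar>x\<bar> + \<bar>y\<bar>)\<^sup>2" "y\<^sup>2 \<le> (\<bar>u\<bar> + \<bar>x\<bar> + \<bar>y\<bar>)\<^sup>2"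
        by (auto intro!: power2_le_iff_abs_le[THEN iffD2])
    qed (auto simp: m2_def)
    also have "\<dots> = ?K * (\<bar>u\<bar> + \<bar>x\<bar> + \<bar>y\<bar>)\<^sup>2 * T n" by (simp add: algebra_simps)
    finally show ?thesis .
  qed
  then show ?thesis using K by (intro exI[of _ ?K]) auto
qed

text \<open>Size of an argument. The weight \<open>1 / 2\<close> makes the off-diagonal part of the drift, which
  feeds \<open>y\<close> into \<open>x\<close>, harmless.\<close>

definition size :: "real \<times> real \<times> real \<Rightarrow> real" where
  "size z = (case z of (u, x, y) \<Rightarrow> \<bar>u\<bar> + \<bar>x\<bar> / 2 + \<bar>y\<bar>)"

definition shift :: "nat \<Rightarrow> real \<times> real \<times> real \<Rightarrow> real \<times> real \<times> real" where
  "shift n z = (case z of (u, x, y) \<Rightarrow> (u - u / T n, x + (a * x + y) / T n, y - y / T n))"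

definition Hgap :: "nat \<Rightarrow> real \<times> real \<times> real \<Rightarrow> real" where
  "Hgap n z = (case z of (u, x, y) \<Rightarrow> gap n u (q * x) y)"

lemma size_nonneg: "0 \<le> size z"
  by (cases z) (simp add: size_def)

lemma size_shift:
  assumes T: "T n \<ge> 1" and c: "0 \<le> 1 + max a (- (1 / 2)) / T n" and ca: "0 \<le> 1 + a / T n"
  shows "size (shift n z) \<le> (1 + max a (- (1 / 2)) / T n) * size z"
proof (cases z)
  case (fields u x y)
  define t where "t = 1 / T n"
  have t: "0 < t" "t \<le> 1" using T by (simp_all add: t_def)
  define b where "b = max a (- (1 / 2))"
  have b: "a \<le> b" "- (1 / 2) \<le> b" by (simp_all add: b_def)
  have div: "r / T n = t * r" for r by (simp add: t_def)
  have "size (shift n z) = \<bar>(1 - t) * u\<bar> + \<bar>(1 + t * a) * x + t * y\<bar> / 2 + \<bar>(1 - t) * y\<bar>"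
    unfolding fields size_def shift_def prod.case div by (simp add: algebra_simps)
  also have "\<dots> \<le> (1 - t) * \<bar>u\<bar> + ((1 + t * a) * \<bar>x\<bar> + t * \<bar>y\<bar>) / 2 + (1 - t) * \<bar>y\<bar>"
  proof -
    have "\<bar>(1 + t * a) * x + t * y\<bar> \<le> \<bar>(1 + t * a) * x\<bar> + \<bar>t * y\<bar>" by (rule abs_triangle_ineq)
    also have "\<dots> = (1 + t * a) * \<bar>x\<bar> + t * \<bar>y\<bar>"
      using t ca unfolding abs_mult div by (simp only: abs_of_nonneg less_imp_le)
    finally show ?thesis using t by (simp add: abs_mult)
  qed
  also have "\<dots> = (1 - t) * \<bar>u\<bar> + (1 + t * a) * (\<bar>x\<bar> / 2) + (1 - t / 2) * \<bar>y\<bar>" by (simp add: algebra_simps)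
  also have "\<dots> \<le> (1 + t * b) * \<bar>u\<bar> + (1 + t * b) * (\<bar>x\<bar> / 2) + (1 + t * b) * \<bar>y\<bar>"
  proof -
    have "t * (- 1) \<le> t * b" "t * a \<le> t * b" "t * (- (1 / 2)) \<le> t * b"
      using t b by (intro mult_left_mono; simp)+
    then have "1 - t \<le> 1 + t * b" "1 + t * a \<le> 1 + t * b" "1 - t / 2 \<le> 1 + t * b" by simp_all
    then show ?thesis by (intro add_mono[OF add_mono] mult_right_mono) simp_all
  qed
  also have "\<dots> = (1 + b / T n) * size z" unfolding fields size_def div by (simp add: algebra_simps)
  finally show ?thesis by (simp add: b_def)
qed

text \<open>The coefficient of \<open>X\<close> in the conditional second moment is divisible by \<open>q\<close>. Its random part is
  therefore again one of the statistics \<open>H\<close>, whose second moments are under control.\<close>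

lemma cov_coefficients_bound:
  fixes u x y w :: real
  assumes w: "\<bar>u\<bar> \<le> w" "\<bar>x\<bar> \<le> w" "\<bar>y\<bar> \<le> w"
  obtains c where "covX u (q * x) y 0 u (q * x) y 0 = q * c"
    "\<bar>covU u (q * x) y 0 u (q * x) y 0\<bar> + \<bar>c\<bar> + \<bar>covY u (q * x) y 0 u (q * x) y 0\<bar> \<le> (6 * \<bar>\<alpha>\<bar> + 20) * w\<^sup>2"
proof -
  have q: "\<bar>q\<bar> \<le> 1" using p_range by (simp add: abs_le_iff)
  have x': "\<bar>q * x\<bar> \<le> w" using mult_mono[OF q w(2)] by (simp add: abs_mult)
  define z where "z = q * x"
  have P: "\<bar>k * (r * s)\<bar> \<le> K * w\<^sup>2" if "\<bar>k\<bar> \<le> K" "\<bar>r\<bar> \<le> w" "\<bar>s\<bar> \<le> w" for k K r s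
    unfolding abs_mult power2_eq_square using that by (intro mult_mono) auto
  define c where "c = \<rho> * (2 * \<alpha> * (u * x) + 2 * (u * (q * x)) + 2 * (u * y))"
  have r: "\<bar>\<rho>\<bar> \<le> 1" "\<bar>1 - \<rho>\<bar> \<le> 1" "\<bar>1 - 2 * \<rho>\<bar> \<le> 1" using rho by (auto simp: abs_le_iff)
  have cX: "covX u (q * x) y 0 u (q * x) y 0 = q * c"
    by (simp add: covX_def c_def algebra_simps)
  have cU: "covU u z y 0 u z y 0 = (1 - 2 * \<rho>) * (u * u) + 1 * (y * y) - 2 * \<alpha> * (z * y) - 2 * q * (y * z) - 2 * q * (y * y)"
    by (simp add: covU_def algebra_simps)
  have cY: "covY u z y 0 u z y 0 = 2 * (1 - \<rho>) * (u * y) - 2 * \<alpha> * (u * z) - 2 * q * (u * z) - 2 * q * (u * y)"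
    by (simp add: covY_def algebra_simps)
  have q2: "\<bar>2 * q\<bar> \<le> 2" "\<bar>2 * (1 - \<rho>)\<bar> \<le> 2" "\<bar>2 * \<alpha>\<bar> \<le> 2 * \<bar>\<alpha>\<bar>" using q r by (auto simp: abs_mult)
  have z: "\<bar>z\<bar> \<le> w" using x' by (simp add: z_def)
  have tri: "\<bar>A + B - C - D - E\<bar> \<le> \<bar>A\<bar> + \<bar>B\<bar> + \<bar>C\<bar> + \<bar>D\<bar> + \<bar>E\<bar>" for A B C D E :: real by linarith
  have tri4: "\<bar>A - B - C - D\<bar> \<le> \<bar>A\<bar> + \<bar>B\<bar> + \<bar>C\<bar> + \<bar>D\<bar>" for A B C D :: real by linarith
  have tri3: "\<bar>A + B + C\<bar> \<le> \<bar>A\<bar> + \<bar>B\<bar> + \<bar>C\<bar>" for A B C :: real by linarith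
  have bU: "\<bar>covU u z y 0 u z y 0\<bar> \<le> 1 * w\<^sup>2 + 1 * w\<^sup>2 + 2 * \<bar>\<alpha>\<bar> * w\<^sup>2 + 2 * w\<^sup>2 + 2 * w\<^sup>2"
    unfolding cU by (rule order_trans[OF tri]) (intro add_mono P w z q2 r, simp)
  have bY: "\<bar>covY u z y 0 u z y 0\<bar> \<le> 2 * w\<^sup>2 + 2 * \<bar>\<alpha>\<bar> * w\<^sup>2 + 2 * w\<^sup>2 + 2 * w\<^sup>2"
    unfolding cY by (rule order_trans[OF tri4]) (intro add_mono P w z q2 r)
  have bc: "\<bar>c\<bar> \<le> 1 * (2 * \<bar>\<alpha>\<bar> * w\<^sup>2 + 2 * w\<^sup>2 + 2 * w\<^sup>2)"
    unfolding c_def abs_mult[of \<rho>]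
  proof (intro mult_mono r order_trans[OF tri3] add_mono P w x' q2)
  qed auto
  have "\<bar>covU u (q * x) y 0 u (q * x) y 0\<bar> + \<bar>c\<bar> + \<bar>covY u (q * x) y 0 u (q * x) y 0\<bar> \<le> (6 * \<bar>\<alpha>\<bar> + 16) * w\<^sup>2"
    using bU bY bc unfolding z_def by (simp add: algebra_simps)
  also have "\<dots> \<le> (6 * \<bar>\<alpha>\<bar> + 20) * w\<^sup>2" by (intro mult_right_mono) auto
  finally show thesis using cX that by blast
qed

text \<open>All hypotheses of \<open>gap_Suc\<close> in terms of the size of the argument: \<open>A\<close> comes from the bound on the
  increments, \<open>B\<close> from the drift and \<open>C\<close> from the random part of the conditional second moment. The
  factors \<open>2\<close> pass from \<open>size\<close> to the sum of the absolute values.\<close>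

lemma Hgap_step:
  assumes n: "n \<ge> 2" and K: "K \<ge> 0" "\<And>n u x y. n \<ge> 1 \<Longrightarrow> mean_sq (H n u x y) \<le> K * (\<bar>u\<bar> + \<bar>x\<bar> + \<bar>y\<bar>)\<^sup>2 * T n"
    and R: "size z * sqrt (T n) \<le> R"
  defines "A \<equiv> 2 * (\<bar>\<alpha>\<bar> + 3)" and "B \<equiv> sqrt K * (2 * (2 + \<bar>a\<bar>))" and "C \<equiv> sqrt K * (4 * (6 * \<bar>\<alpha>\<bar> + 20))"
  shows "Hgap (Suc n) z \<le> Hgap n (shift n z) +
    (A ^ 3 / 6 * R\<^sup>2 + B\<^sup>2 * R + C / 2 * R + A\<^sup>2 / 2 * B * R\<^sup>2 + A ^ 4 / 8 * R ^ 3) * (size z / T n)"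
proof (cases z)
  case (fields u x y)
  define v where "v = size z"
  have n1: "n \<ge> 1" using n by simp
  have T: "T n \<ge> 1" by (rule T_ge_1[OF n1])
  define t where "t = sqrt (T n)"
  have t: "t \<ge> 1" "t\<^sup>2 = T n" using T by (simp_all add: t_def)
  have v: "v \<ge> 0" "\<bar>u\<bar> + \<bar>x\<bar> + \<bar>y\<bar> \<le> 2 * v"
    using size_nonneg[of z] by (auto simp: v_def fields size_def)
  have ABC: "A \<ge> 0" "B \<ge> 0" "C \<ge> 0" using K by (auto simp: A_def B_def C_def)
  have q: "\<bar>q\<bar> \<le> 1" using p_range by (simp add: abs_le_iff)
  have qx: "\<bar>q * x\<bar> \<le> \<bar>x\<bar>" using mult_right_mono[OF q, of "\<bar>x\<bar>"] by (simp add: abs_mult)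
  have D: "\<bar>inc n u (q * x) y 0 \<omega>\<bar> \<le> A * v" for \<omega>
  proof -
    have "\<bar>inc n u (q * x) y 0 \<omega>\<bar> \<le> (\<bar>\<alpha>\<bar> + 3) * (\<bar>u\<bar> + \<bar>q * x\<bar> + \<bar>y\<bar> + \<bar>0\<bar>)" by (rule inc_bound)
    also have "\<dots> \<le> (\<bar>\<alpha>\<bar> + 3) * (2 * v)" using v qx by (intro mult_left_mono) auto
    finally show ?thesis by (simp add: A_def algebra_simps)
  qed
  have drift: "q * x * (\<alpha> + q) + y * q = q * (a * x + y)"
    using a(1) by (simp add: distrib_left mult.commute mult.left_commute)
  have m: "mean_sq (lin n (- u) (q * x * (\<alpha> + q) + y * q) (- y) 0) \<le> (B * v * t)\<^sup>2"
  proof -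
    have "mean_sq (lin n (- u) (q * x * (\<alpha> + q) + y * q) (- y) 0) \<le> K * (\<bar>- u\<bar> + \<bar>a * x + y\<bar> + \<bar>- y\<bar>)\<^sup>2 * T n"
      unfolding drift using K(2)[OF n1] unfolding H_def .
    also have "\<dots> \<le> K * ((2 + \<bar>a\<bar>) * (2 * v))\<^sup>2 * T n"
    proof (intro mult_right_mono mult_left_mono power_mono)
      have "\<bar>a * x + y\<bar> \<le> \<bar>a\<bar> * \<bar>x\<bar> + \<bar>y\<bar>" by (simp only: abs_mult[symmetric] abs_triangle_ineq)
      then have "\<bar>- u\<bar> + \<bar>a * x + y\<bar> + \<bar>- y\<bar> \<le> \<bar>u\<bar> + \<bar>a\<bar> * \<bar>x\<bar> + 2 * \<bar>y\<bar>" by simp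
      also have "\<dots> \<le> (2 + \<bar>a\<bar>) * (\<bar>u\<bar> + \<bar>x\<bar> + \<bar>y\<bar>)" by (simp add: algebra_simps)
      also have "\<dots> \<le> (2 + \<bar>a\<bar>) * (2 * v)" using v by (intro mult_left_mono) auto
      finally show "\<bar>- u\<bar> + \<bar>a * x + y\<bar> + \<bar>- y\<bar> \<le> (2 + \<bar>a\<bar>) * (2 * v)" .
    qed (use K T in auto)
    also have "\<dots> = (B * v * t)\<^sup>2" unfolding t(2)[symmetric] B_def power_mult_distrib using K by simp
    finally show ?thesis .
  qed
  have "\<bar>u\<bar> \<le> 2 * v" "\<bar>x\<bar> \<le> 2 * v" "\<bar>y\<bar> \<le> 2 * v" using v(2) by linarith+
  from cov_coefficients_bound[OF this] obtain c where c: "covX u (q * x) y 0 u (q * x) y 0 = q * c"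
    "\<bar>covU u (q * x) y 0 u (q * x) y 0\<bar> + \<bar>c\<bar> + \<bar>covY u (q * x) y 0 u (q * x) y 0\<bar> \<le> (6 * \<bar>\<alpha>\<bar> + 20) * (2 * v)\<^sup>2"
    by metis
  have k: "mean_sq (lin n (covU u (q * x) y 0 u (q * x) y 0) (covX u (q * x) y 0 u (q * x) y 0) (covY u (q * x) y 0 u (q * x) y 0) 0)
     \<le> (C * v\<^sup>2 * t)\<^sup>2"
  proof -
    let ?U = "covU u (q * x) y 0 u (q * x) y 0" and ?Y = "covY u (q * x) y 0 u (q * x) y 0"
    have "mean_sq (lin n ?U (covX u (q * x) y 0 u (q * x) y 0) ?Y 0) \<le> K * (\<bar>?U\<bar> + \<bar>c\<bar> + \<bar>?Y\<bar>)\<^sup>2 * T n"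
      unfolding c(1) using K(2)[OF n1] unfolding H_def .
    also have "\<dots> \<le> K * ((6 * \<bar>\<alpha>\<bar> + 20) * (2 * v)\<^sup>2)\<^sup>2 * T n"
      using K T c(2) by (intro mult_right_mono mult_left_mono power_mono) auto
    also have "\<dots> = (C * v\<^sup>2 * t)\<^sup>2" unfolding t(2)[symmetric] C_def power_mult_distrib using K by simp
    finally show ?thesis .
  qed
  have "gap (Suc n) u (q * x) y \<le> gap n (u - u / T n) (q * x + (q * x * (\<alpha> + q) + y * q) / T n) (y - y / T n)
     + ((A * v) ^ 3 / 6 + (B * v * t)\<^sup>2 / (T n)\<^sup>2 + C * v\<^sup>2 * t / T n / 2 + (A * v)\<^sup>2 / 2 * (B * v * t / T n) + (A * v) ^ 4 / 8)"
    by (rule gap_Suc[OF n D m _ k]) (use ABC v t in auto)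
  also have "q * x + (q * x * (\<alpha> + q) + y * q) / T n = q * (x + (a * x + y) / T n)"
    unfolding drift by (simp add: distrib_left)
  also have "(A * v) ^ 3 / 6 + (B * v * t)\<^sup>2 / (T n)\<^sup>2 + C * v\<^sup>2 * t / T n / 2 + (A * v)\<^sup>2 / 2 * (B * v * t / T n) + (A * v) ^ 4 / 8
     = A ^ 3 / 6 * (v * t / t) ^ 3 + B\<^sup>2 * (v * t / t)\<^sup>2 / t\<^sup>2 + C / 2 * (v * t / t)\<^sup>2 / t + A\<^sup>2 / 2 * B * (v * t / t) ^ 3 / t + A ^ 4 / 8 * (v * t / t) ^ 4"
    using t(1) unfolding t(2)[symmetric] by (simp add: field_simps power2_eq_square power3_eq_cube power4_eq_xxxx)
  also have "\<dots> \<le> (A ^ 3 / 6 * R\<^sup>2 + B\<^sup>2 * R + C / 2 * R + A\<^sup>2 / 2 * B * R\<^sup>2 + A ^ 4 / 8 * R ^ 3) * ((v * t / t) / t\<^sup>2)"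
    by (rule step_error_bound) (use t v ABC R in \<open>auto simp: v_def t_def\<close>)
  finally show ?thesis
    using t(1) unfolding t(2) v_def[symmetric] by (simp add: Hgap_def shift_def fields v_def)
qed

text \<open>The contraction principle on the scale of the square root of \<open>T\<close>: \<open>shift\<close> enlarges an argument at
  most by the factor \<open>1 + b / T n\<close>, where \<open>2 b < 1 + \<alpha>\<close>, and the scale grows faster.\<close>

theorem Hgap_tendsto:
  assumes R: "\<And>n. size (z n) * sqrt (T n) \<le> R"
  shows "(\<lambda>n. Hgap n (z n)) \<longlonglongrightarrow> 0"
proof -
  obtain K where K: "K \<ge> 0" "\<And>n u x y. n \<ge> 1 \<Longrightarrow> mean_sq (H n u x y) \<le> K * (\<bar>u\<bar> + \<bar>x\<bar> + \<bar>y\<bar>)\<^sup>2 * T n"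
    using H_moment_bound by blast
  define b where "b = max a (- (1 / 2))"
  have "2 * b < 1 + \<alpha>" using a(2) alpha_pos by (simp add: b_def)
  then obtain k n1 where k: "k > 0" "n1 \<ge> 1"
    "\<And>n. n \<ge> n1 \<Longrightarrow> (1 + b / T n) * sqrt (T n) \<le> (1 - k / T n) * sqrt (T (Suc n))"
    "\<And>n. n \<ge> n1 \<Longrightarrow> 0 \<le> 1 + b / T n"
    using tot_sqrt_contraction[OF alpha_pos] by blast
  obtain n2 where n2: "n2 \<ge> 1" "\<And>n. n \<ge> n2 \<Longrightarrow> 0 < ln (T n)" "\<And>n. n \<ge> n2 \<Longrightarrow> k / T n \<le> 1"
    "\<And>n. n \<ge> n2 \<Longrightarrow> (1 - k / T n) * ln (T (Suc n)) \<le> ln (T n)"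
    using ln_tot_rate[OF alpha_pos k(1)] by blast
  obtain n3 where n3: "n3 \<ge> 1" "\<And>n. n \<ge> n3 \<Longrightarrow> T n \<ge> max 1 (- a)"
    using tot_eventually_ge[OF alpha_pos] by blast
  define n0 where "n0 = max 2 (max n1 (max n2 n3))"
  obtain F where F: "\<And>n z. n \<ge> 2 \<Longrightarrow> size z * sqrt (T n) \<le> R \<Longrightarrow> Hgap (Suc n) z \<le> Hgap n (shift n z) + F * (size z / T n)"
    using Hgap_step[OF _ K] by metis
  obtain d where d: "d \<longlonglongrightarrow> 0" "\<And>n z. n \<ge> n0 \<Longrightarrow> size z * sqrt (T n) \<le> R \<Longrightarrow> Hgap n z \<le> d n * (size z * sqrt (T n))"
  proof (rule contraction_family[where D = Hgap and r = "\<lambda>n z. size z * sqrt (T n)" and L = shift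
        and b = "\<lambda>n. k / T n" and e = "\<lambda>n. F / k / sqrt (T (Suc n))" and g = "\<lambda>n. ln (T n)" and R = R and ?n0.0 = n0
        and C = "2 * sqrt K + 2 * K * R"])
    fix n z assume n: "n \<ge> n0" and r: "size z * sqrt (T (Suc n)) \<le> R"
    have T: "T n \<ge> 1" "T (Suc n) \<ge> 1" using n by (auto simp: n0_def intro!: T_ge_1)
    have "sqrt (T n) \<le> sqrt (T (Suc n))" using alpha_pos by (simp add: tot_Suc)
    then have "size z * sqrt (T n) \<le> size z * sqrt (T (Suc n))" using size_nonneg by (rule mult_left_mono)
    with r have "size z * sqrt (T n) \<le> R" by simp
    then have "Hgap (Suc n) z \<le> Hgap n (shift n z) + F * (size z / T n)" using n by (intro F) (auto simp: n0_def)
    also have "F * (size z / T n) = k / T n * (F / k / sqrt (T (Suc n))) * (size z * sqrt (T (Suc n)))"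
      using T k(1) by simp
    finally show "Hgap (Suc n) z \<le> Hgap n (shift n z) + k / T n * (F / k / sqrt (T (Suc n))) * (size z * sqrt (T (Suc n)))" .
  next
    fix n z assume n: "n \<ge> n0"
    have T: "T n \<ge> 1" "T n \<ge> - a" using n n3(2)[of n] by (auto simp: n0_def)
    have ca: "0 \<le> 1 + a / T n" using T by (simp add: field_simps)
    have "size (shift n z) \<le> (1 + b / T n) * size z"
      using size_shift[OF T(1) _ ca] k(4)[of n] n by (simp add: b_def n0_def)
    then have "size (shift n z) * sqrt (T n) \<le> (1 + b / T n) * size z * sqrt (T n)"
      using T by (intro mult_right_mono) auto
    also have "\<dots> = size z * ((1 + b / T n) * sqrt (T n))" by simp
    also have "\<dots> \<le> size z * ((1 - k / T n) * sqrt (T (Suc n)))"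
      using k(3)[of n] n size_nonneg by (intro mult_left_mono) (auto simp: n0_def)
    finally show "size (shift n z) * sqrt (T n) \<le> (1 - k / T n) * (size z * sqrt (T (Suc n)))" by (simp add: mult_ac)
  next
    show "(\<lambda>n. F / k / sqrt (T (Suc n))) \<longlonglongrightarrow> 0"
      by (intro tendsto_divide_0[OF tendsto_const] filterlim_at_top_imp_at_infinity
          filterlim_compose[OF sqrt_at_top] filterlim_compose[OF tot_at_top[OF alpha_pos] filterlim_Suc])
  next
    show "filterlim (\<lambda>n. ln (T n)) at_top sequentially" by (rule ln_tot_at_top[OF alpha_pos])
  next
    fix z assume r: "size z * sqrt (T n0) \<le> R"
    obtain u x y where z: "z = (u, x, y)" by (cases z)
    define v where "v = size z * sqrt (T n0)"
    have n0: "n0 \<ge> 1" by (simp add: n0_def)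
    have v: "0 \<le> v" "v \<le> R" using r size_nonneg T_ge_1[OF n0] by (auto simp: v_def)
    have "mean_sq (H n0 u x y) \<le> K * (\<bar>u\<bar> + \<bar>x\<bar> + \<bar>y\<bar>)\<^sup>2 * T n0" by (rule K(2)[OF n0])
    also have "\<dots> \<le> K * (2 * size z)\<^sup>2 * T n0"
      using K(1) T_ge_1[OF n0] by (intro mult_right_mono mult_left_mono power_mono) (auto simp: z size_def)
    also have "\<dots> = (2 * sqrt K * v)\<^sup>2" using K(1) T_ge_1[OF n0] by (simp add: v_def power_mult_distrib)
    finally have "gap n0 u (q * x) y \<le> 2 * sqrt K * v + (2 * sqrt K * v)\<^sup>2 / 2"
      unfolding H_def by (rule gap_initial) (use K v in auto)
    also have "(2 * sqrt K * v)\<^sup>2 / 2 = 2 * K * v * v" using K(1) by (simp add: power_mult_distrib power2_eq_square)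
    also have "\<dots> \<le> 2 * K * R * v" using v K(1) by (intro mult_right_mono mult_left_mono) auto
    finally show "Hgap n0 z \<le> (2 * sqrt K + 2 * K * R) * (size z * sqrt (T n0))"
      by (simp add: Hgap_def z v_def[unfolded z] distrib_right)
  next
    fix n z assume n: "n \<ge> n0"
    have "T n \<ge> 1" using n by (intro T_ge_1) (simp add: n0_def)
    then show "0 \<le> k / T n" "0 \<le> size z * sqrt (T n)" using k(1) size_nonneg by auto
  qed (use n2 in \<open>auto simp: n0_def\<close>)
  show ?thesis
  proof (rule tendsto_sandwich[OF _ _ tendsto_const])
    show "eventually (\<lambda>n. 0 \<le> Hgap n (z n)) sequentially"
      by (auto simp: Hgap_def gap_def split: prod.split)
    show "(\<lambda>n. \<bar>d n\<bar> * R) \<longlonglongrightarrow> 0" using tendsto_mult_right[OF tendsto_rabs_zero[OF d(1)], of R] by simp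
    show "eventually (\<lambda>n. Hgap n (z n) \<le> \<bar>d n\<bar> * R) sequentially"
    proof (rule eventually_sequentiallyI)
      fix n assume n: "n \<ge> n0"
      have "Hgap n (z n) \<le> d n * (size (z n) * sqrt (T n))" using d(2)[OF n R] .
      also have "\<dots> \<le> \<bar>d n\<bar> * (size (z n) * sqrt (T n))"
        using n T_ge_1[of n] size_nonneg by (intro mult_right_mono) (auto simp: n0_def)
      also have "\<dots> \<le> \<bar>d n\<bar> * R" using R by (intro mult_left_mono) auto
      finally show "Hgap n (z n) \<le> \<bar>d n\<bar> * R" .
    qed
  qed
qed

end

section \<open>Mean-square approximation\<close>

lemma (in prob_space) cis_expectation_diff:
  fixes f g :: "'a \<Rightarrow> real"
  assumes [measurable]: "f \<in> borel_measurable M" "g \<in> borel_measurable M" and "integrable M (\<lambda>\<omega>. (f \<omega> - g \<omega>)\<^sup>2)"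
  shows "cmod ((\<integral>\<omega>. cis (f \<omega>) \<partial>M) - (\<integral>\<omega>. cis (g \<omega>) \<partial>M)) \<le> sqrt (expectation (\<lambda>\<omega>. (f \<omega> - g \<omega>)\<^sup>2))"
proof -
  have i: "integrable M (\<lambda>\<omega>. cis (f \<omega>))" "integrable M (\<lambda>\<omega>. cis (g \<omega>))"
    by (rule integrable_cis; (rule finite_measure_axioms | measurable))+
  have d: "integrable M (\<lambda>\<omega>. f \<omega> - g \<omega>)"
    by (rule square_integrable_imp_integrable[OF _ assms(3)]) measurable
  have "cmod ((\<integral>\<omega>. cis (f \<omega>) \<partial>M) - (\<integral>\<omega>. cis (g \<omega>) \<partial>M)) = cmod (\<integral>\<omega>. cis (f \<omega>) - cis (g \<omega>) \<partial>M)"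
    using i by simp
  also have "\<dots> \<le> expectation (\<lambda>\<omega>. cmod (cis (f \<omega>) - cis (g \<omega>)))" by (rule integral_norm_bound)
  also have "\<dots> \<le> expectation (\<lambda>\<omega>. \<bar>f \<omega> - g \<omega>\<bar>)"
  proof (rule integral_mono)
    fix \<omega>
    have "cis (f \<omega>) - cis (g \<omega>) = cis (g \<omega>) * (cis (f \<omega> - g \<omega>) - 1)"
      by (simp add: right_diff_distrib cis_mult)
    then show "cmod (cis (f \<omega>) - cis (g \<omega>)) \<le> \<bar>f \<omega> - g \<omega>\<bar>"
      using cis_expand0[of "f \<omega> - g \<omega>"] by (simp add: norm_mult)
  qed (use i d in auto)
  also have "\<dots> \<le> sqrt (expectation (\<lambda>\<omega>. (f \<omega> - g \<omega>)\<^sup>2))"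
    by (rule expectation_abs_le[OF _ assms(3)]) measurable
  finally show ?thesis .
qed

lemma (in prob_space) cis_expectation_tendsto:
  fixes f g :: "nat \<Rightarrow> 'a \<Rightarrow> real"
  assumes "\<And>n. f n \<in> borel_measurable M" "\<And>n. g n \<in> borel_measurable M" "\<And>n. integrable M (\<lambda>\<omega>. (f n \<omega> - g n \<omega>)\<^sup>2)"
    and small: "(\<lambda>n. expectation (\<lambda>\<omega>. (f n \<omega> - g n \<omega>)\<^sup>2)) \<longlonglongrightarrow> 0"
    and lim: "(\<lambda>n. \<integral>\<omega>. cis (g n \<omega>) \<partial>M) \<longlonglongrightarrow> l"
  shows "(\<lambda>n. \<integral>\<omega>. cis (f n \<omega>) \<partial>M) \<longlonglongrightarrow> l"
proof -
  have "(\<lambda>n. (\<integral>\<omega>. cis (f n \<omega>) \<partial>M) - (\<integral>\<omega>. cis (g n \<omega>) \<partial>M)) \<longlonglongrightarrow> 0"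
  proof (rule Lim_null_comparison)
    show "(\<lambda>n. sqrt (expectation (\<lambda>\<omega>. (f n \<omega> - g n \<omega>)\<^sup>2))) \<longlonglongrightarrow> 0"
      using tendsto_real_sqrt[OF small] by simp
    show "\<forall>\<^sub>F n in sequentially. norm ((\<integral>\<omega>. cis (f n \<omega>) \<partial>M) - (\<integral>\<omega>. cis (g n \<omega>) \<partial>M)) \<le> sqrt (expectation (\<lambda>\<omega>. (f n \<omega> - g n \<omega>)\<^sup>2))"
      by (rule always_eventually) (use cis_expectation_diff assms in blast)
  qed
  from tendsto_add[OF this lim] show ?thesis by simp
qed

context pa_process
begin

text \<open>Weak limits of the leaf vector are read off from the joint characteristic functions of the
  scaled statistics \<open>U\<close> and \<open>Y\<close>.\<close>

lemma leaf_weak_limit: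
  assumes N: "prob_space N" "sets N = sets borel"
    and char: "\<And>u y. (\<lambda>n. \<integral>\<omega>. cis (c n * lin n u 0 y 0 \<omega>) \<partial>M) \<longlonglongrightarrow>
        (\<integral>x. cis (vector [u + y, u - y] \<bullet> x) \<partial>N)"
    and cT: "\<forall>\<^sub>F n in sequentially. (c n)\<^sup>2 * T n \<le> C" and c0: "c \<longlonglongrightarrow> 0"
    and Y: "\<forall>\<^sub>F n in sequentially. (c n)\<^sup>2 * mean_sq (Y n) \<le> C'"
  shows "weakly_converges (\<lambda>n. distr M borel (\<lambda>\<omega>. c n *\<^sub>R (leaf_vec par col n \<omega> - real n *\<^sub>R leaf_mean \<alpha>))) N"
proof -
  obtain K where K: "K \<ge> 0" "\<And>n. n \<ge> 1 \<Longrightarrow> mean_sq (U n) \<le> K * T n"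
    using moment_U_bound by metis
  show ?thesis
    unfolding leaf_vec_scaled
  proof (rule weak_limit_signed[OF _ _ N])
    show "past n (\<lambda>\<omega>. c n * (U n \<omega> - \<rho> * \<alpha>))" "past n (\<lambda>\<omega>. c n * Y n \<omega>)" for n
      by (intro past_intros)+
    show "(\<lambda>n. \<integral>\<omega>. cis (u * (c n * (U n \<omega> - \<rho> * \<alpha>)) + y * (c n * Y n \<omega>)) \<partial>M) \<longlonglongrightarrow> (\<integral>x. cis (vector [u + y, u - y] \<bullet> x) \<partial>N)" for u y
    proof (rule cis_expectation_tendsto[OF _ _ _ _ char])
      show "(\<lambda>\<omega>. u * (c n * (U n \<omega> - \<rho> * \<alpha>)) + y * (c n * Y n \<omega>)) \<in> borel_measurable M"
        "(\<lambda>\<omega>. c n * lin n u 0 y 0 \<omega>) \<in> borel_measurable M" for n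
        by (rule past_measurable[of n]; intro past_intros)+
      have eq: "u * (c n * (U n \<omega> - \<rho> * \<alpha>)) + y * (c n * Y n \<omega>) - c n * lin n u 0 y 0 \<omega> = - u * \<rho> * \<alpha> * c n" for n \<omega>
        by (simp add: lin_def algebra_simps)
      show "integrable M (\<lambda>\<omega>. (u * (c n * (U n \<omega> - \<rho> * \<alpha>)) + y * (c n * Y n \<omega>) - c n * lin n u 0 y 0 \<omega>)\<^sup>2)" for n
        unfolding eq by simp
      have "(\<lambda>n. (- u * \<rho> * \<alpha> * c n)\<^sup>2) \<longlonglongrightarrow> (- u * \<rho> * \<alpha> * 0)\<^sup>2" by (intro tendsto_intros c0)
      then show "(\<lambda>n. expectation (\<lambda>\<omega>. (u * (c n * (U n \<omega> - \<rho> * \<alpha>)) + y * (c n * Y n \<omega>) - c n * lin n u 0 y 0 \<omega>)\<^sup>2)) \<longlonglongrightarrow> 0"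
        unfolding eq by (simp add: prob_space)
    qed
    have "(\<lambda>n. (c n)\<^sup>2) \<longlonglongrightarrow> 0\<^sup>2" by (intro tendsto_intros c0)
    then have "\<forall>\<^sub>F n in sequentially. (c n)\<^sup>2 < 1" by (rule order_tendstoD) simp
    then show "\<forall>\<^sub>F n in sequentially. expectation (\<lambda>\<omega>. (c n * (U n \<omega> - \<rho> * \<alpha>))\<^sup>2 + (c n * Y n \<omega>)\<^sup>2) \<le> 2 * (K * C) + 2 * (\<rho> * \<alpha>)\<^sup>2 + C'"
      using cT Y eventually_ge_at_top[of 1]
    proof eventually_elim
      case (elim n)
      have i: "integrable M (\<lambda>\<omega>. (U n \<omega>)\<^sup>2)" "integrable M (\<lambda>\<omega>. (Y n \<omega>)\<^sup>2)"
        "integrable M (\<lambda>\<omega>. (c n * (U n \<omega> - \<rho> * \<alpha>))\<^sup>2 + (c n * Y n \<omega>)\<^sup>2)"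
        by (rule past_integrable[of n]; intro past_intros)+
      have "expectation (\<lambda>\<omega>. (c n * (U n \<omega> - \<rho> * \<alpha>))\<^sup>2 + (c n * Y n \<omega>)\<^sup>2)
        \<le> expectation (\<lambda>\<omega>. (c n)\<^sup>2 * (2 * (U n \<omega>)\<^sup>2 + 2 * (\<rho> * \<alpha>)\<^sup>2) + (c n)\<^sup>2 * (Y n \<omega>)\<^sup>2)"
      proof (rule integral_mono[OF i(3)])
        fix \<omega>
        have "0 \<le> (U n \<omega> + \<rho> * \<alpha>)\<^sup>2" by simp
        then have "(U n \<omega> - \<rho> * \<alpha>)\<^sup>2 \<le> 2 * (U n \<omega>)\<^sup>2 + 2 * (\<rho> * \<alpha>)\<^sup>2"
          unfolding power2_sum power2_diff by linarith
        then show "(c n * (U n \<omega> - \<rho> * \<alpha>))\<^sup>2 + (c n * Y n \<omega>)\<^sup>2 \<le> (c n)\<^sup>2 * (2 * (U n \<omega>)\<^sup>2 + 2 * (\<rho> * \<alpha>)\<^sup>2) + (c n)\<^sup>2 * (Y n \<omega>)\<^sup>2"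
          unfolding power_mult_distrib[of "c n"] by (intro add_right_mono mult_left_mono) auto
      qed (use i in auto)
      also have "\<dots> = 2 * ((c n)\<^sup>2 * mean_sq (U n)) + (c n)\<^sup>2 * (2 * (\<rho> * \<alpha>)\<^sup>2) + (c n)\<^sup>2 * mean_sq (Y n)"
        using i by (simp add: prob_space algebra_simps)
      also have "\<dots> \<le> 2 * (K * C) + 1 * (2 * (\<rho> * \<alpha>)\<^sup>2) + C'"
      proof (intro add_mono mult_left_mono[of _ _ "2::real"] mult_right_mono)
        have "(c n)\<^sup>2 * mean_sq (U n) \<le> (c n)\<^sup>2 * (K * T n)"
          using K(2)[OF elim(4)] by (rule mult_left_mono) simp
        also have "\<dots> = K * ((c n)\<^sup>2 * T n)" by simp
        also have "\<dots> \<le> K * C" using elim(2) K(1) by (rule mult_left_mono)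
        finally show "(c n)\<^sup>2 * mean_sq (U n) \<le> K * C" .
      qed (use elim in auto)
      finally show ?case by simp
    qed
  qed
qed

end

section \<open>The normal limit in the subcritical regime\<close>

context subcritical
begin

lemma scaled_size: "(1 / sqrt (real n)) * w * sqrt (T n) \<le> w * sqrt (max 1 (1 + \<alpha>))" if "w \<ge> 0"
proof (cases "n = 0")
  case True then show ?thesis using that by simp
next
  case False
  then have n: "n \<ge> 1" by simp
  have "T n / real n \<le> max 1 (1 + \<alpha>)" using tot_le_max[OF alpha_pos n] n by (simp add: field_simps)
  then have "sqrt (T n / real n) \<le> sqrt (max 1 (1 + \<alpha>))" by (rule real_sqrt_le_mono)
  then have "w * sqrt (T n / real n) \<le> w * sqrt (max 1 (1 + \<alpha>))" using that by (rule mult_left_mono)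
  then show ?thesis by (simp add: real_sqrt_divide)
qed

lemma char_limit:
  "(\<lambda>n. \<integral>\<omega>. cis (1 / sqrt (real n) * lin n u 0 y 0 \<omega>) \<partial>M) \<longlonglongrightarrow> of_real (exp (- ((1 + \<alpha>) * (u\<^sup>2 * vU + y\<^sup>2 * vY)) / 2))"
proof -
  define c where "c n = 1 / sqrt (real n)" for n
  have lin: "lin n (c n * u) (q * 0) (c n * y) 0 \<omega> = c n * lin n u 0 y 0 \<omega>" for n \<omega>
    by (simp add: lin_def algebra_simps)
  have "(\<lambda>n. Hgap n (c n * u, 0, c n * y)) \<longlonglongrightarrow> 0"
  proof (rule Hgap_tendsto)
    fix n
    have "0 \<le> c n" by (simp add: c_def)
    then have "size (c n * u, 0, c n * y) = c n * (\<bar>u\<bar> + \<bar>y\<bar>)"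
      by (simp add: size_def abs_mult distrib_left)
    then have "size (c n * u, 0, c n * y) * sqrt (T n) = (1 / sqrt (real n)) * (\<bar>u\<bar> + \<bar>y\<bar>) * sqrt (T n)"
      by (simp only: c_def)
    also have "\<dots> \<le> (\<bar>u\<bar> + \<bar>y\<bar>) * sqrt (max 1 (1 + \<alpha>))" by (rule scaled_size) simp
    finally show "size (c n * u, 0, c n * y) * sqrt (T n) \<le> (\<bar>u\<bar> + \<bar>y\<bar>) * sqrt (max 1 (1 + \<alpha>))" .
  qed
  then have gap: "(\<lambda>n. (\<integral>\<omega>. cis (c n * lin n u 0 y 0 \<omega>) \<partial>M) - exp (- expectation (\<lambda>\<omega>. (c n * lin n u 0 y 0 \<omega>)\<^sup>2) / 2)) \<longlonglongrightarrow> 0"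
    unfolding Hgap_def gap_def prod.case lin by (rule tendsto_norm_zero_cancel)
  have "(\<lambda>n. (u\<^sup>2 * (m2 n 1 0 0 1 0 0 / T n) + y\<^sup>2 * (m2 n 0 0 1 0 0 1 / T n) + 2 * (u * y * (m2 n 1 0 0 0 0 1 / T n))) * (T n / real n))
     \<longlonglongrightarrow> (u\<^sup>2 * vU + y\<^sup>2 * vY + 2 * (u * y * 0)) * (1 + \<alpha>)"
    by (intro tendsto_intros moment_limits tot_over_n)
  moreover have "\<forall>\<^sub>F n in sequentially. (u\<^sup>2 * (m2 n 1 0 0 1 0 0 / T n) + y\<^sup>2 * (m2 n 0 0 1 0 0 1 / T n) + 2 * (u * y * (m2 n 1 0 0 0 0 1 / T n))) * (T n / real n)
     = expectation (\<lambda>\<omega>. (c n * lin n u 0 y 0 \<omega>)\<^sup>2)"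
  proof (rule eventually_sequentiallyI)
    fix n :: nat assume n: "n \<ge> 1"
    have T: "T n > 0" using T_ge_1[OF n] by simp
    have "lin n u 0 y 0 = H n u 0 y" by (simp add: H_def)
    then have "expectation (\<lambda>\<omega>. (c n * lin n u 0 y 0 \<omega>)\<^sup>2) = (1 / real n) * mean_sq (H n u 0 y)"
      by (simp add: power_mult_distrib c_def power_divide)
    then show "(u\<^sup>2 * (m2 n 1 0 0 1 0 0 / T n) + y\<^sup>2 * (m2 n 0 0 1 0 0 1 / T n) + 2 * (u * y * (m2 n 1 0 0 0 0 1 / T n))) * (T n / real n)
     = expectation (\<lambda>\<omega>. (c n * lin n u 0 y 0 \<omega>)\<^sup>2)"
    proof -
      have "(A * (r / t) + B * (s / t) + 2 * (C * (w / t))) * (t / k) = 1 / k * (A * r + B * s + 2 * (C * w))"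
        if "t > 0" "k > 0" for A B C r s t w k :: real using that by (simp add: field_simps)
      note scale = this[OF T, of "real n"]
      assume "expectation (\<lambda>\<omega>. (c n * lin n u 0 y 0 \<omega>)\<^sup>2) = (1 / real n) * mean_sq (H n u 0 y)"
      then show ?thesis unfolding H_square using n by (subst scale) simp_all
    qed
  qed
  ultimately have var: "(\<lambda>n. expectation (\<lambda>\<omega>. (c n * lin n u 0 y 0 \<omega>)\<^sup>2)) \<longlonglongrightarrow> (1 + \<alpha>) * (u\<^sup>2 * vU + y\<^sup>2 * vY)"
    by (subst (asm) tendsto_cong) (auto simp: mult.commute)
  have "(\<lambda>n. complex_of_real (exp (- expectation (\<lambda>\<omega>. (c n * lin n u 0 y 0 \<omega>)\<^sup>2) / 2)))
     \<longlonglongrightarrow> of_real (exp (- ((1 + \<alpha>) * (u\<^sup>2 * vU + y\<^sup>2 * vY)) / 2))"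
    by (intro tendsto_intros var) simp
  from tendsto_add[OF gap this] show ?thesis by (simp add: c_def)
qed

lemma v_nonneg: "0 \<le> vU" "0 \<le> vY"
proof -
  have "0 \<le> m2 n u x y u x y / T n" if "n \<ge> 1" for n u x y
    using T_ge_1[OF that] by (auto simp: m2_def intro!: divide_nonneg_pos integral_nonneg_AE)
  then have "\<forall>\<^sub>F n in sequentially. 0 \<le> m2 n u x y u x y / T n" for u x y
    by (auto intro: eventually_sequentiallyI[of 1])
  then show "0 \<le> vU" "0 \<le> vY"
    using tendsto_lowerbound[OF moment_limits(4)] tendsto_lowerbound[OF moment_limits(3)] by auto
qed

text \<open>The entries of the limiting covariance matrix are obtained by solving the linear equations
  for the limiting second moments.\<close>

lemma Sigma_I_eq:
  "Sigma_I \<alpha> p = vector [vector [(1 + \<alpha>) * vU / 4 + (1 + \<alpha>) * vY / 4, (1 + \<alpha>) * vU / 4 - (1 + \<alpha>) * vY / 4],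
     vector [(1 + \<alpha>) * vU / 4 - (1 + \<alpha>) * vY / 4, (1 + \<alpha>) * vU / 4 + (1 + \<alpha>) * vY / 4]]"
proof -
  have al: "2 + \<alpha> > 0" "3 + \<alpha> > 0" using alpha_pos by auto
  have cancel: "(\<alpha> + 1) / (4 * D) * s = (1 + \<alpha>) * v / 4 + (1 + \<alpha>) * w / 4" if "s = (v + w) * D" "D > 0" for s v w D :: real
    unfolding that(1) using that(2) by (simp add: field_simps)
  have cancel': "(\<alpha> + 1) / (4 * D) * s = (1 + \<alpha>) * v / 4 - (1 + \<alpha>) * w / 4" if "s = (v - w) * D" "D > 0" for s v w D :: real
    unfolding that(1) using that(2) by (simp add: field_simps)
  have U0: "vU = (1 + \<alpha>) / ((2 + \<alpha>)\<^sup>2 * (3 + \<alpha>))"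
  proof -
    have "1 - \<rho> = (1 + \<alpha>) / (2 + \<alpha>)" unfolding \<rho>_def using al by (simp add: field_simps)
    then have "\<rho> * (1 - \<rho>) = (1 + \<alpha>) / (2 + \<alpha>)\<^sup>2" by (simp add: \<rho>_def power2_eq_square)
    then have "\<rho> - \<rho>\<^sup>2 = (1 + \<alpha>) / (2 + \<alpha>)\<^sup>2" by (simp add: power2_eq_square right_diff_distrib)
    then show ?thesis unfolding vU_def cov0_def using al by (simp add: add.commute)
  qed
  have Y0: "vY * (3 + \<alpha>) = 2 * vXY + 1 + \<rho> * (1 - 2 * q)"
  proof -
    have "1 + \<alpha> + 2 = 3 + \<alpha>" by simp
    then have "vY * (3 + \<alpha>) = 2 * vXY + cov0 0 0 1 0 0 0 1 0" unfolding vY_def using al by simp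
    then show ?thesis by (simp add: cov0_def algebra_simps)
  qed
  show ?thesis
  proof (cases "q = 0")
    case True
    then have p: "p = 1 / 2" by simp
    have "vXY = 0" using True by (simp add: vXY_def vX_def cov0_def)
    then have Y1: "vY = 1 / (2 + \<alpha>)"
    proof -
      have "1 + \<rho> = 1 / (2 + \<alpha>) * (3 + \<alpha>)" using al unfolding \<rho>_def by (simp add: field_simps)
      then have "vY * (3 + \<alpha>) = 1 / (2 + \<alpha>) * (3 + \<alpha>)" using Y0 \<open>vXY = 0\<close> unfolding True by simp
      then show ?thesis using al(2) by (subst (asm) mult_right_cancel) auto
    qed
    let ?D = "(2 + \<alpha>)\<^sup>2 * (3 + \<alpha>)"
    have D: "?D > 0" using al by (intro mult_pos_pos) auto
    have "vU * ?D = 1 + \<alpha>" "vY * (2 + \<alpha>) = 1" unfolding U0 Y1 using al by simp_all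
    then have "7 + 6 * \<alpha> + \<alpha>\<^sup>2 = (vU + vY) * ?D" "- 5 - 4 * \<alpha> - \<alpha>\<^sup>2 = (vU - vY) * ?D" by algebra+
    note c = this(1)[THEN cancel, OF D] this(2)[THEN cancel', OF D]
    have "Sigma_I \<alpha> p = ((\<alpha> + 1) / (4 * ?D)) *\<^sub>R
          vector [vector [7 + 6 * \<alpha> + \<alpha>^2, - 5 - 4 * \<alpha> - \<alpha>^2],
                  vector [- 5 - 4 * \<alpha> - \<alpha>^2, 7 + 6 * \<alpha> + \<alpha>^2]]"
      unfolding Sigma_I_def by (simp add: p mult.assoc)
    then show ?thesis using c by (simp add: vec_eq_iff forall_2)
  next
    case False
    then have sub': "2 * (\<alpha> + q) < 1 + \<alpha>" and aq: "a = \<alpha> + q" using sub by (auto simp: a_def)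
    define d where "d = 3 - \<alpha> - 4 * p"
    have d: "d > 0" "3 - 2 * p > 0" using sub' p_range by (auto simp: d_def)
    have vX: "vX * d = q\<^sup>2 * (\<alpha>\<^sup>2 + 1 + 2 * \<alpha> * q)"
    proof -
      have eq: "1 + \<alpha> - 2 * a = d" by (simp add: aq d_def)
      have "vX * d = cov0 0 q 0 0 0 q 0 0" unfolding vX_def eq using d(1) by simp
      then show ?thesis by (simp add: cov0_def power2_eq_square algebra_simps)
    qed
    have vXY: "vXY * (3 - 2 * p) = vX + q + \<alpha> * q\<^sup>2 - \<rho> * q * (\<alpha> + q)"
    proof -
      have eq: "1 + \<alpha> - (a - 1) = 3 - 2 * p" by (simp add: aq)
      have "vXY * (3 - 2 * p) = vX + cov0 0 q 0 0 0 0 1 0" unfolding vXY_def eq using d(2) by simp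
      then show ?thesis by (simp add: cov0_def power2_eq_square algebra_simps)
    qed
    have r: "\<rho> * (2 + \<alpha>) = 1" by (rule rho)
    let ?s11 = "(8 * p^2 - 6 * p - 1) * \<alpha>^3 + (48 * p^2 - 46 * p + 1) * \<alpha>^2
                     + (112 * p^2 - 158 * p + 49) * \<alpha> + 88 * p^2 - 158 * p + 71"
    let ?s12 = "(1 + 6 * p - 8 * p^2) * \<alpha>^3 - (48 * p^2 - 50 * p + 7) * \<alpha>^2
                     - (96 * p^2 - 126 * p + 37) * \<alpha> - 72 * p^2 + 122 * p - 53"
    let ?D = "(2 + \<alpha>)\<^sup>2 * (3 + \<alpha>) * ((3 - 2 * p) * d)"
    have D: "?D > 0" using al d by (intro mult_pos_pos) auto
    have D': "(2 + \<alpha>)^2 * (3 + \<alpha>) * (2 * p - 3) * (4 * p + \<alpha> - 3) = ?D" by (simp add: d_def algebra_simps)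
    have Yeq: "2 * vY * ?D = ?s11 - ?s12"
      using Y0 vX vXY r unfolding d_def by algebra
    have Ueq: "2 * vU * ?D = ?s11 + ?s12"
    proof -
      have "vU * ((2 + \<alpha>)\<^sup>2 * (3 + \<alpha>)) = 1 + \<alpha>" unfolding U0 using al by simp
      then show ?thesis unfolding d_def by algebra
    qed
    have "?s11 = (vU + vY) * ?D" "?s12 = (vU - vY) * ?D" using Yeq Ueq by algebra+
    note c = this(1)[THEN cancel, OF D] this(2)[THEN cancel', OF D]
    have "4 * (2 + \<alpha>)^2 * (3 + \<alpha>) * (2 * p - 3) * (4 * p + \<alpha> - 3) = 4 * ?D" unfolding D'[symmetric] by simp
    then have "Sigma_I \<alpha> p = ((\<alpha> + 1) / (4 * ?D)) *\<^sub>R vector [vector [?s11, ?s12], vector [?s12, ?s11]]"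
      unfolding Sigma_I_def Let_def using False by simp
    then show ?thesis using c by (simp add: vec_eq_iff forall_2)
  qed
qed

theorem normal_limit:
  "\<exists>N. centred_normal (Sigma_I \<alpha> p) N \<and>
     weakly_converges (\<lambda>n. distr M borel (\<lambda>\<omega>. (1 / sqrt (real n)) *\<^sub>R (leaf_vec par col n \<omega> - real n *\<^sub>R leaf_mean \<alpha>))) N"
proof -
  let ?A = "(1 + \<alpha>) * vU / 4" and ?B = "(1 + \<alpha>) * vY / 4"
  have AB: "?A \<ge> 0" "?B \<ge> 0" using v_nonneg alpha_pos by auto
  obtain N where N: "centred_normal (Sigma_I \<alpha> p) N"
    using centred_normal_exists[OF Sigma_I_eq AB] by blast
  have "weakly_converges (\<lambda>n. distr M borel (\<lambda>\<omega>. (1 / sqrt (real n)) *\<^sub>R (leaf_vec par col n \<omega> - real n *\<^sub>R leaf_mean \<alpha>))) N"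
  proof (rule leaf_weak_limit)
    show "prob_space N" "sets N = sets borel" using N by (auto simp: centred_normal_def)
    show "(\<lambda>n. \<integral>\<omega>. cis (1 / sqrt (real n) * lin n u 0 y 0 \<omega>) \<partial>M) \<longlonglongrightarrow> (\<integral>x. cis (vector [u + y, u - y] \<bullet> x) \<partial>N)" for u y
    proof -
      have "(vector [u + y, u - y] :: real ^ 2) \<bullet> (Sigma_I \<alpha> p *v vector [u + y, u - y]) = (1 + \<alpha>) * (u\<^sup>2 * vU + y\<^sup>2 * vY)"
        unfolding quadratic_form_symmetric[OF Sigma_I_eq] by (simp add: power2_eq_square field_simps)
      then show ?thesis using char_limit[of u y] by (simp only: centred_normal_char[OF N])
    qed
    show "(\<lambda>n. 1 / sqrt (real n)) \<longlonglongrightarrow> 0" by real_asymp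
    show "\<forall>\<^sub>F n in sequentially. (1 / sqrt (real n))\<^sup>2 * T n \<le> max 1 (1 + \<alpha>)"
      by (rule eventually_sequentiallyI[of 1]) (use tot_le_max[OF alpha_pos] in \<open>simp add: power_divide field_simps\<close>)
    have "(\<lambda>n. m2 n 0 0 1 0 0 1 / T n * (T n / real n)) \<longlonglongrightarrow> vY * (1 + \<alpha>)"
      by (intro tendsto_intros moment_limits tot_over_n)
    then have "\<forall>\<^sub>F n in sequentially. m2 n 0 0 1 0 0 1 / T n * (T n / real n) < vY * (1 + \<alpha>) + 1"
      by (rule order_tendstoD) simp
    then show "\<forall>\<^sub>F n in sequentially. (1 / sqrt (real n))\<^sup>2 * mean_sq (Y n) \<le> vY * (1 + \<alpha>) + 1"
      using eventually_ge_at_top[of 1]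
    proof eventually_elim
      case (elim n)
      have T: "T n > 0" using T_ge_1[OF elim(2)] by simp
      have "m2 n 0 0 1 0 0 1 = mean_sq (Y n)"
        by (simp add: m2_def H_def lin_def power2_eq_square)
      then show ?case using elim T by (simp add: power_divide field_simps)
    qed
  qed
  with N show ?thesis by blast
qed

end

section \<open>The critical regime\<close>

text \<open>At criticality the drift of \<open>X\<close> and the growth of the square root of the total weight cancel to first
  order. What remains of the growth of the scale is due to the logarithm: a contraction at the rate
  \<open>1 / (tot b n * ln (tot b n))\<close>, whose sum still diverges, like \<open>ln (ln (tot b n))\<close>. The last four
  facts say that the errors of \<open>gap_X_step\<close> are negligible compared with this rate.\<close>

lemma critical_rates:
  assumes b: "b > 0"
  shows "\<forall>\<^sub>F n in sequentially. (1 + b / 2 / tot b n) * sqrt (tot b n * ln (tot b n))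
       \<le> (1 - b / 4 / (tot b (Suc n) * ln (tot b (Suc n)))) * sqrt (tot b (Suc n) * ln (tot b (Suc n)))" (is ?A)
    and "\<forall>\<^sub>F n in sequentially. (1 - b / 4 / (tot b (Suc n) * ln (tot b (Suc n)))) * ln (ln (tot b (Suc n))) \<le> ln (ln (tot b n))" (is ?B)
    and "filterlim (\<lambda>n. ln (ln (tot b n))) at_top sequentially" (is ?C)
    and "(\<lambda>n. 1 / (tot b n * ln (tot b n)) * sqrt (tot b (Suc n) * ln (tot b (Suc n)))) \<longlonglongrightarrow> 0" (is ?D)
    and "(\<lambda>n. sqrt (tot b n * ln (tot b n)) / (tot b n)\<^sup>2 * sqrt (tot b (Suc n) * ln (tot b (Suc n)))) \<longlonglongrightarrow> 0" (is ?E)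
    and "(\<lambda>n. 1 / (sqrt (tot b n * ln (tot b n)) * tot b n) * sqrt (tot b (Suc n) * ln (tot b (Suc n)))) \<longlonglongrightarrow> 0" (is ?F)
    and "(\<lambda>n. 1 / sqrt (tot b n * ln (tot b n)) ^ 3 * sqrt (tot b (Suc n) * ln (tot b (Suc n)))) \<longlonglongrightarrow> 0" (is ?G)
proof -
  have "(\<lambda>n. ln (tot b n) * b / (2 * tot b n)) \<longlonglongrightarrow> 0" using b unfolding tot_def by real_asymp
  then have "\<forall>\<^sub>F n in sequentially. ln (tot b n) * b / (2 * tot b n) < 1" by (rule order_tendstoD) simp
  moreover have "\<forall>\<^sub>F n in sequentially. tot b n > exp (1 + b)"
    using tot_at_top[OF b] by (simp add: filterlim_at_top_dense)
  ultimately show ?A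
  proof eventually_elim
    case (elim n)
    define t l t' l' where "t = tot b n" and "l = ln t" and "t' = tot b (Suc n)" and "l' = ln t'"
    have t': "t' = t + b" by (simp add: t'_def t_def tot_Suc)
    have "exp (1 + b) \<ge> 1 + (1 + b)" by (rule exp_ge_add_one_self)
    with elim(2) b have t: "t > 1" "t > b" "t' > 1" unfolding t' t_def[symmetric] by linarith+
    have "ln t > ln (exp (1 + b))" using elim(2) t unfolding t_def[symmetric] by (subst ln_less_cancel_iff) auto
    then have l: "l > 1" using b by (simp add: l_def)
    have ll: "l' - l \<ge> b / t'"
    proof -
      have "ln (t / t') \<le> t / t' - 1" using t by (intro ln_le_minus_one) auto
      moreover have "ln (t / t') = l - l'" using t by (simp add: ln_div l_def l'_def)
      moreover have "t / t' - 1 = - (b / t')" using t by (simp add: t' field_simps)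
      ultimately show ?thesis by simp
    qed
    then have l': "l' > 1" using l b t by (smt (verit) divide_pos_pos)
    \<comment> \<open>The logarithm gains \<open>b / t'\<close> in a step. Half of it, \<open>b / (2 t')\<close>, pays for the second-order
        term \<open>b\<^sup>2 / (4 t t')\<close>; the other half is \<open>2 h l'\<close>.\<close>
    define h where "h = b / 4 / (t' * l')"
    have "t' * l' > t' * 1" using l' t by (intro mult_strict_left_mono) auto
    then have "0 < t' * l'" "b / 4 \<le> 1 * (t' * l')" using t b t' by linarith+
    then have h: "h \<le> 1" unfolding h_def by (simp only: pos_divide_le_eq)
    have "l * (1 + b\<^sup>2 / (4 * t * t')) = l + (l * b / (2 * t)) * (b / (2 * t'))" using t by (simp add: field_simps power2_eq_square)
    also have "\<dots> \<le> l + 1 * (b / (2 * t'))"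
      using elim(1) b t unfolding t_def[symmetric] l_def[symmetric] by (intro add_left_mono mult_right_mono) auto
    also have "\<dots> \<le> l' - b / (2 * t')" using ll by simp
    also have "\<dots> = l' * (1 - 2 * h)" using l' t by (simp add: h_def field_simps)
    also have "\<dots> \<le> l' * (1 - h)\<^sup>2" using l' by (intro mult_left_mono) (auto simp: power2_eq_square algebra_simps)
    finally have key: "l * (1 + b\<^sup>2 / (4 * t * t')) \<le> l' * (1 - h)\<^sup>2" .
    have "((1 + b / 2 / t) * sqrt (t * l))\<^sup>2 = (1 + b / 2 / t)\<^sup>2 * (t * l)"
      using t l by (simp add: power_mult_distrib)
    also have "\<dots> = l * (t + b + b\<^sup>2 / (4 * t))" using t by (simp add: field_simps power2_eq_square)
    also have "t + b + b\<^sup>2 / (4 * t) = t' * (1 + b\<^sup>2 / (4 * t * t'))"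
      unfolding t'[symmetric] using t by (simp add: field_simps)
    also have "l * (t' * (1 + b\<^sup>2 / (4 * t * t'))) = t' * (l * (1 + b\<^sup>2 / (4 * t * t')))" by simp
    also have "\<dots> \<le> t' * (l' * (1 - h)\<^sup>2)" using key t by (intro mult_left_mono) auto
    also have "\<dots> = ((1 - h) * sqrt (t' * l'))\<^sup>2" using t l' by (simp add: power_mult_distrib)
    finally have "(1 + b / 2 / t) * sqrt (t * l) \<le> (1 - h) * sqrt (t' * l')"
      by (rule power2_le_imp_le) (use h t l' in auto)
    then show ?case unfolding h_def t_def l_def t'_def l'_def .
  qed
  show ?B using b unfolding tot_def by real_asymp
  show ?C using b unfolding tot_def by real_asymp
  show ?D using b unfolding tot_def by real_asymp
  show ?E using b unfolding tot_def by real_asymp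
  show ?F using b unfolding tot_def by real_asymp
  show ?G using b unfolding tot_def by real_asymp
qed

context pa_process
begin

text \<open>The conditional second moment of the increment of \<open>X\<close> is deterministic, so the fluctuation term of
  \<open>gap_Suc\<close> is absent. Here \<open>t\<close> is the scale on which \<open>X\<close> fluctuates.\<close>

lemma gap_X_step:
  assumes n: "n \<ge> 2" and K: "K \<ge> 0" "mean_sq (X n) \<le> K * t\<^sup>2"
    and t: "t > 0" and R: "\<bar>x\<bar> * t \<le> R"
  defines "A \<equiv> \<bar>\<alpha>\<bar> + 3" and "B \<equiv> \<bar>\<alpha> + q\<bar> * sqrt K"
  shows "gap (Suc n) 0 x 0 \<le> gap n 0 (x + x * (\<alpha> + q) / T n) 0
    + (A ^ 3 / 6 * R\<^sup>2 * (1 / t\<^sup>2) + B\<^sup>2 * R * (t / (T n)\<^sup>2) + A\<^sup>2 / 2 * B * R\<^sup>2 * (1 / (t * T n)) + A ^ 4 / 8 * R ^ 3 * (1 / t ^ 3)) * \<bar>x\<bar>"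
proof -
  have T: "T n > 0" using T_ge_1[of n] n by simp
  have AB: "A \<ge> 0" "B \<ge> 0" using K by (auto simp: A_def B_def)
  define w where "w = \<bar>x\<bar>"
  have w: "w \<ge> 0" "w * t \<le> R" using R by (auto simp: w_def)
  have D: "\<bar>inc n 0 x 0 0 \<omega>\<bar> \<le> A * w" for \<omega>
    using inc_bound[of n 0 x 0 0 \<omega>] by (simp add: A_def w_def)
  have m: "mean_sq (lin n (- 0) (x * (\<alpha> + q) + 0 * q) (- 0) 0) \<le> (B * w * t)\<^sup>2"
  proof -
    have "mean_sq (lin n (- 0) (x * (\<alpha> + q) + 0 * q) (- 0) 0) = (x * (\<alpha> + q))\<^sup>2 * mean_sq (X n)"
      by (simp add: lin_def power_mult_distrib)
    also have "\<dots> \<le> (x * (\<alpha> + q))\<^sup>2 * (K * t\<^sup>2)" using K(2) by (rule mult_left_mono) simp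
    also have "\<dots> = (B * w * t)\<^sup>2" using K(1) by (simp add: B_def w_def power_mult_distrib)
    finally show ?thesis .
  qed
  have z: "covU 0 x 0 0 0 x 0 0 = 0" "covX 0 x 0 0 0 x 0 0 = 0" "covY 0 x 0 0 0 x 0 0 = 0"
    by (simp_all add: covU_def covX_def covY_def)
  have k: "mean_sq (lin n (covU 0 x 0 0 0 x 0 0) (covX 0 x 0 0 0 x 0 0) (covY 0 x 0 0 0 x 0 0) 0) \<le> 0\<^sup>2"
    unfolding z by (simp add: lin_def)
  have "0 \<le> B * w * t" using AB w t by simp
  from gap_Suc[OF n D m this k]
  have "gap (Suc n) 0 x 0 \<le> gap n 0 (x + x * (\<alpha> + q) / T n) 0
     + ((A * w) ^ 3 / 6 + (B * w * t)\<^sup>2 / (T n)\<^sup>2 + (A * w)\<^sup>2 / 2 * (B * w * t / T n) + (A * w) ^ 4 / 8)"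
    by simp
  also have "\<dots> \<le> gap n 0 (x + x * (\<alpha> + q) / T n) 0
    + (A ^ 3 / 6 * R\<^sup>2 * (1 / t\<^sup>2) + B\<^sup>2 * R * (t / (T n)\<^sup>2) + A\<^sup>2 / 2 * B * R\<^sup>2 * (1 / (t * T n)) + A ^ 4 / 8 * R ^ 3 * (1 / t ^ 3)) * w"
  proof -
    have wt: "0 \<le> w * t" "(w * t)\<^sup>2 \<le> R\<^sup>2" "(w * t) ^ 3 \<le> R ^ 3" using w t by (auto intro!: power_mono)
    have "(A * w) ^ 3 / 6 = (A ^ 3 / 6 * (1 / t\<^sup>2) * w) * (w * t)\<^sup>2"
      using t by (simp add: power_mult_distrib power2_eq_square power3_eq_cube field_simps)
    also have "\<dots> \<le> (A ^ 3 / 6 * (1 / t\<^sup>2) * w) * R\<^sup>2" using AB w t wt by (intro mult_left_mono) auto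
    finally have 1: "(A * w) ^ 3 / 6 \<le> (A ^ 3 / 6 * (1 / t\<^sup>2) * w) * R\<^sup>2" .
    have "(B * w * t)\<^sup>2 / (T n)\<^sup>2 = (B\<^sup>2 * (t / (T n)\<^sup>2) * w) * (w * t)"
      by (simp add: power_mult_distrib power2_eq_square)
    also have "\<dots> \<le> (B\<^sup>2 * (t / (T n)\<^sup>2) * w) * R" using AB w t by (intro mult_left_mono) auto
    finally have 2: "(B * w * t)\<^sup>2 / (T n)\<^sup>2 \<le> (B\<^sup>2 * (t / (T n)\<^sup>2) * w) * R" .
    have "(A * w)\<^sup>2 / 2 * (B * w * t / T n) = (A\<^sup>2 / 2 * B * (1 / (t * T n)) * w) * (w * t)\<^sup>2"
      using t T by (simp add: power_mult_distrib power2_eq_square field_simps)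
    also have "\<dots> \<le> (A\<^sup>2 / 2 * B * (1 / (t * T n)) * w) * R\<^sup>2" using AB w t wt T by (intro mult_left_mono) auto
    finally have 3: "(A * w)\<^sup>2 / 2 * (B * w * t / T n) \<le> (A\<^sup>2 / 2 * B * (1 / (t * T n)) * w) * R\<^sup>2" .
    have "(A * w) ^ 4 / 8 = (A ^ 4 / 8 * (1 / t ^ 3) * w) * (w * t) ^ 3"
      using t by (simp add: power_mult_distrib power3_eq_cube power4_eq_xxxx field_simps)
    also have "\<dots> \<le> (A ^ 4 / 8 * (1 / t ^ 3) * w) * R ^ 3" using AB w t wt by (intro mult_left_mono) auto
    finally have 4: "(A * w) ^ 4 / 8 \<le> (A ^ 4 / 8 * (1 / t ^ 3) * w) * R ^ 3" .
    show ?thesis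
      unfolding distrib_right
      using 1 2 3 4 by (intro add_left_mono add_mono) (simp_all only: mult_ac)
  qed
  finally show ?thesis by (simp add: w_def)
qed

text \<open>The contraction principle on the scale of the square root of \<open>T ln T\<close>, for \<open>X\<close> alone: the
  other statistics are negligible on this scale or follow \<open>X\<close>.\<close>

theorem gap_X_tendsto:
  assumes crit: "2 * (\<alpha> + q) = 1 + \<alpha>"
    and R: "\<And>n. n \<ge> 1 \<Longrightarrow> \<bar>x n\<bar> * sqrt (T n * ln (T n)) \<le> R"
  shows "(\<lambda>n. gap n 0 (x n) 0) \<longlonglongrightarrow> 0"
proof -
  define b where "b = 1 + \<alpha>"
  have b: "b > 0" using alpha_pos by (simp add: b_def)
  have aq: "\<alpha> + q = b / 2" using crit by (simp add: b_def)
  define t where "t n = sqrt (T n * ln (T n))" for n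
  have rec: "mean_sq (X (Suc n)) = (1 + b / T n) * mean_sq (X n) + (\<alpha>\<^sup>2 + 1 + 2 * \<alpha> * q)" if "n \<ge> 1" for n
    using moment_X_Suc[OF that] crit unfolding b_def by simp
  have "(\<lambda>n. mean_sq (X n) / (T n * ln (T n))) \<longlonglongrightarrow> (\<alpha>\<^sup>2 + 1 + 2 * \<alpha> * q) / b"
    using critical_recursion_limit[OF b, where w = "\<lambda>n. mean_sq (X n)", folded b_def] rec unfolding b_def by blast
  then have "Bseq (\<lambda>n. mean_sq (X n) / (T n * ln (T n)))"
    by (rule convergent_imp_Bseq[OF convergentI])
  then obtain K where K: "K > 0" "\<And>n. norm (mean_sq (X n) / (T n * ln (T n))) \<le> K"
    by (elim BseqE) blast
  define k where "k n = b / 4 / (T (Suc n) * ln (T (Suc n)))" for n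
  have "\<forall>\<^sub>F n in sequentially. T n > exp (exp 1 + b)"
    using tot_at_top[OF alpha_pos] by (simp add: filterlim_at_top_dense)
  with critical_rates(1,2)[OF b] have "\<forall>\<^sub>F n in sequentially. (1 + b / 2 / T n) * t n \<le> (1 - k n) * t (Suc n) \<and>
     (1 - k n) * ln (ln (T (Suc n))) \<le> ln (ln (T n)) \<and> T n > exp (exp 1 + b)"
    unfolding b_def t_def k_def by eventually_elim simp
  then obtain n1 where n1: "\<And>n. n \<ge> n1 \<Longrightarrow> (1 + b / 2 / T n) * t n \<le> (1 - k n) * t (Suc n) \<and>
     (1 - k n) * ln (ln (T (Suc n))) \<le> ln (ln (T n)) \<and> T n > exp (exp 1 + b)"
    by (auto simp: eventually_sequentially)
  \<comment> \<open>The lower bound \<open>exp (exp 1 + b)\<close> on \<open>T\<close> makes the iterated logarithm positive and the rate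
      \<open>k\<close> at most \<open>1\<close>.\<close>
  define n0 where "n0 = max 2 n1"
  have big: "T n > 1" "T n > b" "ln (T n) > 1" "ln (ln (T n)) > 0" "t n > 0" if "n \<ge> n0" for n
  proof -
    have T: "T n > exp (exp 1 + b)" using n1[of n] that by (simp add: n0_def)
    have "exp (exp 1 + b) \<ge> 1 + (exp 1 + b)" "exp (1 :: real) \<ge> 1 + 1" by (rule exp_ge_add_one_self)+
    with T b show T1: "T n > 1" "T n > b" by linarith+
    have "ln (T n) > ln (exp (exp 1 + b))" using T T1 by (subst ln_less_cancel_iff) auto
    then have l: "ln (T n) > exp 1" using b by simp
    then show "ln (T n) > 1" using \<open>exp (1 :: real) \<ge> 1 + 1\<close> by linarith
    then have "ln (ln (T n)) > ln (exp 1)" using l by (subst ln_less_cancel_iff) auto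
    then show "ln (ln (T n)) > 0" by simp
    show "t n > 0" using T1 by (simp add: t_def)
  qed
  have tmono: "t n \<le> t (Suc n)" if "n \<ge> n0" for n
    unfolding t_def using big[OF that] b
    by (intro real_sqrt_le_mono mult_mono) (auto simp: tot_Suc b_def)
  have EX: "mean_sq (X n) \<le> K * (t n)\<^sup>2" if "n \<ge> n0" for n
  proof -
    have p: "T n * ln (T n) > 0" using big[OF that] by simp
    have "mean_sq (X n) / (T n * ln (T n)) \<le> K" using K(2)[of n] unfolding real_norm_def by (rule order_trans[OF abs_ge_self])
    then have "mean_sq (X n) \<le> K * (T n * ln (T n))" using p by (simp only: pos_divide_le_eq)
    then show ?thesis using p by (simp add: t_def)
  qed
  let ?A = "\<bar>\<alpha>\<bar> + 3" and ?B = "\<bar>\<alpha> + q\<bar> * sqrt K"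
  define F where "F n = ?A ^ 3 / 6 * R\<^sup>2 * (1 / (t n)\<^sup>2) + ?B\<^sup>2 * R * (t n / (T n)\<^sup>2) + ?A\<^sup>2 / 2 * ?B * R\<^sup>2 * (1 / (t n * T n)) + ?A ^ 4 / 8 * R ^ 3 * (1 / t n ^ 3)" for n
  have Flim: "(\<lambda>n. F n * t (Suc n) * (4 / b)) \<longlonglongrightarrow> 0"
  proof -
    note cr = critical_rates(4-7)[OF alpha_pos]
    have "\<forall>\<^sub>F n in sequentially. 1 / (T n * ln (T n)) * t (Suc n) = 1 / (t n)\<^sup>2 * t (Suc n)"
      using big by (intro eventually_sequentiallyI[of n0]) (auto simp: t_def dest!: big)
    then have 1: "(\<lambda>n. 1 / (t n)\<^sup>2 * t (Suc n)) \<longlonglongrightarrow> 0"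
      using cr(1) unfolding t_def[symmetric] by (rule Lim_transform_eventually[rotated])
    have "(\<lambda>n. ?A ^ 3 / 6 * R\<^sup>2 * (1 / (t n)\<^sup>2 * t (Suc n)) + ?B\<^sup>2 * R * (t n / (T n)\<^sup>2 * t (Suc n)) + ?A\<^sup>2 / 2 * ?B * R\<^sup>2 * (1 / (t n * T n) * t (Suc n)) + ?A ^ 4 / 8 * R ^ 3 * (1 / t n ^ 3 * t (Suc n)))
      \<longlonglongrightarrow> ?A ^ 3 / 6 * R\<^sup>2 * 0 + ?B\<^sup>2 * R * 0 + ?A\<^sup>2 / 2 * ?B * R\<^sup>2 * 0 + ?A ^ 4 / 8 * R ^ 3 * 0"
      by (intro tendsto_add tendsto_mult_left 1 cr(2-4)[folded t_def])
    from tendsto_mult_right[OF this, of "4 / b"] show ?thesis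
      by (simp add: F_def distrib_right mult.assoc)
  qed
  obtain d where d: "d \<longlonglongrightarrow> 0" "\<And>n x. n \<ge> n0 \<Longrightarrow> \<bar>x\<bar> * t n \<le> R \<Longrightarrow> gap n 0 x 0 \<le> d n * (\<bar>x\<bar> * t n)"
  proof (rule contraction_family[where D = "\<lambda>n x. gap n 0 x 0" and r = "\<lambda>n x. \<bar>x\<bar> * t n" and L = "\<lambda>n x. x + x * (\<alpha> + q) / T n"
        and b = k and e = "\<lambda>n. F n * t (Suc n) * (4 / b)" and g = "\<lambda>n. ln (ln (T n))" and R = R and ?n0.0 = n0
        and C = "sqrt K + K * R / 2"])
    fix n and x :: real assume n: "n \<ge> n0" and r: "\<bar>x\<bar> * t (Suc n) \<le> R"
    have S: "n0 \<le> Suc n" using n by simp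
    have "\<bar>x\<bar> * t n \<le> \<bar>x\<bar> * t (Suc n)" using tmono[OF n] by (rule mult_left_mono) simp
    with r have r': "\<bar>x\<bar> * t n \<le> R" by simp
    have "gap (Suc n) 0 x 0 \<le> gap n 0 (x + x * (\<alpha> + q) / T n) 0 + F n * \<bar>x\<bar>"
      unfolding F_def by (rule gap_X_step) (use n K EX[OF n] big[OF n] r' in \<open>auto simp: n0_def\<close>)
    also have "F n * \<bar>x\<bar> = k n * (F n * t (Suc n) * (4 / b)) * (\<bar>x\<bar> * t (Suc n))"
    proof -
      have "t (Suc n) * t (Suc n) = T (Suc n) * ln (T (Suc n))" using big[OF S] by (simp add: t_def)
      then have "k n * (t (Suc n) * t (Suc n)) * (4 / b) = 1" using big[OF S] b by (simp add: k_def)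
      moreover have "k n * (F n * t (Suc n) * (4 / b)) * (\<bar>x\<bar> * t (Suc n)) = (k n * (t (Suc n) * t (Suc n)) * (4 / b)) * (F n * \<bar>x\<bar>)"
        by (simp only: mult_ac)
      ultimately show ?thesis by (simp only: mult_1_left)
    qed
    finally show "gap (Suc n) 0 x 0 \<le> gap n 0 (x + x * (\<alpha> + q) / T n) 0 + k n * (F n * t (Suc n) * (4 / b)) * (\<bar>x\<bar> * t (Suc n))" .
  next
    fix n and x :: real assume n: "n \<ge> n0"
    have T: "T n > 0" using big[OF n] by simp
    have "x + x * (\<alpha> + q) / T n = (1 + b / 2 / T n) * x" unfolding aq by (simp add: algebra_simps)
    moreover have "0 < 1 + b / 2 / T n" using T b by (simp add: add_pos_pos)
    ultimately have "\<bar>x + x * (\<alpha> + q) / T n\<bar> * t n = \<bar>x\<bar> * ((1 + b / 2 / T n) * t n)"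
      by (simp add: abs_mult)
    also have "\<dots> \<le> \<bar>x\<bar> * ((1 - k n) * t (Suc n))" using n1[of n] n by (intro mult_left_mono) (auto simp: n0_def)
    finally show "\<bar>x + x * (\<alpha> + q) / T n\<bar> * t n \<le> (1 - k n) * (\<bar>x\<bar> * t (Suc n))" by (simp add: mult_ac)
  next
    fix n assume n: "n \<ge> n0"
    then have S: "n0 \<le> Suc n" by simp
    have "T (Suc n) * ln (T (Suc n)) > b * 1" using big[OF S] b by (intro mult_strict_mono) auto
    then show "0 \<le> k n" "k n \<le> 1" unfolding k_def using b by auto
    show "0 < ln (ln (T n))" using big[OF n] by simp
    show "(1 - k n) * ln (ln (T (Suc n))) \<le> ln (ln (T n))" using n1[of n] n by (simp add: n0_def)
    show "0 \<le> \<bar>x\<bar> * t n" for x using big[OF n] by simp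
  next
    show "filterlim (\<lambda>n. ln (ln (T n))) at_top sequentially" by (rule critical_rates(3)[OF alpha_pos])
  next
    show "(\<lambda>n. F n * t (Suc n) * (4 / b)) \<longlonglongrightarrow> 0" by (rule Flim)
  next
    fix x :: real assume r: "\<bar>x\<bar> * t n0 \<le> R"
    define v where "v = \<bar>x\<bar> * t n0"
    have v: "0 \<le> v" "v \<le> R" using r big[of n0] by (auto simp: v_def)
    have "mean_sq (lin n0 0 x 0 0) = x\<^sup>2 * mean_sq (X n0)"
      by (simp add: lin_def power_mult_distrib)
    also have "\<dots> \<le> x\<^sup>2 * (K * (t n0)\<^sup>2)" using EX[of n0] by (intro mult_left_mono) auto
    also have "\<dots> = (sqrt K * v)\<^sup>2" using K(1) by (simp add: v_def power_mult_distrib)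
    finally have "gap n0 0 x 0 \<le> sqrt K * v + (sqrt K * v)\<^sup>2 / 2"
      by (rule gap_initial) (use v K in auto)
    also have "(sqrt K * v)\<^sup>2 / 2 = K / 2 * v * v" using K(1) by (simp add: power_mult_distrib power2_eq_square)
    also have "\<dots> \<le> K / 2 * R * v" using v K by (intro mult_right_mono mult_left_mono) auto
    finally show "gap n0 0 x 0 \<le> (sqrt K + K * R / 2) * (\<bar>x\<bar> * t n0)" by (simp add: v_def distrib_right)
  qed blast
  show ?thesis
  proof (rule tendsto_sandwich[OF _ _ tendsto_const])
    show "eventually (\<lambda>n. 0 \<le> gap n 0 (x n) 0) sequentially" by (simp add: gap_def)
    show "(\<lambda>n. \<bar>d n\<bar> * R) \<longlonglongrightarrow> 0" using tendsto_mult_right[OF tendsto_rabs_zero[OF d(1)], of R] by simp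
    show "eventually (\<lambda>n. gap n 0 (x n) 0 \<le> \<bar>d n\<bar> * R) sequentially"
    proof (rule eventually_sequentiallyI)
      fix n assume n: "n \<ge> n0"
      have Rn: "\<bar>x n\<bar> * t n \<le> R" using R[of n] n by (simp add: t_def n0_def)
      have "gap n 0 (x n) 0 \<le> d n * (\<bar>x n\<bar> * t n)" using d(2)[OF n Rn] .
      also have "\<dots> \<le> \<bar>d n\<bar> * (\<bar>x n\<bar> * t n)" using big[OF n] by (intro mult_right_mono) auto
      also have "\<dots> \<le> \<bar>d n\<bar> * R" using Rn by (intro mult_left_mono) auto
      finally show "gap n 0 (x n) 0 \<le> \<bar>d n\<bar> * R" .
    qed
  qed
qed

section \<open>Leaf statistics on larger scales\<close>

text \<open>The drift of \<open>Y - q / (\<alpha> + 2 p) * X\<close> is \<open>- 1 / T\<close> times this statistic, and the same is true of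
  \<open>U\<close>. Both are therefore of the order of the square root of \<open>n\<close>, and on larger scales, where
  \<open>(c n)\<^sup>2 * T n\<close> tends to \<open>0\<close>, the leaf statistics are governed by \<open>X\<close>.\<close>

lemma negligible_remainder:
  assumes ap: "\<alpha> + 2 * p \<noteq> 0" and c: "(\<lambda>n. (c n)\<^sup>2 * T n) \<longlonglongrightarrow> 0"
  shows "(\<lambda>n. expectation (\<lambda>\<omega>. (c n * lin n u (- (q / (\<alpha> + 2 * p)) * y) y 0 \<omega>)\<^sup>2)) \<longlonglongrightarrow> 0"
proof -
  let ?c = "q / (\<alpha> + 2 * p)"
  have "- ?c * (\<alpha> + q) + (1 + 0) * q = - 1 * - ?c"
    using ap by (simp add: field_simps)
  then obtain K where K: "K \<ge> 0" "\<And>n. n \<ge> 1 \<Longrightarrow> mean_sq (lin n 0 (- ?c) 1 0) \<le> K * T n"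
    using eigen_moment_bound[of "- 1" 0 "- ?c" 1 0] alpha_pos by auto
  obtain K' where K': "K' \<ge> 0" "\<And>n. n \<ge> 1 \<Longrightarrow> mean_sq (U n) \<le> K' * T n"
    using moment_U_bound by metis
  have bound: "expectation (\<lambda>\<omega>. (c n * lin n u (- ?c * y) y 0 \<omega>)\<^sup>2) \<le> (2 * u\<^sup>2 * K' + 2 * y\<^sup>2 * K) * ((c n)\<^sup>2 * T n)" if n: "n \<ge> 1" for n
  proof -
    have i: "integrable M (\<lambda>\<omega>. (c n * lin n u (- ?c * y) y 0 \<omega>)\<^sup>2)" "integrable M (\<lambda>\<omega>. (U n \<omega>)\<^sup>2)" "integrable M (\<lambda>\<omega>. (lin n 0 (- ?c) 1 0 \<omega>)\<^sup>2)"
      by (rule past_integrable[of n]; intro past_intros)+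
    have "expectation (\<lambda>\<omega>. (c n * lin n u (- ?c * y) y 0 \<omega>)\<^sup>2) \<le> expectation (\<lambda>\<omega>. (c n)\<^sup>2 * (2 * u\<^sup>2 * (U n \<omega>)\<^sup>2 + 2 * y\<^sup>2 * (lin n 0 (- ?c) 1 0 \<omega>)\<^sup>2))"
    proof (rule integral_mono[OF i(1)])
      fix \<omega>
      have e: "lin n u (- ?c * y) y 0 \<omega> = u * U n \<omega> + y * lin n 0 (- ?c) 1 0 \<omega>" by (simp add: lin_def algebra_simps)
      note power2_sum_le[of "u * U n \<omega>" "y * lin n 0 (- ?c) 1 0 \<omega>"]
      then show "(c n * lin n u (- ?c * y) y 0 \<omega>)\<^sup>2 \<le> (c n)\<^sup>2 * (2 * u\<^sup>2 * (U n \<omega>)\<^sup>2 + 2 * y\<^sup>2 * (lin n 0 (- ?c) 1 0 \<omega>)\<^sup>2)"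
        unfolding e power_mult_distrib[of "c n"] by (intro mult_left_mono) (auto simp: power_mult_distrib)
    qed (use i in auto)
    also have "\<dots> = (c n)\<^sup>2 * (2 * u\<^sup>2 * mean_sq (U n) + 2 * y\<^sup>2 * mean_sq (lin n 0 (- ?c) 1 0))"
      using i by simp
    also have "\<dots> \<le> (c n)\<^sup>2 * (2 * u\<^sup>2 * (K' * T n) + 2 * y\<^sup>2 * (K * T n))"
      using K(2)[OF n] K'(2)[OF n] by (intro mult_left_mono add_mono) auto
    also have "\<dots> = (2 * u\<^sup>2 * K' + 2 * y\<^sup>2 * K) * ((c n)\<^sup>2 * T n)" by (simp add: algebra_simps)
    finally show ?thesis .
  qed
  show ?thesis
  proof (rule tendsto_sandwich[OF _ _ tendsto_const])
    show "\<forall>\<^sub>F n in sequentially. 0 \<le> expectation (\<lambda>\<omega>. (c n * lin n u (- ?c * y) y 0 \<omega>)\<^sup>2)" by simp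
    show "\<forall>\<^sub>F n in sequentially. expectation (\<lambda>\<omega>. (c n * lin n u (- ?c * y) y 0 \<omega>)\<^sup>2) \<le> (2 * u\<^sup>2 * K' + 2 * y\<^sup>2 * K) * ((c n)\<^sup>2 * T n)"
      using bound by (rule eventually_sequentiallyI)
    show "(\<lambda>n. (2 * u\<^sup>2 * K' + 2 * y\<^sup>2 * K) * ((c n)\<^sup>2 * T n)) \<longlonglongrightarrow> 0"
      using tendsto_mult_left[OF c] by simp
  qed
qed

lemma moment_Y_from_X:
  assumes ap: "\<alpha> + 2 * p \<noteq> 0" and c: "(\<lambda>n. (c n)\<^sup>2 * T n) \<longlonglongrightarrow> 0"
    and X: "(\<lambda>n. (c n)\<^sup>2 * mean_sq (X n)) \<longlonglongrightarrow> v"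
  shows "\<exists>C. \<forall>\<^sub>F n in sequentially. (c n)\<^sup>2 * mean_sq (Y n) \<le> C"
proof -
  let ?c = "q / (\<alpha> + 2 * p)"
  let ?W = "\<lambda>n. expectation (\<lambda>\<omega>. (c n * lin n 0 (- ?c * 1) 1 0 \<omega>)\<^sup>2)"
  have "(\<lambda>n. 2 * ?W n + 2 * ?c\<^sup>2 * ((c n)\<^sup>2 * mean_sq (X n))) \<longlonglongrightarrow> 2 * 0 + 2 * ?c\<^sup>2 * v"
    by (intro tendsto_add tendsto_mult_left negligible_remainder ap c X)
  then have "\<forall>\<^sub>F n in sequentially. 2 * ?W n + 2 * ?c\<^sup>2 * ((c n)\<^sup>2 * mean_sq (X n)) < 2 * ?c\<^sup>2 * v + 1"
    by (rule order_tendstoD) simp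
  moreover have "(c n)\<^sup>2 * mean_sq (Y n) \<le> 2 * ?W n + 2 * ?c\<^sup>2 * ((c n)\<^sup>2 * mean_sq (X n))" for n
  proof -
    have i: "integrable M (\<lambda>\<omega>. (c n * lin n 0 (- ?c * 1) 1 0 \<omega>)\<^sup>2)" "integrable M (\<lambda>\<omega>. (X n \<omega>)\<^sup>2)" "integrable M (\<lambda>\<omega>. (c n * Y n \<omega>)\<^sup>2)"
      by (rule past_integrable[of n]; intro past_intros)+
    have "(c n)\<^sup>2 * mean_sq (Y n) = expectation (\<lambda>\<omega>. (c n * Y n \<omega>)\<^sup>2)" by (simp add: power_mult_distrib)
    also have "\<dots> \<le> expectation (\<lambda>\<omega>. 2 * (c n * lin n 0 (- ?c * 1) 1 0 \<omega>)\<^sup>2 + 2 * ?c\<^sup>2 * ((c n)\<^sup>2 * (X n \<omega>)\<^sup>2))"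
    proof (rule integral_mono[OF i(3)])
      fix \<omega>
      define r s where "r = c n * lin n 0 (- ?c * 1) 1 0 \<omega>" and "s = ?c * (c n * X n \<omega>)"
      have "c n * Y n \<omega> = r + s" by (simp add: r_def s_def lin_def algebra_simps)
      moreover note power2_sum_le[of r s]
      moreover have "2 * s\<^sup>2 = 2 * ?c\<^sup>2 * ((c n)\<^sup>2 * (X n \<omega>)\<^sup>2)" unfolding s_def power_mult_distrib by simp
      ultimately show "(c n * Y n \<omega>)\<^sup>2 \<le> 2 * (c n * lin n 0 (- ?c * 1) 1 0 \<omega>)\<^sup>2 + 2 * ?c\<^sup>2 * ((c n)\<^sup>2 * (X n \<omega>)\<^sup>2)"
        by (simp only: r_def)
    qed (use i in \<open>auto intro!: Bochner_Integration.integrable_add integrable_mult_right\<close>)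
    also have "\<dots> = 2 * ?W n + 2 * ?c\<^sup>2 * ((c n)\<^sup>2 * mean_sq (X n))"
      by (subst Bochner_Integration.integral_add) (use i in \<open>auto intro!: integrable_mult_right simp del: mult_minus_left\<close>)
    finally show ?thesis .
  qed
  ultimately show ?thesis by (intro exI[of _ "2 * ?c\<^sup>2 * v + 1"]) (auto elim!: eventually_mono intro: order_trans less_imp_le)
qed

lemma Sigma_II_eq:
  "Sigma_II \<alpha> = vector [vector [0 + (\<alpha> - 1)\<^sup>2 * (\<alpha> + 1) / (4 * (3 + \<alpha>)\<^sup>2), 0 - (\<alpha> - 1)\<^sup>2 * (\<alpha> + 1) / (4 * (3 + \<alpha>)\<^sup>2)],
     vector [0 - (\<alpha> - 1)\<^sup>2 * (\<alpha> + 1) / (4 * (3 + \<alpha>)\<^sup>2), 0 + (\<alpha> - 1)\<^sup>2 * (\<alpha> + 1) / (4 * (3 + \<alpha>)\<^sup>2)]]"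
  unfolding Sigma_II_def by (simp add: vec_eq_iff forall_2)

theorem critical_normal_limit:
  assumes p: "p = (3 - \<alpha>) / 4"
  shows "\<exists>N. centred_normal (Sigma_II \<alpha>) N \<and>
     weakly_converges (\<lambda>n. distr M borel (\<lambda>\<omega>. (1 / sqrt (real n * ln (real n))) *\<^sub>R (leaf_vec par col n \<omega> - real n *\<^sub>R leaf_mean \<alpha>))) N"
proof -
  define c where "c n = 1 / sqrt (real n * ln (real n))" for n
  let ?B = "(\<alpha> - 1)\<^sup>2 * (\<alpha> + 1) / (4 * (3 + \<alpha>)\<^sup>2)"
  have B: "?B \<ge> 0" using alpha_pos by (intro divide_nonneg_nonneg mult_nonneg_nonneg) auto
  obtain N where N: "centred_normal (Sigma_II \<alpha>) N"
    using centred_normal_exists[OF Sigma_II_eq _ B] by auto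
  have q2: "2 * (\<alpha> + q) = 1 + \<alpha>" and ap: "\<alpha> + 2 * p = (3 + \<alpha>) / 2" and q: "q = (1 - \<alpha>) / 2" using p by (simp_all add: field_simps)
  have ap0: "\<alpha> + 2 * p \<noteq> 0" using alpha_pos unfolding ap by simp
  define k where "k = q / (\<alpha> + 2 * p)"
  have k: "k = (1 - \<alpha>) / (3 + \<alpha>)"
  proof -
    have "3 + \<alpha> \<noteq> 0" using alpha_pos by simp
    then show ?thesis unfolding k_def ap q by (simp add: divide_simps) (simp add: algebra_simps)
  qed
  have c2: "(c n)\<^sup>2 = 1 / (real n * ln (real n))" if "n \<ge> 1" for n
    using that by (simp add: c_def power_divide)
  have TL: "(\<lambda>n. T n * ln (T n) / (real n * ln (real n))) \<longlonglongrightarrow> 1 + \<alpha>"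
    unfolding tot_def using alpha_pos by real_asymp
  have EX: "(\<lambda>n. mean_sq (X n) / (T n * ln (T n))) \<longlonglongrightarrow> 1"
  proof -
    have s: "\<alpha>\<^sup>2 + 1 + 2 * \<alpha> * q = 1 + \<alpha>" unfolding q by (simp add: power2_eq_square field_simps)
    have "mean_sq (X (Suc n)) = (1 + (1 + \<alpha>) / T n) * mean_sq (X n) + (1 + \<alpha>)" if "n \<ge> 1" for n
      using moment_X_Suc[OF that] unfolding q2 s .
    from critical_recursion_limit[OF alpha_pos this] show ?thesis using alpha_pos by simp
  qed
  have cX: "(\<lambda>n. (c n)\<^sup>2 * mean_sq (X n)) \<longlonglongrightarrow> 1 + \<alpha>"
  proof (rule Lim_transform_eventually)
    show "(\<lambda>n. mean_sq (X n) / (T n * ln (T n)) * (T n * ln (T n) / (real n * ln (real n)))) \<longlonglongrightarrow> 1 + \<alpha>"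
      using tendsto_mult[OF EX TL] by simp
    have "\<forall>\<^sub>F n in sequentially. ln (T n) > 0"
      using ln_tot_at_top[OF alpha_pos] by (simp add: filterlim_at_top_dense)
    then show "\<forall>\<^sub>F n in sequentially. mean_sq (X n) / (T n * ln (T n)) * (T n * ln (T n) / (real n * ln (real n)))
       = (c n)\<^sup>2 * mean_sq (X n)"
      using eventually_ge_at_top[of 1]
    proof eventually_elim
      case (elim n)
      then show ?case using T_ge_1[OF elim(2)] by (simp add: c2)
    qed
  qed
  have cT: "(\<lambda>n. (c n)\<^sup>2 * T n) \<longlonglongrightarrow> 0"
  proof (rule Lim_transform_eventually)
    show "(\<lambda>n. T n / (real n * ln (real n))) \<longlonglongrightarrow> 0" unfolding tot_def using alpha_pos by real_asymp
    show "\<forall>\<^sub>F n in sequentially. T n / (real n * ln (real n)) = (c n)\<^sup>2 * T n"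
      by (rule eventually_sequentiallyI[of 1]) (simp add: c2)
  qed
  have bounded: "Bseq (\<lambda>n. T n * ln (T n) / (real n * ln (real n)))" by (rule convergent_imp_Bseq[OF convergentI[OF TL]])
  then obtain K where K: "K > 0" "\<And>n. norm (T n * ln (T n) / (real n * ln (real n))) \<le> K" by (elim BseqE) blast
  have main: "(\<lambda>n. \<integral>\<omega>. cis (c n * lin n 0 (k * y) 0 0 \<omega>) \<partial>M) \<longlonglongrightarrow> of_real (exp (- ((k * y)\<^sup>2 * (1 + \<alpha>)) / 2))" for y
  proof -
    have lin: "lin n 0 (c n * (k * y)) 0 0 \<omega> = c n * lin n 0 (k * y) 0 0 \<omega>" for n \<omega> by (simp add: lin_def)
    have "(\<lambda>n. gap n 0 (c n * (k * y)) 0) \<longlonglongrightarrow> 0"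
    proof (rule gap_X_tendsto[OF q2])
      fix n :: nat assume n: "n \<ge> 1"
      have "c n * sqrt (T n * ln (T n)) = sqrt (T n * ln (T n) / (real n * ln (real n)))"
        by (simp add: c_def real_sqrt_divide)
      also have "\<dots> \<le> sqrt K" using order_trans[OF abs_ge_self K(2)[of n, unfolded real_norm_def]] by (rule real_sqrt_le_mono)
      finally have "\<bar>k * y\<bar> * (c n * sqrt (T n * ln (T n))) \<le> \<bar>k * y\<bar> * sqrt K" by (rule mult_left_mono) simp
      moreover have "0 \<le> c n" using n by (simp add: c_def)
      ultimately show "\<bar>c n * (k * y)\<bar> * sqrt (T n * ln (T n)) \<le> \<bar>k * y\<bar> * sqrt K"
        by (simp add: abs_mult mult_ac)
    qed
    then have gap: "(\<lambda>n. (\<integral>\<omega>. cis (c n * lin n 0 (k * y) 0 0 \<omega>) \<partial>M) - exp (- expectation (\<lambda>\<omega>. (c n * lin n 0 (k * y) 0 0 \<omega>)\<^sup>2) / 2)) \<longlonglongrightarrow> 0"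
      unfolding gap_def lin by (rule tendsto_norm_zero_cancel)
    have "expectation (\<lambda>\<omega>. (c n * lin n 0 (k * y) 0 0 \<omega>)\<^sup>2) = (k * y)\<^sup>2 * ((c n)\<^sup>2 * mean_sq (X n))" for n
      by (simp add: lin_def power_mult_distrib)
    then have var: "(\<lambda>n. expectation (\<lambda>\<omega>. (c n * lin n 0 (k * y) 0 0 \<omega>)\<^sup>2)) \<longlonglongrightarrow> (k * y)\<^sup>2 * (1 + \<alpha>)"
      using tendsto_mult_left[OF cX] by simp
    have "(\<lambda>n. complex_of_real (exp (- expectation (\<lambda>\<omega>. (c n * lin n 0 (k * y) 0 0 \<omega>)\<^sup>2) / 2))) \<longlonglongrightarrow> of_real (exp (- ((k * y)\<^sup>2 * (1 + \<alpha>)) / 2))"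
      by (intro tendsto_intros var) simp
    from tendsto_add[OF gap this] show ?thesis by simp
  qed
  \<comment> \<open>So \<open>Y\<close> inherits the normal limit of \<open>X\<close>, multiplied by \<open>k\<close>.\<close>
  obtain C where C: "\<forall>\<^sub>F n in sequentially. (c n)\<^sup>2 * mean_sq (Y n) \<le> C"
    using moment_Y_from_X[OF ap0 cT cX] by blast
  have "weakly_converges (\<lambda>n. distr M borel (\<lambda>\<omega>. c n *\<^sub>R (leaf_vec par col n \<omega> - real n *\<^sub>R leaf_mean \<alpha>))) N"
  proof (rule leaf_weak_limit[OF _ _ _ _ _ C])
    show "prob_space N" "sets N = sets borel" using N by (auto simp: centred_normal_def)
    show "(\<lambda>n. \<integral>\<omega>. cis (c n * lin n u 0 y 0 \<omega>) \<partial>M) \<longlonglongrightarrow> (\<integral>x. cis (vector [u + y, u - y] \<bullet> x) \<partial>N)" for u y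
    proof -
      have "(vector [u + y, u - y] :: real ^ 2) \<bullet> (Sigma_II \<alpha> *v vector [u + y, u - y]) = 4 * ?B * y\<^sup>2"
        unfolding quadratic_form_symmetric[OF Sigma_II_eq] by (simp add: power2_eq_square)
      also have "\<dots> = (k * y)\<^sup>2 * (1 + \<alpha>)"
        unfolding k using alpha_pos by (simp add: power_mult_distrib power_divide power2_commute add.commute)
      finally have q: "(\<integral>x. cis (vector [u + y, u - y] \<bullet> x) \<partial>N) = of_real (exp (- ((k * y)\<^sup>2 * (1 + \<alpha>)) / 2))"
        by (simp only: centred_normal_char[OF N])
      have diff: "c n * lin n u 0 y 0 \<omega> - c n * lin n 0 (k * y) 0 0 \<omega> = c n * lin n u (- (q / (\<alpha> + 2 * p)) * y) y 0 \<omega>" for n \<omega>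
        unfolding k_def by (simp add: lin_def algebra_simps)
      show ?thesis unfolding q
      proof (rule cis_expectation_tendsto[OF _ _ _ _ main])
        show "(\<lambda>\<omega>. c n * lin n u 0 y 0 \<omega>) \<in> borel_measurable M" "(\<lambda>\<omega>. c n * lin n 0 (k * y) 0 0 \<omega>) \<in> borel_measurable M" for n
          by (rule past_measurable[of n]; intro past_intros)+
        show "integrable M (\<lambda>\<omega>. (c n * lin n u 0 y 0 \<omega> - c n * lin n 0 (k * y) 0 0 \<omega>)\<^sup>2)" for n
          by (rule past_integrable[of n]; intro past_intros)
        show "(\<lambda>n. expectation (\<lambda>\<omega>. (c n * lin n u 0 y 0 \<omega> - c n * lin n 0 (k * y) 0 0 \<omega>)\<^sup>2)) \<longlonglongrightarrow> 0"
          unfolding diff by (rule negligible_remainder[OF ap0 cT])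
      qed
    qed
    show "\<forall>\<^sub>F n in sequentially. (c n)\<^sup>2 * T n \<le> 1"
      using order_tendstoD(2)[OF cT, of 1] by (auto elim: eventually_mono)
    show "c \<longlonglongrightarrow> 0" unfolding c_def by real_asymp
  qed
  with N show ?thesis unfolding c_def by blast
qed

end

section \<open>Mean-square limits\<close>

text \<open>A Cauchy sequence in mean square is Cauchy in mean, so a subsequence converges almost everywhere; by
  Fatou's lemma its limit is also the limit in mean square.\<close>

lemma (in prob_space) L2_complete:
  fixes f :: "nat \<Rightarrow> 'a \<Rightarrow> real"
  assumes f [measurable]: "\<And>n. f n \<in> borel_measurable M" and f2: "\<And>n. integrable M (\<lambda>\<omega>. (f n \<omega>)\<^sup>2)"
    and cauchy: "\<And>e. e > 0 \<Longrightarrow> \<exists>N. \<forall>m\<ge>N. \<forall>n\<ge>N. expectation (\<lambda>\<omega>. (f m \<omega> - f n \<omega>)\<^sup>2) < e"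
  shows "\<exists>\<xi>. \<xi> \<in> borel_measurable M \<and> integrable M (\<lambda>\<omega>. (\<xi> \<omega>)\<^sup>2) \<and>
    (\<forall>n. integrable M (\<lambda>\<omega>. (f n \<omega> - \<xi> \<omega>)\<^sup>2)) \<and> (\<lambda>n. expectation (\<lambda>\<omega>. (f n \<omega> - \<xi> \<omega>)\<^sup>2)) \<longlonglongrightarrow> 0"
proof -
  have sq_int: "integrable M (\<lambda>\<omega>. (g \<omega> + h \<omega>)\<^sup>2)" if [measurable]: "g \<in> borel_measurable M" "h \<in> borel_measurable M"
    and "integrable M (\<lambda>\<omega>. (g \<omega>)\<^sup>2)" "integrable M (\<lambda>\<omega>. (h \<omega>)\<^sup>2)" for g h :: "'a \<Rightarrow> real"
    by (rule Bochner_Integration.integrable_bound[of M "\<lambda>\<omega>. 2 * (g \<omega>)\<^sup>2 + 2 * (h \<omega>)\<^sup>2"]) (use that power2_sum_le in auto)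
  have d2: "integrable M (\<lambda>\<omega>. (f m \<omega> - f n \<omega>)\<^sup>2)" for m n
    using sq_int[of "f m" "\<lambda>\<omega>. - f n \<omega>"] f2 by simp
  have L1: "\<exists>N. \<forall>i\<ge>N. \<forall>j\<ge>N. LINT x|M. norm (f i x - f j x) < e" if e: "e > 0" for e
  proof -
    obtain N where N: "\<And>m n. m \<ge> N \<Longrightarrow> n \<ge> N \<Longrightarrow> expectation (\<lambda>\<omega>. (f m \<omega> - f n \<omega>)\<^sup>2) < e\<^sup>2"
      using cauchy[of "e\<^sup>2"] e by auto
    have "LINT x|M. norm (f i x - f j x) < e" if "i \<ge> N" "j \<ge> N" for i j
    proof -
      have "LINT x|M. norm (f i x - f j x) \<le> sqrt (expectation (\<lambda>\<omega>. (f i \<omega> - f j \<omega>)\<^sup>2))"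
        using expectation_abs_le[OF _ d2[of i j]] by simp
      also have "\<dots> < sqrt (e\<^sup>2)" using N[OF that] by (rule real_sqrt_less_mono)
      finally show ?thesis using e by simp
    qed
    then show ?thesis by blast
  qed
  have fi: "integrable M (f n)" for n by (rule square_integrable_imp_integrable[OF f f2])
  obtain r where r: "strict_mono r" "AE x in M. Cauchy (\<lambda>i. f (r i) x)"
    using cauchy_L1_AE_cauchy_subseq[of M f, OF fi L1] by blast
  define \<xi> where "\<xi> \<omega> = lim (\<lambda>i. f (r i) \<omega>)" for \<omega>
  have \<xi>m [measurable]: "\<xi> \<in> borel_measurable M" unfolding \<xi>_def by measurable
  have conv: "AE \<omega> in M. (\<lambda>i. f (r i) \<omega>) \<longlonglongrightarrow> \<xi> \<omega>"
    using r(2) by eventually_elim (simp add: \<xi>_def Cauchy_convergent_iff convergent_LIMSEQ_iff)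
  have fatou: "(\<integral>\<^sup>+\<omega>. ennreal ((f n \<omega> - \<xi> \<omega>)\<^sup>2) \<partial>M) \<le> ennreal e"
    if N: "\<And>m n. m \<ge> N \<Longrightarrow> n \<ge> N \<Longrightarrow> expectation (\<lambda>\<omega>. (f m \<omega> - f n \<omega>)\<^sup>2) < e" and n: "n \<ge> N" for N n e
  proof -
    have "(\<integral>\<^sup>+\<omega>. ennreal ((f n \<omega> - \<xi> \<omega>)\<^sup>2) \<partial>M) = (\<integral>\<^sup>+\<omega>. liminf (\<lambda>i. ennreal ((f n \<omega> - f (r i) \<omega>)\<^sup>2)) \<partial>M)"
    proof (rule nn_integral_cong_AE, use conv in eventually_elim)
      fix \<omega> assume "(\<lambda>i. f (r i) \<omega>) \<longlonglongrightarrow> \<xi> \<omega>"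
      then have "(\<lambda>i. ennreal ((f n \<omega> - f (r i) \<omega>)\<^sup>2)) \<longlonglongrightarrow> ennreal ((f n \<omega> - \<xi> \<omega>)\<^sup>2)"
        by (intro tendsto_ennrealI tendsto_intros)
      then show "ennreal ((f n \<omega> - \<xi> \<omega>)\<^sup>2) = liminf (\<lambda>i. ennreal ((f n \<omega> - f (r i) \<omega>)\<^sup>2))"
        by (rule lim_imp_Liminf[OF trivial_limit_sequentially, symmetric])
    qed
    also have "\<dots> \<le> liminf (\<lambda>i. \<integral>\<^sup>+\<omega>. ennreal ((f n \<omega> - f (r i) \<omega>)\<^sup>2) \<partial>M)"
      by (rule nn_integral_liminf) measurable
    also have "\<dots> \<le> ennreal e"
    proof (rule Liminf_le)
      show "\<forall>\<^sub>F i in sequentially. (\<integral>\<^sup>+\<omega>. ennreal ((f n \<omega> - f (r i) \<omega>)\<^sup>2) \<partial>M) \<le> ennreal e"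
      proof (rule eventually_sequentiallyI[of N])
        fix i assume "i \<ge> N"
        then have "r i \<ge> N" using seq_suble[OF r(1), of i] by linarith
        then show "(\<integral>\<^sup>+\<omega>. ennreal ((f n \<omega> - f (r i) \<omega>)\<^sup>2) \<partial>M) \<le> ennreal e"
          using N[OF n, of "r i"] d2[of n "r i"] by (subst nn_integral_eq_integral) (auto intro: ennreal_leI)
      qed
    qed simp
    finally show ?thesis .
  qed
  have int: "integrable M (\<lambda>\<omega>. (f n \<omega> - \<xi> \<omega>)\<^sup>2) \<and> expectation (\<lambda>\<omega>. (f n \<omega> - \<xi> \<omega>)\<^sup>2) \<le> e"
    if N: "\<And>m n. m \<ge> N \<Longrightarrow> n \<ge> N \<Longrightarrow> expectation (\<lambda>\<omega>. (f m \<omega> - f n \<omega>)\<^sup>2) < e" and n: "n \<ge> N" and e: "e > 0" for N n e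
  proof -
    have le: "(\<integral>\<^sup>+\<omega>. ennreal ((f n \<omega> - \<xi> \<omega>)\<^sup>2) \<partial>M) \<le> ennreal e"
      by (rule fatou[of N]) (use N n in auto)
    have i: "integrable M (\<lambda>\<omega>. (f n \<omega> - \<xi> \<omega>)\<^sup>2)"
      by (rule integrableI_bounded) (use le in \<open>auto simp: le_less_trans[OF _ ennreal_less_top]\<close>)
    then have "ennreal (expectation (\<lambda>\<omega>. (f n \<omega> - \<xi> \<omega>)\<^sup>2)) \<le> ennreal e"
      using le by (subst (asm) nn_integral_eq_integral) auto
    then show ?thesis using i e by (simp add: ennreal_le_iff)
  qed
  obtain N1 where N1: "\<And>m n. m \<ge> N1 \<Longrightarrow> n \<ge> N1 \<Longrightarrow> expectation (\<lambda>\<omega>. (f m \<omega> - f n \<omega>)\<^sup>2) < 1"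
    using cauchy[of 1] by auto
  have i1: "integrable M (\<lambda>\<omega>. (f N1 \<omega> - \<xi> \<omega>)\<^sup>2)" using int[of N1 1 N1] N1 by simp
  have iall: "integrable M (\<lambda>\<omega>. (f n \<omega> - \<xi> \<omega>)\<^sup>2)" for n
    using sq_int[OF _ _ d2[of n N1] i1] by simp
  have i1': "integrable M (\<lambda>\<omega>. (\<xi> \<omega> - f N1 \<omega>)\<^sup>2)" using i1 by (simp add: power2_commute)
  have \<xi>2: "integrable M (\<lambda>\<omega>. (\<xi> \<omega>)\<^sup>2)"
    using sq_int[OF _ f i1' f2[of N1]] by simp
  have lim: "(\<lambda>n. expectation (\<lambda>\<omega>. (f n \<omega> - \<xi> \<omega>)\<^sup>2)) \<longlonglongrightarrow> 0"
  proof (rule LIMSEQ_I)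
    fix e :: real assume e: "e > 0"
    obtain N where N: "\<And>m n. m \<ge> N \<Longrightarrow> n \<ge> N \<Longrightarrow> expectation (\<lambda>\<omega>. (f m \<omega> - f n \<omega>)\<^sup>2) < e / 2"
      using cauchy[of "e / 2"] e by auto
    have "norm (expectation (\<lambda>\<omega>. (f n \<omega> - \<xi> \<omega>)\<^sup>2) - 0) < e" if "n \<ge> N" for n
      using int[of N "e / 2" n] N that e by simp
    then show "\<exists>N. \<forall>n\<ge>N. norm (expectation (\<lambda>\<omega>. (f n \<omega> - \<xi> \<omega>)\<^sup>2) - 0) < e" by blast
  qed
  show ?thesis using \<xi>m \<xi>2 iall lim by blast
qed

text \<open>From \<open>(f n)\<^sup>2 - \<xi>\<^sup>2 = 2 \<xi> h + h\<^sup>2\<close> with \<open>h = f n - \<xi>\<close>, and \<open>2 \<bar>\<xi> h\<bar> \<le> s \<xi>\<^sup>2 + h\<^sup>2 / s\<close> for every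
  \<open>s > 0\<close>.\<close>

lemma (in prob_space) L2_second_moment:
  fixes f :: "nat \<Rightarrow> 'a \<Rightarrow> real"
  assumes [measurable]: "\<And>n. f n \<in> borel_measurable M" "\<xi> \<in> borel_measurable M"
    and i: "\<And>n. integrable M (\<lambda>\<omega>. (f n \<omega>)\<^sup>2)" "integrable M (\<lambda>\<omega>. (\<xi> \<omega>)\<^sup>2)" "\<And>n. integrable M (\<lambda>\<omega>. (f n \<omega> - \<xi> \<omega>)\<^sup>2)"
    and lim: "(\<lambda>n. expectation (\<lambda>\<omega>. (f n \<omega> - \<xi> \<omega>)\<^sup>2)) \<longlonglongrightarrow> 0"
  shows "(\<lambda>n. mean_sq (f n)) \<longlonglongrightarrow> mean_sq \<xi>"
proof (rule LIMSEQ_I)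
  fix e :: real assume e: "e > 0"
  define V where "V = mean_sq \<xi>"
  define d where "d n = expectation (\<lambda>\<omega>. (f n \<omega> - \<xi> \<omega>)\<^sup>2)" for n
  have V: "V \<ge> 0" by (simp add: V_def)
  define s where "s = e / (2 * (V + 1))"
  have s: "s > 0" "s * V < e / 2" using e V by (auto simp: s_def field_simps)
  have bound: "\<bar>mean_sq (f n) - V\<bar> \<le> s * V + (1 + 1 / s) * d n" for n
  proof -
    have "\<bar>mean_sq (f n) - V\<bar> = \<bar>expectation (\<lambda>\<omega>. (f n \<omega>)\<^sup>2 - (\<xi> \<omega>)\<^sup>2)\<bar>"
      using i by (simp add: V_def)
    also have "\<dots> \<le> expectation (\<lambda>\<omega>. \<bar>(f n \<omega>)\<^sup>2 - (\<xi> \<omega>)\<^sup>2\<bar>)" by (rule integral_abs_bound)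
    also have "\<dots> \<le> expectation (\<lambda>\<omega>. s * (\<xi> \<omega>)\<^sup>2 + (1 + 1 / s) * (f n \<omega> - \<xi> \<omega>)\<^sup>2)"
    proof (rule integral_mono)
      fix \<omega>
      define x h where "x = \<xi> \<omega>" and "h = f n \<omega> - \<xi> \<omega>"
      have amgm: "\<bar>2 * x * h\<bar> \<le> s * x\<^sup>2 + h\<^sup>2 / s"
      proof -
        have "0 \<le> (s * \<bar>x\<bar> - \<bar>h\<bar>)\<^sup>2 / s" using s by simp
        also have "\<dots> = s * x\<^sup>2 + h\<^sup>2 / s - \<bar>2 * x * h\<bar>"
          using s by (simp add: power2_diff power_mult_distrib abs_mult field_simps power2_eq_square)
        finally show ?thesis by simp
      qed
      have "(f n \<omega>)\<^sup>2 - (\<xi> \<omega>)\<^sup>2 = 2 * x * h + h\<^sup>2" by (simp add: x_def h_def power2_eq_square algebra_simps)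
      then have "\<bar>(f n \<omega>)\<^sup>2 - (\<xi> \<omega>)\<^sup>2\<bar> \<le> \<bar>2 * x * h\<bar> + h\<^sup>2" using abs_triangle_ineq[of "2 * x * h" "h\<^sup>2"] by simp
      also have "\<dots> \<le> s * x\<^sup>2 + (1 + 1 / s) * h\<^sup>2" using amgm by (simp add: distrib_right)
      finally show "\<bar>(f n \<omega>)\<^sup>2 - (\<xi> \<omega>)\<^sup>2\<bar> \<le> s * (\<xi> \<omega>)\<^sup>2 + (1 + 1 / s) * (f n \<omega> - \<xi> \<omega>)\<^sup>2" by (simp only: x_def h_def)
    qed (use i in auto)
    also have "\<dots> = s * V + (1 + 1 / s) * d n" using i by (simp add: V_def d_def)
    finally show ?thesis .
  qed
  have "(\<lambda>n. (1 + 1 / s) * d n) \<longlonglongrightarrow> (1 + 1 / s) * 0" using lim unfolding d_def by (rule tendsto_mult_left)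
  then have "\<forall>\<^sub>F n in sequentially. (1 + 1 / s) * d n < e / 2" by (rule order_tendstoD) (use e in simp)
  then obtain N where N: "\<And>n. n \<ge> N \<Longrightarrow> (1 + 1 / s) * d n < e / 2" by (auto simp: eventually_sequentially)
  have "norm (mean_sq (f n) - V) < e" if "n \<ge> N" for n
    using bound[of n] N[OF that] s(2) unfolding real_norm_def by linarith
  then show "\<exists>N. \<forall>n\<ge>N. norm (mean_sq (f n) - mean_sq \<xi>) < e" unfolding V_def by blast
qed

section \<open>Growth factors and the Gamma function\<close>

text \<open>The solution of the homogeneous recursion with coefficient \<open>c\<close> and value \<open>1\<close> at \<open>n = 1\<close>.\<close>

definition growth :: "real \<Rightarrow> real \<Rightarrow> nat \<Rightarrow> real" where
  "growth b c n = (\<Prod>k\<in>{1..<n}. 1 + c / tot b k)"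

lemma growth_1: "growth b c 1 = 1"
  by (simp add: growth_def)

lemma growth_Suc: "n \<ge> 1 \<Longrightarrow> growth b c (Suc n) = (1 + c / tot b n) * growth b c n"
  by (simp add: growth_def prod.atLeastLessThan_Suc mult.commute)

lemma growth_pos: "b > 0 \<Longrightarrow> c > 0 \<Longrightarrow> growth b c n > 0"
  unfolding growth_def by (intro prod_pos ballI add_pos_pos divide_pos_pos) (auto intro: less_le_trans[OF zero_less_one tot_ge_1])

text \<open>Both \<open>tot b (Suc m)\<close> and \<open>tot b (Suc m) + c\<close> are arithmetic progressions in \<open>m\<close> with difference
  \<open>b\<close>, so the product is a quotient of rising factorials.\<close>

lemma growth_pochhammer:
  assumes b: "b > 0"
  shows "growth b c (Suc m) = pochhammer ((1 + c) / b) m / pochhammer (1 / b) m"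
proof (induction m)
  case 0 then show ?case by (simp add: growth_def)
next
  case (Suc m)
  have T: "tot b (Suc m) = b * (1 / b + real m)" using b by (simp add: tot_def field_simps)
  have "tot b (Suc m) > 0" using tot_ge_1[OF b, of "Suc m"] by simp
  then have "1 + c / tot b (Suc m) = (tot b (Suc m) + c) / tot b (Suc m)" by (simp add: field_simps)
  also have "tot b (Suc m) + c = b * ((1 + c) / b + real m)" using b by (simp add: tot_def field_simps)
  also have "\<dots> / tot b (Suc m) = ((1 + c) / b + real m) / (1 / b + real m)" unfolding T using b by simp
  finally show ?case using Suc by (simp add: growth_Suc[of "Suc m"] pochhammer_Suc mult.commute)
qed

text \<open>Euler's product for the Gamma function. The index is shifted because \<open>Gamma_series x m\<close> contains the
  rising factorial of length \<open>m + 1\<close>, which belongs to \<open>growth\<close> at \<open>m + 2\<close>.\<close>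

lemma growth_asymptotics:
  assumes b: "b > 0" and c: "c > 0"
  shows "(\<lambda>n. growth b c n / real n powr (c / b)) \<longlonglongrightarrow> Gamma (1 / b) / Gamma ((1 + c) / b)"
proof -
  define x y where "x = 1 / b" and "y = (1 + c) / b"
  have xy: "x > 0" "y > 0" "y - x = c / b" using b c by (simp_all add: x_def y_def field_simps)
  have G: "Gamma y \<noteq> 0" using Gamma_real_pos[OF xy(2)] by simp
  have eq: "growth b c (m + 2) / real (m + 2) powr (c / b) = (real m / real (m + 2)) powr (c / b) * (Gamma_series x m / Gamma_series y m)"
    if m: "m \<ge> 1" for m
  proof -
    have P: "pochhammer x (m + 1) > 0" "pochhammer y (m + 1) > 0" using xy by (auto intro: pochhammer_pos)
    have "growth b c (m + 2) = pochhammer y (m + 1) / pochhammer x (m + 1)"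
      using growth_pochhammer[OF b, of c "Suc m"] by (simp add: x_def y_def)
    moreover have "Gamma_series x m / Gamma_series y m = real m powr x / real m powr y * (pochhammer y (m + 1) / pochhammer x (m + 1))"
      using P m by (simp add: Gamma_series_def powr_def field_simps)
    moreover have "real m powr x / real m powr y = 1 / real m powr (c / b)"
      unfolding xy(3)[symmetric] using m by (simp add: powr_diff)
    moreover have "(real m / real (m + 2)) powr (c / b) = real m powr (c / b) / real (m + 2) powr (c / b)"
      by (rule powr_divide)
    ultimately show ?thesis using m by simp
  qed
  have "(\<lambda>m. (real m / real (m + 2)) powr (c / b) * (Gamma_series x m / Gamma_series y m)) \<longlonglongrightarrow> 1 * (Gamma x / Gamma y)"
  proof (intro tendsto_mult tendsto_divide Gamma_series_LIMSEQ G)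
    show "(\<lambda>m. (real m / real (m + 2)) powr (c / b)) \<longlonglongrightarrow> 1" by real_asymp
  qed
  then have "(\<lambda>m. growth b c (m + 2) / real (m + 2) powr (c / b)) \<longlonglongrightarrow> 1 * (Gamma x / Gamma y)"
    by (rule Lim_transform_eventually) (rule eventually_sequentiallyI[of 1], simp only: eq)
  then show ?thesis unfolding x_def y_def mult_1 by (rule LIMSEQ_offset)
qed

section \<open>The supercritical regime\<close>

locale supercritical = pa_process +
  assumes super: "2 * (\<alpha> + q) > 1 + \<alpha>"
begin

text \<open>\<open>X\<close> has the drift \<open>r X / T\<close> and grows like \<open>n powr ex\<close>; \<open>V\<close> will be the second moment of \<open>Z\<close>.\<close>

definition r :: real where "r = \<alpha> + q"
definition ex :: real where "ex = r / (1 + \<alpha>)"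
definition V :: real where "V = (1 + \<alpha>) * (4 * p + \<alpha> - 2) / (4 * p + \<alpha> - 3) * (Gamma (1 / (1 + \<alpha>)) / Gamma ((1 + 2 * r) / (1 + \<alpha>)))"

lemma r: "r > 0" "2 * r > 1 + \<alpha>" "ex > 1 / 2" "ex > 0"
  using super alpha_pos by (auto simp: r_def ex_def field_simps)

text \<open>The quotient of \<open>X\<close> and \<open>growth (1 + \<alpha>) r\<close> is a martingale.\<close>

lemma correlation_X:
  assumes m: "1 \<le> m" "m \<le> n" and g: "past m g"
  shows "expectation (\<lambda>\<omega>. X n \<omega> * g \<omega>) = growth (1 + \<alpha>) r n / growth (1 + \<alpha>) r m * expectation (\<lambda>\<omega>. X m \<omega> * g \<omega>)"
  using m(2)
proof (induction n rule: dec_induct)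
  case base
  then show ?case using growth_pos[OF alpha_pos r(1), of m] by simp
next
  case (step n)
  have n: "n \<ge> 1" and gn: "past n g" using step m past_mono[OF g] by auto
  have i: "integrable M (\<lambda>\<omega>. X n \<omega> * g \<omega>)" "integrable M (\<lambda>\<omega>. inc n 0 1 0 0 \<omega> * g \<omega>)"
    by (rule past_integrable[of "Suc n"]; intro past_intros n past_Suc[OF gn])+
  have "expectation (\<lambda>\<omega>. X (Suc n) \<omega> * g \<omega>) = expectation (\<lambda>\<omega>. X n \<omega> * g \<omega> + inc n 0 1 0 0 \<omega> * g \<omega>)"
    using lin_Suc[OF n, of _ 0 1 0 0] by (intro Bochner_Integration.integral_cong refl) (simp add: lin_def distrib_right)
  also have "\<dots> = expectation (\<lambda>\<omega>. X n \<omega> * g \<omega>) + expectation (\<lambda>\<omega>. inc n 0 1 0 0 \<omega> * g \<omega>)" using i by simp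
  also have "expectation (\<lambda>\<omega>. inc n 0 1 0 0 \<omega> * g \<omega>) = expectation (\<lambda>\<omega>. r / T n * (X n \<omega> * g \<omega>))"
    by (rule trans[OF inc_mean[OF n gn, of 0 1 0 0, unfolded real_scaleR_def]])
       (intro Bochner_Integration.integral_cong refl, simp add: lin_def r_def)
  also have "\<dots> = r / T n * expectation (\<lambda>\<omega>. X n \<omega> * g \<omega>)" by (rule integral_mult_right_zero)
  finally have "expectation (\<lambda>\<omega>. X (Suc n) \<omega> * g \<omega>) = (1 + r / T n) * expectation (\<lambda>\<omega>. X n \<omega> * g \<omega>)" by (simp add: distrib_right)
  then show ?case using step by (simp add: growth_Suc[OF n])
qed

text \<open>The recursion for the second moment has the particular solution \<open>k T\<close>; the initial value \<open>1\<close>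
  determines the multiple of the homogeneous solution.\<close>

lemma moment_X_exact:
  assumes "n \<ge> 1"
  defines "k \<equiv> (\<alpha>\<^sup>2 + 1 + 2 * \<alpha> * q) / (1 + \<alpha> - 2 * r)"
  shows "mean_sq (X n) = k * T n + (1 - k) * growth (1 + \<alpha>) (2 * r) n"
  using assms(1)
proof (induction n rule: dec_induct)
  case base
  have "(X 1 \<omega>)\<^sup>2 = 1" for \<omega> by (simp only: initial_stats power2_eq_square csign_simps)
  then show ?case by (simp only: growth_1) (simp add: prob_space tot_def)
next
  case (step n)
  have k: "k * (1 + \<alpha> - 2 * r) = \<alpha>\<^sup>2 + 1 + 2 * \<alpha> * q" using r(2) by (simp add: k_def)
  have T: "T n > 0" using T_ge_1[OF step(1)] by simp
  have "mean_sq (X (Suc n)) = (1 + 2 * r / T n) * (k * T n + (1 - k) * growth (1 + \<alpha>) (2 * r) n) + k * (1 + \<alpha> - 2 * r)"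
    using moment_X_Suc[OF step(1)] step.IH k by (simp add: r_def)
  also have "\<dots> = (1 + 2 * r / T n) * T n * k + k * (1 + \<alpha> - 2 * r) + (1 - k) * ((1 + 2 * r / T n) * growth (1 + \<alpha>) (2 * r) n)"
  proof -
    have "x * (k * t + (1 - k) * g) + z = x * t * k + z + (1 - k) * (x * g)" for x t g z :: real
      by (simp add: algebra_simps)
    then show ?thesis .
  qed
  also have "(1 + 2 * r / T n) * T n = T n + 2 * r" using T by (simp add: field_simps)
  also have "(T n + 2 * r) * k + k * (1 + \<alpha> - 2 * r) = k * (T n + (1 + \<alpha>))" by (simp add: algebra_simps)
  finally show ?case unfolding growth_Suc[OF step(1)] tot_Suc .
qed

definition f :: "nat \<Rightarrow> 'a \<Rightarrow> real" where "f n \<omega> = 1 / real n powr ex * X n \<omega>"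

lemma past_f [past_intros]: "past n (f n)"
  unfolding f_def by (intro past_intros)

lemma scale_T: "(\<lambda>n. (1 / real n powr ex)\<^sup>2 * T n) \<longlonglongrightarrow> 0"
proof (rule Lim_transform_eventually)
  have "(\<lambda>n. real n powr (1 - 2 * ex)) \<longlonglongrightarrow> 0"
    by (rule tendsto_neg_powr) (use r filterlim_real_sequentially in auto)
  then show "(\<lambda>n. T n / real n * real n powr (1 - 2 * ex)) \<longlonglongrightarrow> 0"
    using tendsto_mult[OF tot_over_n[of "1 + \<alpha>"]] by fastforce
  show "\<forall>\<^sub>F n in sequentially. T n / real n * real n powr (1 - 2 * ex) = (1 / real n powr ex)\<^sup>2 * T n"
    by (rule eventually_sequentiallyI[of 1])
       (simp add: power_divide powr_diff power2_eq_square powr_add[symmetric])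
qed

lemma moment_f: "(\<lambda>n. mean_sq (f n)) \<longlonglongrightarrow> V"
proof -
  define k where "k = (\<alpha>\<^sup>2 + 1 + 2 * \<alpha> * q) / (1 + \<alpha> - 2 * r)"
  have "(\<lambda>n. k * ((1 / real n powr ex)\<^sup>2 * T n) + (1 - k) * (growth (1 + \<alpha>) (2 * r) n / real n powr (2 * r / (1 + \<alpha>))))
     \<longlonglongrightarrow> k * 0 + (1 - k) * (Gamma (1 / (1 + \<alpha>)) / Gamma ((1 + 2 * r) / (1 + \<alpha>)))"
    by (intro tendsto_add tendsto_mult_left scale_T growth_asymptotics) (use alpha_pos r in auto)
  moreover have "\<forall>\<^sub>F n in sequentially. k * ((1 / real n powr ex)\<^sup>2 * T n) + (1 - k) * (growth (1 + \<alpha>) (2 * r) n / real n powr (2 * r / (1 + \<alpha>)))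
     = mean_sq (f n)"
  proof (rule eventually_sequentiallyI)
    fix n :: nat assume n: "n \<ge> 1"
    have "real n powr (2 * r / (1 + \<alpha>)) = (real n powr ex)\<^sup>2"
      by (simp add: power2_eq_square powr_add[symmetric] ex_def)
    moreover have "mean_sq (f n) = (1 / real n powr ex)\<^sup>2 * mean_sq (X n)"
      unfolding f_def power_mult_distrib by (rule integral_mult_right_zero)
    ultimately show "k * ((1 / real n powr ex)\<^sup>2 * T n) + (1 - k) * (growth (1 + \<alpha>) (2 * r) n / real n powr (2 * r / (1 + \<alpha>)))
     = mean_sq (f n)"
      using moment_X_exact[OF n] by (simp add: k_def power_divide add_divide_distrib)
  qed
  moreover have "1 - k = (1 + \<alpha>) * (4 * p + \<alpha> - 2) / (4 * p + \<alpha> - 3)"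
  proof -
    have e: "1 + \<alpha> - 2 * r = - (4 * p + \<alpha> - 3)" by (simp add: r_def)
    have nz: "4 * p + \<alpha> - 3 \<noteq> 0" using r(2) unfolding r_def by auto
    show ?thesis unfolding k_def e using nz by (simp add: field_simps power2_eq_square)
  qed
  ultimately show ?thesis unfolding V_def by (simp only: mult_zero_right add_0) (rule Lim_transform_eventually)
qed

lemma mean_f: "(\<lambda>n. expectation (\<lambda>\<omega>. csign (col 0 \<omega>) * f n \<omega>)) \<longlonglongrightarrow> Gamma (1 / (1 + \<alpha>)) / Gamma ((1 + r) / (1 + \<alpha>))"
proof (rule Lim_transform_eventually[OF growth_asymptotics[OF alpha_pos r(1)]])
  show "\<forall>\<^sub>F n in sequentially. growth (1 + \<alpha>) r n / real n powr (r / (1 + \<alpha>)) = expectation (\<lambda>\<omega>. csign (col 0 \<omega>) * f n \<omega>)"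
  proof (rule eventually_sequentiallyI)
    fix n :: nat assume n: "n \<ge> 1"
    have "past 1 (\<lambda>\<omega>. csign (col 0 \<omega>))" by (intro past_intros) simp
    from correlation_X[OF _ n this] have "expectation (\<lambda>\<omega>. X n \<omega> * csign (col 0 \<omega>)) = growth (1 + \<alpha>) r n"
      by (simp add: initial_stats[unfolded One_nat_def] growth_1[unfolded One_nat_def] prob_space)
    moreover have "expectation (\<lambda>\<omega>. csign (col 0 \<omega>) * f n \<omega>) = expectation (\<lambda>\<omega>. 1 / real n powr ex * (X n \<omega> * csign (col 0 \<omega>)))"
      by (simp add: f_def mult_ac)
    moreover have "\<dots> = 1 / real n powr ex * expectation (\<lambda>\<omega>. X n \<omega> * csign (col 0 \<omega>))" by (rule integral_mult_right_zero)
    ultimately show "growth (1 + \<alpha>) r n / real n powr (r / (1 + \<alpha>)) = expectation (\<lambda>\<omega>. csign (col 0 \<omega>) * f n \<omega>)"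
      by (simp add: ex_def)
  qed
qed

text \<open>By the martingale property the mean of \<open>f m * f n\<close> for \<open>m \<le> n\<close> is the second moment of
  \<open>f m\<close> up to a factor tending to \<open>1\<close>; as the second moments converge, the sequence is Cauchy.\<close>

lemma f_cauchy:
  assumes e: "e > 0"
  shows "\<exists>N. \<forall>m\<ge>N. \<forall>n\<ge>N. expectation (\<lambda>\<omega>. (f m \<omega> - f n \<omega>)\<^sup>2) < e"
proof -
  define a where "a n = mean_sq (f n)" for n
  define g where "g n = growth (1 + \<alpha>) r n / real n powr ex" for n
  define G where "G = Gamma (1 / (1 + \<alpha>)) / Gamma ((1 + r) / (1 + \<alpha>))"
  have aV: "a \<longlonglongrightarrow> V" unfolding a_def by (rule moment_f)
  have gG: "g \<longlonglongrightarrow> G" unfolding g_def G_def ex_def by (rule growth_asymptotics[OF alpha_pos r(1)])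
  have G: "G > 0" unfolding G_def using alpha_pos r by (intro divide_pos_pos Gamma_real_pos) auto
  have a0: "a n \<ge> 0" for n by (simp add: a_def)
  have key: "expectation (\<lambda>\<omega>. (f n \<omega> - f m \<omega>)\<^sup>2) = a n + a m - 2 * (g n / g m * a m)" if m: "1 \<le> m" "m \<le> n" for m n
  proof -
    have i: "integrable M (\<lambda>\<omega>. (f n \<omega>)\<^sup>2)" "integrable M (\<lambda>\<omega>. (f m \<omega>)\<^sup>2)" "integrable M (\<lambda>\<omega>. f n \<omega> * f m \<omega>)"
      using past_mono[OF past_f m(2)] by (intro past_integrable[of n] past_intros; simp)+
    have "expectation (\<lambda>\<omega>. (f n \<omega> - f m \<omega>)\<^sup>2) = expectation (\<lambda>\<omega>. (f n \<omega>)\<^sup>2 + (f m \<omega>)\<^sup>2 - 2 * (f n \<omega> * f m \<omega>))"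
      by (simp add: power2_diff mult.assoc)
    also have "\<dots> = a n + a m - 2 * expectation (\<lambda>\<omega>. f n \<omega> * f m \<omega>)" using i by (simp add: a_def)
    also have "expectation (\<lambda>\<omega>. f n \<omega> * f m \<omega>) = 1 / real n powr ex * expectation (\<lambda>\<omega>. X n \<omega> * f m \<omega>)"
      unfolding f_def[of n] mult.assoc by (rule integral_mult_right_zero)
    also have "expectation (\<lambda>\<omega>. X n \<omega> * f m \<omega>) = growth (1 + \<alpha>) r n / growth (1 + \<alpha>) r m * expectation (\<lambda>\<omega>. X m \<omega> * f m \<omega>)"
      by (rule correlation_X[OF m past_f])
    also have "expectation (\<lambda>\<omega>. X m \<omega> * f m \<omega>) = expectation (\<lambda>\<omega>. real m powr ex * (f m \<omega>)\<^sup>2)"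
      using m by (intro Bochner_Integration.integral_cong refl) (simp add: f_def power2_eq_square)
    also have "\<dots> = real m powr ex * a m" unfolding a_def by (rule integral_mult_right_zero)
    finally show ?thesis by (simp add: g_def mult_ac)
  qed
  \<comment> \<open>Eventually \<open>a\<close> is below \<open>A\<close>, and \<open>g\<close> is above \<open>G / 2\<close>.\<close>
  define A where "A = \<bar>V\<bar> + 1"
  have A: "A > 0" by (simp add: A_def)
  define D where "D = 1 + A / (G / 2)"
  have D: "D > 0" unfolding D_def using A G by (simp add: add_pos_pos)
  define d where "d = e / (4 * D)"
  have d: "d > 0" "d * (1 + A / (G / 2)) * 4 = e" unfolding D_def[symmetric] using e D by (simp_all add: d_def)
  have "\<forall>\<^sub>F n in sequentially. \<bar>a n - V\<bar> < d" using tendstoD[OF aV d(1)] by (simp add: dist_real_def)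
  moreover have "\<forall>\<^sub>F n in sequentially. \<bar>g n - G\<bar> < d" using tendstoD[OF gG d(1)] by (simp add: dist_real_def)
  moreover have "\<forall>\<^sub>F n in sequentially. g n > G / 2" using order_tendstoD(1)[OF gG, of "G / 2"] G by simp
  moreover have "\<forall>\<^sub>F n in sequentially. a n < A" using order_tendstoD(2)[OF aV, of A] by (simp add: A_def)
  moreover have "\<forall>\<^sub>F n in sequentially. n \<ge> (1 :: nat)" by (rule eventually_ge_at_top)
  ultimately have "\<forall>\<^sub>F n in sequentially. \<bar>a n - V\<bar> < d \<and> \<bar>g n - G\<bar> < d \<and> g n > G / 2 \<and> a n < A \<and> n \<ge> 1"
    by eventually_elim blast
  then obtain N where N: "\<And>n. n \<ge> N \<Longrightarrow> \<bar>a n - V\<bar> < d \<and> \<bar>g n - G\<bar> < d \<and> g n > G / 2 \<and> a n < A \<and> n \<ge> 1"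
    by (auto simp: eventually_sequentially)
  have ord: "expectation (\<lambda>\<omega>. (f n \<omega> - f m \<omega>)\<^sup>2) < e" if m: "N \<le> m" "m \<le> n" for m n
  proof -
    note Nm = N[OF m(1)] and Nn = N[OF order_trans[OF m]]
    have gm: "g m > 0" using Nm G by linarith
    have "expectation (\<lambda>\<omega>. (f n \<omega> - f m \<omega>)\<^sup>2) = (a n - a m) + 2 * ((g m - g n) / g m * a m)"
      using key[of m n] Nm m gm by (simp add: field_simps)
    also have "\<dots> \<le> 2 * d + 2 * (2 * d / (G / 2) * A)"
    proof (intro add_mono mult_left_mono mult_mono)
      show "a n - a m \<le> 2 * d" using Nm Nn by linarith
      show "(g m - g n) / g m \<le> 2 * d / (G / 2)"
      proof -
        have "(g m - g n) / g m \<le> 2 * d / g m" using Nm Nn gm by (intro divide_right_mono) linarith+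
        also have "\<dots> \<le> 2 * d / (G / 2)" using Nm G d gm by (intro divide_left_mono) auto
        finally show ?thesis .
      qed
    qed (use a0 d G Nm in auto)
    also have "\<dots> \<le> 2 * d * (1 + A / (G / 2)) + 2 * d * (A / (G / 2))" by (simp add: algebra_simps)
    also have "\<dots> < d * (1 + A / (G / 2)) * 4" using d(1) by (simp add: algebra_simps)
    also have "\<dots> = e" by (rule d)
    finally show ?thesis .
  qed
  have "expectation (\<lambda>\<omega>. (f m \<omega> - f n \<omega>)\<^sup>2) < e" if "m \<ge> N" "n \<ge> N" for m n
  proof (cases "m \<le> n")
    case True
    then show ?thesis using ord[of m n] that by (simp add: power2_commute)
  next
    case False
    then show ?thesis using ord[of n m] that by simp
  qed
  then show ?thesis by blast
qed

text \<open>Multiplying the mean-square limit of \<open>f\<close> by the sign of the root gives \<open>Z\<close>, because signs square to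
  \<open>1\<close>. Both convergences then say that a statistic is a multiple of \<open>X\<close> up to a remainder that is
  negligible on the scale of \<open>X\<close>, which is larger than the square root of \<open>n\<close>.\<close>

theorem limit:
  "\<exists>Z :: 'a \<Rightarrow> real. Z \<in> borel_measurable M \<and> integrable M Z \<and>
     (\<integral>\<omega>. Z \<omega> \<partial>M) = Gamma (1 / (1 + \<alpha>)) / Gamma ((2 * p + \<alpha>) / (1 + \<alpha>)) \<and>
     integrable M (\<lambda>\<omega>. (Z \<omega>)\<^sup>2) \<and>
     (\<integral>\<omega>. (Z \<omega>)\<^sup>2 \<partial>M) =
       (Gamma (1 / (1 + \<alpha>)) * (1 + \<alpha>) * (4 * p + \<alpha> - 2)) /
       (Gamma ((4 * p + 2 * \<alpha> - 1) / (1 + \<alpha>)) * (4 * p + \<alpha> - 3)) \<and>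
     weakly_converges
       (\<lambda>n. distr M borel (\<lambda>\<omega>.
          (1 / real n powr ((2 * p + \<alpha> - 1) / (1 + \<alpha>))) *\<^sub>R (leaf_vec par col n \<omega> - real n *\<^sub>R leaf_mean \<alpha>)))
       (distr M borel (\<lambda>\<omega>. (root_sign col \<omega> * Z \<omega> / (2 * \<alpha> + 4 * p)) *\<^sub>R (vector [2 * p - 1, 1 - 2 * p] :: real ^ 2))) \<and>
     weakly_converges
       (\<lambda>n. distr M borel (\<lambda>\<omega>.
          (1 / real n powr ((2 * p + \<alpha> - 1) / (1 + \<alpha>))) *\<^sub>R (colour_vec col n \<omega> - real n *\<^sub>R vector [1 / 2, 1 / 2])))
       (distr M borel (\<lambda>\<omega>. (root_sign col \<omega> * Z \<omega> / (2 * (2 * p + \<alpha> - 1))) *\<^sub>R (vector [2 * p - 1, 1 - 2 * p] :: real ^ 2)))"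
proof -
  define c where "c n = 1 / real n powr ex" for n
  have fm: "f n \<in> borel_measurable M" for n by (rule past_measurable[OF past_f])
  have f2: "integrable M (\<lambda>\<omega>. (f n \<omega>)\<^sup>2)" for n by (rule past_integrable[of n]) (intro past_intros)
  obtain \<xi> where \<xi> [measurable]: "\<xi> \<in> borel_measurable M" and \<xi>2: "integrable M (\<lambda>\<omega>. (\<xi> \<omega>)\<^sup>2)"
    and df: "\<And>n. integrable M (\<lambda>\<omega>. (f n \<omega> - \<xi> \<omega>)\<^sup>2)" and lim: "(\<lambda>n. expectation (\<lambda>\<omega>. (f n \<omega> - \<xi> \<omega>)\<^sup>2)) \<longlonglongrightarrow> 0"
    using L2_complete[OF fm f2 f_cauchy] by blast
  have V: "mean_sq \<xi> = V"
    using LIMSEQ_unique[OF L2_second_moment[OF fm \<xi> f2 \<xi>2 df lim] moment_f] .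
  have Bm [measurable]: "(\<lambda>\<omega>. csign (col 0 \<omega>)) \<in> borel_measurable M"
    by (rule past_measurable[of 1]) (intro past_intros, simp)
  define Z where "Z \<omega> = csign (col 0 \<omega>) * \<xi> \<omega>" for \<omega>
  have BZ: "root_sign col \<omega> * Z \<omega> = \<xi> \<omega>" for \<omega>
    by (simp add: root_sign_def Z_def csign_def)
  have Z2: "(Z \<omega>)\<^sup>2 = (\<xi> \<omega>)\<^sup>2" for \<omega> by (simp add: Z_def csign_def)
  have Zm [measurable]: "Z \<in> borel_measurable M" unfolding Z_def by measurable
  have Z2i: "integrable M (\<lambda>\<omega>. (Z \<omega>)\<^sup>2)" unfolding Z2 by (rule \<xi>2)
  have Zi: "integrable M Z" by (rule square_integrable_imp_integrable[OF Zm Z2i])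
  have EZ: "expectation Z = Gamma (1 / (1 + \<alpha>)) / Gamma ((2 * p + \<alpha>) / (1 + \<alpha>))"
  proof -
    have "(\<lambda>n. expectation (\<lambda>\<omega>. csign (col 0 \<omega>) * f n \<omega>) - expectation Z) \<longlonglongrightarrow> 0"
    proof (rule Lim_null_comparison)
      show "(\<lambda>n. sqrt (expectation (\<lambda>\<omega>. (f n \<omega> - \<xi> \<omega>)\<^sup>2))) \<longlonglongrightarrow> 0" using tendsto_real_sqrt[OF lim] by simp
      have "norm (expectation (\<lambda>\<omega>. csign (col 0 \<omega>) * f n \<omega>) - expectation Z) \<le> sqrt (expectation (\<lambda>\<omega>. (f n \<omega> - \<xi> \<omega>)\<^sup>2))" if n: "n \<ge> 1" for n
      proof -
        have i: "integrable M (\<lambda>\<omega>. csign (col 0 \<omega>) * f n \<omega>)"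
          by (rule past_integrable[of n]) (use n in \<open>intro past_intros; simp\<close>)
        have "\<bar>expectation (\<lambda>\<omega>. csign (col 0 \<omega>) * f n \<omega>) - expectation Z\<bar> = \<bar>expectation (\<lambda>\<omega>. csign (col 0 \<omega>) * f n \<omega> - Z \<omega>)\<bar>"
          using i Zi by simp
        also have "\<dots> \<le> expectation (\<lambda>\<omega>. \<bar>csign (col 0 \<omega>) * f n \<omega> - Z \<omega>\<bar>)" by (rule integral_abs_bound)
        also have "(\<lambda>\<omega>. \<bar>csign (col 0 \<omega>) * f n \<omega> - Z \<omega>\<bar>) = (\<lambda>\<omega>. \<bar>f n \<omega> - \<xi> \<omega>\<bar>)"
          unfolding Z_def right_diff_distrib[symmetric] abs_mult by simp
        also have "expectation \<dots> \<le> sqrt (expectation (\<lambda>\<omega>. (f n \<omega> - \<xi> \<omega>)\<^sup>2))"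
          by (rule expectation_abs_le[OF _ df]) (use fm in measurable)
        finally show ?thesis by simp
      qed
      then show "\<forall>\<^sub>F n in sequentially. norm (expectation (\<lambda>\<omega>. csign (col 0 \<omega>) * f n \<omega>) - expectation Z) \<le> sqrt (expectation (\<lambda>\<omega>. (f n \<omega> - \<xi> \<omega>)\<^sup>2))"
        by (rule eventually_sequentiallyI)
    qed
    then have "(\<lambda>n. expectation (\<lambda>\<omega>. csign (col 0 \<omega>) * f n \<omega>)) \<longlonglongrightarrow> expectation Z" by (simp add: LIM_zero_iff)
    moreover have "1 + r = 2 * p + \<alpha>" by (simp add: r_def)
    ultimately show ?thesis using LIMSEQ_unique[OF _ mean_f] by metis
  qed
  have EZ2: "mean_sq Z = (Gamma (1 / (1 + \<alpha>)) * (1 + \<alpha>) * (4 * p + \<alpha> - 2)) /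
       (Gamma ((4 * p + 2 * \<alpha> - 1) / (1 + \<alpha>)) * (4 * p + \<alpha> - 3))"
  proof -
    have e: "1 + 2 * r = 4 * p + 2 * \<alpha> - 1" by (simp add: r_def)
    show ?thesis unfolding Z2 V V_def e by (simp add: mult_ac)
  qed
  have ap: "\<alpha> + 2 * p \<noteq> 0" using r(1) by (simp add: r_def)
  have cT: "(\<lambda>n. (c n)\<^sup>2 * T n) \<longlonglongrightarrow> 0" unfolding c_def by (rule scale_T)
  have cX: "(\<lambda>n. (c n)\<^sup>2 * mean_sq (X n)) \<longlonglongrightarrow> V"
    using moment_f unfolding f_def c_def[symmetric] power_mult_distrib by simp
  have c0: "c \<longlonglongrightarrow> 0"
  proof -
    have "(\<lambda>n. real n powr (- ex)) \<longlonglongrightarrow> 0" by (rule tendsto_neg_powr) (use r filterlim_real_sequentially in auto)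
    then show ?thesis unfolding c_def powr_minus_divide .
  qed
  have main: "(\<lambda>n. \<integral>\<omega>. cis (y * f n \<omega>) \<partial>M) \<longlonglongrightarrow> (\<integral>\<omega>. cis (y * \<xi> \<omega>) \<partial>M)" for y
  proof (rule cis_expectation_tendsto[OF _ _ _ _ tendsto_const])
    have e: "(y * f n \<omega> - y * \<xi> \<omega>)\<^sup>2 = y\<^sup>2 * (f n \<omega> - \<xi> \<omega>)\<^sup>2" for n \<omega>
      by (simp only: right_diff_distrib[symmetric] power_mult_distrib)
    show "(\<lambda>\<omega>. y * f n \<omega>) \<in> borel_measurable M" "(\<lambda>\<omega>. y * \<xi> \<omega>) \<in> borel_measurable M" for n using fm by measurable
    show "integrable M (\<lambda>\<omega>. (y * f n \<omega> - y * \<xi> \<omega>)\<^sup>2)" for n unfolding e using df by simp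
    show "(\<lambda>n. expectation (\<lambda>\<omega>. (y * f n \<omega> - y * \<xi> \<omega>)\<^sup>2)) \<longlonglongrightarrow> 0" unfolding e using tendsto_mult_left[OF lim, of "y\<^sup>2"] by simp
  qed
  let ?N = "\<lambda>d. distr M borel (\<lambda>\<omega>. (root_sign col \<omega> * Z \<omega> / d) *\<^sub>R (vector [2 * p - 1, 1 - 2 * p] :: real ^ 2))"
  have Nm: "(\<lambda>\<omega>. (\<xi> \<omega> / d) *\<^sub>R (vector [2 * p - 1, 1 - 2 * p] :: real ^ 2)) \<in> borel_measurable M" for d by measurable
  have N: "prob_space (?N d)" "sets (?N d) = sets borel" for d
    unfolding BZ using prob_space_distr[OF Nm] by simp_all
  have Nchar: "(\<integral>x. cis (vector [u + y, u - y] \<bullet> x) \<partial>?N d) = (\<integral>\<omega>. cis (2 * q / d * y * \<xi> \<omega>) \<partial>M)" for d u y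
  proof -
    have cm: "(\<lambda>x :: real ^ 2. cis (vector [u + y, u - y] \<bullet> x)) \<in> borel_measurable borel" unfolding cis_conv_exp by measurable
    have e: "vector [u + y, u - y] \<bullet> ((\<xi> \<omega> / d) *\<^sub>R (vector [2 * p - 1, 1 - 2 * p] :: real ^ 2)) = 2 * q / d * y * \<xi> \<omega>" for \<omega>
      by (simp add: inner_vec_def sum_2 add_divide_distrib diff_divide_distrib algebra_simps)
    show ?thesis unfolding BZ by (subst integral_distr[OF Nm cm]) (simp only: e)
  qed
  have leaf: "weakly_converges (\<lambda>n. distr M borel (\<lambda>\<omega>. c n *\<^sub>R (leaf_vec par col n \<omega> - real n *\<^sub>R leaf_mean \<alpha>))) (?N (2 * \<alpha> + 4 * p))"
  proof -
    obtain C where C: "\<forall>\<^sub>F n in sequentially. (c n)\<^sup>2 * mean_sq (Y n) \<le> C"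
      using moment_Y_from_X[OF ap cT cX] by blast
    show ?thesis
    proof (rule leaf_weak_limit[OF N _ _ c0 C])
      show "\<forall>\<^sub>F n in sequentially. (c n)\<^sup>2 * T n \<le> 1"
        using order_tendstoD(2)[OF cT, of 1] by (auto elim: eventually_mono)
      fix u y
      define k where "k = q / (\<alpha> + 2 * p)"
      have k: "2 * q / (2 * \<alpha> + 4 * p) = k"
      proof -
        have "2 * \<alpha> + 4 * p = 2 * (\<alpha> + 2 * p)" by simp
        then show ?thesis unfolding k_def by (simp only: mult_divide_mult_cancel_left_if) simp
      qed
      have diff: "c n * lin n u 0 y 0 \<omega> - k * y * f n \<omega> = c n * lin n u (- (q / (\<alpha> + 2 * p)) * y) y 0 \<omega>" for n \<omega>
        unfolding k_def[symmetric] f_def c_def by (simp add: lin_def algebra_simps)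
      show "(\<lambda>n. \<integral>\<omega>. cis (c n * lin n u 0 y 0 \<omega>) \<partial>M) \<longlonglongrightarrow> (\<integral>x. cis (vector [u + y, u - y] \<bullet> x) \<partial>?N (2 * \<alpha> + 4 * p))"
        unfolding Nchar k
      proof (rule cis_expectation_tendsto[OF _ _ _ _ main])
        show "(\<lambda>\<omega>. c n * lin n u 0 y 0 \<omega>) \<in> borel_measurable M" "(\<lambda>\<omega>. k * y * f n \<omega>) \<in> borel_measurable M" for n
          by (rule past_measurable[of n]; intro past_intros)+
        show "integrable M (\<lambda>\<omega>. (c n * lin n u 0 y 0 \<omega> - k * y * f n \<omega>)\<^sup>2)" for n
          by (rule past_integrable[of n]) (intro past_intros)
        show "(\<lambda>n. expectation (\<lambda>\<omega>. (c n * lin n u 0 y 0 \<omega> - k * y * f n \<omega>)\<^sup>2)) \<longlonglongrightarrow> 0"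
          unfolding diff by (rule negligible_remainder[OF ap cT])
      qed
    qed
  qed
  have colour: "weakly_converges (\<lambda>n. distr M borel (\<lambda>\<omega>. c n *\<^sub>R (colour_vec col n \<omega> - real n *\<^sub>R vector [1 / 2, 1 / 2]))) (?N (2 * r))"
  proof -
    define k where "k = q / r"
    have k: "2 * q / (2 * r) = k" unfolding k_def by (rule mult_divide_mult_cancel_left) simp
    \<comment> \<open>The statistic \<open>S - k X\<close> has no drift, so its second moment is of order \<open>n\<close>.\<close>
    have "- k * (\<alpha> + q) + (0 + 1) * q = 0 * - k" using r(1) by (simp add: k_def r_def)
    then obtain K where K: "K \<ge> 0" "\<And>n. n \<ge> 1 \<Longrightarrow> mean_sq (lin n 0 (- k) 0 1) \<le> K * T n"
      using eigen_moment_bound[of 0 0 "- k" 0 1] alpha_pos by auto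
    have rem: "(\<lambda>n. (c n)\<^sup>2 * mean_sq (lin n 0 (- k) 0 1)) \<longlonglongrightarrow> 0"
    proof (rule tendsto_sandwich[OF _ _ tendsto_const])
      show "(\<lambda>n. K * ((c n)\<^sup>2 * T n)) \<longlonglongrightarrow> 0" using tendsto_mult_left[OF cT, of K] by simp
      have "(c n)\<^sup>2 * mean_sq (lin n 0 (- k) 0 1) \<le> K * ((c n)\<^sup>2 * T n)" if "n \<ge> 1" for n
        using mult_left_mono[OF K(2)[OF that], of "(c n)\<^sup>2"] by (simp add: mult_ac)
      then show "\<forall>\<^sub>F n in sequentially. (c n)\<^sup>2 * mean_sq (lin n 0 (- k) 0 1) \<le> K * ((c n)\<^sup>2 * T n)"
        by (rule eventually_sequentiallyI)
    qed simp
    have i: "integrable M (\<lambda>\<omega>. (lin n 0 (- k) 0 1 \<omega>)\<^sup>2)" "integrable M (\<lambda>\<omega>. (X n \<omega>)\<^sup>2)" "integrable M (\<lambda>\<omega>. 0\<^sup>2 + (c n * S n \<omega>)\<^sup>2)" for n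
      by (rule past_integrable[of n]; intro past_intros)+
    have bound: "expectation (\<lambda>\<omega>. 0\<^sup>2 + (c n * S n \<omega>)\<^sup>2) \<le> 2 * ((c n)\<^sup>2 * mean_sq (lin n 0 (- k) 0 1)) + 2 * k\<^sup>2 * ((c n)\<^sup>2 * mean_sq (X n))" for n
    proof -
      have "expectation (\<lambda>\<omega>. 0\<^sup>2 + (c n * S n \<omega>)\<^sup>2) \<le> expectation (\<lambda>\<omega>. 2 * (c n)\<^sup>2 * (lin n 0 (- k) 0 1 \<omega>)\<^sup>2 + 2 * k\<^sup>2 * (c n)\<^sup>2 * (X n \<omega>)\<^sup>2)"
      proof (rule integral_mono[OF i(3)])
        fix \<omega>
        define a b where "a = c n * lin n 0 (- k) 0 1 \<omega>" and "b = k * (c n * X n \<omega>)"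
        have "c n * S n \<omega> = a + b" by (simp add: a_def b_def lin_def algebra_simps)
        moreover note power2_sum_le[of a b]
        ultimately show "0\<^sup>2 + (c n * S n \<omega>)\<^sup>2 \<le> 2 * (c n)\<^sup>2 * (lin n 0 (- k) 0 1 \<omega>)\<^sup>2 + 2 * k\<^sup>2 * (c n)\<^sup>2 * (X n \<omega>)\<^sup>2"
          unfolding a_def b_def by (simp add: power_mult_distrib)
      qed (use i in auto)
      also have "\<dots> = 2 * ((c n)\<^sup>2 * mean_sq (lin n 0 (- k) 0 1)) + 2 * k\<^sup>2 * ((c n)\<^sup>2 * mean_sq (X n))"
        using i by simp
      finally show ?thesis .
    qed
    show ?thesis
      unfolding colour_vec_scaled
    proof (rule weak_limit_signed[OF _ _ N])
      show "past n (\<lambda>\<omega>. 0 :: real)" "past n (\<lambda>\<omega>. c n * S n \<omega>)" for n by (intro past_intros)+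
      have "(\<lambda>n. 2 * ((c n)\<^sup>2 * mean_sq (lin n 0 (- k) 0 1)) + 2 * k\<^sup>2 * ((c n)\<^sup>2 * mean_sq (X n))) \<longlonglongrightarrow> 2 * 0 + 2 * k\<^sup>2 * V"
        by (intro tendsto_add tendsto_mult_left rem cX)
      then have "\<forall>\<^sub>F n in sequentially. 2 * ((c n)\<^sup>2 * mean_sq (lin n 0 (- k) 0 1)) + 2 * k\<^sup>2 * ((c n)\<^sup>2 * mean_sq (X n)) < 2 * k\<^sup>2 * V + 1"
        by (rule order_tendstoD) simp
      then show "\<forall>\<^sub>F n in sequentially. expectation (\<lambda>\<omega>. 0\<^sup>2 + (c n * S n \<omega>)\<^sup>2) \<le> 2 * k\<^sup>2 * V + 1"
        by eventually_elim (rule order_trans[OF bound less_imp_le])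
      fix u y
      have e: "(u * 0 + y * (c n * S n \<omega>) - k * y * f n \<omega>)\<^sup>2 = y\<^sup>2 * (c n)\<^sup>2 * (lin n 0 (- k) 0 1 \<omega>)\<^sup>2" for n \<omega>
      proof -
        have "u * 0 + y * (c n * S n \<omega>) - k * y * f n \<omega> = y * c n * lin n 0 (- k) 0 1 \<omega>"
          by (simp add: f_def c_def lin_def algebra_simps)
        then show ?thesis by (simp add: power_mult_distrib)
      qed
      show "(\<lambda>n. \<integral>\<omega>. cis (u * 0 + y * (c n * S n \<omega>)) \<partial>M) \<longlonglongrightarrow> (\<integral>x. cis (vector [u + y, u - y] \<bullet> x) \<partial>?N (2 * r))"
        unfolding Nchar k
      proof (rule cis_expectation_tendsto[OF _ _ _ _ main])
        show "(\<lambda>\<omega>. u * 0 + y * (c n * S n \<omega>)) \<in> borel_measurable M" "(\<lambda>\<omega>. k * y * f n \<omega>) \<in> borel_measurable M" for n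
          by (rule past_measurable[of n]; intro past_intros)+
        show "integrable M (\<lambda>\<omega>. (u * 0 + y * (c n * S n \<omega>) - k * y * f n \<omega>)\<^sup>2)" for n
          unfolding e using i by simp
        show "(\<lambda>n. expectation (\<lambda>\<omega>. (u * 0 + y * (c n * S n \<omega>) - k * y * f n \<omega>)\<^sup>2)) \<longlonglongrightarrow> 0"
          unfolding e using tendsto_mult_left[OF rem, of "y\<^sup>2"] by (simp add: mult.assoc)
      qed
    qed
  qed
  have ex: "(2 * p + \<alpha> - 1) / (1 + \<alpha>) = ex" "2 * (2 * p + \<alpha> - 1) = 2 * r" by (simp_all add: ex_def r_def)
  show ?thesis
    unfolding ex c_def[symmetric]
    by (intro exI[of _ Z] conjI Zm Zi EZ Z2i EZ2 leaf colour)
qed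

end

section \<open>The limit theorem\<close>

theorem theorem2p4:
  fixes M :: "'w measure" and \<alpha> p :: real
    and par :: "nat \<Rightarrow> 'w \<Rightarrow> nat" and col :: "nat \<Rightarrow> 'w \<Rightarrow> colour"
  assumes alpha: "\<alpha> \<ge> 0 \<or> (\<exists>d::int. d \<ge> 2 \<and> \<alpha> = - 1 / of_int d)"
    and p: "0 \<le> p" "p \<le> 1"
    and process: "broadcast_pa_trees M \<alpha> p par col"
  shows
    "(p \<noteq> 1 \<longrightarrow>
        (AE \<omega> in M. (\<lambda>n. (1 / real n) *\<^sub>R leaf_vec par col n \<omega>) \<longlonglongrightarrow> leaf_mean \<alpha>))
     \<and> (p < (3 - \<alpha>) / 4 \<or> p = 1 / 2 \<longrightarrow>
        (\<exists>N. centred_normal (Sigma_I \<alpha> p) N \<and>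
           weakly_converges
             (\<lambda>n. distr M borel (\<lambda>\<omega>.
                (1 / sqrt (real n)) *\<^sub>R (leaf_vec par col n \<omega> - real n *\<^sub>R leaf_mean \<alpha>))) N))
     \<and> (p = (3 - \<alpha>) / 4 \<and> p \<noteq> 1 / 2 \<longrightarrow>
        (\<exists>N. centred_normal (Sigma_II \<alpha>) N \<and>
           weakly_converges
             (\<lambda>n. distr M borel (\<lambda>\<omega>.
                (1 / sqrt (real n * ln (real n))) *\<^sub>R
                  (leaf_vec par col n \<omega> - real n *\<^sub>R leaf_mean \<alpha>))) N))
     \<and> (p > (3 - \<alpha>) / 4 \<and> p \<noteq> 1 / 2 \<longrightarrow>
        (\<exists>Z :: 'w \<Rightarrow> real.
           Z \<in> borel_measurable M \<and>
           integrable M Z \<and>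
           (\<integral>\<omega>. Z \<omega> \<partial>M) = Gamma (1 / (1 + \<alpha>)) / Gamma ((2 * p + \<alpha>) / (1 + \<alpha>)) \<and>
           integrable M (\<lambda>\<omega>. (Z \<omega>)\<^sup>2) \<and>
           (\<integral>\<omega>. (Z \<omega>)\<^sup>2 \<partial>M) =
             (Gamma (1 / (1 + \<alpha>)) * (1 + \<alpha>) * (4 * p + \<alpha> - 2)) /
             (Gamma ((4 * p + 2 * \<alpha> - 1) / (1 + \<alpha>)) * (4 * p + \<alpha> - 3)) \<and>
           weakly_converges
             (\<lambda>n. distr M borel (\<lambda>\<omega>.
                (1 / real n powr ((2 * p + \<alpha> - 1) / (1 + \<alpha>))) *\<^sub>R
                  (leaf_vec par col n \<omega> - real n *\<^sub>R leaf_mean \<alpha>)))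
             (distr M borel (\<lambda>\<omega>.
                (root_sign col \<omega> * Z \<omega> / (2 * \<alpha> + 4 * p)) *\<^sub>R
                  (vector [2 * p - 1, 1 - 2 * p] :: real ^ 2))) \<and>
           weakly_converges
             (\<lambda>n. distr M borel (\<lambda>\<omega>.
                (1 / real n powr ((2 * p + \<alpha> - 1) / (1 + \<alpha>))) *\<^sub>R
                  (colour_vec col n \<omega> - real n *\<^sub>R vector [1 / 2, 1 / 2])))
             (distr M borel (\<lambda>\<omega>.
                (root_sign col \<omega> * Z \<omega> / (2 * (2 * p + \<alpha> - 1))) *\<^sub>R
                  (vector [2 * p - 1, 1 - 2 * p] :: real ^ 2)))))"
proof -
  interpret broadcast_pa_trees M \<alpha> p par col by (rule process)
  have "- 1 < \<alpha>"
    using alpha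
  proof
    assume "\<exists>d::int. d \<ge> 2 \<and> \<alpha> = - 1 / of_int d"
    then obtain d :: int where d: "d \<ge> 2" "\<alpha> = - 1 / of_int d" by blast
    then have "1 / real_of_int d \<le> 1 / 2" by (intro divide_left_mono) auto
    then show ?thesis using d(2) by simp
  qed simp
  then interpret pa_process M \<alpha> p par col by unfold_locales (use p in auto)
  have sub: "subcritical M \<alpha> p par col" if "p < (3 - \<alpha>) / 4 \<or> p = 1 / 2"
    using that by unfold_locales auto
  have super: "supercritical M \<alpha> p par col" if "p > (3 - \<alpha>) / 4"
    using that by unfold_locales auto
  show ?thesis
    by (intro conjI impI strong_law subcritical.normal_limit[OF sub] critical_normal_limit
        supercritical.limit[OF super]) auto
qed

end
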